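(* Let $\mathcal{G}$ be a directed acyclic graph with node set $V$, let $n$ be the number of its source nodes, and for each $v\in V$ let $d_v$ be the number of in-edges of $v$. Let $f:\mathbb{R}^n\to\mathbb{R}$ be a compositional $\mathcal{G}$-function, where each of the constituent functions (the one at node $v$) is in $W_{m_v}^{d_v}$. Consider shallow and deep networks with an activation function $\sigma:\mathbb{R}\to\mathbb{R}$ that is infinitely differentiable and not a polynomial. Then deep networks with an associated graph that corresponds to the graph of $f$ avoid the curse of dimensionality in approximating $f$ for increasing $n$, whereas shallow networks cannot directly avoid the curse. In particular, the complexity of the best approximating shallow network is exponential in $n$: $$N_s=\mathcal{O}\big(\epsilon^{-n/m}\big),\qquad m=\min_{v\in V}m_v,$$ while the complexity of the deep network is $$N_d=\mathcal{O}\Big(\sum_{v\in V}\epsilon^{-d_v/m_v}\Big).$$ Here $\epsilon>0$ is the accuracy of approximation of $f$.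
   Context: For integers $d,m\ge1$, $W_m^d$ is the set of functions $h$ of $d$ variables on $[-1,1]^d$ with continuous partial derivatives of orders up to $m$ such that $\|h\|+\sum_{1\le|\mathbf{k}|_1\le m}\|D^{\mathbf{k}}h\|\le1$, where $\|\cdot\|$ is the sup norm on $[-1,1]^d$, $D^{\mathbf{k}}$ is the partial derivative with multi-index $\mathbf{k}$ and $|\mathbf{k}|_1$ is the sum of the components of $\mathbf{k}$. A $\mathcal{G}$-function is defined as follows. Each source node obtains an input from $\mathbb{R}$. Each in-edge of every other node represents an input real variable, and the node itself represents a function of these input real variables, called a constituent function. The out-edges fan out the result of this evaluation. It is assumed that there is only one sink node, whose output is the $\mathcal{G}$-function. Ignoring its compositional structure, a $\mathcal{G}$-function is thus a function of $n$ variables. The minimum and the sum over $v\in V$ concern the nodes that carry a constituent function, i.e. the non-source nodes. A shallow network with $N$ units in $d$ variables is a function $x\mapsto\sum_{k=1}^N a_k\sigma(\langle w_k,x\rangle+b_k)$ with $w_k\in\mathbb{R}^d$, $a_k,b_k\in\mathbb{R}$. A deep network with associated graph $\mathcal{G}$ is a $\mathcal{G}$-function whose constituent function at each non-source node $v$ is a shallow network in $d_v$ variables. The complexity of a network is its total number of units; the complexities $N_s$, $N_d$ are the numbers of units of networks that provide accuracy at least $\epsilon$ in the approximation of $f$, measured in the sup norm on $[-1,1]^n$. The curse of dimensionality is the exponential dependence on the dimension $n$ of the number of parameters (of order $\epsilon^{-n/m}$ for a generic function in $W_m^n$) needed to obtain accuracy $\epsilon$. *)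

theory Defs
  imports "HOL-Analysis.Analysis" "Graph_Theory.Digraph"
begin

section \<open>Functions of finitely many variables on the unit cube\<close>

text \<open>
  Real variables are indexed by a finite set \<open>I\<close>: a point of \<open>\<real>\<^sup>d\<close>, \<open>d = card I\<close>, is a function
  on \<open>I\<close>, and a function of \<open>d\<close> variables has type \<open>('i \<Rightarrow> real) \<Rightarrow> real\<close>. Dimensions cannot be types
  here because the in-degree varies from node to node.
\<close>

definition cube :: "'i set \<Rightarrow> ('i \<Rightarrow> real) set" where
  "cube I = (\<Pi>\<^sub>E i\<in>I. {-1..1})"

definition sup_norm :: "'i set \<Rightarrow> (('i \<Rightarrow> real) \<Rightarrow> real) \<Rightarrow> real" where
  "sup_norm I g = (SUP x\<in>cube I. \<bar>g x\<bar>)"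

definition multi_indices :: "'i set \<Rightarrow> nat \<Rightarrow> ('i \<Rightarrow> nat) set" where
  "multi_indices I m = {k. (\<forall>i. i \<notin> I \<longrightarrow> k i = 0) \<and> (\<Sum>i\<in>I. k i) \<le> m}"

text \<open>
  \<open>D k\<close> is the partial derivative of \<open>h\<close> with multi-index \<open>k\<close>, for all \<open>k\<close> of order at most \<open>m\<close>;
  on faces of the cube the derivatives are one-sided. The values of the \<open>D k\<close> on the cube are
  determined by \<open>h\<close>.
\<close>

definition partial_derivatives ::
  "'i set \<Rightarrow> nat \<Rightarrow> (('i \<Rightarrow> real) \<Rightarrow> real) \<Rightarrow> (('i \<Rightarrow> nat) \<Rightarrow> ('i \<Rightarrow> real) \<Rightarrow> real) \<Rightarrow> bool" where
  "partial_derivatives I m h D \<longleftrightarrow>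
     (\<forall>x\<in>cube I. D (\<lambda>_. 0) x = h x) \<and>
     (\<forall>k\<in>multi_indices I m. \<forall>i\<in>I. k(i := Suc (k i)) \<in> multi_indices I m \<longrightarrow>
        (\<forall>x\<in>cube I. ((\<lambda>t. D k (x(i := t))) has_real_derivative D (k(i := Suc (k i))) x)
           (at (x i) within {-1..1})))"

text \<open>The class \<open>W\<^sub>m\<^sup>d\<close>; the summand with multi-index \<open>0\<close> is the norm of \<open>h\<close> itself.\<close>

definition W :: "nat \<Rightarrow> 'i set \<Rightarrow> (('i \<Rightarrow> real) \<Rightarrow> real) set" where
  "W m I = {h. \<exists>D. partial_derivatives I m h D \<and>
     (\<forall>k\<in>multi_indices I m. continuous_on (cube I) (D k)) \<and>
     (\<Sum>k\<in>multi_indices I m. sup_norm I (D k)) \<le> 1}"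


section \<open>Compositional functions\<close>

definition sources :: "('v, 'e) pre_digraph \<Rightarrow> 'v set" where
  "sources G = {v \<in> verts G. in_degree G v = 0}"

definition inner_nodes :: "('v, 'e) pre_digraph \<Rightarrow> 'v set" where
  "inner_nodes G = verts G - sources G"

definition sinks :: "('v, 'e) pre_digraph \<Rightarrow> 'v set" where
  "sinks G = {v \<in> verts G. out_degree G v = 0}"

lemma restrict_fundef_cong [fundef_cong]:
  "I = J \<Longrightarrow> (\<And>i. i \<in> J \<Longrightarrow> f i = g i) \<Longrightarrow> restrict f I = restrict g J"
  by (auto simp: restrict_def)

lemma wf_arcs_ends:
  assumes "fin_digraph G" "acyclic (arcs_ends G)"
  shows "wf (arcs_ends G)"
  using assms by (simp add: finite_acyclic_wf arcs_ends_def fin_digraph.finite_arcs)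

lemma wf_node_value_calls:
  "wf {((G :: ('v, 'e) pre_digraph, h :: 'h, x :: 'x, u), (G', h', x', v)). G = G' \<and> h = h' \<and> x = x' \<and>
     fin_digraph G \<and> acyclic (arcs_ends G) \<and> (u, v) \<in> arcs_ends G}" (is "wf ?R")
proof (rule wfUNIVI)
  fix P and z :: "('v, 'e) pre_digraph \<times> 'h \<times> 'x \<times> 'v"
  assume step: "\<forall>z. (\<forall>y. (y, z) \<in> ?R \<longrightarrow> P y) \<longrightarrow> P z"
  obtain G h x v where z: "z = (G, h, x, v)" by (cases z)
  have "P (G, h, x, v)"
  proof (cases "fin_digraph G \<and> acyclic (arcs_ends G)")
    case True
    then have "wf (arcs_ends G)" by (simp add: wf_arcs_ends)
    then show ?thesis
    proof (induction v rule: wf_induct_rule)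
      case (less v)
      show ?case by (rule step[rule_format]) (auto intro: less)
    qed
  next
    case False
    show ?thesis by (rule step[rule_format]) (use False in auto)
  qed
  then show "P z" by (simp add: z)
qed

text \<open>
  The output of node \<open>v\<close> for the source inputs \<open>x\<close> and the constituent functions \<open>h\<close>. The input
  variables of \<open>h v\<close> are indexed by the in-edges of \<open>v\<close>. The guard is only there for termination;
  see \<open>node_value_source\<close> and \<open>node_value_inner\<close>.
\<close>

function node_value ::
  "('v, 'e) pre_digraph \<Rightarrow> ('v \<Rightarrow> ('e \<Rightarrow> real) \<Rightarrow> real) \<Rightarrow> ('v \<Rightarrow> real) \<Rightarrow> 'v \<Rightarrow> real" where
  "node_value G h x v =
     (if fin_digraph G \<and> acyclic (arcs_ends G) \<and> v \<in> inner_nodes G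
      then h v (\<lambda>e\<in>in_arcs G v. node_value G h x (tail G e))
      else x v)"
  by pat_completeness auto

termination node_value
  by (relation "{((G, h, x, u), (G', h', x', v)). G = G' \<and> h = h' \<and> x = x' \<and>
        fin_digraph G \<and> acyclic (arcs_ends G) \<and> (u, v) \<in> arcs_ends G}",
      rule wf_node_value_calls)
    (auto simp: in_arcs_def arcs_ends_conv)

declare node_value.simps [simp del]

lemma node_value_source: "v \<in> sources G \<Longrightarrow> node_value G h x v = x v"
  by (simp add: node_value.simps inner_nodes_def)

lemma node_value_inner:
  assumes "fin_digraph G" "acyclic (arcs_ends G)" "v \<in> inner_nodes G"
  shows "node_value G h x v = h v (\<lambda>e\<in>in_arcs G v. node_value G h x (tail G e))"
  using assms by (subst node_value.simps) simp

definition G_function ::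
  "('v, 'e) pre_digraph \<Rightarrow> ('v \<Rightarrow> ('e \<Rightarrow> real) \<Rightarrow> real) \<Rightarrow> ('v \<Rightarrow> real) \<Rightarrow> real" where
  "G_function G h x = node_value G h x (the_elem (sinks G))"

text \<open>
  The case without inner nodes (a single node, which is source and sink) is excluded: it has no
  constituent function, and the minimum of the \<open>m v\<close> would not exist.
\<close>

definition compositional_graph :: "('v, 'e) pre_digraph \<Rightarrow> ('v \<Rightarrow> nat) \<Rightarrow> bool" where
  "compositional_graph G m \<longleftrightarrow>
     digraph G \<and> acyclic (arcs_ends G) \<and> is_singleton (sinks G) \<and> inner_nodes G \<noteq> {} \<and>
     (\<forall>v\<in>inner_nodes G. 1 \<le> m v)"

definition compositional_functions ::
  "('v, 'e) pre_digraph \<Rightarrow> ('v \<Rightarrow> nat) \<Rightarrow> (('v \<Rightarrow> real) \<Rightarrow> real) set" where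
  "compositional_functions G m =
     {G_function G h |h. \<forall>v\<in>inner_nodes G. h v \<in> W (m v) (in_arcs G v)}"


section \<open>Networks and their complexity\<close>

definition shallow_networks ::
  "(real \<Rightarrow> real) \<Rightarrow> 'i set \<Rightarrow> nat \<Rightarrow> (('i \<Rightarrow> real) \<Rightarrow> real) set" where
  "shallow_networks \<sigma> I N =
     {\<lambda>x. \<Sum>k<N. a k * \<sigma> ((\<Sum>i\<in>I. w k i * x i) + b k) |a w b. True}"

definition deep_networks ::
  "(real \<Rightarrow> real) \<Rightarrow> ('v, 'e) pre_digraph \<Rightarrow> nat \<Rightarrow> (('v \<Rightarrow> real) \<Rightarrow> real) set" where
  "deep_networks \<sigma> G N =
     {G_function G g |g units. (\<forall>v\<in>inner_nodes G. g v \<in> shallow_networks \<sigma> (in_arcs G v) (units v)) \<and>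
        N = (\<Sum>v\<in>inner_nodes G. units v)}"

text \<open>
  The least number of units with which networks from \<open>\<N> N\<close>, \<open>N = 0, 1, \<dots>\<close>, approximate every
  function in \<open>F\<close> with accuracy \<open>\<epsilon>\<close>, i.e. the supremum of the complexities over \<open>F\<close>; it is
  \<open>\<infinity>\<close> if some function in \<open>F\<close> cannot be approximated or if the complexities are unbounded.
\<close>

definition complexity ::
  "'i set \<Rightarrow> (nat \<Rightarrow> (('i \<Rightarrow> real) \<Rightarrow> real) set) \<Rightarrow> (('i \<Rightarrow> real) \<Rightarrow> real) set \<Rightarrow> real \<Rightarrow> enat" where
  "complexity I \<N> F \<epsilon> =
     (SUP f\<in>F. INF N\<in>{N. \<exists>P\<in>\<N> N. sup_norm I (\<lambda>x. f x - P x) \<le> \<epsilon>}. enat N)"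

definition shallow_complexity ::
  "(real \<Rightarrow> real) \<Rightarrow> ('v, 'e) pre_digraph \<Rightarrow> ('v \<Rightarrow> nat) \<Rightarrow> real \<Rightarrow> enat" where
  "shallow_complexity \<sigma> G m =
     complexity (sources G) (shallow_networks \<sigma> (sources G)) (compositional_functions G m)"

definition deep_complexity ::
  "(real \<Rightarrow> real) \<Rightarrow> ('v, 'e) pre_digraph \<Rightarrow> ('v \<Rightarrow> nat) \<Rightarrow> real \<Rightarrow> enat" where
  "deep_complexity \<sigma> G m =
     complexity (sources G) (deep_networks \<sigma> G) (compositional_functions G m)"

text \<open>\<open>N \<epsilon> = \<O>(g \<epsilon>)\<close> as \<open>\<epsilon> \<rightarrow> 0\<close>, for possibly infinite \<open>N\<close>.\<close>

definition is_bigo :: "(real \<Rightarrow> enat) \<Rightarrow> (real \<Rightarrow> real) \<Rightarrow> bool" where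
  "is_bigo N g \<longleftrightarrow> (\<exists>C. \<forall>\<^sub>F \<epsilon> in at_right 0. ereal_of_enat (N \<epsilon>) \<le> ereal (C * g \<epsilon>))"


section \<open>The curse of dimensionality\<close>

text \<open>
  A statement for increasing dimension \<open>n = card (sources G)\<close> is one about a family of graphs, with
  orders of smoothness. In-degrees and orders are bounded and the number of nodes is polynomially
  bounded in \<open>n\<close> (for binary trees, the in-degree is \<open>2\<close> and there are \<open>n - 1\<close> inner nodes).
\<close>

definition bounded_family :: "(('v, 'e) pre_digraph \<times> ('v \<Rightarrow> nat)) set \<Rightarrow> bool" where
  "bounded_family \<F> \<longleftrightarrow>
     (\<forall>(G, m)\<in>\<F>. compositional_graph G m) \<and>
     (\<exists>d M. \<forall>(G, m)\<in>\<F>. \<forall>v\<in>inner_nodes G. in_degree G v \<le> d \<and> m v \<le> M) \<and>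
     (\<exists>A a. \<forall>(G, m)\<in>\<F>. card (verts G) \<le> A * card (sources G) ^ a)"

text \<open>
  The curse: the number of units needed for accuracy \<open>\<epsilon>\<close> depends exponentially on \<open>n\<close>, in that the
  exponent of \<open>1/\<epsilon>\<close> is at least proportional to \<open>n\<close>. It is avoided if the number of units is at
  most polynomial in \<open>n\<close>, with an exponent of \<open>1/\<epsilon>\<close> that does not depend on \<open>n\<close>.
\<close>

definition suffers_curse ::
  "(('v, 'e) pre_digraph \<Rightarrow> ('v \<Rightarrow> nat) \<Rightarrow> real \<Rightarrow> enat) \<Rightarrow>
   (('v, 'e) pre_digraph \<times> ('v \<Rightarrow> nat)) set \<Rightarrow> bool" where
  "suffers_curse N \<F> \<longleftrightarrow>
     (\<exists>c>0. \<forall>(G, m)\<in>\<F>. 2 \<le> card (sources G) \<longrightarrow>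
        \<not> is_bigo (N G m) (\<lambda>\<epsilon>. \<epsilon> powr (- c * real (card (sources G)))))"

definition avoids_curse ::
  "(('v, 'e) pre_digraph \<Rightarrow> ('v \<Rightarrow> nat) \<Rightarrow> real \<Rightarrow> enat) \<Rightarrow>
   (('v, 'e) pre_digraph \<times> ('v \<Rightarrow> nat)) set \<Rightarrow> bool" where
  "avoids_curse N \<F> \<longleftrightarrow>
     (\<exists>C p q. \<forall>(G, m)\<in>\<F>. \<forall>\<epsilon>\<in>{0<..1}.
        ereal_of_enat (N G m \<epsilon>) \<le> ereal (C * real (card (sources G)) powr p * \<epsilon> powr (- q)))"

lemma suffers_curse_imp_not_avoids_curse:
  assumes curse: "suffers_curse N \<F>" and unbounded: "\<And>b. \<exists>(G, m)\<in>\<F>. b < card (sources G)"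
  shows "\<not> avoids_curse N \<F>"
proof
  assume "avoids_curse N \<F>"
  then obtain C p q where avoid: "\<And>G m \<epsilon>. (G, m) \<in> \<F> \<Longrightarrow> \<epsilon> \<in> {0<..1} \<Longrightarrow>
      ereal_of_enat (N G m \<epsilon>) \<le> ereal (C * real (card (sources G)) powr p * \<epsilon> powr (- q))"
    unfolding avoids_curse_def by blast
  obtain c where c: "c > 0" and not_O: "\<And>G m. (G, m) \<in> \<F> \<Longrightarrow> 2 \<le> card (sources G) \<Longrightarrow>
      \<not> is_bigo (N G m) (\<lambda>\<epsilon>. \<epsilon> powr (- c * real (card (sources G))))"
    using curse unfolding suffers_curse_def by blast
  obtain G m where Gm: "(G, m) \<in> \<F>" and n: "max 2 (nat \<lceil>q / c\<rceil>) < card (sources G)"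
    using unbounded by blast
  define n where "n = card (sources G)"
  have "q / c \<le> real n" using n unfolding n_def by linarith
  then have q: "q \<le> c * real n" using c by (simp add: field_simps)
  define C' where "C' = \<bar>C * real n powr p\<bar>"
  have "ereal_of_enat (N G m \<epsilon>) \<le> ereal (C' * \<epsilon> powr (- c * real n))" if "0 < \<epsilon>" "\<epsilon> < 1" for \<epsilon>
  proof -
    have "ereal_of_enat (N G m \<epsilon>) \<le> ereal (C * real n powr p * \<epsilon> powr (- q))"
      using avoid[OF Gm] that unfolding n_def by simp
    also have "C * real n powr p * \<epsilon> powr (- q) \<le> C' * \<epsilon> powr (- c * real n)"
      unfolding C'_def using that q by (intro mult_mono powr_mono') auto
    finally show ?thesis by simp
  qed
  then have "\<forall>\<^sub>F \<epsilon> in at_right 0. ereal_of_enat (N G m \<epsilon>) \<le> ereal (C' * \<epsilon> powr (- c * real n))"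
    unfolding eventually_at_right_field by (intro exI[of _ 1]) simp
  then have "is_bigo (N G m) (\<lambda>\<epsilon>. \<epsilon> powr (- c * real n))"
    unfolding is_bigo_def by blast
  moreover have "2 \<le> card (sources G)" using n by simp
  ultimately show False using not_O[OF Gm] unfolding n_def by blast
qed


section \<open>Activation functions\<close>

definition infinitely_differentiable :: "(real \<Rightarrow> real) \<Rightarrow> bool" where
  "infinitely_differentiable \<sigma> \<longleftrightarrow> (\<forall>k x. (deriv ^^ k) \<sigma> field_differentiable at x)"

definition is_polynomial :: "(real \<Rightarrow> real) \<Rightarrow> bool" where
  "is_polynomial \<sigma> \<longleftrightarrow> (\<exists>p. \<sigma> = poly p)"

end

theory Submission
  imports Defs
begin

text \<open>
  Upper bounds. Difference quotients of \<open>\<sigma>\<close> with respect to the weights converge to monomials, since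
  some point is not a zero of any of the derivatives involved; so a polynomial of degree less than
  \<open>q\<close> in each of \<open>d\<close> variables is a limit of networks with \<open>O(q\<^sup>d)\<close> units, and Jackson's theorem
  gives the rate \<open>\<epsilon> powr (- d / m)\<close> for a function with \<open>m\<close> bounded derivatives. A
  compositional function has as many derivatives as its roughest constituent, which settles shallow
  networks. For deep ones the constituents are approximated separately; they are Lipschitz, so the
  errors only add up over the nodes.

  Lower bound. If the constituents square the source variables and add up, and the sink
  applies a wave, the result is a multiple of \<open>cos (2 * pi * k * \<bar>x\<bar>\<^sup>2)\<close> or of
  \<open>sin (2 * pi * k * \<bar>x\<bar>\<^sup>2)\<close>, of size \<open>k powr (- m)\<close>. On a product of \<open>r = n div 2\<close> unit disks
  \<open>exp (2 * pi * \<i> * k * \<bar>x\<bar>\<^sup>2)\<close> is a product of radial functions. Replacing the Zernike radial part of angular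
  frequency \<open>0\<close> by the one of frequency \<open>2 * \<kappa>\<close> changes the integral against a ridge function by a phase
  only, so that \<open>(S + 1) ^ r\<close> tuples of frequencies give as many test functions whose integrals
  against a unit are proportional to a vector of phases. A projection of corank \<open>N\<close> that kills the
  phase vectors of \<open>N\<close> units yields a test function orthogonal to all the units, but not to the wave
  when \<open>2 * N \<le> (S + 1) ^ r\<close>. Hence accuracy of order \<open>S powr (- m)\<close> needs \<open>S ^ r\<close> units up
  to constants.
\<close>

subsection \<open>Polynomials as limits of shallow networks\<close>

text \<open>Smoothness of \<open>\<sigma>\<close> says nothing about how much a single unit can
  express, and the weights are unbounded; so the lower bound must treat a unit as an arbitrary
  continuous function of one linear form, and only the directions of the forms can be exploited. The
  network may choose them after seeing the target, therefore the test function has to be built after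
  the network is known, from a supply that is richer than the number of units. The supply on one
  disk is limited by the degree: a Zernike polynomial of angular frequency
  \<open>2 * \<kappa>\<close> exists in degrees \<open>2 * l\<close> with
  \<open>l \<ge> \<kappa>\<close> only. All frequencies up to \<open>S\<close> can share one radial
  profile only if the target keeps a sizable part in degrees \<open>l \<ge> S\<close>, and this is
  what sets the frequency of the wave, at most \<open>4 * S\<close>, and with it the size that the
  smoothness class allows.

  In the upper bounds everything is arranged to move one variable at a time. No mixed derivative of
  a composition has to be estimated, and constants are always chosen before the functions, so that
  they can be uniform over a family of graphs.\<close>

lemma nonvanishing_derivatives:
  fixes s :: "nat \<Rightarrow> real \<Rightarrow> real"
  assumes d: "\<And>k x. (s k has_real_derivative s (Suc k) x) (at x)"
    and T: "s T x0 \<noteq> 0"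
  shows "\<exists>b. \<forall>k\<le>T. s k b \<noteq> 0"
proof -
  have cont: "continuous_on UNIV (s k)" for k
    using d by (meson DERIV_isCont continuous_at_imp_continuous_on)
  have op: "open {x. s k x \<noteq> 0}" for k
    by (intro open_Collect_neq cont continuous_intros)
  \<comment> \<open>Descent through the orders. If the function of the next lower order vanished on
    all of \<open>U\<close>, so would its derivative, against the choice of \<open>U\<close>; so the
    points of \<open>U\<close> where it is not 0 form a nonempty open set.\<close>
  have "\<exists>U. open U \<and> U \<noteq> {} \<and> (\<forall>k. T - j \<le> k \<and> k \<le> T \<longrightarrow> (\<forall>x\<in>U. s k x \<noteq> 0))" for j
  proof (induction j)
    case 0
    then show ?case using op[of T] T by (intro exI[of _ "{x. s T x \<noteq> 0}"]) auto
  next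
    case (Suc j)
    then obtain U where U: "open U" "U \<noteq> {}" "\<And>k x. T - j \<le> k \<Longrightarrow> k \<le> T \<Longrightarrow> x \<in> U \<Longrightarrow> s k x \<noteq> 0"
      by blast
    show ?case
    proof (cases "j < T")
      case False
      then show ?thesis using U by (intro exI[of _ U]) auto
    next
      case True
      define k0 where "k0 = T - Suc j"
      have k0: "Suc k0 = T - j" using True by (simp add: k0_def)
      let ?V = "U \<inter> {x. s k0 x \<noteq> 0}"
      have "?V \<noteq> {}"
      proof
        assume e: "?V = {}"
        obtain x where x: "x \<in> U" using U by blast
        have "((\<lambda>_. 0) has_real_derivative s (Suc k0) x) (at x)"
          using e by (intro has_field_derivative_transform_within_open[OF d[of k0 x] U(1) x]) auto
        then have "s (Suc k0) x = 0" using DERIV_unique DERIV_const by blast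
        with U(3)[of "Suc k0" x] x k0 show False by simp
      qed
      moreover have "open ?V" using U op by blast
      moreover have "s k x \<noteq> 0" if "T - Suc j \<le> k" "k \<le> T" "x \<in> ?V" for k x
        using that U(3)[of k x] k0 k0_def by (cases "k = k0") auto
      ultimately show ?thesis by blast
    qed
  qed
  from this[of T] show ?thesis by (metis all_not_in_conv diff_self_eq_0 zero_le)
qed

text \<open>Used in contraposition: no derivative of \<open>\<sigma>\<close> vanishes identically.
  If one did, the remainder of the Taylor expansion at 0 would be 0.\<close>

lemma polynomial_if_derivative_vanishes:
  fixes s :: "nat \<Rightarrow> real \<Rightarrow> real"
  assumes d: "\<And>k x. (s k has_real_derivative s (Suc k) x) (at x)"
    and T: "\<And>x. s T x = 0"
  shows "is_polynomial (s 0)"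
proof -
  have "s 0 x = poly (\<Sum>m<T. monom (s m 0 / fact m) m) x" for x
  proof -
    obtain t where "s 0 x = (\<Sum>m<T. s m 0 / fact m * x ^ m) + s T t / fact T * x ^ T"
      using Maclaurin_all_le[of s "s 0" x T] d by blast
    then show ?thesis by (simp add: T poly_sum poly_monom)
  qed
  then show ?thesis unfolding is_polynomial_def by blast
qed

text \<open>Mixed forward difference with the steps in the list. The steps will be
  \<open>h * x i\<close>, so that all evaluation points are \<open>b\<close> plus a lattice
  combination of the inputs: exactly what units can evaluate.\<close>

fun idiff :: "real list \<Rightarrow> (real \<Rightarrow> real) \<Rightarrow> real \<Rightarrow> real" where
  "idiff [] f b = f b"
| "idiff (y # ys) f b = idiff ys f (b + y) - idiff ys f b"

lemma real_mvt_increment: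
  fixes f f' :: "real \<Rightarrow> real"
  assumes "\<And>x. (f has_real_derivative f' x) (at x)"
  shows "\<exists>z. \<bar>z - b\<bar> \<le> \<bar>y\<bar> \<and> f (b + y) - f b = y * f' z"
proof (cases y "0::real" rule: linorder_cases)
  case less
  then obtain z where "b + y < z" "z < b" "f b - f (b + y) = (b - (b + y)) * f' z"
    using MVT2[of "b + y" b f f'] assms by auto
  then show ?thesis by (intro exI[of _ z]) (auto simp: algebra_simps)
next
  case equal
  then show ?thesis by (intro exI[of _ b]) auto
next
  case greater
  then obtain z where "b < z" "z < b + y" "f (b + y) - f b = (b + y - b) * f' z"
    using MVT2[of b "b + y" f f'] assms by auto
  then show ?thesis by (intro exI[of _ z]) auto
qed

lemma idiff_has_derivative:
  assumes "\<And>x. (f has_real_derivative f' x) (at x)"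
  shows "(idiff ys f has_real_derivative idiff ys f' b) (at b)"
proof (induction ys arbitrary: b)
  case Nil
  have "idiff [] g = g" for g by (rule ext) simp
  then show ?case using assms by simp
next
  case (Cons y ys)
  have "((\<lambda>b. idiff ys f (b + y)) has_real_derivative idiff ys f' (b + y)) (at b)"
    using Cons[of "b + y"] by (simp add: DERIV_shift)
  then have "((\<lambda>b. idiff ys f (b + y) - idiff ys f b) has_real_derivative
      idiff ys f' (b + y) - idiff ys f' b) (at b)"
    by (intro DERIV_diff Cons)
  then show ?case by simp
qed

text \<open>The derivative of a mixed difference is the mixed difference of the derivative; so each
  step costs one application of the mean value theorem and yields its factor \<open>y\<close> and
  one more derivative.\<close>

lemma idiff_mvt:
  fixes s :: "nat \<Rightarrow> real \<Rightarrow> real"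
  assumes d: "\<And>k x. (s k has_real_derivative s (Suc k) x) (at x)"
  shows "\<exists>\<xi>. \<bar>\<xi> - b\<bar> \<le> (\<Sum>y\<leftarrow>ys. \<bar>y\<bar>) \<and> idiff ys (s k) b = prod_list ys * s (k + length ys) \<xi>"
proof (induction ys arbitrary: b k)
  case Nil
  then show ?case by auto
next
  case (Cons y ys)
  obtain z where z: "\<bar>z - b\<bar> \<le> \<bar>y\<bar>" "idiff ys (s k) (b + y) - idiff ys (s k) b = y * idiff ys (s (Suc k)) z"
    using real_mvt_increment[of "idiff ys (s k)" "idiff ys (s (Suc k))" b y] idiff_has_derivative d by blast
  obtain \<xi> where "\<bar>\<xi> - z\<bar> \<le> (\<Sum>y\<leftarrow>ys. \<bar>y\<bar>)" "idiff ys (s (Suc k)) z = prod_list ys * s (Suc k + length ys) \<xi>"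
    using Cons[of z "Suc k"] by blast
  then show ?case using z by (intro exI[of _ \<xi>]) (auto simp: algebra_simps)
qed

text \<open>The coefficients must not depend on \<open>f\<close>, \<open>b\<close> and
  \<open>x\<close>: they become output weights. The multi-indices in \<open>\<Gamma>\<close> become
  weight vectors, which lets different monomials share their units.\<close>

definition lattice_combination ::
  "'i set \<Rightarrow> ('i \<Rightarrow> nat) set \<Rightarrow> ((real \<Rightarrow> real) \<Rightarrow> real \<Rightarrow> ('i \<Rightarrow> real) \<Rightarrow> real) \<Rightarrow> bool" where
  "lattice_combination I \<Gamma> u \<longleftrightarrow>
     (\<exists>c. \<forall>f b x. u f b x = (\<Sum>\<gamma>\<in>\<Gamma>. c \<gamma> * f (b + (\<Sum>i\<in>I. real (\<gamma> i) * x i))))"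

lemma lattice_combination_mono:
  assumes "lattice_combination I \<Gamma> u" "\<Gamma> \<subseteq> \<Delta>" "finite \<Delta>"
  shows "lattice_combination I \<Delta> u"
proof -
  obtain c where c: "\<And>f b x. u f b x = (\<Sum>\<gamma>\<in>\<Gamma>. c \<gamma> * f (b + (\<Sum>i\<in>I. real (\<gamma> i) * x i)))"
    using assms(1) unfolding lattice_combination_def by blast
  have "u f b x = (\<Sum>\<gamma>\<in>\<Delta>. (if \<gamma> \<in> \<Gamma> then c \<gamma> else 0) * f (b + (\<Sum>i\<in>I. real (\<gamma> i) * x i)))" for f b x
    unfolding c using assms by (intro sum.mono_neutral_cong_left) auto
  then show ?thesis unfolding lattice_combination_def by (intro exI allI)
qed

lemma lattice_combination_diff:
  assumes "lattice_combination I \<Gamma> u" "lattice_combination I \<Gamma> v"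
  shows "lattice_combination I \<Gamma> (\<lambda>f b x. u f b x - v f b x)"
proof -
  obtain c d where "\<And>f b x. u f b x = (\<Sum>\<gamma>\<in>\<Gamma>. c \<gamma> * f (b + (\<Sum>i\<in>I. real (\<gamma> i) * x i)))"
      "\<And>f b x. v f b x = (\<Sum>\<gamma>\<in>\<Gamma>. d \<gamma> * f (b + (\<Sum>i\<in>I. real (\<gamma> i) * x i)))"
    using assms unfolding lattice_combination_def by blast
  then have "u f b x - v f b x = (\<Sum>\<gamma>\<in>\<Gamma>. (c \<gamma> - d \<gamma>) * f (b + (\<Sum>i\<in>I. real (\<gamma> i) * x i)))" for f b x
    by (simp add: sum_subtractf algebra_simps)
  then show ?thesis unfolding lattice_combination_def by (intro exI allI)
qed

lemma lattice_combination_shift: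
  assumes "lattice_combination I \<Gamma> u" "i \<in> I" "finite I"
  shows "lattice_combination I ((\<lambda>\<gamma>. \<gamma>(i := Suc (\<gamma> i))) ` \<Gamma>) (\<lambda>f b x. u f (b + x i) x)"
proof -
  let ?s = "\<lambda>\<gamma>. \<gamma>(i := Suc (\<gamma> i))" and ?p = "\<lambda>\<gamma>. \<gamma>(i := \<gamma> i - 1)"
  obtain c where c: "\<And>f b x. u f b x = (\<Sum>\<gamma>\<in>\<Gamma>. c \<gamma> * f (b + (\<Sum>i\<in>I. real (\<gamma> i) * x i)))"
    using assms(1) unfolding lattice_combination_def by blast
  have sh: "(\<Sum>j\<in>I. real (?s \<gamma> j) * x j) = x i + (\<Sum>j\<in>I. real (\<gamma> j) * x j)" for \<gamma> :: "'a \<Rightarrow> nat" and x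
  proof -
    have "(\<Sum>j\<in>I - {i}. real (?s \<gamma> j) * x j) = (\<Sum>j\<in>I - {i}. real (\<gamma> j) * x j)"
      by (intro sum.cong) auto
    then show ?thesis
      using sum.remove[OF assms(3,2), of "\<lambda>j. real (?s \<gamma> j) * x j"]
        sum.remove[OF assms(3,2), of "\<lambda>j. real (\<gamma> j) * x j"] by (simp add: algebra_simps)
  qed
  have inj: "inj_on ?s \<Gamma>"
    by (rule inj_on_inverseI[of _ ?p]) simp
  have "u f (b + x i) x = (\<Sum>\<gamma>\<in>?s ` \<Gamma>. c (?p \<gamma>) * f (b + (\<Sum>j\<in>I. real (\<gamma> j) * x j)))" for f b x
    unfolding sum.reindex[OF inj] o_def c
    by (intro sum.cong refl) (simp only: sh add.assoc fun_upd_upd fun_upd_same diff_Suc_1 fun_upd_triv)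
  then show ?thesis
    unfolding lattice_combination_def by (intro exI[of _ "\<lambda>\<gamma>. c (?p \<gamma>)"]) simp
qed

text \<open>Every occurrence of \<open>i\<close> in \<open>L\<close> either shifts the argument by
  \<open>x i\<close> or does not; so the coefficient of \<open>x i\<close> ranges from 0 to the
  multiplicity of \<open>i\<close>.\<close>

lemma idiff_lattice_combination:
  assumes "set L \<subseteq> I" "finite I"
  shows "lattice_combination I (\<Pi>\<^sub>E i\<in>I. {..count_list L i}) (\<lambda>f b x. idiff (map x L) f b)"
  using assms(1)
proof (induction L)
  case Nil
  have "(\<Pi>\<^sub>E i\<in>I. {..count_list [] i}) = {\<lambda>i\<in>I. 0}" by (auto simp: PiE_def extensional_def fun_eq_iff restrict_def)
  then show ?case unfolding lattice_combination_def by (intro exI[of _ "\<lambda>_. 1"]) simp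
next
  case (Cons i L)
  let ?\<Gamma> = "\<Pi>\<^sub>E j\<in>I. {..count_list L j}" and ?\<Delta> = "\<Pi>\<^sub>E j\<in>I. {..count_list (i # L) j}"
  have i: "i \<in> I" and IH: "lattice_combination I ?\<Gamma> (\<lambda>f b x. idiff (map x L) f b)"
    using Cons by auto
  have fin: "finite ?\<Delta>" using assms by (intro finite_PiE) auto
  have "?\<Gamma> \<subseteq> ?\<Delta>" by (intro PiE_mono) auto
  then have 1: "lattice_combination I ?\<Delta> (\<lambda>f b x. idiff (map x L) f b)"
    using IH fin lattice_combination_mono by blast
  have "(\<lambda>\<gamma>. \<gamma>(i := Suc (\<gamma> i))) ` ?\<Gamma> \<subseteq> ?\<Delta>" using i by (auto simp: PiE_iff extensional_def)
  then have 2: "lattice_combination I ?\<Delta> (\<lambda>f b x. idiff (map x L) f (b + x i))"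
    using lattice_combination_mono[OF lattice_combination_shift[OF IH i assms(2)] _ fin] by blast
  show ?case using lattice_combination_diff[OF 2 1] by simp
qed

lemma list_with_multiplicities:
  assumes "finite I"
  shows "\<exists>L. set L \<subseteq> I \<and> (\<forall>i. count_list L i = (if i \<in> I then \<alpha> i else 0)) \<and> length L = sum \<alpha> I \<and>
    (\<forall>x::'i \<Rightarrow> real. prod_list (map x L) = (\<Prod>i\<in>I. x i ^ \<alpha> i))"
  using assms
proof (induction I)
  case empty
  then show ?case by (intro exI[of _ "[]"]) auto
next
  case (insert j I)
  then obtain L where L: "set L \<subseteq> I" "\<And>i. count_list L i = (if i \<in> I then \<alpha> i else 0)"
      "length L = sum \<alpha> I" "\<And>x::'i \<Rightarrow> real. prod_list (map x L) = (\<Prod>i\<in>I. x i ^ \<alpha> i)"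
    by blast
  have c: "count_list (replicate n j) i = (if i = j then n else 0)" for n i
    by (induction n) auto
  have p: "prod_list (replicate n y) = y ^ n" for n and y :: real
    by (induction n) auto
  show ?case using L insert
    by (intro exI[of _ "replicate (\<alpha> j) j @ L"]) (auto simp: c p)
qed

lemma cube_abs_le: "x \<in> cube I \<Longrightarrow> i \<in> I \<Longrightarrow> \<bar>x i\<bar> \<le> 1"
  by (auto simp: cube_def PiE_iff abs_le_iff)

lemma abs_prod_le_one: "(\<And>i. i \<in> I \<Longrightarrow> \<bar>x i :: real\<bar> \<le> 1) \<Longrightarrow> \<bar>\<Prod>i\<in>I. x i ^ a i\<bar> \<le> 1"
  unfolding abs_prod by (intro prod_le_1) (simp add: power_abs power_le_one)

text \<open>With steps \<open>h * x i\<close>, the mean value form is \<open>h ^ length L\<close>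
  times the monomial times a derivative at a point that tends to \<open>b\<close> with
  \<open>h\<close>.\<close>

lemma monomial_difference_quotient:
  fixes s :: "nat \<Rightarrow> real \<Rightarrow> real"
  assumes d: "\<And>k x. (s k has_real_derivative s (Suc k) x) (at x)"
    and L: "set L \<subseteq> I" "\<And>x::'i \<Rightarrow> real. prod_list (map x L) = (\<Prod>i\<in>I. x i ^ \<alpha> i)"
    and b: "s (length L) b \<noteq> 0" and e: "0 < e"
  shows "\<forall>\<^sub>F h in at_right 0. \<forall>x\<in>cube I.
    \<bar>idiff (map (\<lambda>i. h * x i) L) (s 0) b / (h ^ length L * s (length L) b) - (\<Prod>i\<in>I. x i ^ \<alpha> i)\<bar> \<le> e"
proof -
  let ?n = "length L"
  have "isCont (s ?n) b" using d DERIV_isCont by blast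
  then obtain r where r: "r > 0" "\<And>\<xi>. \<bar>\<xi> - b\<bar> < r \<Longrightarrow> \<bar>s ?n \<xi> - s ?n b\<bar> < e * \<bar>s ?n b\<bar>"
    unfolding continuous_at_eps_delta using e b by (metis dist_real_def mult_pos_pos zero_less_abs_iff)
  \<comment> \<open>The intermediate point is within \<open>length L * h\<close> of
    \<open>b\<close>; the summand 1 in the bound for \<open>h\<close> covers the empty list.\<close>
  have "\<bar>idiff (map (\<lambda>i. h * x i) L) (s 0) b / (h ^ ?n * s ?n b) - (\<Prod>i\<in>I. x i ^ \<alpha> i)\<bar> \<le> e"
    if h: "0 < h" "h < r / (real ?n + 1)" and x: "x \<in> cube I" for h x
  proof -
    obtain \<xi> where \<xi>: "\<bar>\<xi> - b\<bar> \<le> (\<Sum>y\<leftarrow>map (\<lambda>i. h * x i) L. \<bar>y\<bar>)"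
      "idiff (map (\<lambda>i. h * x i) L) (s 0) b = prod_list (map (\<lambda>i. h * x i) L) * s (0 + length (map (\<lambda>i. h * x i) L)) \<xi>"
      using idiff_mvt[of s b "map (\<lambda>i. h * x i) L" 0] d by blast
    have pl: "prod_list (map (\<lambda>i. h * x i) M) = h ^ length M * prod_list (map x M)" for M
      by (induction M) auto
    have "(\<Sum>y\<leftarrow>map (\<lambda>i. h * x i) L. \<bar>y\<bar>) \<le> (\<Sum>i\<leftarrow>L. h)"
      unfolding map_map o_def
    proof (intro sum_list_mono)
      fix i assume "i \<in> set L"
      then have "\<bar>x i\<bar> \<le> 1" using L(1) by (intro cube_abs_le[OF x]) auto
      then show "\<bar>h * x i\<bar> \<le> h" using h(1) by (simp add: abs_mult mult_left_le)
    qed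
    also have "\<dots> = real ?n * h" by (simp add: sum_list_triv)
    also have "\<dots> < r"
    proof -
      have "real ?n * h \<le> (real ?n + 1) * h" using h by (simp add: algebra_simps)
      also have "\<dots> < r" using h(2) by (simp add: field_simps)
      finally show ?thesis .
    qed
    finally have "\<bar>\<xi> - b\<bar> < r" using \<xi>(1) by linarith
    then have sx: "\<bar>s ?n \<xi> - s ?n b\<bar> < e * \<bar>s ?n b\<bar>" by (rule r)
    define P where "P = (\<Prod>i\<in>I. x i ^ \<alpha> i)"
    have P: "\<bar>P\<bar> \<le> 1" unfolding P_def using x by (intro abs_prod_le_one cube_abs_le)
    have "idiff (map (\<lambda>i. h * x i) L) (s 0) b / (h ^ ?n * s ?n b) - P = P * ((s ?n \<xi> - s ?n b) / s ?n b)"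
      unfolding \<xi>(2) pl L(2) P_def[symmetric] using h b by (simp add: field_simps)
    also have "\<bar>\<dots>\<bar> \<le> 1 * e"
      unfolding abs_mult using P sx b by (intro mult_mono) (auto simp: field_simps abs_divide)
    finally show ?thesis unfolding P_def by simp
  qed
  then show ?thesis
    unfolding eventually_at_right_field
    by (intro exI[of _ "r / (real ?n + 1)"]) (use r(1) in \<open>auto intro: divide_pos_pos\<close>)
qed

lemma shallow_networks_finite_sum:
  assumes "finite \<Gamma>" "card \<Gamma> = N"
  shows "(\<lambda>x. \<Sum>\<gamma>\<in>\<Gamma>. a \<gamma> * \<sigma> ((\<Sum>i\<in>I. w \<gamma> i * x i) + b \<gamma>)) \<in> shallow_networks \<sigma> I N"
proof -
  obtain e where e: "bij_betw e {..<N} \<Gamma>"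
    using ex_bij_betw_nat_finite[OF assms(1)] assms(2) by (auto simp: atLeast0LessThan)
  have "(\<lambda>x. \<Sum>\<gamma>\<in>\<Gamma>. a \<gamma> * \<sigma> ((\<Sum>i\<in>I. w \<gamma> i * x i) + b \<gamma>)) =
      (\<lambda>x. \<Sum>k<N. a (e k) * \<sigma> ((\<Sum>i\<in>I. w (e k) i * x i) + b (e k)))"
    by (intro ext sum.reindex_bij_betw[OF e, symmetric])
  then show ?thesis
    unfolding shallow_networks_def mem_Collect_eq
    by (intro exI[of _ "\<lambda>k. a (e k)"] exI[of _ "\<lambda>k. b (e k)"] exI[of _ "\<lambda>k. w (e k)"]) simp
qed

text \<open>The number of units is the number of lattice points in the box and not its square,
  because all monomials use the same \<open>b\<close>, the same \<open>h\<close> and the same weight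
  vectors.\<close>

lemma shallow_networks_approximate_polynomials:
  assumes \<sigma>: "infinitely_differentiable \<sigma>" "\<not> is_polynomial \<sigma>" and I: "finite I" and e: "0 < e"
  shows "\<exists>g\<in>shallow_networks \<sigma> I ((q + 1) ^ card I). \<forall>x\<in>cube I.
    \<bar>(\<Sum>\<alpha>\<in>(\<Pi>\<^sub>E i\<in>I. {..q}). a \<alpha> * (\<Prod>i\<in>I. x i ^ \<alpha> i)) - g x\<bar> \<le> e"
proof -
  define s where "s k = (deriv ^^ k) \<sigma>" for k
  have d: "(s k has_real_derivative s (Suc k) x) (at x)" for k x
    using \<sigma>(1) unfolding infinitely_differentiable_def s_def
    by (simp add: field_differentiable_derivI)
  have s0: "s 0 = \<sigma>" by (simp add: s_def)
  \<comment> \<open>The largest degree of a monomial with all exponents at most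
    \<open>q\<close>.\<close>
  let ?T = "q * card I"
  have "\<not> (\<forall>x. s ?T x = 0)" using polynomial_if_derivative_vanishes[of s ?T] d \<sigma>(2) s0 by metis
  then obtain x0 where "s ?T x0 \<noteq> 0" by blast
  from nonvanishing_derivatives[of s, OF d this]
  obtain b where b: "\<And>k. k \<le> ?T \<Longrightarrow> s k b \<noteq> 0" by auto
  define \<Gamma> where "\<Gamma> = (\<Pi>\<^sub>E i\<in>I. {..q})"
  have fin: "finite \<Gamma>" unfolding \<Gamma>_def using I by (intro finite_PiE) auto
  have "\<forall>\<alpha>. \<exists>L. set L \<subseteq> I \<and> (\<forall>i. count_list L i = (if i \<in> I then \<alpha> i else 0)) \<and> length L = sum \<alpha> I \<and>
    (\<forall>x::'a \<Rightarrow> real. prod_list (map x L) = (\<Prod>i\<in>I. x i ^ \<alpha> i))"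
    using list_with_multiplicities[OF I] by blast
  then obtain L where L: "\<And>\<alpha>. set (L \<alpha>) \<subseteq> I" "\<And>\<alpha> i. count_list (L \<alpha>) i = (if i \<in> I then \<alpha> i else 0)"
    "\<And>\<alpha>. length (L \<alpha>) = sum \<alpha> I" "\<And>\<alpha> x::'a \<Rightarrow> real. prod_list (map x (L \<alpha>)) = (\<Prod>i\<in>I. x i ^ \<alpha> i)"
    by metis
  have "lattice_combination I \<Gamma> (\<lambda>f b x. idiff (map x (L \<alpha>)) f b)" if "\<alpha> \<in> \<Gamma>" for \<alpha>
  proof (rule lattice_combination_mono[OF idiff_lattice_combination[OF L(1) I] _ fin])
    show "(\<Pi>\<^sub>E i\<in>I. {..count_list (L \<alpha>) i}) \<subseteq> \<Gamma>"
      unfolding \<Gamma>_def using that by (intro PiE_mono) (auto simp: L(2) \<Gamma>_def)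
  qed
  then have "\<forall>\<alpha>\<in>\<Gamma>. \<exists>c. \<forall>f b x.
      idiff (map x (L \<alpha>)) f b = (\<Sum>\<gamma>\<in>\<Gamma>. c \<gamma> * f (b + (\<Sum>i\<in>I. real (\<gamma> i) * x i)))"
    unfolding lattice_combination_def by blast
  from bchoice[OF this] obtain c where c: "\<And>\<alpha> f b x. \<alpha> \<in> \<Gamma> \<Longrightarrow>
      idiff (map x (L \<alpha>)) f b = (\<Sum>\<gamma>\<in>\<Gamma>. c \<alpha> \<gamma> * f (b + (\<Sum>i\<in>I. real (\<gamma> i) * x i)))"
    by blast
  have len: "length (L \<alpha>) \<le> ?T" if "\<alpha> \<in> \<Gamma>" for \<alpha>
    using that sum_bounded_above[of I \<alpha> q] unfolding L(3) \<Gamma>_def by (auto simp: mult.commute PiE_iff)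
  \<comment> \<open>Each monomial may err by \<open>e / A\<close>; the summand 1 keeps
    \<open>A\<close> positive if all coefficients are 0.\<close>
  define A where "A = 1 + (\<Sum>\<alpha>\<in>\<Gamma>. \<bar>a \<alpha>\<bar>)"
  have A: "A > 0" unfolding A_def by (smt (verit) sum_nonneg abs_ge_zero)
  have "\<forall>\<^sub>F h in at_right 0. \<forall>\<alpha>\<in>\<Gamma>. \<forall>x\<in>cube I.
      \<bar>idiff (map (\<lambda>i. h * x i) (L \<alpha>)) (s 0) b / (h ^ length (L \<alpha>) * s (length (L \<alpha>)) b) - (\<Prod>i\<in>I. x i ^ \<alpha> i)\<bar> \<le> e / A"
  proof (rule eventually_ball_finite[OF fin], rule ballI)
    fix \<alpha> assume "\<alpha> \<in> \<Gamma>"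
    then have "s (length (L \<alpha>)) b \<noteq> 0" using b len by blast
    then show "\<forall>\<^sub>F h in at_right 0. \<forall>x\<in>cube I.
      \<bar>idiff (map (\<lambda>i. h * x i) (L \<alpha>)) (s 0) b / (h ^ length (L \<alpha>) * s (length (L \<alpha>)) b) - (\<Prod>i\<in>I. x i ^ \<alpha> i)\<bar> \<le> e / A"
      by (intro monomial_difference_quotient[of s, OF d L(1) L(4)] divide_pos_pos e A)
  qed
  from eventually_happens'[OF trivial_limit_at_right_real this]
  obtain h where h: "\<And>\<alpha> x. \<alpha> \<in> \<Gamma> \<Longrightarrow> x \<in> cube I \<Longrightarrow>
      \<bar>idiff (map (\<lambda>i. h * x i) (L \<alpha>)) (s 0) b / (h ^ length (L \<alpha>) * s (length (L \<alpha>)) b) - (\<Prod>i\<in>I. x i ^ \<alpha> i)\<bar> \<le> e / A"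
    by blast
  define K where "K \<alpha> = h ^ length (L \<alpha>) * s (length (L \<alpha>)) b" for \<alpha>
  \<comment> \<open>After an exchange of sums, the unit \<open>\<gamma>\<close> carries the
    contributions of all monomials.\<close>
  define w where "w \<gamma> = (\<Sum>\<alpha>\<in>\<Gamma>. a \<alpha> / K \<alpha> * c \<alpha> \<gamma>)" for \<gamma>
  define g where "g x = (\<Sum>\<gamma>\<in>\<Gamma>. w \<gamma> * \<sigma> ((\<Sum>i\<in>I. (real (\<gamma> i) * h) * x i) + b))" for x
  have gx: "g x = (\<Sum>\<alpha>\<in>\<Gamma>. a \<alpha> * (idiff (map (\<lambda>i. h * x i) (L \<alpha>)) (s 0) b / K \<alpha>))" for x
  proof -
    have "(\<Sum>\<alpha>\<in>\<Gamma>. a \<alpha> * (idiff (map (\<lambda>i. h * x i) (L \<alpha>)) (s 0) b / K \<alpha>)) =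
      (\<Sum>\<alpha>\<in>\<Gamma>. \<Sum>\<gamma>\<in>\<Gamma>. a \<alpha> / K \<alpha> * c \<alpha> \<gamma> * \<sigma> ((\<Sum>i\<in>I. (real (\<gamma> i) * h) * x i) + b))"
      by (intro sum.cong refl) (simp add: c s0 sum_distrib_left sum_divide_distrib algebra_simps)
    also have "\<dots> = g x" unfolding g_def w_def sum_distrib_right by (rule sum.swap)
    finally show ?thesis ..
  qed
  have "\<bar>(\<Sum>\<alpha>\<in>\<Gamma>. a \<alpha> * (\<Prod>i\<in>I. x i ^ \<alpha> i)) - g x\<bar> \<le> e" if x: "x \<in> cube I" for x
  proof -
    have "(\<Sum>\<alpha>\<in>\<Gamma>. a \<alpha> * (\<Prod>i\<in>I. x i ^ \<alpha> i)) - g x =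
        (\<Sum>\<alpha>\<in>\<Gamma>. a \<alpha> * ((\<Prod>i\<in>I. x i ^ \<alpha> i) - idiff (map (\<lambda>i. h * x i) (L \<alpha>)) (s 0) b / K \<alpha>))"
      unfolding gx by (simp add: sum_subtractf algebra_simps)
    also have "\<bar>\<dots>\<bar> \<le> (\<Sum>\<alpha>\<in>\<Gamma>. \<bar>a \<alpha>\<bar> * (e / A))"
      unfolding K_def
    proof (intro order_trans[OF sum_abs] sum_mono, unfold abs_mult, intro mult_left_mono abs_ge_zero)
      fix \<alpha> assume "\<alpha> \<in> \<Gamma>"
      from h[OF this x] show "\<bar>(\<Prod>i\<in>I. x i ^ \<alpha> i) - idiff (map (\<lambda>i. h * x i) (L \<alpha>)) (s 0) b /
          (h ^ length (L \<alpha>) * s (length (L \<alpha>)) b)\<bar> \<le> e / A"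
        by (simp only: abs_minus_commute)
    qed
    also have "\<dots> = (A - 1) * (e / A)" unfolding A_def by (simp add: sum_distrib_right sum_divide_distrib)
    also have "\<dots> \<le> e" using A e by (simp add: field_simps)
    finally show ?thesis .
  qed
  moreover have "g \<in> shallow_networks \<sigma> I ((q + 1) ^ card I)"
    unfolding g_def
    by (rule shallow_networks_finite_sum[OF fin]) (use I in \<open>simp add: \<Gamma>_def card_PiE\<close>)
  ultimately show ?thesis unfolding \<Gamma>_def by blast
qed

subsection \<open>Jackson's theorem in several variables\<close>

text \<open>At a quarter of the angle, cosine is at least \<open>sqrt 2 / 2\<close> and sine at
  least that multiple of the argument. This gives \<open>y \<le> sin (2 * y)\<close> for
  \<open>y = \<bar>\<theta>\<bar> / 4\<close>, while \<open>1 - cos \<theta>\<close> is twice the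
  square of \<open>sin (2 * y)\<close>. Through this bound the first Fourier coefficient of a kernel
  controls its second moment.\<close>

lemma one_minus_cos_ge:
  fixes \<theta> :: real
  assumes "\<bar>\<theta>\<bar> \<le> pi"
  shows "\<theta>\<^sup>2 / 8 \<le> 1 - cos \<theta>"
proof -
  define y where "y = \<bar>\<theta>\<bar> / 4"
  have y: "0 \<le> y" "y \<le> pi / 4" using assms by (auto simp: y_def)
  have c: "sqrt 2 / 2 \<le> cos y" using cos_monotone_0_pi_le[of y "pi / 4"] y by (simp add: cos_45)
  have s: "y * (sqrt 2 / 2) \<le> sin y"
  proof (cases "y = 0")
    case False
    then obtain z where z: "0 < z" "z < y" "sin y - sin 0 = (y - 0) * cos z"
      using MVT2[of 0 y sin cos] y by auto
    have "sqrt 2 / 2 \<le> cos z" using cos_monotone_0_pi_le[of z "pi / 4"] y z by (simp add: cos_45)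
    then show ?thesis using z y by (simp add: mult_left_mono)
  qed simp
  have "y = 2 * (y * (sqrt 2 / 2)) * (sqrt 2 / 2)" by (simp add: field_simps)
  also have "\<dots> \<le> 2 * sin y * cos y" using s c y by (intro mult_mono) (auto intro: order_trans[OF _ s])
  also have "\<dots> = sin (2 * y)" by (simp add: sin_double)
  finally have "y\<^sup>2 \<le> (sin (2 * y))\<^sup>2" using y by (simp add: power_mono)
  moreover have "1 - cos \<theta> = 2 * (sin (2 * y))\<^sup>2"
    using cos_double_sin[of "2 * y"] by (simp add: y_def)
  ultimately show ?thesis by (simp add: y_def power2_eq_square)
qed

lemma integral_cos_int:
  fixes c :: real
  assumes "c \<in> \<int>"
  shows "((\<lambda>\<theta>. cos (c * \<theta>)) has_integral (if c = 0 then 2 * pi else 0)) {-pi..pi}"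
proof (cases "c = 0")
  case True
  then show ?thesis using has_integral_const_real[of "1::real" "-pi" pi] by simp
next
  case False
  have "((\<lambda>\<theta>. cos (c * \<theta>)) has_integral (sin (c * pi) / c - sin (c * (-pi)) / c)) {-pi..pi}"
    using False by (intro fundamental_theorem_of_calculus)
      (auto intro!: derivative_eq_intros simp flip: has_real_derivative_iff_has_vector_derivative)
  moreover have "sin (c * pi) = 0" using assms by (auto simp: sin_zero_iff_int2 elim: Ints_cases)
  ultimately show ?thesis using False by simp
qed

text \<open>
  The Fejer-Korovkin kernel: among the squares \<open>\<bar>\<Sum>k. b k * exp (\<i> * k * \<theta>)\<bar>\<^sup>2\<close> the coefficients
  \<open>b k = sin (k * \<eta>)\<close> maximise the first Fourier coefficient, by the recurrence
  \<open>b (k - 1) + b (k + 1) = 2 * cos \<eta> * b k\<close>.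
\<close>

lemma fejer_korovkin_kernel:
  fixes q :: nat
  shows "\<exists>\<kappa>. (\<forall>\<theta>. 0 \<le> (\<Sum>a\<le>q. \<kappa> a * cos (real a * \<theta>))) \<and>
    integral {-pi..pi} (\<lambda>\<theta>. \<Sum>a\<le>q. \<kappa> a * cos (real a * \<theta>)) = 1 \<and>
    integral {-pi..pi} (\<lambda>\<theta>. \<bar>\<theta>\<bar> * (\<Sum>a\<le>q. \<kappa> a * cos (real a * \<theta>))) \<le> 8 / real (q + 1)"
proof -
  \<comment> \<open>With this angle \<open>b\<close> vanishes at \<open>0\<close> and at
    \<open>q + 2\<close>, so the recurrence also holds at both ends of the index range.\<close>
  define \<eta> where "\<eta> = pi / real (q + 2)"
  define b where "b k = sin (real k * \<eta>)" for k
  define Q where "Q = {1..q+1} \<times> {1..q+1}"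
  define Z where "Z = 2 * pi * (\<Sum>k\<in>{1..q+1}. (b k)\<^sup>2)"
  define w where "w = (\<lambda>(k, l). b k * b l / Z)"
  define n where "n = (\<lambda>(k, l). nat \<bar>int k - int l\<bar>)"
  \<comment> \<open>The double sum over \<open>k\<close> and \<open>l\<close> involves
    \<open>\<theta>\<close> through \<open>\<bar>k - l\<bar>\<close> only; collecting pairs by this
    value shows a cosine polynomial of degree at most \<open>q\<close>.\<close>
  define \<kappa> where "\<kappa> a = (\<Sum>p\<in>{p\<in>Q. n p = a}. w p)" for a
  have \<eta>: "0 < \<eta>" "\<eta> \<le> pi" by (auto simp: \<eta>_def field_simps)
  have b0: "b 0 = 0" "b (q + 2) = 0" by (auto simp: b_def \<eta>_def)
  have bpos: "0 < b k" if "k \<in> {1..q+1}" for k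
    unfolding b_def
  proof (rule sin_gt_zero)
    show "0 < real k * \<eta>" using that \<eta> by auto
    have "real k * pi < real (q + 2) * pi" using that by (intro mult_strict_right_mono) auto
    then show "real k * \<eta> < pi" by (simp add: \<eta>_def field_simps)
  qed
  have "(\<Sum>k\<in>{1..q+1}. (b k)\<^sup>2) > 0" using bpos by (intro sum_pos) force+
  then have Z: "Z > 0" by (simp add: Z_def)
  define K where "K \<theta> = (\<Sum>a\<le>q. \<kappa> a * cos (real a * \<theta>))" for \<theta>
  have finQ: "finite Q" by (simp add: Q_def)
  have np: "real (n p) = \<bar>real (fst p) - real (snd p)\<bar>" for p
    by (cases p) (auto simp: n_def)
  have cosn: "cos (real (n p) * \<theta>) = cos ((real (fst p) - real (snd p)) * \<theta>)" for p \<theta>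
    unfolding np by (cases "real (fst p) - real (snd p) \<ge> 0") (auto simp: abs_if minus_mult_left[symmetric] simp del: minus_mult_left minus_diff_eq)
  have KQ: "K \<theta> = (\<Sum>p\<in>Q. w p * cos ((real (fst p) - real (snd p)) * \<theta>))" for \<theta>
  proof -
    have "K \<theta> = (\<Sum>a\<le>q. \<Sum>p\<in>{p\<in>Q. n p = a}. w p * cos (real (n p) * \<theta>))"
      unfolding K_def \<kappa>_def sum_distrib_right by (intro sum.cong) auto
    also have "\<dots> = (\<Sum>p\<in>Q. w p * cos (real (n p) * \<theta>))"
      by (rule sum.group[OF finQ]) (auto simp: Q_def n_def)
    finally show ?thesis by (simp add: cosn)
  qed
  have Qsum: "(\<Sum>p\<in>Q. w p * h (fst p) (snd p)) = (\<Sum>k\<in>{1..q+1}. \<Sum>l\<in>{1..q+1}. b k * b l / Z * h k l)" for h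
    unfolding Q_def w_def sum.cartesian_product by (intro sum.cong) auto
  have K0: "0 \<le> K \<theta>" for \<theta>
  proof -
    have "K \<theta> = ((\<Sum>k\<in>{1..q+1}. b k * cos (real k * \<theta>))\<^sup>2 + (\<Sum>k\<in>{1..q+1}. b k * sin (real k * \<theta>))\<^sup>2) / Z"
      unfolding KQ Qsum[of "\<lambda>k l. cos ((real k - real l) * \<theta>)"] power2_eq_square sum_product sum.distrib[symmetric] sum_divide_distrib
      by (intro sum.cong refl) (simp add: left_diff_distrib cos_diff field_simps)
    then show ?thesis using Z by simp
  qed
  have K1: "(K has_integral 1) {-pi..pi}"
  proof -
    have "(K has_integral (\<Sum>p\<in>Q. w p * (if real (fst p) - real (snd p) = 0 then 2 * pi else 0))) {-pi..pi}"
      unfolding KQ[abs_def] by (intro has_integral_sum finQ has_integral_mult_right integral_cos_int) auto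
    also have "(\<Sum>p\<in>Q. w p * (if real (fst p) - real (snd p) = 0 then 2 * pi else 0)) =
        (\<Sum>k\<in>{1..q+1}. b k * b k / Z * (2 * pi))"
      unfolding Qsum[of "\<lambda>k l. if real k - real l = 0 then 2 * pi else 0"] by (intro sum.cong refl) (simp add: sum.delta if_distrib cong: if_cong)
    also have "\<dots> = (2 * pi * (\<Sum>k\<in>{1..q+1}. (b k)\<^sup>2)) / Z"
      by (simp add: sum_distrib_left sum_divide_distrib power2_eq_square mult_ac del: sum.cl_ivl_Suc)
    also have "\<dots> = 1" unfolding Z_def[symmetric] using Z by simp
    finally show ?thesis .
  qed
  \<comment> \<open>The cosine shifts \<open>k - l\<close> by one in both directions. Pairs of
    neighbours survive the integration, and the recurrence turns their sum into
    \<open>cos \<eta>\<close> times the normalisation.\<close>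
  have Kcos: "((\<lambda>\<theta>. K \<theta> * cos \<theta>) has_integral cos \<eta>) {-pi..pi}"
  proof -
    have "K \<theta> * cos \<theta> = (\<Sum>p\<in>Q. w p * ((cos ((real (fst p) - real (snd p) + 1) * \<theta>) + cos ((real (fst p) - real (snd p) - 1) * \<theta>)) / 2))" for \<theta>
      unfolding KQ sum_distrib_right
      by (intro sum.cong refl) (simp add: cos_times_cos distrib_right left_diff_distrib mult.assoc add.commute)
    moreover have "((\<lambda>\<theta>. \<Sum>p\<in>Q. w p * ((cos ((real (fst p) - real (snd p) + 1) * \<theta>) + cos ((real (fst p) - real (snd p) - 1) * \<theta>)) / 2))
      has_integral (\<Sum>p\<in>Q. w p * (((if real (fst p) - real (snd p) + 1 = 0 then 2 * pi else 0) +
        (if real (fst p) - real (snd p) - 1 = 0 then 2 * pi else 0)) / 2))) {-pi..pi}"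
      by (intro has_integral_sum finQ has_integral_mult_right has_integral_divide has_integral_add integral_cos_int) auto
    ultimately have "((\<lambda>\<theta>. K \<theta> * cos \<theta>) has_integral (\<Sum>p\<in>Q. w p * (((if real (fst p) - real (snd p) + 1 = 0 then 2 * pi else 0) +
        (if real (fst p) - real (snd p) - 1 = 0 then 2 * pi else 0)) / 2))) {-pi..pi}"
      by simp
    also have "(\<Sum>p\<in>Q. w p * (((if real (fst p) - real (snd p) + 1 = 0 then 2 * pi else 0) +
        (if real (fst p) - real (snd p) - 1 = 0 then 2 * pi else 0)) / 2)) =
      (\<Sum>k\<in>{1..q+1}. b k * (b (k + 1) + b (k - 1)) * pi / Z)"
      unfolding Qsum[of "\<lambda>k l. ((if real k - real l + 1 = 0 then 2 * pi else 0) + (if real k - real l - 1 = 0 then 2 * pi else 0)) / 2"]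
    proof (intro sum.cong refl)
      fix k assume k: "k \<in> {1..q+1}"
      have "(\<Sum>l\<in>{1..q+1}. b k * b l / Z * (((if real k - real l + 1 = 0 then 2 * pi else 0) + (if real k - real l - 1 = 0 then 2 * pi else 0)) / 2))
        = (\<Sum>l\<in>{1..q+1}. (if l = k + 1 then b k * b l / Z * pi else 0) + (if l = k - 1 then b k * b l / Z * pi else 0))"
      proof (intro sum.cong refl)
        fix l assume l: "l \<in> {1..q+1}"
        have 1: "real k - real l + 1 = 0 \<longleftrightarrow> l = k + 1" by linarith
        have 2: "real k - real l - 1 = 0 \<longleftrightarrow> l = k - 1" using l k by (auto simp: of_nat_diff)
        show "b k * b l / Z * (((if real k - real l + 1 = 0 then 2 * pi else 0) + (if real k - real l - 1 = 0 then 2 * pi else 0)) / 2) =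
          (if l = k + 1 then b k * b l / Z * pi else 0) + (if l = k - 1 then b k * b l / Z * pi else 0)"
          unfolding 1 2 by (simp add: field_simps)
      qed
      also have "\<dots> = b k * b (k + 1) / Z * pi + b k * b (k - 1) / Z * pi"
      proof -
        have "k + 1 \<notin> {1..q+1} \<Longrightarrow> b (k + 1) = 0" using k b0 by (auto dest: antisym)
        moreover have "k - 1 \<notin> {1..q+1} \<Longrightarrow> b (k - 1) = 0" using k b0 by (cases "k = 1") auto
        ultimately have "(if k + 1 \<in> {1..q+1} then b k * b (k + 1) / Z * pi else 0) = b k * b (k + 1) / Z * pi"
            "(if k - 1 \<in> {1..q+1} then b k * b (k - 1) / Z * pi else 0) = b k * b (k - 1) / Z * pi"
          by (simp_all del: atLeastAtMost_iff)
        then show ?thesis unfolding sum.distrib by (simp only: sum.delta finite_atLeastAtMost)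
      qed
      also have "\<dots> = b k * (b (k + 1) + b (k - 1)) * pi / Z"
        by (simp add: algebra_simps add_divide_distrib)
      finally show "(\<Sum>l\<in>{1..q+1}. b k * b l / Z * (((if real k - real l + 1 = 0 then 2 * pi else 0) + (if real k - real l - 1 = 0 then 2 * pi else 0)) / 2)) =
        b k * (b (k + 1) + b (k - 1)) * pi / Z" .
    qed
    also have "\<dots> = (\<Sum>k\<in>{1..q+1}. cos \<eta> * (2 * pi * (b k)\<^sup>2) / Z)"
    proof (intro sum.cong refl)
      fix k assume k: "k \<in> {1..q+1}"
      then have "b (k + 1) + b (k - 1) = 2 * cos \<eta> * b k"
        unfolding b_def by (simp add: of_nat_diff distrib_right left_diff_distrib sin_add sin_diff)
      then show "b k * (b (k + 1) + b (k - 1)) * pi / Z = cos \<eta> * (2 * pi * (b k)\<^sup>2) / Z"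
        by (simp add: power2_eq_square)
    qed
    also have "\<dots> = cos \<eta> * Z / Z"
      unfolding Z_def sum_distrib_left sum_divide_distrib by (simp add: mult_ac)
    also have "\<dots> = cos \<eta>" using Z by simp
    finally show ?thesis .
  qed
  have Kcont: "continuous_on S K" for S unfolding K_def[abs_def] by (intro continuous_intros)
  have i1: "((\<lambda>\<theta>. 4 / \<eta> * (K \<theta> - K \<theta> * cos \<theta>) + \<eta> / 2 * K \<theta>) has_integral (4 / \<eta> * (1 - cos \<eta>) + \<eta> / 2 * 1)) {-pi..pi}"
    by (intro has_integral_add has_integral_mult_right has_integral_diff K1 Kcos)
  have i2: "((\<lambda>\<theta>. \<bar>\<theta>\<bar> * K \<theta>) has_integral integral {-pi..pi} (\<lambda>\<theta>. \<bar>\<theta>\<bar> * K \<theta>)) {-pi..pi}"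
    by (intro integrable_integral integrable_continuous_interval continuous_intros Kcont)
  \<comment> \<open>Arithmetic-geometric mean inequality for \<open>\<bar>\<theta>\<bar>\<close> and
    \<open>\<eta>\<close>, then the lower bound for \<open>1 - cos \<theta>\<close>. The integral of
    the right-hand side will be at most \<open>5 / 2 * \<eta>\<close>.\<close>
  have i3: "\<bar>\<theta>\<bar> * K \<theta> \<le> 4 / \<eta> * (K \<theta> - K \<theta> * cos \<theta>) + \<eta> / 2 * K \<theta>" if "\<theta> \<in> {-pi..pi}" for \<theta>
  proof -
    have "\<bar>\<theta>\<bar> \<le> \<theta>\<^sup>2 / (2 * \<eta>) + \<eta> / 2"
    proof -
      have "0 \<le> (\<bar>\<theta>\<bar> - \<eta>)\<^sup>2 / (2 * \<eta>)" using \<eta> by simp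
      also have "\<dots> = \<theta>\<^sup>2 / (2 * \<eta>) + \<eta> / 2 - \<bar>\<theta>\<bar>" using \<eta> by (simp add: power2_diff field_simps power2_eq_square)
      finally show ?thesis by simp
    qed
    also have "\<theta>\<^sup>2 / (2 * \<eta>) \<le> 4 / \<eta> * (1 - cos \<theta>)"
      using one_minus_cos_ge[of \<theta>] that \<eta> by (simp add: abs_le_iff field_simps)
    finally have "\<bar>\<theta>\<bar> * K \<theta> \<le> (4 / \<eta> * (1 - cos \<theta>) + \<eta> / 2) * K \<theta>" by (intro mult_right_mono K0) simp
    then show ?thesis by (simp add: algebra_simps diff_divide_distrib add_divide_distrib)
  qed
  have "integral {-pi..pi} (\<lambda>\<theta>. \<bar>\<theta>\<bar> * K \<theta>) \<le> 4 / \<eta> * (1 - cos \<eta>) + \<eta> / 2 * 1"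
    by (rule has_integral_le[OF i2 i1 i3])
  also have "1 - cos \<eta> \<le> \<eta>\<^sup>2 / 2"
  proof -
    have "cos \<eta> = 1 - 2 * (sin (\<eta> / 2))\<^sup>2" using cos_double_sin[of "\<eta> / 2"] by simp
    moreover have "(sin (\<eta> / 2))\<^sup>2 \<le> (\<eta> / 2)\<^sup>2"
      using abs_sin_x_le_abs_x abs_le_square_iff by blast
    ultimately show ?thesis by (simp add: power2_eq_square)
  qed
  then have "4 / \<eta> * (1 - cos \<eta>) + \<eta> / 2 * 1 \<le> 4 / \<eta> * (\<eta>\<^sup>2 / 2) + \<eta> / 2"
    using \<eta> by (intro add_mono mult_left_mono) auto
  also have "\<dots> = 5 / 2 * \<eta>" using \<eta> by (simp add: power2_eq_square field_simps)
  \<comment> \<open>The constant 8 comes from \<open>5 * pi \<le> 16\<close>.\<close>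
  also have "\<dots> \<le> 8 / real (q + 1)"
  proof -
    have "pi * 5 \<le> 16" using pi_less_4 pi_approx by simp
    then have "pi * 5 * (1 + real q) \<le> 16 * (2 + real q)" by (intro mult_mono) auto
    then show ?thesis by (simp add: \<eta>_def field_simps)
  qed
  finally show ?thesis using K0 K1 unfolding K_def by (intro exI[of _ \<kappa>]) (auto intro: integral_unique)
qed

lemma integral_periodic_shift:
  fixes H :: "real \<Rightarrow> real"
  assumes c: "continuous_on UNIV H" and p: "\<And>x. H (x + 2 * pi) = H x"
  shows "integral {-pi..pi} (\<lambda>x. H (t + x)) = integral {-pi..pi} H"
proof -
  \<comment> \<open>The margin 5 exceeds \<open>pi\<close>: the points \<open>s + pi\<close> and
    \<open>s - pi\<close> stay inside the open interval on which \<open>P\<close> is a two-sided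
    antiderivative.\<close>
  define a where "a = - \<bar>t\<bar> - 5"
  define b where "b = \<bar>t\<bar> + 5"
  define P where "P x = integral {a..x} H" for x
  have cH: "continuous_on S H" for S using c continuous_on_subset by blast
  have pi5: "0 < pi" "pi < 4" by (rule pi_gt_zero, rule pi_less_4)
  have dP: "(P has_real_derivative H x) (at x)" if "a < x" "x < b" for x
  proof -
    have "(P has_real_derivative H x) (at x within {a..b})"
      unfolding P_def using that by (intro integral_has_real_derivative cH) auto
    then show ?thesis using at_within_Icc_at[of a x b] that by simp
  qed
  \<comment> \<open>The integral over the period centred at \<open>s\<close>; periodicity makes its
    derivative 0.\<close>
  let ?\<phi> = "\<lambda>s. P (s + pi) - P (s - pi)"
  have d\<phi>: "(?\<phi> has_real_derivative 0) (at s)" if "\<bar>s\<bar> \<le> \<bar>t\<bar>" for s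
  proof -
    have "((\<lambda>s. P (s + pi)) has_real_derivative H (s + pi)) (at s)"
      unfolding DERIV_shift[symmetric] using that pi5 by (intro dP; unfold a_def b_def; linarith)
    moreover have "((\<lambda>s. P (s + (-pi))) has_real_derivative H (s + (-pi))) (at s)"
      unfolding DERIV_shift[symmetric] using that pi5 by (intro dP; unfold a_def b_def; linarith)
    ultimately have "((\<lambda>s. P (s + pi) - P (s + (-pi))) has_real_derivative (H (s + pi) - H (s + (-pi)))) (at s)"
      by (rule DERIV_diff)
    then have "(?\<phi> has_real_derivative (H (s + pi) - H (s + (-pi)))) (at s)" by simp
    moreover have "H (s + pi) = H (s + (-pi))" using p[of "s - pi"] by (simp add: algebra_simps)
    ultimately show ?thesis by simp
  qed
  have "?\<phi> t = ?\<phi> 0"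
  proof -
    have "\<exists>c. \<forall>x\<in>{-\<bar>t\<bar>..\<bar>t\<bar>}. ?\<phi> x = c"
    proof (rule has_field_derivative_zero_constant)
      show "(?\<phi> has_real_derivative 0) (at x within {-\<bar>t\<bar>..\<bar>t\<bar>})" if "x \<in> {-\<bar>t\<bar>..\<bar>t\<bar>}" for x
      proof (rule has_field_derivative_at_within[OF d\<phi>])
        show "\<bar>x\<bar> \<le> \<bar>t\<bar>" using that unfolding atLeastAtMost_iff by linarith
      qed
    qed simp
    then obtain c where c: "\<And>x. x \<in> {-\<bar>t\<bar>..\<bar>t\<bar>} \<Longrightarrow> ?\<phi> x = c" by blast
    have "t \<in> {-\<bar>t\<bar>..\<bar>t\<bar>}" "0 \<in> {-\<bar>t\<bar>..\<bar>t\<bar>}"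
      unfolding atLeastAtMost_iff by linarith+
    then show ?thesis using c[of t] c[of 0] by simp
  qed
  moreover have int: "P (s + pi) - P (s - pi) = integral {s - pi..s + pi} H" if "\<bar>s\<bar> \<le> \<bar>t\<bar>" for s
  proof -
    have "a \<le> s - pi" "s - pi \<le> s + pi" using that pi5 unfolding a_def by linarith+
    then have "P (s - pi) + integral {s - pi..s + pi} H = P (s + pi)"
      unfolding P_def
      by (intro Henstock_Kurzweil_Integration.integral_combine integrable_continuous_interval cH)
    then show ?thesis by simp
  qed
  moreover have "integral {t - pi..t + pi} H = integral {-pi..pi} (\<lambda>x. H (t + x))"
    using integral_shift_real_ivl[of "t - pi" t "t + pi" H] by (simp add: algebra_simps)
  ultimately show ?thesis using int[of 0] by simp
qed

section \<open>Lipschitz conditions in single variables and cosine coefficients\<close>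

definition lip :: "real \<Rightarrow> 'i \<Rightarrow> (('i \<Rightarrow> real) \<Rightarrow> real) \<Rightarrow> bool" where
  "lip L i F \<longleftrightarrow> (\<forall>t \<tau>. \<bar>F (t(i := \<tau>)) - F t\<bar> \<le> L * \<bar>\<tau> - t i\<bar>)"

lemma lip_continuous:
  assumes "lip L i F"
  shows "continuous_on S (\<lambda>\<theta>. F (t(i := \<theta>)))"
proof (rule lipschitz_on_continuous_on[of "\<bar>L\<bar>"], rule lipschitz_onI)
  fix x y
  have "\<bar>F ((t(i := y))(i := x)) - F (t(i := y))\<bar> \<le> L * \<bar>x - (t(i := y)) i\<bar>"
    using assms unfolding lip_def by blast
  also have "\<dots> \<le> \<bar>L\<bar> * \<bar>x - y\<bar>" by (simp add: mult_right_mono)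
  finally show "dist (F (t(i := x))) (F (t(i := y))) \<le> \<bar>L\<bar> * dist x y" by (simp add: dist_real_def)
qed simp

lemma lip_continuous_translate:
  assumes "lip L i F"
  shows "continuous_on S (\<lambda>\<theta>. F (t(i := c + \<theta>)))"
  by (rule continuous_on_compose2[OF lip_continuous[OF assms, of UNIV t]]) (auto intro!: continuous_intros)

lemma lip_diff: "lip L i F \<Longrightarrow> lip M i G \<Longrightarrow> lip (L + M) i (\<lambda>t. F t - G t)"
  unfolding lip_def
proof (intro allI)
  fix t \<tau>
  assume "\<forall>t \<tau>. \<bar>F (t(i := \<tau>)) - F t\<bar> \<le> L * \<bar>\<tau> - t i\<bar>" "\<forall>t \<tau>. \<bar>G (t(i := \<tau>)) - G t\<bar> \<le> M * \<bar>\<tau> - t i\<bar>"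
  then have "\<bar>F (t(i := \<tau>)) - F t\<bar> \<le> L * \<bar>\<tau> - t i\<bar>" "\<bar>G (t(i := \<tau>)) - G t\<bar> \<le> M * \<bar>\<tau> - t i\<bar>" by auto
  then show "\<bar>F (t(i := \<tau>)) - G (t(i := \<tau>)) - (F t - G t)\<bar> \<le> (L + M) * \<bar>\<tau> - t i\<bar>"
    unfolding distrib_right by linarith
qed

definition dlip_step :: "'i \<Rightarrow> real \<Rightarrow> (('i \<Rightarrow> real) \<Rightarrow> real) \<Rightarrow> ('i \<Rightarrow> real) \<Rightarrow> real" where
  "dlip_step i h F t = F (t(i := t i + h)) - F t"

text \<open>All \<open>m\<close>-fold differences in the variable \<open>i\<close> with steps \<open>h\<^sub>1, \<dots>, h\<^sub>m\<close> are at most \<open>C * \<bar>h\<^sub>1\<bar> * \<dots> * \<bar>h\<^sub>m\<bar>\<close>.\<close>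

fun dlip :: "nat \<Rightarrow> 'i \<Rightarrow> real \<Rightarrow> (('i \<Rightarrow> real) \<Rightarrow> real) \<Rightarrow> bool" where
  "dlip 0 i C F \<longleftrightarrow> (\<forall>t. \<bar>F t\<bar> \<le> C)"
| "dlip (Suc m) i C F \<longleftrightarrow> (\<forall>h. dlip m i (C * \<bar>h\<bar>) (dlip_step i h F))"

lemma lip_dlip_step: "lip L i F \<Longrightarrow> lip (L + L) i (dlip_step i h F)"
proof -
  assume F: "lip L i F"
  have "lip L i (\<lambda>t. F (t(i := t i + h)))"
    unfolding lip_def
  proof (intro allI)
    fix t \<tau>
    have "\<bar>F ((t(i := t i + h))(i := \<tau> + h)) - F (t(i := t i + h))\<bar> \<le> L * \<bar>(\<tau> + h) - (t(i := t i + h)) i\<bar>"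
      using F unfolding lip_def by blast
    then show "\<bar>F ((t(i := \<tau>))(i := (t(i := \<tau>)) i + h)) - F (t(i := t i + h))\<bar> \<le> L * \<bar>\<tau> - t i\<bar>"
      by simp
  qed
  from lip_diff[OF this F] show ?thesis unfolding dlip_step_def by (simp add: dlip_step_def[abs_def])
qed

definition separately_lip :: "'i set \<Rightarrow> (('i \<Rightarrow> real) \<Rightarrow> real) \<Rightarrow> bool" where
  "separately_lip I F \<longleftrightarrow> (\<exists>L. \<forall>i\<in>I. lip L i F)"

definition even_periodic :: "'i set \<Rightarrow> (('i \<Rightarrow> real) \<Rightarrow> real) \<Rightarrow> bool" where
  "even_periodic I F \<longleftrightarrow> separately_lip I F \<and>
     (\<forall>i\<in>I. \<forall>t. F (t(i := t i + 2 * pi)) = F t \<and> F (t(i := - t i)) = F t)"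

text \<open>Unnormalised Fourier coefficient in the variable \<open>i\<close>. It stays a function
  of the full point, constant in \<open>t i\<close>, so that the other variables can be treated by
  the same operators.\<close>

definition cos_coeff :: "'i \<Rightarrow> nat \<Rightarrow> (('i \<Rightarrow> real) \<Rightarrow> real) \<Rightarrow> ('i \<Rightarrow> real) \<Rightarrow> real" where
  "cos_coeff i a F t = integral {-pi..pi} (\<lambda>\<theta>. F (t(i := \<theta>)) * cos (real a * \<theta>))"

lemma integral_abs_le_weighted:
  fixes f g :: "real \<Rightarrow> real"
  assumes "f integrable_on S" "g integrable_on S" "\<And>x. x \<in> S \<Longrightarrow> \<bar>f x\<bar> \<le> g x"
  shows "\<bar>integral S f\<bar> \<le> integral S g"
  using integral_norm_bound_integral[of f S g] assms by simp

text \<open>Lets the coefficients obtained in one variable be smoothed in the next one.\<close>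

lemma cos_coeff_even_periodic:
  assumes F: "even_periodic I F" and i: "i \<in> I"
  shows "even_periodic I (cos_coeff i a F)"
proof -
  obtain L where L: "\<And>j. j \<in> I \<Longrightarrow> lip L j F" using F unfolding even_periodic_def separately_lip_def by blast
  have ep: "F (t(j := t j + 2 * pi)) = F t" "F (t(j := - t j)) = F t" if "j \<in> I" for t j
    using F that unfolding even_periodic_def by blast+
  have int: "(\<lambda>\<theta>. F (t(i := \<theta>)) * cos (real a * \<theta>)) integrable_on {-pi..pi}" for t
    by (intro integrable_continuous_interval continuous_intros lip_continuous[OF L[OF i]])
  have sw: "j \<noteq> i \<Longrightarrow> (t(j := x))(i := y) = (t(i := y))(j := x)" for t :: "'a \<Rightarrow> real" and j x y
    by (rule fun_upd_twist)
  have "lip (2 * pi * \<bar>L\<bar>) j (cos_coeff i a F)" if j: "j \<in> I" for j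
    unfolding lip_def
  proof (intro allI)
    fix t \<tau>
    show "\<bar>cos_coeff i a F (t(j := \<tau>)) - cos_coeff i a F t\<bar> \<le> 2 * pi * \<bar>L\<bar> * \<bar>\<tau> - t j\<bar>"
    proof (cases "j = i")
      case True
      then show ?thesis by (simp add: cos_coeff_def)
    next
      case False
      have "cos_coeff i a F (t(j := \<tau>)) - cos_coeff i a F t =
        integral {-pi..pi} (\<lambda>\<theta>. F ((t(j := \<tau>))(i := \<theta>)) * cos (real a * \<theta>) - F (t(i := \<theta>)) * cos (real a * \<theta>))"
        unfolding cos_coeff_def by (rule integral_diff[symmetric, OF int int])
      also have "\<bar>\<dots>\<bar> \<le> integral {-pi..pi} (\<lambda>\<theta>. \<bar>L\<bar> * \<bar>\<tau> - t j\<bar>)"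
      proof (rule integral_abs_le_weighted[OF integrable_diff[OF int int]])
        fix \<theta>
        have "\<bar>F ((t(i := \<theta>))(j := \<tau>)) - F (t(i := \<theta>))\<bar> \<le> L * \<bar>\<tau> - (t(i := \<theta>)) j\<bar>"
          using L[OF j] unfolding lip_def by blast
        also have "\<dots> \<le> \<bar>L\<bar> * \<bar>\<tau> - t j\<bar>" using False by (simp add: mult_right_mono)
        finally have "\<bar>F ((t(i := \<theta>))(j := \<tau>)) - F (t(i := \<theta>))\<bar> * \<bar>cos (real a * \<theta>)\<bar> \<le> \<bar>L\<bar> * \<bar>\<tau> - t j\<bar> * 1"
          by (intro mult_mono) auto
        then show "\<bar>F ((t(j := \<tau>))(i := \<theta>)) * cos (real a * \<theta>) - F (t(i := \<theta>)) * cos (real a * \<theta>)\<bar> \<le> \<bar>L\<bar> * \<bar>\<tau> - t j\<bar>"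
          unfolding sw[OF False] by (simp add: abs_mult left_diff_distrib[symmetric])
      qed (rule integrable_const_ivl)
      also have "\<dots> = 2 * pi * \<bar>L\<bar> * \<bar>\<tau> - t j\<bar>" by simp
      finally show ?thesis .
    qed
  qed
  moreover have "cos_coeff i a F (t(j := t j + 2 * pi)) = cos_coeff i a F t \<and> cos_coeff i a F (t(j := - t j)) = cos_coeff i a F t"
    if j: "j \<in> I" for t j
  proof (cases "j = i")
    case True
    then show ?thesis by (simp add: cos_coeff_def)
  next
    case False
    have "F ((t(i := \<theta>))(j := t j + 2 * pi)) = F (t(i := \<theta>))" "F ((t(i := \<theta>))(j := - t j)) = F (t(i := \<theta>))" for \<theta>
      using ep[OF j, of "t(i := \<theta>)"] False by auto
    then show ?thesis unfolding cos_coeff_def sw[OF False] by simp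
  qed
  ultimately show ?thesis unfolding even_periodic_def separately_lip_def by blast
qed

section \<open>Convolution with a nonnegative cosine kernel in one variable\<close>

locale kernel =
  fixes q :: nat and \<kappa> :: "nat \<Rightarrow> real" and K :: "real \<Rightarrow> real" and \<delta> :: real
  assumes K_def: "K \<theta> = (\<Sum>a\<le>q. \<kappa> a * cos (real a * \<theta>))"
    and K_nonneg: "0 \<le> K \<theta>"
    and K_mass: "integral {-pi..pi} K = 1"
    and K_moment: "integral {-pi..pi} (\<lambda>\<theta>. \<bar>\<theta>\<bar> * K \<theta>) \<le> \<delta>"
begin

lemma K_continuous [continuous_intros]:
  fixes S :: "real set"
  shows "continuous_on S f \<Longrightarrow> continuous_on S (\<lambda>x. K (f x))"
  unfolding K_def by (auto intro!: continuous_intros)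

lemma K_minus: "K (- \<theta>) = K \<theta>"
  by (simp add: K_def)

definition smooth :: "'i \<Rightarrow> (('i \<Rightarrow> real) \<Rightarrow> real) \<Rightarrow> ('i \<Rightarrow> real) \<Rightarrow> real" where
  "smooth i F t = integral {-pi..pi} (\<lambda>\<theta>. F (t(i := t i + \<theta>)) * K \<theta>)"

text \<open>The operator \<open>(1 - smooth) ^ m\<close>. The order of approximation by one
  convolution with a positive kernel is limited; here each factor \<open>1 - smooth\<close> gains a
  factor \<open>\<delta>\<close>, and the difference to the identity is still a combination of
  convolutions.\<close>

fun residual :: "'i \<Rightarrow> nat \<Rightarrow> (('i \<Rightarrow> real) \<Rightarrow> real) \<Rightarrow> ('i \<Rightarrow> real) \<Rightarrow> real" where
  "residual i 0 F = F"
| "residual i (Suc m) F = (\<lambda>t. residual i m F t - smooth i (residual i m F) t)"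

lemma smooth_integrable:
  assumes "lip L i F"
  shows "(\<lambda>\<theta>. F (t(i := c + \<theta>)) * K \<theta>) integrable_on {-pi..pi}"
  by (intro integrable_continuous_interval continuous_intros lip_continuous_translate[OF assms])

lemma K_integrable: "(\<lambda>\<theta>. c * K \<theta>) integrable_on {-pi..pi}"
  by (intro integrable_continuous_interval continuous_intros)

lemma smooth_bound:
  assumes "lip L i F" "\<And>t. \<bar>F t\<bar> \<le> B"
  shows "\<bar>smooth i F t\<bar> \<le> B"
proof -
  have "\<bar>smooth i F t\<bar> \<le> integral {-pi..pi} (\<lambda>\<theta>. B * K \<theta>)"
    unfolding smooth_def
    by (intro integral_abs_le_weighted smooth_integrable[OF assms(1)] K_integrable)
      (auto simp: abs_mult K_nonneg intro!: mult_right_mono assms(2))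
  then show ?thesis by (simp add: K_mass)
qed

lemma smooth_diff:
  assumes "lip L i F" "lip M i G"
  shows "smooth i (\<lambda>t. F t - G t) t = smooth i F t - smooth i G t"
  unfolding smooth_def left_diff_distrib
  by (intro integral_diff smooth_integrable[OF assms(1)] smooth_integrable[OF assms(2)])

lemma lip_smooth:
  fixes F :: "('i \<Rightarrow> real) \<Rightarrow> real"
  assumes F: "lip L j F" "lip M i F"
  shows "lip L j (smooth i F)"
  unfolding lip_def
proof (intro allI)
  fix t :: "'i \<Rightarrow> real" and \<tau> :: real
  let ?t' = "t(j := \<tau>)"
  have "smooth i F ?t' - smooth i F t =
      integral {-pi..pi} (\<lambda>\<theta>. F (?t'(i := ?t' i + \<theta>)) * K \<theta> - F (t(i := t i + \<theta>)) * K \<theta>)"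
    unfolding smooth_def by (intro integral_diff[symmetric] smooth_integrable[OF F(2)])
  also have "\<bar>\<dots>\<bar> \<le> integral {-pi..pi} (\<lambda>\<theta>. (L * \<bar>\<tau> - t j\<bar>) * K \<theta>)"
  proof (intro integral_abs_le_weighted integrable_diff smooth_integrable[OF F(2)] K_integrable)
    fix \<theta>
    have "\<bar>F ((t(i := t i + \<theta>))(j := if j = i then \<tau> + \<theta> else \<tau>)) - F (t(i := t i + \<theta>))\<bar> \<le>
        L * \<bar>(if j = i then \<tau> + \<theta> else \<tau>) - (t(i := t i + \<theta>)) j\<bar>"
      using F(1) unfolding lip_def by blast
    moreover have "(t(i := t i + \<theta>))(j := if j = i then \<tau> + \<theta> else \<tau>) = ?t'(i := ?t' i + \<theta>)"
      by (auto simp: fun_eq_iff)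
    ultimately have "\<bar>F (?t'(i := ?t' i + \<theta>)) - F (t(i := t i + \<theta>))\<bar> \<le> L * \<bar>\<tau> - t j\<bar>"
      by (auto split: if_splits)
    then have "\<bar>F (?t'(i := ?t' i + \<theta>)) - F (t(i := t i + \<theta>))\<bar> * K \<theta> \<le> L * \<bar>\<tau> - t j\<bar> * K \<theta>"
      by (intro mult_right_mono K_nonneg)
    then show "\<bar>F (?t'(i := ?t' i + \<theta>)) * K \<theta> - F (t(i := t i + \<theta>)) * K \<theta>\<bar> \<le> L * \<bar>\<tau> - t j\<bar> * K \<theta>"
      unfolding left_diff_distrib[symmetric] abs_mult by (simp add: K_nonneg)
  qed
  also have "\<dots> = L * \<bar>\<tau> - t j\<bar>" by (simp add: K_mass)
  finally show "\<bar>smooth i F ?t' - smooth i F t\<bar> \<le> L * \<bar>\<tau> - t j\<bar>" .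
qed

lemma separately_lip_residual:
  assumes "separately_lip I F" "i \<in> I"
  shows "separately_lip I (residual i m F)"
proof (induction m)
  case (Suc m)
  then obtain L where L: "\<And>j. j \<in> I \<Longrightarrow> lip L j (residual i m F)" unfolding separately_lip_def by blast
  have "lip (L + L) j (residual i (Suc m) F)" if "j \<in> I" for j
    unfolding residual.simps using lip_diff[OF L[OF that] lip_smooth[OF L[OF that] L[OF assms(2)]]] .
  then show ?case unfolding separately_lip_def by blast
qed (use assms in simp)

lemma residual_bound:
  assumes "separately_lip I F" "i \<in> I" "\<And>t. \<bar>F t\<bar> \<le> B"
  shows "\<bar>residual i m F t\<bar> \<le> 2 ^ m * B"
proof (induction m arbitrary: t)
  case (Suc m)
  obtain L where L: "lip L i (residual i m F)"
    using separately_lip_residual[OF assms(1,2)] assms(2) unfolding separately_lip_def by blast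
  have "\<bar>smooth i (residual i m F) t\<bar> \<le> 2 ^ m * B" using L Suc by (rule smooth_bound)
  with Suc[of t] show ?case by simp
qed (use assms in simp)

lemma residual_diff:
  assumes "separately_lip I F" "separately_lip I G" "i \<in> I"
  shows "residual i m (\<lambda>t. F t - G t) t = residual i m F t - residual i m G t"
proof (induction m arbitrary: t)
  case (Suc m)
  obtain L where L: "lip L i (residual i m F)"
    using separately_lip_residual[OF assms(1,3)] assms(3) unfolding separately_lip_def by blast
  obtain M where M: "lip M i (residual i m G)"
    using separately_lip_residual[OF assms(2,3)] assms(3) unfolding separately_lip_def by blast
  have eq: "residual i m (\<lambda>t. F t - G t) = (\<lambda>t. residual i m F t - residual i m G t)"
    using Suc by (intro ext)
  show ?case unfolding residual.simps eq smooth_diff[OF L M] by simp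
qed simp

text \<open>One difference is traded for one factor \<open>\<delta>\<close>: up to sign,
  \<open>F - smooth i F\<close> is an average of differences with step \<open>\<theta>\<close>, and
  the kernel has first moment at most \<open>\<delta>\<close>. The other differences are untouched
  because they commute with convolution; derivatives would have to be taken under the
  integral.\<close>

lemma dlip_smooth:
  assumes "dlip (Suc m) i C F" "lip L i F"
  shows "dlip m i (C * \<delta>) (\<lambda>t. F t - smooth i F t)"
  using assms
proof (induction m arbitrary: C F L)
  case 0
  have C: "\<bar>dlip_step i h F t\<bar> \<le> C * \<bar>h\<bar>" for h t using 0 by simp
  from C[of 1] have C0: "0 \<le> C" using abs_ge_zero[of "dlip_step i 1 F undefined"] by (metis abs_one mult.right_neutral order_trans)
  have "\<bar>F t - smooth i F t\<bar> \<le> C * \<delta>" for t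
  proof -
    have "smooth i F t - F t = smooth i F t - integral {-pi..pi} (\<lambda>\<theta>. F t * K \<theta>)"
      by (simp add: K_mass)
    also have "\<dots> = integral {-pi..pi} (\<lambda>\<theta>. F (t(i := t i + \<theta>)) * K \<theta> - F t * K \<theta>)"
      unfolding smooth_def by (intro integral_diff[symmetric] smooth_integrable[OF 0(2)] K_integrable)
    also have "\<bar>\<dots>\<bar> \<le> integral {-pi..pi} (\<lambda>\<theta>. C * (\<bar>\<theta>\<bar> * K \<theta>))"
    proof (intro integral_abs_le_weighted integrable_diff smooth_integrable[OF 0(2)] K_integrable)
      show "(\<lambda>\<theta>. C * (\<bar>\<theta>\<bar> * K \<theta>)) integrable_on {-pi..pi}"
        by (intro integrable_continuous_interval continuous_intros)
      fix \<theta>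
      have "\<bar>dlip_step i \<theta> F t\<bar> * K \<theta> \<le> C * \<bar>\<theta>\<bar> * K \<theta>" by (intro mult_right_mono C K_nonneg)
      then show "\<bar>F (t(i := t i + \<theta>)) * K \<theta> - F t * K \<theta>\<bar> \<le> C * (\<bar>\<theta>\<bar> * K \<theta>)"
        unfolding left_diff_distrib[symmetric] abs_mult by (simp add: K_nonneg dlip_step_def mult.assoc)
    qed
    also have "\<dots> = C * integral {-pi..pi} (\<lambda>\<theta>. \<bar>\<theta>\<bar> * K \<theta>)" by simp
    also have "\<dots> \<le> C * \<delta>" by (intro mult_left_mono K_moment C0)
    finally show ?thesis by (simp add: abs_minus_commute)
  qed
  then show ?case by simp
next
  case (Suc m)
  have "dlip m i (C * \<delta> * \<bar>h\<bar>) (dlip_step i h (\<lambda>t. F t - smooth i F t))" for h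
  proof -
    have lh: "lip L i (\<lambda>t. F (t(i := t i + h)))"
      unfolding lip_def
    proof (intro allI)
      fix t \<tau>
      have "\<bar>F ((t(i := t i + h))(i := \<tau> + h)) - F (t(i := t i + h))\<bar> \<le> L * \<bar>(\<tau> + h) - (t(i := t i + h)) i\<bar>"
        using Suc.prems(2) unfolding lip_def by blast
      then show "\<bar>F ((t(i := \<tau>))(i := (t(i := \<tau>)) i + h)) - F (t(i := t i + h))\<bar> \<le> L * \<bar>\<tau> - t i\<bar>"
        by simp
    qed
    have "smooth i (dlip_step i h F) t = smooth i (\<lambda>t. F (t(i := t i + h))) t - smooth i F t" for t
      unfolding dlip_step_def[abs_def] by (rule smooth_diff[OF lh Suc.prems(2)])
    moreover have "smooth i (\<lambda>t. F (t(i := t i + h))) t = smooth i F (t(i := t i + h))" for t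
      unfolding smooth_def by (simp add: algebra_simps)
    ultimately have "dlip_step i h (\<lambda>t. F t - smooth i F t) = (\<lambda>t. dlip_step i h F t - smooth i (dlip_step i h F) t)"
      by (auto simp: dlip_step_def fun_eq_iff)
    moreover have "dlip (Suc m) i (C * \<bar>h\<bar>) (dlip_step i h F)" using Suc.prems(1) by simp
    ultimately show ?thesis
      using Suc.IH[OF _ lip_dlip_step[OF Suc.prems(2)], of "C * \<bar>h\<bar>" h] by (simp only: mult_ac)
  qed
  then show ?case by simp
qed

lemma residual_small:
  assumes "separately_lip I F" "i \<in> I" "dlip m i C F"
  shows "\<bar>residual i m F t\<bar> \<le> C * \<delta> ^ m"
proof -
  have "dlip (m - k) i (C * \<delta> ^ k) (residual i k F)" if "k \<le> m" for k
    using that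
  proof (induction k)
    case (Suc k)
    obtain L where L: "lip L i (residual i k F)"
      using separately_lip_residual[OF assms(1,2)] assms(2) unfolding separately_lip_def by blast
    have "m - k = Suc (m - Suc k)" using Suc.prems by simp
    then show ?case using dlip_smooth[OF _ L, of "m - Suc k" "C * \<delta> ^ k"] Suc by (simp add: mult_ac)
  qed (use assms in simp)
  from this[of m] show ?thesis by simp
qed

text \<open>Periodicity moves the shift from \<open>F\<close> to the kernel, the addition theorem
  separates the variables, and evenness of \<open>F\<close> removes the sine terms.\<close>

lemma smooth_cos_form:
  assumes F: "even_periodic I F" and i: "i \<in> I"
  shows "smooth i F t = (\<Sum>a\<le>q. \<kappa> a * cos (real a * t i) * cos_coeff i a F t)"
proof -
  obtain L where L: "lip L i F" using F i unfolding even_periodic_def separately_lip_def by blast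
  define G where "G \<theta> = F (t(i := \<theta>))" for \<theta>
  have Gc [continuous_intros]: "continuous_on S f \<Longrightarrow> continuous_on S (\<lambda>x. G (f x))" for S f
    unfolding G_def by (rule continuous_on_compose2[OF lip_continuous[OF L, of UNIV t]]) auto
  have Gp: "G (x + 2 * pi) = G x" "G (- x) = G x" for x
    using F i unfolding even_periodic_def G_def by (metis fun_upd_same fun_upd_upd)+
  have Kp: "K (x + 2 * pi) = K x" for x
  proof -
    have "cos (real a * x + real a * (2 * pi)) = cos (real a * x)" for a
      using cos_int_2pin[of "int a"] sin_int_2pin[of "int a"] by (simp add: cos_add mult_ac)
    then show ?thesis unfolding K_def by (simp add: distrib_left)
  qed
  have "smooth i F t = integral {-pi..pi} (\<lambda>\<theta>. G (t i + \<theta>) * K ((t i + \<theta>) - t i))"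
    by (simp add: smooth_def G_def)
  also have "\<dots> = integral {-pi..pi} (\<lambda>\<theta>. G \<theta> * K (\<theta> - t i))"
  proof (rule integral_periodic_shift[of "\<lambda>x. G x * K (x - t i)" "t i"])
    show "continuous_on UNIV (\<lambda>x. G x * K (x - t i))" by (intro continuous_intros)
    show "G (x + 2 * pi) * K (x + 2 * pi - t i) = G x * K (x - t i)" for x
      using Gp(1)[of x] Kp[of "x - t i"] by (simp add: algebra_simps)
  qed
  also have "\<dots> = integral {-pi..pi} (\<lambda>\<theta>. \<Sum>a\<le>q. \<kappa> a * cos (real a * t i) * (G \<theta> * cos (real a * \<theta>)) +
      \<kappa> a * sin (real a * t i) * (G \<theta> * sin (real a * \<theta>)))"
    unfolding K_def sum_distrib_left
    by (intro integral_cong sum.cong refl) (simp add: right_diff_distrib cos_diff algebra_simps)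
  also have "\<dots> = (\<Sum>a\<le>q. integral {-pi..pi} (\<lambda>\<theta>. \<kappa> a * cos (real a * t i) * (G \<theta> * cos (real a * \<theta>)) +
      \<kappa> a * sin (real a * t i) * (G \<theta> * sin (real a * \<theta>))))"
    by (intro integral_sum integrable_continuous_interval continuous_intros) auto
  also have "\<dots> = (\<Sum>a\<le>q. \<kappa> a * cos (real a * t i) * integral {-pi..pi} (\<lambda>\<theta>. G \<theta> * cos (real a * \<theta>)) +
      \<kappa> a * sin (real a * t i) * integral {-pi..pi} (\<lambda>\<theta>. G \<theta> * sin (real a * \<theta>)))"
    by (intro sum.cong refl, subst Henstock_Kurzweil_Integration.integral_add)
      (auto intro!: integrable_continuous_interval continuous_intros)
  also have "\<dots> = (\<Sum>a\<le>q. \<kappa> a * cos (real a * t i) * cos_coeff i a F t)"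
  proof (intro sum.cong refl)
    fix a
    have "integral {-pi..pi} (\<lambda>\<theta>. G (- \<theta>) * sin (real a * (- \<theta>))) = integral {-pi..pi} (\<lambda>\<theta>. G \<theta> * sin (real a * \<theta>))"
      using Henstock_Kurzweil_Integration.integral_reflect_real[of pi "-pi" "\<lambda>\<theta>. G \<theta> * sin (real a * \<theta>)"] by simp
    then have "integral {-pi..pi} (\<lambda>\<theta>. G \<theta> * sin (real a * \<theta>)) = 0"
      by (simp add: Gp)
    then show "\<kappa> a * cos (real a * t i) * integral {-pi..pi} (\<lambda>\<theta>. G \<theta> * cos (real a * \<theta>)) +
      \<kappa> a * sin (real a * t i) * integral {-pi..pi} (\<lambda>\<theta>. G \<theta> * sin (real a * \<theta>)) =
      \<kappa> a * cos (real a * t i) * cos_coeff i a F t"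
      by (simp add: cos_coeff_def G_def)
  qed
  finally show ?thesis .
qed

text \<open>Cosines are eigenfunctions of the convolution, since the kernel is even.\<close>

lemma smooth_cos:
  "smooth i (\<lambda>t. cos (real a * t i) * cos_coeff i b F t) t =
     integral {-pi..pi} (\<lambda>\<theta>. cos (real a * \<theta>) * K \<theta>) * (cos (real a * t i) * cos_coeff i b F t)"
proof -
  have "integral {-pi..pi} (\<lambda>\<theta>. sin (real a * (- \<theta>)) * K (- \<theta>)) = integral {-pi..pi} (\<lambda>\<theta>. sin (real a * \<theta>) * K \<theta>)"
    using Henstock_Kurzweil_Integration.integral_reflect_real[of pi "-pi" "\<lambda>\<theta>. sin (real a * \<theta>) * K \<theta>"] by simp
  then have s: "integral {-pi..pi} (\<lambda>\<theta>. sin (real a * \<theta>) * K \<theta>) = 0" by (simp add: K_minus)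
  let ?c = "cos_coeff i b F t"
  have "cos_coeff i b F (t(i := x)) = ?c" for x by (simp add: cos_coeff_def)
  then have "smooth i (\<lambda>t. cos (real a * t i) * cos_coeff i b F t) t =
    integral {-pi..pi} (\<lambda>\<theta>. ?c * cos (real a * t i) * (cos (real a * \<theta>) * K \<theta>) - ?c * sin (real a * t i) * (sin (real a * \<theta>) * K \<theta>))"
    unfolding smooth_def by (simp add: distrib_left cos_add algebra_simps)
  also have "\<dots> = ?c * cos (real a * t i) * integral {-pi..pi} (\<lambda>\<theta>. cos (real a * \<theta>) * K \<theta>)
     - ?c * sin (real a * t i) * integral {-pi..pi} (\<lambda>\<theta>. sin (real a * \<theta>) * K \<theta>)"
    by (subst integral_diff) (auto intro!: integrable_continuous_interval continuous_intros)
  finally show ?thesis by (simp add: s)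
qed

lemma residual_cos_form:
  "\<exists>\<gamma>. \<forall>F t. even_periodic I F \<longrightarrow>
     residual i m F t = F t - (\<Sum>a\<le>q. \<gamma> a * (cos (real a * t i) * cos_coeff i a F t))" if i: "i \<in> I"
proof (induction m)
  case 0
  show ?case by (intro exI[of _ "\<lambda>_. 0"]) simp
next
  case (Suc m)
  then obtain \<gamma> where \<gamma>: "\<And>F t. even_periodic I F \<Longrightarrow>
      residual i m F t = F t - (\<Sum>a\<le>q. \<gamma> a * (cos (real a * t i) * cos_coeff i a F t))"
    by blast
  define \<mu> where "\<mu> a = integral {-pi..pi} (\<lambda>\<theta>. cos (real a * \<theta>) * K \<theta>)" for a
  \<comment> \<open>One more factor \<open>1 - smooth\<close> subtracts \<open>\<kappa> a\<close> on
    account of \<open>F\<close> itself and gives back \<open>\<gamma> a * \<mu> a\<close>, the modes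
    being eigenfunctions with eigenvalue \<open>\<mu> a\<close>.\<close>
  have "residual i (Suc m) F t = F t - (\<Sum>a\<le>q. (\<gamma> a + \<kappa> a - \<gamma> a * \<mu> a) * (cos (real a * t i) * cos_coeff i a F t))"
    if F: "even_periodic I F" for F t
  proof -
    obtain L where L: "lip L i F" using F i unfolding even_periodic_def separately_lip_def by blast
    let ?c = "\<lambda>t a. cos (real a * t i) * cos_coeff i a F t"
    have cc: "cos_coeff i a F (t(i := x)) = cos_coeff i a F t" for a t x by (simp add: cos_coeff_def)
    have int: "(\<lambda>\<theta>. cos (real a * (t i + \<theta>)) * cos_coeff i a F (t(i := t i + \<theta>)) * K \<theta>) integrable_on {-pi..pi}" for a
      unfolding cc by (intro integrable_continuous_interval continuous_intros)
    have eq: "residual i m F = (\<lambda>t. F t - (\<Sum>a\<le>q. \<gamma> a * ?c t a))"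
      using \<gamma>[OF F] by (intro ext)
    have "smooth i (residual i m F) t =
        integral {-pi..pi} (\<lambda>\<theta>. F (t(i := t i + \<theta>)) * K \<theta> -
          (\<Sum>a\<le>q. \<gamma> a * (cos (real a * (t i + \<theta>)) * cos_coeff i a F (t(i := t i + \<theta>)) * K \<theta>)))"
      unfolding eq smooth_def by (simp add: left_diff_distrib sum_distrib_right mult.assoc)
    also have "\<dots> = smooth i F t - (\<Sum>a\<le>q. \<gamma> a * smooth i (\<lambda>t. ?c t a) t)"
    proof -
      have "integral {-pi..pi} (\<lambda>\<theta>. \<Sum>a\<le>q. \<gamma> a * (cos (real a * (t i + \<theta>)) * cos_coeff i a F (t(i := t i + \<theta>)) * K \<theta>)) =
          (\<Sum>a\<le>q. integral {-pi..pi} (\<lambda>\<theta>. \<gamma> a * (cos (real a * (t i + \<theta>)) * cos_coeff i a F (t(i := t i + \<theta>)) * K \<theta>)))"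
        by (intro integral_sum integrable_on_mult_right int) auto
      also have "\<dots> = (\<Sum>a\<le>q. \<gamma> a * smooth i (\<lambda>t. ?c t a) t)"
        by (simp add: smooth_def)
      finally show ?thesis
        by (subst integral_diff) (auto simp: smooth_def intro!: smooth_integrable[OF L] integrable_sum integrable_on_mult_right int)
    qed
    also have "\<dots> = (\<Sum>a\<le>q. (\<kappa> a - \<gamma> a * \<mu> a) * ?c t a)"
      unfolding smooth_cos_form[OF F i] smooth_cos \<mu>_def sum_subtractf[symmetric]
      by (intro sum.cong refl) (simp add: algebra_simps)
    finally show ?thesis
      using \<gamma>[OF F, of t] by (simp add: sum_subtractf sum.distrib algebra_simps)
  qed
  then show ?case by (intro exI[of _ "\<lambda>a. \<gamma> a + \<kappa> a - \<gamma> a * \<mu> a"]) blast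
qed

text \<open>The tensor product over the variables of the operators
  \<open>1 - (1 - smooth i) ^ m\<close>.\<close>

fun approximant :: "nat \<Rightarrow> 'i list \<Rightarrow> (('i \<Rightarrow> real) \<Rightarrow> real) \<Rightarrow> ('i \<Rightarrow> real) \<Rightarrow> real" where
  "approximant m [] F = F"
| "approximant m (i # is) F = approximant m is (\<lambda>t. F t - residual i m F t)"

lemma separately_lip_diff: "separately_lip I F \<Longrightarrow> separately_lip I G \<Longrightarrow> separately_lip I (\<lambda>t. F t - G t)"
  unfolding separately_lip_def using lip_diff by metis

lemma approximant_diff:
  assumes "separately_lip I F" "separately_lip I G" "set is \<subseteq> I"
  shows "approximant m is (\<lambda>t. F t - G t) t = approximant m is F t - approximant m is G t"
  using assms
proof (induction "is" arbitrary: F G)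
  case (Cons i "is")
  have i: "i \<in> I" using Cons.prems by simp
  have "(\<lambda>t. F t - G t - residual i m (\<lambda>t. F t - G t) t) = (\<lambda>t. (F t - residual i m F t) - (G t - residual i m G t))"
    using residual_diff[OF Cons.prems(1,2) i] by (simp add: fun_eq_iff)
  moreover have "approximant m is (\<lambda>t. (F t - residual i m F t) - (G t - residual i m G t)) t =
      approximant m is (\<lambda>t. F t - residual i m F t) t - approximant m is (\<lambda>t. G t - residual i m G t) t"
    using Cons.prems i by (intro Cons.IH separately_lip_diff separately_lip_residual) auto
  ultimately show ?case by simp
qed simp

lemma approximant_bound:
  assumes "separately_lip I F" "\<And>t. \<bar>F t\<bar> \<le> B" "set is \<subseteq> I"
  shows "\<bar>approximant m is F t\<bar> \<le> (1 + 2 ^ m) ^ length is * B"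
  using assms
proof (induction "is" arbitrary: F B)
  case (Cons i "is")
  have i: "i \<in> I" using Cons.prems by simp
  have "\<bar>F t - residual i m F t\<bar> \<le> (1 + 2 ^ m) * B" for t
    using residual_bound[OF Cons.prems(1) i Cons.prems(2), of m t] Cons.prems(2)[of t] by (simp add: distrib_right)
  then have "\<bar>approximant m is (\<lambda>t. F t - residual i m F t) t\<bar> \<le> (1 + 2 ^ m) ^ length is * ((1 + 2 ^ m) * B)"
    using Cons.prems i by (intro Cons.IH separately_lip_diff separately_lip_residual) auto
  then show ?case by (simp add: mult_ac)
qed simp

text \<open>Telescoping. What is removed for the variable \<open>i\<close> is the residual of the
  original \<open>F\<close>, and only afterwards the operators of the other variables act on it,
  each with norm at most \<open>1 + 2 ^ m\<close>. So smoothness is asked of \<open>F\<close> and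
  never of a partly smoothed function.\<close>

lemma approximant_error:
  assumes "separately_lip I F" "\<And>i. i \<in> I \<Longrightarrow> dlip m i B F" "set is \<subseteq> I" "0 \<le> B" "0 \<le> \<delta>"
  shows "\<bar>F t - approximant m is F t\<bar> \<le> real (length is) * (1 + 2 ^ m) ^ length is * B * \<delta> ^ m"
  using assms(3)
proof (induction "is")
  case (Cons i "is")
  have i: "i \<in> I" using Cons.prems by simp
  let ?C = "1 + 2 ^ m :: real" and ?e = "B * \<delta> ^ m"
  have e: "0 \<le> ?e" using assms by simp
  have r: "separately_lip I (residual i m F)" by (rule separately_lip_residual[OF assms(1) i])
  have "approximant m (i # is) F t = approximant m is F t - approximant m is (residual i m F) t"
    using approximant_diff[OF assms(1) r] Cons.prems by simp
  moreover have "\<bar>approximant m is (residual i m F) t\<bar> \<le> ?C ^ length is * ?e"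
    using Cons.prems by (intro approximant_bound[OF r] residual_small[OF assms(1) i assms(2)[OF i]]) auto
  moreover have "\<bar>F t - approximant m is F t\<bar> \<le> real (length is) * ?C ^ length is * B * \<delta> ^ m"
    using Cons by simp
  ultimately have "\<bar>F t - approximant m (i # is) F t\<bar> \<le> real (length (i # is)) * (?C ^ length is * ?e)"
    by (simp add: algebra_simps)
  also have "\<dots> \<le> real (length (i # is)) * (?C ^ length (i # is) * ?e)"
    using e by (intro mult_left_mono mult_right_mono power_increasing) auto
  finally show ?case by (simp add: mult_ac)
qed simp

end

section \<open>Chebyshev polynomials and the passage to algebraic polynomials\<close>

lemma cos_multiple_polynomial: "\<exists>p. degree p \<le> a \<and> (\<forall>t::real. cos (real a * t) = poly p (cos t))"
proof (induction a rule: less_induct)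
  case (less a)
  consider "a = 0" | "a = 1" | b where "a = Suc (Suc b)" by (metis One_nat_def not0_implies_Suc)
  then show ?case
  proof cases
    case 1
    then show ?thesis by (intro exI[of _ "[:1:]"]) simp
  next
    case 2
    then show ?thesis by (intro exI[of _ "[:0, 1:]"]) simp
  next
    case 3
    obtain p where p: "degree p \<le> Suc b" "\<And>t::real. cos (real (Suc b) * t) = poly p (cos t)"
      using less[of "Suc b"] 3 by auto
    obtain r where r: "degree r \<le> b" "\<And>t::real. cos (real b * t) = poly r (cos t)"
      using less[of b] 3 by auto
    have "cos (real a * t) = poly ([:0, 2:] * p - r) (cos t)" for t
    proof -
      have "cos (real a * t) + cos (real b * t) = 2 * cos t * cos (real (Suc b) * t)"
        using cos_add[of "real (Suc b) * t" t] cos_diff[of "real (Suc b) * t" t] 3 by (simp add: algebra_simps)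
      then show ?thesis using p r by simp
    qed
    moreover have "degree ([:0, 2:] * p - r) \<le> a"
      using p r 3 degree_mult_le[of "[:0, 2:]" p] by (intro degree_diff_le) auto
    ultimately show ?thesis by blast
  qed
qed

lemma sum_PiE_insert:
  assumes "i \<notin> S"
  shows "(\<Sum>\<alpha>\<in>(\<Pi>\<^sub>E j\<in>insert i S. A). g (\<alpha> i) (restrict \<alpha> S)) = (\<Sum>b\<in>A. \<Sum>\<beta>\<in>(\<Pi>\<^sub>E j\<in>S. A). g b \<beta>)"
proof -
  have "(\<Sum>b\<in>A. \<Sum>\<beta>\<in>(\<Pi>\<^sub>E j\<in>S. A). g b \<beta>) = (\<Sum>(b, \<beta>)\<in>A \<times> (\<Pi>\<^sub>E j\<in>S. A). g b \<beta>)"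
    by (rule sum.cartesian_product)
  also have "\<dots> = (\<Sum>\<alpha>\<in>(\<Pi>\<^sub>E j\<in>insert i S. A). g (\<alpha> i) (restrict \<alpha> S))"
  proof (rule sum.reindex_bij_witness[of _ "\<lambda>\<alpha>. (\<alpha> i, restrict \<alpha> S)" "\<lambda>(b, \<beta>). \<beta>(i := b)"])
    fix p assume "p \<in> A \<times> (\<Pi>\<^sub>E j\<in>S. A)"
    then obtain b \<beta> where p: "p = (b, \<beta>)" "b \<in> A" "\<beta> \<in> (\<Pi>\<^sub>E j\<in>S. A)" by blast
    have r: "restrict (\<beta>(i := b)) S = \<beta>"
      using p(3) assms by (auto simp: fun_eq_iff restrict_def PiE_def extensional_def)
    show "(\<lambda>\<alpha>. (\<alpha> i, restrict \<alpha> S)) ((\<lambda>(b, \<beta>). \<beta>(i := b)) p) = p" using p r by simp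
    show "(\<lambda>(b, \<beta>). \<beta>(i := b)) p \<in> (\<Pi>\<^sub>E j\<in>insert i S. A)" using p by (auto simp: PiE_iff extensional_def)
    show "g (((\<lambda>(b, \<beta>). \<beta>(i := b)) p) i) (restrict ((\<lambda>(b, \<beta>). \<beta>(i := b)) p) S) = (case p of (b, \<beta>) \<Rightarrow> g b \<beta>)"
      using p r by simp
  next
    fix \<alpha> assume a: "\<alpha> \<in> (\<Pi>\<^sub>E j\<in>insert i S. A)"
    show "(\<lambda>(b, \<beta>). \<beta>(i := b)) (\<alpha> i, restrict \<alpha> S) = \<alpha>"
      using a by (auto simp: fun_eq_iff restrict_def PiE_def extensional_def)
    show "(\<alpha> i, restrict \<alpha> S) \<in> A \<times> (\<Pi>\<^sub>E j\<in>S. A)" using a by (auto simp: PiE_iff)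
  qed
  finally show ?thesis ..
qed

context kernel begin

lemma approximant_sum:
  assumes "finite A" "\<And>a. a \<in> A \<Longrightarrow> separately_lip I (F a)" "set is \<subseteq> I"
  shows "separately_lip I (\<lambda>t. \<Sum>a\<in>A. F a t) \<and>
    approximant m is (\<lambda>t. \<Sum>a\<in>A. F a t) t = (\<Sum>a\<in>A. approximant m is (F a) t)"
  using assms(1,2)
proof (induction A)
  case empty
  have z: "separately_lip I (\<lambda>t. 0)" by (auto simp: separately_lip_def lip_def intro: exI[of _ 0])
  have "approximant m is (\<lambda>t. 0 - 0) t = approximant m is (\<lambda>t. 0) t - approximant m is (\<lambda>t. 0) t"
    by (rule approximant_diff[OF z z assms(3)])
  with z show ?case by simp
next
  case (insert a A)
  have neg: "separately_lip I (\<lambda>t. - G t) \<and> approximant m is (\<lambda>t. - G t) t = - approximant m is G t" if G: "separately_lip I G" for G t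
  proof -
    have z: "separately_lip I (\<lambda>t. 0)" by (auto simp: separately_lip_def lip_def intro: exI[of _ 0])
    have "approximant m is (\<lambda>t. 0 - 0) t = approximant m is (\<lambda>t. 0) t - approximant m is (\<lambda>t. 0) t"
      by (rule approximant_diff[OF z z assms(3)])
    then have "approximant m is (\<lambda>t. 0) t = 0" by simp
    with approximant_diff[OF z G assms(3), of m t] separately_lip_diff[OF z G] show ?thesis by simp
  qed
  let ?S = "\<lambda>t. \<Sum>a\<in>A. F a t"
  have S: "separately_lip I ?S" "approximant m is ?S t = (\<Sum>a\<in>A. approximant m is (F a) t)" using insert by auto
  have "separately_lip I (\<lambda>t. F a t - - ?S t)" using insert.prems neg[OF S(1)] by (intro separately_lip_diff) auto
  moreover have "approximant m is (\<lambda>t. F a t - - ?S t) t = approximant m is (F a) t + approximant m is ?S t"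
    using approximant_diff[of I "F a" "\<lambda>t. - ?S t" "is" m t] insert.prems neg[OF S(1)] assms(3) by simp
  ultimately show ?case using insert S by simp
qed

lemma residual_scale:
  assumes "\<And>t x. c (t(i := x)) = c t"
  shows "residual i m (\<lambda>t. c t * F t) t = c t * residual i m F t"
proof (induction m arbitrary: t)
  case (Suc m)
  have eq: "residual i m (\<lambda>t. c t * F t) = (\<lambda>t. c t * residual i m F t)" using Suc by (intro ext)
  have "smooth i (\<lambda>t. c t * residual i m F t) t = c t * smooth i (residual i m F) t"
    unfolding smooth_def by (simp add: assms mult.assoc)
  then show ?case unfolding residual.simps eq by (simp add: algebra_simps)
qed simp

lemma approximant_scale:
  assumes "\<And>i t x. i \<in> set is \<Longrightarrow> c (t(i := x)) = c t"
  shows "approximant m is (\<lambda>t. c t * F t) t = c t * approximant m is F t"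
  using assms
proof (induction "is" arbitrary: F)
  case (Cons i "is")
  have "(\<lambda>t. c t * F t - residual i m (\<lambda>t. c t * F t) t) = (\<lambda>t. c t * (F t - residual i m F t))"
    using residual_scale[of c i m F] Cons.prems by (simp add: fun_eq_iff algebra_simps)
  then show ?case using Cons by simp
qed simp

text \<open>Bookkeeping for the coefficients in \<open>approximant_polynomial\<close>: they are
  functions of \<open>t\<close> until all variables have been expanded, and have to be constant in
  the end.\<close>

definition indep_of :: "'i set \<Rightarrow> (('i \<Rightarrow> real) \<Rightarrow> real) \<Rightarrow> bool" where
  "indep_of S F \<longleftrightarrow> (\<forall>t t'. (\<forall>j. j \<notin> S \<longrightarrow> t j = t' j) \<longrightarrow> F t = F t')"

lemma indep_of_cos_coeff:
  fixes F :: "('i \<Rightarrow> real) \<Rightarrow> real"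
  assumes "indep_of S F"
  shows "indep_of (insert i S) (cos_coeff i a F)"
  unfolding indep_of_def
proof (intro allI impI)
  fix t t' :: "'i \<Rightarrow> real"
  assume "\<forall>j. j \<notin> insert i S \<longrightarrow> t j = t' j"
  then have "F (t(i := \<theta>)) = F (t'(i := \<theta>))" for \<theta>
    using assms unfolding indep_of_def by auto
  then show "cos_coeff i a F t = cos_coeff i a F t'" by (simp add: cos_coeff_def)
qed

lemma approximant_polynomial:
  fixes F :: "('i \<Rightarrow> real) \<Rightarrow> real"
  assumes "distinct is" "set is \<subseteq> I" "even_periodic I F" "indep_of S F"
  shows "\<exists>a. (\<forall>t. approximant m is F t = (\<Sum>\<alpha>\<in>(\<Pi>\<^sub>E i\<in>set is. {..q}). a \<alpha> t * (\<Prod>i\<in>set is. cos (t i) ^ \<alpha> i))) \<and>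
    (\<forall>\<alpha>. indep_of (set is \<union> S) (a \<alpha>))"
  using assms
proof (induction "is" arbitrary: F S)
  case Nil
  then show ?case by (intro exI[of _ "\<lambda>_. F"]) simp
next
  case (Cons i "is")
  let ?S = "set is"
  have i: "i \<in> I" "i \<notin> ?S" using Cons.prems by auto
  obtain \<gamma> where \<gamma>: "\<And>F t. even_periodic I F \<Longrightarrow>
      residual i m F t = F t - (\<Sum>c\<le>q. \<gamma> c * (cos (real c * t i) * cos_coeff i c F t))"
    using residual_cos_form[OF i(1)] by blast
  have ep: "even_periodic I (cos_coeff i c F)" for c
    by (rule cos_coeff_even_periodic[OF Cons.prems(3) i(1)])
  have ex: "\<exists>a. (\<forall>t. approximant m is (cos_coeff i c F) t = (\<Sum>\<alpha>\<in>(\<Pi>\<^sub>E i\<in>?S. {..q}). a \<alpha> t * (\<Prod>i\<in>?S. cos (t i) ^ \<alpha> i))) \<and>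
    (\<forall>\<alpha>. indep_of (?S \<union> insert i S) (a \<alpha>))" for c
    using Cons.prems by (intro Cons.IH ep indep_of_cos_coeff) auto
  have "\<forall>c. \<exists>a. (\<forall>t. approximant m is (cos_coeff i c F) t = (\<Sum>\<alpha>\<in>(\<Pi>\<^sub>E i\<in>?S. {..q}). a \<alpha> t * (\<Prod>i\<in>?S. cos (t i) ^ \<alpha> i))) \<and>
    (\<forall>\<alpha>. indep_of (?S \<union> insert i S) (a \<alpha>))" by (intro allI ex)
  from choice[OF this] obtain a where
    "\<forall>c. (\<forall>t. approximant m is (cos_coeff i c F) t = (\<Sum>\<alpha>\<in>(\<Pi>\<^sub>E i\<in>?S. {..q}). a c \<alpha> t * (\<Prod>i\<in>?S. cos (t i) ^ \<alpha> i))) \<and>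
      (\<forall>\<alpha>. indep_of (?S \<union> insert i S) (a c \<alpha>))" by (elim exE)
  then have a: "\<And>c t. approximant m is (cos_coeff i c F) t = (\<Sum>\<alpha>\<in>(\<Pi>\<^sub>E i\<in>?S. {..q}). a c \<alpha> t * (\<Prod>i\<in>?S. cos (t i) ^ \<alpha> i))"
    "\<And>c \<alpha>. indep_of (?S \<union> insert i S) (a c \<alpha>)" by simp_all
  have "\<forall>c. \<exists>p. degree p \<le> c \<and> (\<forall>t::real. cos (real c * t) = poly p (cos t))"
    using cos_multiple_polynomial by blast
  from choice[OF this] obtain p where
    "\<forall>c. degree (p c) \<le> c \<and> (\<forall>t::real. cos (real c * t) = poly (p c) (cos t))" by (elim exE)
  then have p: "\<And>c. degree (p c) \<le> c" "\<And>c t. cos (real c * t) = poly (p c) (cos t)" by simp_all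
  have px: "cos (real c * x) = (\<Sum>b\<le>q. coeff (p c) b * cos x ^ b)" if "c \<le> q" for c x
  proof -
    have "degree (p c) \<le> q" using p(1)[of c] that by simp
    from poly_as_sum_of_monoms'[OF this] have "poly (\<Sum>b\<le>q. monom (coeff (p c) b) b) (cos x) = poly (p c) (cos x)" by simp
    then show ?thesis by (simp add: p(2) poly_sum poly_monom)
  qed
  define A where "A b \<beta> t = (\<Sum>c\<le>q. \<gamma> c * coeff (p c) b * a c \<beta> t)" for b \<beta> t
  have "approximant m (i # is) F t =
    (\<Sum>\<alpha>\<in>(\<Pi>\<^sub>E j\<in>set (i # is). {..q}). A (\<alpha> i) (restrict \<alpha> ?S) t * (\<Prod>j\<in>set (i # is). cos (t j) ^ \<alpha> j))" for t
  proof -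
    obtain L where L: "\<And>c j. j \<in> ?S \<Longrightarrow> lip (L c) j (cos_coeff i c F)"
      using ep Cons.prems(2) unfolding even_periodic_def separately_lip_def by (metis subset_iff set_subset_Cons)
    have sl: "separately_lip ?S (\<lambda>t. (\<gamma> c * cos (real c * t i)) * cos_coeff i c F t)" for c
      unfolding separately_lip_def
    proof (intro exI[of _ "\<bar>\<gamma> c\<bar> * L c"] ballI)
      fix j assume j: "j \<in> ?S"
      then have ji: "i \<noteq> j" using i by blast
      show "lip (\<bar>\<gamma> c\<bar> * L c) j (\<lambda>t. (\<gamma> c * cos (real c * t i)) * cos_coeff i c F t)"
        unfolding lip_def
      proof (intro allI)
        fix t \<tau>
        have "\<bar>\<gamma> c * cos (real c * t i)\<bar> * \<bar>cos_coeff i c F (t(j := \<tau>)) - cos_coeff i c F t\<bar> \<le> (\<bar>\<gamma> c\<bar> * 1) * (L c * \<bar>\<tau> - t j\<bar>)"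
          using L[OF j, of c] unfolding lip_def abs_mult by (intro mult_mono) auto
        then show "\<bar>(\<gamma> c * cos (real c * (t(j := \<tau>)) i)) * cos_coeff i c F (t(j := \<tau>)) - (\<gamma> c * cos (real c * t i)) * cos_coeff i c F t\<bar>
            \<le> \<bar>\<gamma> c\<bar> * L c * \<bar>\<tau> - t j\<bar>"
          using ji by (simp add: abs_mult[symmetric] right_diff_distrib mult_ac)
      qed
    qed
    have "approximant m (i # is) F t = approximant m is (\<lambda>t. \<Sum>c\<le>q. (\<gamma> c * cos (real c * t i)) * cos_coeff i c F t) t"
      by (simp add: \<gamma>[OF Cons.prems(3)] mult.assoc)
    also have "\<dots> = (\<Sum>c\<le>q. approximant m is (\<lambda>t. (\<gamma> c * cos (real c * t i)) * cos_coeff i c F t) t)"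
      using approximant_sum[of "{..q}" ?S "\<lambda>c t. (\<gamma> c * cos (real c * t i)) * cos_coeff i c F t" "is" m t] sl by simp
    also have "\<dots> = (\<Sum>c\<le>q. (\<gamma> c * cos (real c * t i)) * approximant m is (cos_coeff i c F) t)"
      using i(2) by (intro sum.cong refl approximant_scale) auto
    also have "\<dots> = (\<Sum>c\<le>q. \<Sum>b\<le>q. \<Sum>\<beta>\<in>(\<Pi>\<^sub>E i\<in>?S. {..q}). \<gamma> c * coeff (p c) b * a c \<beta> t * (cos (t i) ^ b * (\<Prod>j\<in>?S. cos (t j) ^ \<beta> j)))"
    proof (intro sum.cong refl)
      fix c assume "c \<in> {..q}"
      then have "(\<gamma> c * cos (real c * t i)) * approximant m is (cos_coeff i c F) t =
          (\<Sum>b\<le>q. \<gamma> c * coeff (p c) b * cos (t i) ^ b) * (\<Sum>\<beta>\<in>(\<Pi>\<^sub>E i\<in>?S. {..q}). a c \<beta> t * (\<Prod>j\<in>?S. cos (t j) ^ \<beta> j))"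
        by (simp add: px a(1) sum_distrib_left mult.assoc)
      also have "\<dots> = (\<Sum>b\<le>q. \<Sum>\<beta>\<in>(\<Pi>\<^sub>E i\<in>?S. {..q}). \<gamma> c * coeff (p c) b * a c \<beta> t * (cos (t i) ^ b * (\<Prod>j\<in>?S. cos (t j) ^ \<beta> j)))"
        unfolding sum_product by (intro sum.cong refl) (simp only: mult_ac)
      finally show "(\<gamma> c * cos (real c * t i)) * approximant m is (cos_coeff i c F) t =
        (\<Sum>b\<le>q. \<Sum>\<beta>\<in>(\<Pi>\<^sub>E i\<in>?S. {..q}). \<gamma> c * coeff (p c) b * a c \<beta> t * (cos (t i) ^ b * (\<Prod>j\<in>?S. cos (t j) ^ \<beta> j)))" .
    qed
    also have "\<dots> = (\<Sum>b\<le>q. \<Sum>\<beta>\<in>(\<Pi>\<^sub>E i\<in>?S. {..q}). A b \<beta> t * (cos (t i) ^ b * (\<Prod>j\<in>?S. cos (t j) ^ \<beta> j)))"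
      unfolding A_def sum_distrib_right by (subst sum.swap, intro sum.cong refl, rule sum.swap)
    also have "\<dots> = (\<Sum>\<alpha>\<in>(\<Pi>\<^sub>E j\<in>insert i ?S. {..q}). A (\<alpha> i) (restrict \<alpha> ?S) t *
        (cos (t i) ^ \<alpha> i * (\<Prod>j\<in>?S. cos (t j) ^ restrict \<alpha> ?S j)))"
      by (rule sum_PiE_insert[OF i(2), symmetric])
    also have "\<dots> = (\<Sum>\<alpha>\<in>(\<Pi>\<^sub>E j\<in>set (i # is). {..q}). A (\<alpha> i) (restrict \<alpha> ?S) t * (\<Prod>j\<in>set (i # is). cos (t j) ^ \<alpha> j))"
      using i(2) by simp
    finally show ?thesis .
  qed
  moreover have "indep_of (set (i # is) \<union> S) (A b \<beta>)" for b \<beta>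
    unfolding indep_of_def
  proof (intro allI impI)
    fix t t' :: "'i \<Rightarrow> real" assume "\<forall>j. j \<notin> set (i # is) \<union> S \<longrightarrow> t j = t' j"
    then have "a c \<beta> t = a c \<beta> t'" for c using a(2)[of c \<beta>] unfolding indep_of_def by auto
    then show "A b \<beta> t = A b \<beta> t'" by (simp add: A_def)
  qed
  ultimately show ?case by (intro exI[of _ "\<lambda>\<alpha>. A (\<alpha> i) (restrict \<alpha> ?S)"]) simp
qed

end

text \<open>The substitution \<open>x i = cos (t i)\<close> makes any function on the cube even and
  periodic, and even trigonometric polynomials become algebraic ones. Smoothness is therefore asked
  for after the substitution.\<close>

lemma jackson_approximation:
  fixes f :: "('i \<Rightarrow> real) \<Rightarrow> real" and I :: "'i set"
  defines "F \<equiv> \<lambda>t. f (\<lambda>i\<in>I. cos (t i))"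
  assumes I: "finite I" and lip: "separately_lip I F" and dl: "\<And>i. i \<in> I \<Longrightarrow> dlip m i B F" and B: "0 \<le> B"
  shows "\<exists>a. \<forall>x\<in>cube I. \<bar>f x - (\<Sum>\<alpha>\<in>(\<Pi>\<^sub>E i\<in>I. {..q}). a \<alpha> * (\<Prod>i\<in>I. x i ^ \<alpha> i))\<bar>
    \<le> real (card I) * (1 + 2 ^ m) ^ card I * B * (8 / real (q + 1)) ^ m"
proof -
  obtain \<kappa> where \<kappa>: "\<And>\<theta>. 0 \<le> (\<Sum>a\<le>q. \<kappa> a * cos (real a * \<theta>))"
    "integral {-pi..pi} (\<lambda>\<theta>. \<Sum>a\<le>q. \<kappa> a * cos (real a * \<theta>)) = 1"
    "integral {-pi..pi} (\<lambda>\<theta>. \<bar>\<theta>\<bar> * (\<Sum>a\<le>q. \<kappa> a * cos (real a * \<theta>))) \<le> 8 / real (q + 1)"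
    using fejer_korovkin_kernel[of q] by blast
  interpret kernel q \<kappa> "\<lambda>\<theta>. \<Sum>a\<le>q. \<kappa> a * cos (real a * \<theta>)" "8 / real (q + 1)"
    by unfold_locales (use \<kappa> in auto)
  have ep: "even_periodic I F"
    unfolding even_periodic_def
  proof (intro conjI ballI allI lip)
    fix i t
    have "(\<lambda>j\<in>I. cos ((t(i := t i + 2 * pi)) j)) = (\<lambda>j\<in>I. cos (t j))" by (auto simp: fun_eq_iff restrict_def)
    then show "F (t(i := t i + 2 * pi)) = F t" by (simp add: F_def)
    have "(\<lambda>j\<in>I. cos ((t(i := - t i)) j)) = (\<lambda>j\<in>I. cos (t j))" by (auto simp: fun_eq_iff restrict_def)
    then show "F (t(i := - t i)) = F t" by (simp add: F_def)
  qed
  obtain xs where xs: "set xs = I" "distinct xs" using finite_distinct_list[OF I] by blast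
  \<comment> \<open>Together with the expansion in all variables of \<open>I\<close> this makes the
    coefficients constant; they are read off at the point 0.\<close>
  have "indep_of (- I) F"
    unfolding indep_of_def
  proof (intro allI impI)
    fix t t' :: "'i \<Rightarrow> real" assume "\<forall>j. j \<notin> - I \<longrightarrow> t j = t' j"
    then have "(\<lambda>i\<in>I. cos (t i)) = (\<lambda>i\<in>I. cos (t' i))" by (intro restrict_ext) simp
    then show "F t = F t'" by (simp add: F_def)
  qed
  from approximant_polynomial[OF xs(2) equalityD1[OF xs(1)] ep this, of m]
  obtain a where a': "(\<forall>t. approximant m xs F t = (\<Sum>\<alpha>\<in>(\<Pi>\<^sub>E i\<in>set xs. {..q}). a \<alpha> t * (\<Prod>i\<in>set xs. cos (t i) ^ \<alpha> i))) \<and>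
    (\<forall>\<alpha>. indep_of (set xs \<union> - I) (a \<alpha>))" by (elim exE)
  have a: "\<And>t. approximant m xs F t = (\<Sum>\<alpha>\<in>(\<Pi>\<^sub>E i\<in>I. {..q}). a \<alpha> t * (\<Prod>i\<in>I. cos (t i) ^ \<alpha> i))"
    "\<And>\<alpha>. indep_of UNIV (a \<alpha>)"
    using conjunct1[OF a', rule_format] conjunct2[OF a', rule_format] unfolding xs(1) Compl_partition .
  have "\<bar>f x - (\<Sum>\<alpha>\<in>(\<Pi>\<^sub>E i\<in>I. {..q}). a \<alpha> (\<lambda>_. 0) * (\<Prod>i\<in>I. x i ^ \<alpha> i))\<bar>
    \<le> real (card I) * (1 + 2 ^ m) ^ card I * B * (8 / real (q + 1)) ^ m" if x: "x \<in> cube I" for x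
  proof -
    define t where "t i = arccos (x i)" for i
    have ct: "cos (t i) = x i" if "i \<in> I" for i
      using x that unfolding t_def cube_def by (intro cos_arccos) (auto simp: PiE_iff)
    have "(\<lambda>i\<in>I. cos (t i)) = x" using x ct by (auto simp: cube_def PiE_iff extensional_def fun_eq_iff restrict_def)
    then have Ft: "F t = f x" by (simp add: F_def)
    have "a \<alpha> t = a \<alpha> (\<lambda>_. 0)" for \<alpha> using a(2)[of \<alpha>] unfolding indep_of_def by simp
    then have ap: "approximant m xs F t = (\<Sum>\<alpha>\<in>(\<Pi>\<^sub>E i\<in>I. {..q}). a \<alpha> (\<lambda>_. 0) * (\<Prod>i\<in>I. x i ^ \<alpha> i))"
      unfolding a(1) by (intro sum.cong prod.cong arg_cong2[of _ _ _ _ "(*)"] refl) (simp_all add: ct)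
    have len: "length xs = card I" using distinct_card[OF xs(2)] unfolding xs(1) by (rule sym)
    have err: "\<bar>F t - approximant m xs F t\<bar> \<le> real (length xs) * (1 + 2 ^ m) ^ length xs * B * (8 / real (q + 1)) ^ m"
    proof (rule approximant_error[of I F m B xs t])
      show "set xs \<subseteq> I" using xs(1) by (rule equalityD1)
      show "0 \<le> 8 / real (q + 1)" by simp
    qed (fact lip dl B)+
    show ?thesis using err unfolding Ft ap len .
  qed
  then show ?thesis by (intro exI[of _ "\<lambda>\<alpha>. a \<alpha> (\<lambda>_. 0)"] ballI)
qed

section \<open>Functions on the real line with bounded derivatives\<close>

fun bounded_derivs :: "nat \<Rightarrow> real \<Rightarrow> (real \<Rightarrow> real) \<Rightarrow> bool" where
  "bounded_derivs 0 B c \<longleftrightarrow> (\<forall>t. \<bar>c t\<bar> \<le> B)"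
| "bounded_derivs (Suc m) B c \<longleftrightarrow> (\<forall>t. \<bar>c t\<bar> \<le> B) \<and>
     (\<exists>c'. (\<forall>t. (c has_real_derivative c' t) (at t)) \<and> bounded_derivs m B c')"

lemma bounded_derivs_bound: "bounded_derivs m B c \<Longrightarrow> \<bar>c t\<bar> \<le> B"
  by (cases m) auto

lemma bounded_derivs_nonneg: "bounded_derivs m B c \<Longrightarrow> 0 \<le> B"
  using bounded_derivs_bound[of m B c 0] by linarith

lemma bounded_derivs_mono: "bounded_derivs m B c \<Longrightarrow> B \<le> B' \<Longrightarrow> bounded_derivs m B' c"
  by (induction m arbitrary: c) (auto intro: order_trans)

lemma bounded_derivs_SucD: "bounded_derivs (Suc m) B c \<Longrightarrow> bounded_derivs m B c"
  by (induction m arbitrary: c) auto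

lemma bounded_derivs_add:
  "bounded_derivs m B c \<Longrightarrow> bounded_derivs m B' d \<Longrightarrow> bounded_derivs m (B + B') (\<lambda>t. c t + d t)"
proof (induction m arbitrary: c d)
  case 0
  then show ?case by (auto intro: order_trans[OF abs_triangle_ineq] add_mono)
next
  case (Suc m)
  then obtain c' d' where "\<And>t. (c has_real_derivative c' t) (at t)" "bounded_derivs m B c'"
    "\<And>t. (d has_real_derivative d' t) (at t)" "bounded_derivs m B' d'" by auto
  moreover have "\<bar>c t + d t\<bar> \<le> B + B'" for t
    using bounded_derivs_bound[OF Suc.prems(1), of t] bounded_derivs_bound[OF Suc.prems(2), of t] by linarith
  ultimately show ?case using Suc.IH
    unfolding bounded_derivs.simps by (intro conjI allI exI[of _ "\<lambda>t. c' t + d' t"] DERIV_add)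
qed

lemma bounded_derivs_const: "\<bar>a\<bar> \<le> B \<Longrightarrow> bounded_derivs m B (\<lambda>_. a)"
proof (induction m arbitrary: a)
  case (Suc m)
  have "bounded_derivs m B (\<lambda>_. 0)" using Suc.prems by (intro Suc.IH) auto
  then show ?case using Suc.prems by (auto intro!: exI[of _ "\<lambda>_. 0"])
qed auto

lemma bounded_derivs_sum:
  assumes "finite S" "\<And>e. e \<in> S \<Longrightarrow> bounded_derivs m B (c e)" "0 \<le> B"
  shows "bounded_derivs m (real (card S) * B) (\<lambda>t. \<Sum>e\<in>S. c e t)"
  using assms
proof (induction S)
  case empty
  then show ?case using bounded_derivs_const[of 0 0 m] by simp
next
  case (insert e S)
  then have "bounded_derivs m (B + real (card S) * B) (\<lambda>t. c e t + (\<Sum>e\<in>S. c e t))"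
    by (intro bounded_derivs_add) auto
  then show ?case using insert by (simp add: distrib_right)
qed

text \<open>Leibniz rule: one factor 2 per order for the two summands of the derivative of a
  product.\<close>

lemma bounded_derivs_mult:
  "bounded_derivs m B c \<Longrightarrow> bounded_derivs m B' d \<Longrightarrow> bounded_derivs m (2 ^ m * B * B') (\<lambda>t. c t * d t)"
proof (induction m arbitrary: c d)
  case 0
  then have "0 \<le> B" using bounded_derivs_nonneg by blast
  with 0 show ?case by (auto simp: abs_mult intro!: mult_mono)
next
  case (Suc m)
  have B: "0 \<le> B" "0 \<le> B'" using Suc.prems bounded_derivs_nonneg by blast+
  obtain c' d' where d: "\<And>t. (c has_real_derivative c' t) (at t)" "bounded_derivs m B c'"
    "\<And>t. (d has_real_derivative d' t) (at t)" "bounded_derivs m B' d'" using Suc.prems by auto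
  note bounded_derivs_add[OF Suc.IH[OF bounded_derivs_SucD[OF Suc.prems(1)] d(4)]
      Suc.IH[OF d(2) bounded_derivs_SucD[OF Suc.prems(2)]]]
  then have "bounded_derivs m (2 ^ Suc m * B * B') (\<lambda>t. c t * d' t + c' t * d t)" by (simp add: mult_ac)
  moreover have "\<bar>c t * d t\<bar> \<le> 2 ^ Suc m * B * B'" for t
  proof -
    have "\<bar>c t\<bar> * \<bar>d t\<bar> \<le> B * B'" using Suc.prems B by (intro mult_mono) auto
    also have "\<dots> \<le> 2 ^ Suc m * (B * B')"
    proof -
      have "1 * (B * B') \<le> 2 ^ Suc m * (B * B')" using B by (intro mult_right_mono one_le_power) auto
      then show ?thesis by simp
    qed
    finally show ?thesis by (simp add: abs_mult mult.assoc)
  qed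
  ultimately show ?case using d
    by (auto intro!: exI[of _ "\<lambda>t. c t * d' t + c' t * d t"] derivative_eq_intros simp: mult.commute)
qed

lemma bounded_derivs_uminus: "bounded_derivs m B c \<Longrightarrow> bounded_derivs m B (\<lambda>t. - c t)"
proof (induction m arbitrary: c)
  case (Suc m)
  then obtain c' where "\<And>t. (c has_real_derivative c' t) (at t)" "bounded_derivs m B c'" by auto
  then show ?case using Suc by (auto intro!: exI[of _ "\<lambda>t. - c' t"] derivative_eq_intros)
qed auto

lemma bounded_derivs_cos_sin: "bounded_derivs m 1 cos \<and> bounded_derivs m 1 sin"
proof (induction m)
  case (Suc m)
  then have "bounded_derivs m 1 (\<lambda>t. - sin t)" by (intro bounded_derivs_uminus) simp
  then show ?case using Suc
    unfolding bounded_derivs.simps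
    by (intro conjI allI exI[of _ "\<lambda>t. - sin t"] exI[of _ cos]) (auto intro!: derivative_eq_intros)
qed auto

lemma bounded_derivs_difference:
  assumes "bounded_derivs (Suc m) B c"
  shows "bounded_derivs m (B * \<bar>h\<bar>) (\<lambda>t. c (t + h) - c t)"
  using assms
proof (induction m arbitrary: c)
  case 0
  then obtain c' where d: "\<And>t. (c has_real_derivative c' t) (at t)" "\<And>t. \<bar>c' t\<bar> \<le> B" by auto
  have "\<bar>c (t + h) - c t\<bar> \<le> B * \<bar>h\<bar>" for t
    using field_differentiable_bound[of UNIV c c' B t "t + h"] d by (simp add: abs_minus_commute mult.commute)
  then show ?case by simp
next
  case (Suc m)
  then obtain c' where d: "\<And>t. (c has_real_derivative c' t) (at t)" "bounded_derivs (Suc m) B c'" by auto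
  have "\<bar>c (t + h) - c t\<bar> \<le> B * \<bar>h\<bar>" for t
    using field_differentiable_bound[of UNIV c c' B t "t + h"] d bounded_derivs_bound[OF d(2)] by (simp add: abs_minus_commute mult.commute)
  moreover have "((\<lambda>t. c (t + h) - c t) has_real_derivative c' (t + h) - c' t) (at t)" for t
    using DERIV_diff[OF _ d(1)] d(1)[of "t + h"] by (simp add: DERIV_shift)
  ultimately show ?case using Suc.IH[OF d(2)]
    unfolding bounded_derivs.simps by (intro conjI allI exI[of _ "\<lambda>t. c' (t + h) - c' t"])
qed

subsection \<open>Functions on the cube\<close>

lemma cube_update: "x \<in> cube I \<Longrightarrow> i \<in> I \<Longrightarrow> t \<in> {-1..1} \<Longrightarrow> x(i := t) \<in> cube I"
  by (auto simp: cube_def PiE_iff extensional_def)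

lemma cube_nonempty: "cube I \<noteq> {}"
  by (auto simp: cube_def PiE_eq_empty_iff)

text \<open>Points of the cube are extensional; so in the product topology on all functions it is a
  product of compact sets, whose factors outside \<open>I\<close> are single points.\<close>

lemma compact_cube: "compact (cube (I :: 'i set))"
proof -
  have "cube I = (\<Pi>\<^sub>E i\<in>UNIV. if i \<in> I then {-1..1::real} else {undefined})"
    by (auto simp: cube_def PiE_iff extensional_def split: if_splits)
  moreover have "compactin (product_topology (\<lambda>i::'i. euclidean) UNIV) (\<Pi>\<^sub>E i\<in>UNIV. if i \<in> I then {-1..1::real} else {undefined})"
    unfolding compactin_PiE by (auto simp: compactin_euclidean_iff)
  ultimately show ?thesis by (simp add: euclidean_product_topology compactin_euclidean_iff)
qed

lemma abs_le_sup_norm: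
  assumes "bdd_above ((\<lambda>x. \<bar>g x\<bar>) ` cube I)" "x \<in> cube I"
  shows "\<bar>g x\<bar> \<le> sup_norm I g"
  unfolding sup_norm_def using assms by (intro cSUP_upper)

lemma continuous_on_cube_bdd_above:
  fixes g :: "('i \<Rightarrow> real) \<Rightarrow> real"
  assumes "continuous_on (cube I) g"
  shows "bdd_above ((\<lambda>x. \<bar>g x\<bar>) ` cube I)"
proof -
  have "bounded (g ` cube I)"
    by (intro compact_imp_bounded compact_continuous_image compact_cube assms)
  then obtain a where "\<forall>y\<in>g ` cube I. norm y \<le> a" unfolding bounded_iff by blast
  then show ?thesis by (intro bdd_aboveI2[of _ _ a]) auto
qed

lemma sup_norm_le:
  assumes "\<And>x. x \<in> cube I \<Longrightarrow> \<bar>g x\<bar> \<le> e"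
  shows "sup_norm I g \<le> e"
  unfolding sup_norm_def using cube_nonempty assms by (intro cSUP_least)

lemma tendsto_coordinatewise:
  fixes f :: "'a \<Rightarrow> 'i \<Rightarrow> 'b::topological_space"
  assumes "\<And>i. ((\<lambda>x. f x i) \<longlongrightarrow> l i) F"
  shows "(f \<longlongrightarrow> l) F"
  using assms limitin_componentwise[of "\<lambda>_::'i. euclidean :: 'b topology" UNIV f l F]
  by (simp add: euclidean_product_topology)

section \<open>Calculus with one-sided partial derivatives\<close>

definition partials :: "'i set \<Rightarrow> (('i \<Rightarrow> real) \<Rightarrow> real) \<Rightarrow> ('i \<Rightarrow> ('i \<Rightarrow> real) \<Rightarrow> real) \<Rightarrow> bool" where
  "partials I h h' \<longleftrightarrow> (\<forall>i\<in>I. continuous_on (cube I) (h' i) \<and>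
     (\<forall>x\<in>cube I. ((\<lambda>t. h (x(i := t))) has_real_derivative h' i x) (at (x i) within {-1..1})))"

lemma partials_mvt:
  assumes h: "partials I h h'" and i: "i \<in> I" and x: "x \<in> cube I" and b: "b \<in> {-1..1}"
  shows "\<exists>\<xi>\<in>{-1..1}. \<bar>\<xi> - x i\<bar> \<le> \<bar>b - x i\<bar> \<and> h (x(i := b)) - h x = h' i (x(i := \<xi>)) * (b - x i)"
proof -
  let ?\<phi> = "\<lambda>s. h (x(i := s))" and ?\<phi>' = "\<lambda>s. h' i (x(i := s))"
  have d: "(?\<phi> has_real_derivative ?\<phi>' s) (at s within {-1..1})" if "s \<in> {-1..1}" for s
    using h i cube_update[OF x i that] unfolding partials_def by force
  have mvt: "\<exists>\<xi>. u < \<xi> \<and> \<xi> < v \<and> ?\<phi> v - ?\<phi> u = (v - u) * ?\<phi>' \<xi>" if "-1 \<le> u" "u < v" "v \<le> 1" for u v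
  proof -
    have "\<exists>\<xi>\<in>{u<..<v}. ?\<phi> v - ?\<phi> u = (\<lambda>y. ?\<phi>' \<xi> * y) (v - u)"
    proof (rule mvt_simple[OF that(2)])
      fix s assume "u \<le> s" "s \<le> v"
      then show "(?\<phi> has_derivative (\<lambda>y. ?\<phi>' s * y)) (at s within {u..v})"
        using d[of s] that unfolding has_field_derivative_def
        by (intro has_derivative_subset[of ?\<phi> "\<lambda>y. ?\<phi>' s * y" s "{-1..1}" "{u..v}"]) auto
    qed
    then show ?thesis by (auto simp: mult.commute)
  qed
  have xi: "x i \<in> {-1..1}" using x i by (auto simp: cube_def)
  consider "b = x i" | "x i < b" | "b < x i" by linarith
  then show ?thesis
  proof cases
    case 1
    then show ?thesis using xi by (intro bexI[of _ "x i"]) auto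
  next
    case 2
    then show ?thesis using mvt[of "x i" b] xi b by (force simp: mult.commute)
  next
    case 3
    then obtain \<xi> where "b < \<xi>" "\<xi> < x i" "?\<phi> (x i) - ?\<phi> b = (x i - b) * ?\<phi>' \<xi>"
      using mvt[of b "x i"] xi b by auto
    then show ?thesis using xi b by (intro bexI[of _ \<xi>]) (auto simp: algebra_simps)
  qed
qed

text \<open>The coordinates are switched from their values at \<open>t\<close> to those at
  \<open>s\<close> one after the other. Then the mean value theorem in one coordinate and continuity
  of the partial derivatives suffice, also on the boundary of the cube. It is used with
  \<open>T\<close> the real line and with \<open>T\<close> an interval.\<close>

lemma chain_rule_cube:
  fixes c :: "'i \<Rightarrow> real \<Rightarrow> real"
  assumes I: "finite I" and h: "partials I h h'"
    and cube: "\<And>s. s \<in> T \<Longrightarrow> (\<lambda>e\<in>I. c e s) \<in> cube I" and t: "t \<in> T"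
    and c: "\<And>e. e \<in> I \<Longrightarrow> (c e has_real_derivative c' e) (at t within T)"
  shows "((\<lambda>s. h (\<lambda>e\<in>I. c e s)) has_real_derivative (\<Sum>e\<in>I. h' e (\<lambda>e\<in>I. c e t) * c' e)) (at t within T)"
proof -
  define y where "y S s = (\<lambda>e\<in>I. if e \<in> S then c e s else c e t)" for S s
  have ci: "c e s \<in> {-1..1}" if "e \<in> I" "s \<in> T" for e s
    using cube[OF that(2)] that(1) by (auto simp: cube_def PiE_iff)
  have yc: "y S s \<in> cube I" if "s \<in> T" for S s
    using ci that t by (auto simp: y_def cube_def PiE_iff)
  have "((\<lambda>s. h (y S s)) has_real_derivative (\<Sum>e\<in>S. h' e (y {} t) * c' e)) (at t within T)" if "finite S" "S \<subseteq> I" for S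
    using that
  proof (induction S)
    case empty
    have "y {} s = y {} t" for s by (simp add: y_def)
    then have "(\<lambda>s. h (y {} s)) = (\<lambda>_. h (y {} t))" by metis
    then show ?case by simp
  next
    case (insert i S)
    then have i: "i \<in> I" by simp
    have yi: "y (insert i S) s = (y S s)(i := c i s)" for s
      using i by (auto simp: y_def fun_eq_iff restrict_def)
    have ySi: "y S s i = c i t" for s using i insert by (simp add: y_def)
    have "\<forall>s\<in>T. \<exists>\<xi>. \<xi> \<in> {-1..1} \<and> \<bar>\<xi> - c i t\<bar> \<le> \<bar>c i s - c i t\<bar> \<and>
        h (y (insert i S) s) - h (y S s) = h' i ((y S s)(i := \<xi>)) * (c i s - c i t)"
    proof (rule ballI)
      fix s assume s: "s \<in> T"
      from partials_mvt[OF h i yc[OF s, of S] ci[OF i s]]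
      show "\<exists>\<xi>. \<xi> \<in> {-1..1} \<and> \<bar>\<xi> - c i t\<bar> \<le> \<bar>c i s - c i t\<bar> \<and>
        h (y (insert i S) s) - h (y S s) = h' i ((y S s)(i := \<xi>)) * (c i s - c i t)"
        unfolding ySi yi by (simp only: Bex_def)
    qed
    from bchoice[OF this] obtain \<xi> where \<xi>: "\<And>s. s \<in> T \<Longrightarrow> \<xi> s \<in> {-1..1}" "\<And>s. s \<in> T \<Longrightarrow> \<bar>\<xi> s - c i t\<bar> \<le> \<bar>c i s - c i t\<bar>"
      "\<And>s. s \<in> T \<Longrightarrow> h (y (insert i S) s) - h (y S s) = h' i ((y S s)(i := \<xi> s)) * (c i s - c i t)"
      by blast
    define z where "z s = (y S s)(i := \<xi> s)" for s
    have ev: "\<forall>\<^sub>F s in at t within T. s \<in> T" by (simp add: eventually_at_filter)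
    have ct: "((\<lambda>s. c e s) \<longlongrightarrow> c e t) (at t within T)" if "e \<in> I" for e
      using DERIV_continuous[OF c[OF that]] by (simp add: continuous_within)
    have "((\<lambda>s. c i s - c i t) \<longlongrightarrow> 0) (at t within T)"
      using tendsto_diff[OF ct[OF i] tendsto_const[of "c i t"]] by simp
    then have "((\<lambda>s. \<xi> s - c i t) \<longlongrightarrow> 0) (at t within T)"
      by (rule tendsto_0_le[of _ _ _ 1]) (use ev \<xi>(2) in \<open>auto elim!: eventually_mono\<close>)
    then have \<xi>t: "(\<xi> \<longlongrightarrow> c i t) (at t within T)" by (simp add: LIM_zero_iff)
    have "((\<lambda>s. z s e) \<longlongrightarrow> y {} t e) (at t within T)" for e
    proof (cases "e = i")
      case True
      then show ?thesis using \<xi>t i by (simp add: z_def y_def)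
    next
      case False
      then show ?thesis using ct[of e] by (cases "e \<in> I"; cases "e \<in> S") (auto simp: z_def y_def)
    qed
    then have zt: "(z \<longlongrightarrow> y {} t) (at t within T)" by (rule tendsto_coordinatewise)
    have "((\<lambda>s. h' i (z s)) \<longlongrightarrow> h' i (y {} t)) (at t within T)"
    proof (rule continuous_on_tendsto_compose[OF _ zt yc[OF t]])
      show "continuous_on (cube I) (h' i)" using h i unfolding partials_def by blast
      show "\<forall>\<^sub>F s in at t within T. z s \<in> cube I"
        using ev by eventually_elim (use yc \<xi>(1) i in \<open>auto simp: z_def intro!: cube_update\<close>)
    qed
    then have "((\<lambda>s. h' i (z s) * ((c i s - c i t) / (s - t))) \<longlongrightarrow> h' i (y {} t) * c' i) (at t within T)"
      using c[OF i] unfolding has_field_derivative_iff by (intro tendsto_mult)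
    moreover have "\<forall>\<^sub>F s in at t within T. h' i (z s) * ((c i s - c i t) / (s - t)) =
        ((h (y (insert i S) s) - h (y S s)) - (h (y (insert i S) t) - h (y S t))) / (s - t)"
      using ev by eventually_elim (use \<xi>(3) t in \<open>simp add: z_def\<close>)
    ultimately have "((\<lambda>s. h (y (insert i S) s) - h (y S s)) has_real_derivative h' i (y {} t) * c' i) (at t within T)"
      unfolding has_field_derivative_iff by (rule Lim_transform_eventually)
    from DERIV_add[OF this insert.IH] show ?case using insert by simp
  qed
  from this[OF I subset_refl] have "((\<lambda>s. h (y I s)) has_real_derivative (\<Sum>e\<in>I. h' e (y {} t) * c' e)) (at t within T)" .
  moreover have "y I s = (\<lambda>e\<in>I. c e s)" "y {} t = (\<lambda>e\<in>I. c e t)" for s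
    by (auto simp: y_def fun_eq_iff restrict_def)
  ultimately show ?thesis by (simp only:)
qed

text \<open>Recursion over first partial derivatives instead of multi-indices, in step with
  \<open>bounded_derivs\<close>, so that compositions can be treated by induction on
  \<open>m\<close>.\<close>

fun smooth_on_cube :: "nat \<Rightarrow> 'i set \<Rightarrow> (('i \<Rightarrow> real) \<Rightarrow> real) \<Rightarrow> bool" where
  "smooth_on_cube 0 I h \<longleftrightarrow> (\<forall>x\<in>cube I. \<bar>h x\<bar> \<le> 1)"
| "smooth_on_cube (Suc m) I h \<longleftrightarrow> (\<forall>x\<in>cube I. \<bar>h x\<bar> \<le> 1) \<and>
     (\<exists>h'. partials I h h' \<and> (\<forall>i\<in>I. smooth_on_cube m I (h' i)))"

lemma smooth_on_cube_bound: "smooth_on_cube m I h \<Longrightarrow> x \<in> cube I \<Longrightarrow> \<bar>h x\<bar> \<le> 1"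
  by (cases m) auto

lemma finite_multi_indices: "finite I \<Longrightarrow> finite (multi_indices I m)"
proof -
  assume I: "finite I"
  have "multi_indices I m \<subseteq> {k. (\<forall>i. (i \<in> I \<longrightarrow> k i \<in> {..m}) \<and> (i \<notin> I \<longrightarrow> k i = 0))}"
  proof
    fix k assume k: "k \<in> multi_indices I m"
    have "k i \<le> m" if "i \<in> I" for i
      using k member_le_sum[of i I k] that I by (auto simp: multi_indices_def)
    then show "k \<in> {k. (\<forall>i. (i \<in> I \<longrightarrow> k i \<in> {..m}) \<and> (i \<notin> I \<longrightarrow> k i = 0))}"
      using k by (auto simp: multi_indices_def)
  qed
  moreover have "finite {k. (\<forall>i. (i \<in> I \<longrightarrow> k i \<in> {..m}) \<and> (i \<notin> I \<longrightarrow> k i = 0))}"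
    using I by (intro finite_set_of_finite_funs) auto
  ultimately show ?thesis using finite_subset by blast
qed

lemma multi_indices_Suc:
  assumes "finite I" "k \<in> multi_indices I m" "i \<in> I" "Suc (sum k I) \<le> m"
  shows "k(i := Suc (k i)) \<in> multi_indices I m" "sum (k(i := Suc (k i))) I = Suc (sum k I)"
proof -
  have "sum (k(i := Suc (k i))) (I - {i}) = sum k (I - {i})" by (intro sum.cong) auto
  then show s: "sum (k(i := Suc (k i))) I = Suc (sum k I)"
    using sum.remove[OF assms(1,3), of "k(i := Suc (k i))"] sum.remove[OF assms(1,3), of k] by simp
  show "k(i := Suc (k i)) \<in> multi_indices I m"
    unfolding multi_indices_def using assms s by (auto simp: multi_indices_def)
qed

lemma W_derivatives:
  assumes I: "finite I" and h: "h \<in> W m I"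
  obtains D where "partial_derivatives I m h D" "\<And>k. k \<in> multi_indices I m \<Longrightarrow> continuous_on (cube I) (D k)"
    "\<And>x k. (\<And>k. x k \<in> cube I) \<Longrightarrow> (\<Sum>k\<in>multi_indices I m. \<bar>D k (x k)\<bar>) \<le> 1"
proof -
  obtain D where D: "partial_derivatives I m h D" "\<And>k. k \<in> multi_indices I m \<Longrightarrow> continuous_on (cube I) (D k)"
    "(\<Sum>k\<in>multi_indices I m. sup_norm I (D k)) \<le> 1" using h unfolding W_def by auto
  have "(\<Sum>k\<in>multi_indices I m. \<bar>D k (x k)\<bar>) \<le> 1" if "\<And>k. x k \<in> cube I" for x :: "_ \<Rightarrow> _ \<Rightarrow> real"
    by (rule order_trans[OF sum_mono D(3)]) (use D(2) that in \<open>auto intro!: abs_le_sup_norm continuous_on_cube_bdd_above\<close>)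
  with D that show ?thesis by blast
qed

lemma W_smooth_on_cube:
  assumes I: "finite I" and h: "h \<in> W m I" and j: "j \<le> m"
  shows "smooth_on_cube j I h"
proof -
  obtain D where D: "partial_derivatives I m h D" "\<And>k. k \<in> multi_indices I m \<Longrightarrow> continuous_on (cube I) (D k)"
    "\<And>x k. (\<And>k. x k \<in> cube I) \<Longrightarrow> (\<Sum>k\<in>multi_indices I m. \<bar>D k (x k)\<bar>) \<le> 1"
    using W_derivatives[OF I h] by blast
  have b: "\<bar>D k x\<bar> \<le> 1" if "k \<in> multi_indices I m" "x \<in> cube I" for k x
    using D(3)[of "\<lambda>_. x"] that member_le_sum[of k "multi_indices I m" "\<lambda>k. \<bar>D k x\<bar>"] finite_multi_indices[OF I] by force
  have p: "partials I (D k) (\<lambda>i. D (k(i := Suc (k i))))" if "k \<in> multi_indices I m" "Suc (sum k I) \<le> m" for k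
    unfolding partials_def using D(1,2) multi_indices_Suc(1)[OF I that(1) _ that(2)] that(1)
    by (auto simp: partial_derivatives_def)
  have *: "smooth_on_cube j I (D k)" if "k \<in> multi_indices I m" "j + sum k I \<le> m" for j k
    using that
  proof (induction j arbitrary: k)
    case (Suc j)
    have "smooth_on_cube j I (D (k(i := Suc (k i))))" if "i \<in> I" for i
    proof (rule Suc.IH)
      have s: "Suc (sum k I) \<le> m" using Suc.prems by simp
      note mi = multi_indices_Suc[OF I Suc.prems(1) that s]
      show "k(i := Suc (k i)) \<in> multi_indices I m" by (rule mi(1))
      show "j + sum (k(i := Suc (k i))) I \<le> m" unfolding mi(2) using Suc.prems by simp
    qed
    then show ?case using p[OF Suc.prems(1)] Suc.prems b
      unfolding smooth_on_cube.simps by (intro conjI ballI exI[of _ "\<lambda>i. D (k(i := Suc (k i)))"]) auto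
  qed (use b in auto)
  have z0: "(\<lambda>_. 0) \<in> multi_indices I m" by (simp add: multi_indices_def)
  have eq: "h x = D (\<lambda>_. 0) x" if "x \<in> cube I" for x using D(1) that by (simp add: partial_derivatives_def)
  show ?thesis
  proof (cases j)
    case 0
    then show ?thesis using b[OF z0] eq by simp
  next
    case (Suc i)
    then obtain h' where h': "partials I (D (\<lambda>_. 0)) h'" "\<forall>i'\<in>I. smooth_on_cube i I (h' i')"
      using *[OF z0, of j] j by auto
    have "partials I h h'"
      unfolding partials_def
    proof (intro ballI conjI)
      fix i x assume i: "i \<in> I" and x: "x \<in> cube I"
      then have "((\<lambda>t. D (\<lambda>_. 0) (x(i := t))) has_real_derivative h' i x) (at (x i) within {-1..1})"
        using h'(1) unfolding partials_def by blast
      then show "((\<lambda>t. h (x(i := t))) has_real_derivative h' i x) (at (x i) within {-1..1})"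
        by (rule has_field_derivative_transform_within[of _ _ _ _ 1])
          (use i x cube_update[OF x i] eq in \<open>auto simp: cube_def PiE_iff\<close>)
    qed (use h' in \<open>auto simp: partials_def\<close>)
    then show ?thesis using Suc h' b[OF z0] eq by auto
  qed
qed

text \<open>The norm of the class sums over multi-indices, so the absolute partial derivatives of
  first order add up to at most 1 at each point: \<open>h\<close> does not expand the maximum norm.
  With a constant above 1 the errors in \<open>node_value_error\<close> would multiply from level to
  level.\<close>

lemma W_lipschitz:
  assumes I: "finite I" and h: "h \<in> W m I" and m: "1 \<le> m"
    and xy: "x \<in> cube I" "y \<in> cube I" "\<And>i. i \<in> I \<Longrightarrow> \<bar>x i - y i\<bar> \<le> r" and r: "0 \<le> r"
  shows "\<bar>h x - h y\<bar> \<le> r"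
proof -
  obtain D where D: "partial_derivatives I m h D" "\<And>k. k \<in> multi_indices I m \<Longrightarrow> continuous_on (cube I) (D k)"
    "\<And>x k. (\<And>k. x k \<in> cube I) \<Longrightarrow> (\<Sum>k\<in>multi_indices I m. \<bar>D k (x k)\<bar>) \<le> 1"
    using W_derivatives[OF I h] by blast
  have z0: "(\<lambda>_. 0) \<in> multi_indices I m" by (simp add: multi_indices_def)
  \<comment> \<open>The multi-index of the first partial derivative in \<open>i\<close>.\<close>
  define u where "u i = (\<lambda>j::'a. 0::nat)(i := Suc 0)" for i
  have u: "u i \<in> multi_indices I m" if "i \<in> I" for i
    using multi_indices_Suc(1)[OF I z0 that] m by (simp add: u_def)
  have p: "partials I (D (\<lambda>_. 0)) (\<lambda>i. D (u i))"
    unfolding partials_def using D(1,2) u z0 by (auto simp: partial_derivatives_def u_def)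
  define c where "c i s = x i + s * (y i - x i)" for i s
  have c: "(\<lambda>i\<in>I. c i s) \<in> cube I" if "s \<in> {0..1}" for s
  proof -
    have "c i s \<in> {-1..1}" if i: "i \<in> I" for i
    proof -
      have "c i s = (1 - s) * x i + s * y i" by (simp add: c_def algebra_simps)
      moreover have "x i \<in> {-1..1}" "y i \<in> {-1..1}" using xy i by (auto simp: cube_def)
      ultimately show ?thesis using \<open>s \<in> {0..1}\<close> convexD_alt[of "{-1..1::real}" "x i" "y i" s] by (auto simp: convex_real_interval)
    qed
    then show ?thesis by (auto simp: cube_def)
  qed
  let ?g = "\<lambda>s. D (\<lambda>_. 0) (\<lambda>i\<in>I. c i s)"
  let ?g' = "\<lambda>s. \<Sum>i\<in>I. D (u i) (\<lambda>i\<in>I. c i s) * (y i - x i)"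
  have "(?g has_real_derivative ?g' s) (at s within {0..1})" if "s \<in> {0..1}" for s
    by (rule chain_rule_cube[OF I p c that]) (auto simp: c_def intro!: derivative_eq_intros)
  then have "\<exists>s\<in>{0<..<1}. ?g 1 - ?g 0 = (\<lambda>y. ?g' s * y) (1 - 0)"
    by (intro mvt_simple) (simp_all only: has_field_derivative_def atLeastAtMost_iff zero_less_one)
  then obtain s where s': "s \<in> {0<..<1}" "?g 1 - ?g 0 = ?g' s * (1 - 0)" by (elim bexE)
  then have s: "s \<in> {0..1}" "?g 1 - ?g 0 = ?g' s" by auto
  have "\<bar>?g' s\<bar> \<le> (\<Sum>i\<in>I. \<bar>D (u i) (\<lambda>i\<in>I. c i s)\<bar> * r)"
    using xy(3) by (intro order_trans[OF sum_abs] sum_mono) (auto simp: abs_mult abs_minus_commute intro!: mult_left_mono)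
  \<comment> \<open>Different coordinates have different multi-indices, so the sum over the gradient
    is a partial sum of the norm.\<close>
  also have "\<dots> = (\<Sum>k\<in>u ` I. \<bar>D k (\<lambda>i\<in>I. c i s)\<bar>) * r"
  proof -
    have "inj_on u I" by (auto simp: inj_on_def u_def fun_eq_iff split: if_splits)
    then show ?thesis by (simp add: sum.reindex sum_distrib_right)
  qed
  also have "\<dots> \<le> 1 * r"
  proof (intro mult_right_mono r)
    have "(\<Sum>k\<in>u ` I. \<bar>D k (\<lambda>i\<in>I. c i s)\<bar>) \<le> (\<Sum>k\<in>multi_indices I m. \<bar>D k (\<lambda>i\<in>I. c i s)\<bar>)"
      using u by (intro sum_mono2 finite_multi_indices I) auto
    also have "\<dots> \<le> 1" using c[OF s(1)] by (intro D(3))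
    finally show "(\<Sum>k\<in>u ` I. \<bar>D k (\<lambda>i\<in>I. c i s)\<bar>) \<le> 1" .
  qed
  finally have "\<bar>?g 1 - ?g 0\<bar> \<le> r" using s by simp
  moreover have "(\<lambda>i\<in>I. c i 1) = y" "(\<lambda>i\<in>I. c i 0) = x"
    using xy(1,2) by (auto simp: c_def cube_def PiE_iff extensional_def fun_eq_iff)
  moreover have "D (\<lambda>_. 0) x = h x" "D (\<lambda>_. 0) y = h y" using D(1) xy by (auto simp: partial_derivatives_def)
  ultimately show ?thesis by simp
qed

text \<open>The bound is chosen before the index set and the functions. By this uniformity the
  constant in the rate of a node depends on in-degree and smoothness only.\<close>

lemma bounded_derivs_compose:
  fixes n m :: nat and B :: real
  shows "\<exists>B'\<ge>1. \<forall>(I :: 'i set) h c. finite I \<longrightarrow> card I = n \<longrightarrow> smooth_on_cube m I h \<longrightarrow>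
    (\<forall>e\<in>I. bounded_derivs m B (c e)) \<longrightarrow> (\<forall>s. (\<lambda>e\<in>I. c e s) \<in> cube I) \<longrightarrow>
    bounded_derivs m B' (\<lambda>s. h (\<lambda>e\<in>I. c e s))"
proof (induction m)
  case 0
  show ?case by (intro exI[of _ 1]) auto
next
  case (Suc m)
  then obtain B' where B': "B' \<ge> 1" "\<forall>(I :: 'i set) h c. finite I \<longrightarrow> card I = n \<longrightarrow> smooth_on_cube m I h \<longrightarrow>
      (\<forall>e\<in>I. bounded_derivs m B (c e)) \<longrightarrow> (\<forall>s. (\<lambda>e\<in>I. c e s) \<in> cube I) \<longrightarrow>
      bounded_derivs m B' (\<lambda>s. h (\<lambda>e\<in>I. c e s))" by (elim exE conjE)
  \<comment> \<open>Chain rule: \<open>n\<close> summands, each a product of two functions with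
    \<open>m\<close> bounded derivatives; the maximum with 1 covers the values of \<open>h\<close>
    itself.\<close>
  let ?B = "max 1 (real n * (2 ^ m * B' * \<bar>B\<bar>))"
  have key: "bounded_derivs (Suc m) ?B (\<lambda>s. h (\<lambda>e\<in>I. c e s))"
    if I: "finite I" "card I = n" and h: "smooth_on_cube (Suc m) I h" and c: "\<And>e. e \<in> I \<Longrightarrow> bounded_derivs (Suc m) B (c e)"
      and cube: "\<And>s. (\<lambda>e\<in>I. c e s) \<in> cube I" for I :: "'i set" and h c
  proof -
    obtain h' where h': "partials I h h'" "\<And>i. i \<in> I \<Longrightarrow> smooth_on_cube m I (h' i)" using h by auto
    have "\<forall>e\<in>I. \<exists>c'. (\<forall>t. (c e has_real_derivative c' t) (at t)) \<and> bounded_derivs m B c'" using c by simp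
    from bchoice[OF this] obtain c' where c': "\<And>e t. e \<in> I \<Longrightarrow> (c e has_real_derivative c' e t) (at t)"
      "\<And>e. e \<in> I \<Longrightarrow> bounded_derivs m B (c' e)" by blast
    have A: "((\<lambda>s. h (\<lambda>e\<in>I. c e s)) has_real_derivative (\<Sum>e\<in>I. h' e (\<lambda>e\<in>I. c e t) * c' e t)) (at t)" for t
      using c' cube by (intro chain_rule_cube[OF I(1) h'(1), of UNIV]) auto
    have "bounded_derivs m (real (card I) * (2 ^ m * B' * \<bar>B\<bar>)) (\<lambda>t. \<Sum>e\<in>I. h' e (\<lambda>e\<in>I. c e t) * c' e t)"
    proof (intro bounded_derivs_sum I bounded_derivs_mult)
      fix e assume e: "e \<in> I"
      show "bounded_derivs m B' (\<lambda>t. h' e (\<lambda>e\<in>I. c e t))"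
        by (rule B'(2)[rule_format, of I "h' e" c, OF I h'(2)[OF e] bounded_derivs_SucD[OF c] cube])
      show "bounded_derivs m \<bar>B\<bar> (c' e)" by (rule bounded_derivs_mono[OF c'(2)[OF e]]) simp
    qed (use B'(1) in auto)
    then have C: "bounded_derivs m ?B (\<lambda>t. \<Sum>e\<in>I. h' e (\<lambda>e\<in>I. c e t) * c' e t)"
      by (rule bounded_derivs_mono) (simp add: I)
    have E: "\<bar>h (\<lambda>e\<in>I. c e s)\<bar> \<le> ?B" for s
      using smooth_on_cube_bound[OF h cube[of s]] by simp
    show ?thesis
      unfolding bounded_derivs.simps
      by (intro conjI allI E exI[of _ "\<lambda>t. \<Sum>e\<in>I. h' e (\<lambda>e\<in>I. c e t) * c' e t"] A C)
  qed
  show ?case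
  proof (intro exI[of _ ?B] conjI allI impI)
    fix I :: "'i set" and h c
    assume "finite I" "card I = n" "smooth_on_cube (Suc m) I h" "\<forall>e\<in>I. bounded_derivs (Suc m) B (c e)"
      "\<forall>s. (\<lambda>e\<in>I. c e s) \<in> cube I"
    then show "bounded_derivs (Suc m) ?B (\<lambda>s. h (\<lambda>e\<in>I. c e s))" by (intro key) blast+
  qed simp
qed

section \<open>From bounded derivatives to numbers of units\<close>

lemma dlip_if_bounded_derivs:
  assumes "\<And>t. bounded_derivs m B (\<lambda>\<tau>. F (t(i := \<tau>)))"
  shows "dlip m i B F"
  using assms
proof (induction m arbitrary: B F)
  case 0
  have "\<bar>F t\<bar> \<le> B" for t using bounded_derivs_bound[OF 0[of t], of "t i"] by simp
  then show ?case by simp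
next
  case (Suc m)
  have "dlip m i (B * \<bar>h\<bar>) (dlip_step i h F)" for h
    using bounded_derivs_difference[OF Suc.prems, of h] by (intro Suc.IH) (simp only: dlip_step_def fun_upd_same fun_upd_upd)
  then show ?case by simp
qed

lemma lip_if_bounded_derivs:
  assumes "\<And>t. bounded_derivs m B (\<lambda>\<tau>. F (t(i := \<tau>)))" "1 \<le> m"
  shows "lip B i F"
  unfolding lip_def
proof (intro allI)
  fix t \<tau>
  obtain k where k: "m = Suc k" using assms(2) by (cases m) auto
  show "\<bar>F (t(i := \<tau>)) - F t\<bar> \<le> B * \<bar>\<tau> - t i\<bar>"
    using bounded_derivs_bound[OF bounded_derivs_difference[OF assms(1)[unfolded k, of t], of "\<tau> - t i"], of "t i"] by simp
qed

lemma network_rate: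
  fixes n m :: nat and B :: real
  assumes \<sigma>: "infinitely_differentiable \<sigma>" "\<not> is_polynomial \<sigma>" and m: "1 \<le> m" and B: "0 \<le> B"
  shows "\<exists>C>0. \<forall>(I :: 'i set) f \<epsilon>. finite I \<longrightarrow> card I = n \<longrightarrow>
    (\<forall>i\<in>I. \<forall>t. bounded_derivs m B (\<lambda>\<tau>. f (\<lambda>j\<in>I. cos ((t(i := \<tau>)) j)))) \<longrightarrow> 0 < \<epsilon> \<longrightarrow> \<epsilon> \<le> 1 \<longrightarrow>
    (\<exists>N. \<exists>g\<in>shallow_networks \<sigma> I N. real N \<le> C * \<epsilon> powr (- (real n / real m)) \<and> (\<forall>x\<in>cube I. \<bar>f x - g x\<bar> \<le> \<epsilon>))"
proof -
  \<comment> \<open>The constant in Jackson's theorem, increased by 1 to have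
    \<open>2 * E / \<epsilon> \<ge> 1\<close>.\<close>
  define E where "E = real n * (1 + 2 ^ m) ^ n * B * 8 ^ m + 1"
  have E: "E \<ge> 1" using B by (simp add: E_def)
  let ?C = "3 ^ n * (2 * E) powr (real n / real m)"
  have key: "\<exists>N. \<exists>g\<in>shallow_networks \<sigma> I N. real N \<le> ?C * \<epsilon> powr (- (real n / real m)) \<and> (\<forall>x\<in>cube I. \<bar>f x - g x\<bar> \<le> \<epsilon>)"
    if I: "finite I" "card I = n" and f: "\<And>i t. i \<in> I \<Longrightarrow> bounded_derivs m B (\<lambda>\<tau>. f (\<lambda>j\<in>I. cos ((t(i := \<tau>)) j)))"
      and e: "0 < \<epsilon>" "\<epsilon> \<le> 1" for I :: "'i set" and f \<epsilon>
  proof -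
    \<comment> \<open>Chosen so that Jackson's error is at most \<open>\<epsilon> / 2\<close> as
      soon as \<open>q + 1 \<ge> y\<close>. The factor \<open>3 ^ n\<close> in the constant is the
      cost of rounding: \<open>q + 1 \<le> y + 2 \<le> 3 * y\<close>.\<close>
    define y where "y = (2 * E / \<epsilon>) powr (1 / real m)"
    define q where "q = nat \<lceil>y\<rceil>"
    have "1 \<le> 2 * E / \<epsilon>" using E e by (simp add: field_simps)
    then have y: "1 \<le> y" unfolding y_def by (intro ge_one_powr_ge_zero) auto
    have q: "y \<le> real (q + 1)" "real (q + 1) \<le> 3 * y" unfolding q_def using y by linarith+
    have ym: "y ^ m = 2 * E / \<epsilon>"
      unfolding y_def using E e m by (simp add: powr_realpow[symmetric] powr_powr)
    have yn: "y ^ n = (2 * E) powr (real n / real m) * \<epsilon> powr (- (real n / real m))"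
    proof -
      have "y ^ n = (2 * E / \<epsilon>) powr (real n / real m)"
        unfolding y_def using E e m by (simp add: powr_realpow[symmetric] powr_powr)
      then show ?thesis using E e by (simp add: powr_divide powr_minus_divide)
    qed
    obtain a where a: "\<And>x. x \<in> cube I \<Longrightarrow> \<bar>f x - (\<Sum>\<alpha>\<in>(\<Pi>\<^sub>E i\<in>I. {..q}). a \<alpha> * (\<Prod>i\<in>I. x i ^ \<alpha> i))\<bar>
        \<le> real (card I) * (1 + 2 ^ m) ^ card I * B * (8 / real (q + 1)) ^ m"
    proof -
      have "separately_lip I (\<lambda>t. f (\<lambda>j\<in>I. cos (t j)))"
        unfolding separately_lip_def using f m by (intro exI[of _ B] ballI lip_if_bounded_derivs) auto
      moreover have "dlip m i B (\<lambda>t. f (\<lambda>j\<in>I. cos (t j)))" if "i \<in> I" for i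
        using f[OF that] by (rule dlip_if_bounded_derivs)
      ultimately show ?thesis using jackson_approximation[OF I(1) _ _ B, where f = f and m = m and q = q] that by blast
    qed
    obtain g where g: "g \<in> shallow_networks \<sigma> I ((q + 1) ^ card I)"
      "\<And>x. x \<in> cube I \<Longrightarrow> \<bar>(\<Sum>\<alpha>\<in>(\<Pi>\<^sub>E i\<in>I. {..q}). a \<alpha> * (\<Prod>i\<in>I. x i ^ \<alpha> i)) - g x\<bar> \<le> \<epsilon> / 2"
      using shallow_networks_approximate_polynomials[OF \<sigma> I(1), of "\<epsilon> / 2" q a] e by auto
    have "real n * (1 + 2 ^ m) ^ n * B * (8 / real (q + 1)) ^ m \<le> \<epsilon> / 2"
    proof -
      have "real n * (1 + 2 ^ m) ^ n * B * (8 / real (q + 1)) ^ m = (real n * (1 + 2 ^ m) ^ n * B * 8 ^ m) / real (q + 1) ^ m"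
        by (simp add: power_divide)
      also have "\<dots> \<le> E / y ^ m" using B y q E unfolding E_def by (intro frac_le power_mono) auto
      also have "\<dots> = \<epsilon> / 2" using E e by (simp add: ym)
      finally show ?thesis .
    qed
    then have "\<bar>f x - g x\<bar> \<le> \<epsilon>" if "x \<in> cube I" for x
      using a[OF that, unfolded I(2)] g(2)[OF that] by linarith
    moreover have "real ((q + 1) ^ card I) \<le> ?C * \<epsilon> powr (- (real n / real m))"
    proof -
      have "real ((q + 1) ^ card I) \<le> (3 * y) ^ n"
        unfolding I(2) of_nat_power using q(2) by (intro power_mono) auto
      then show ?thesis by (simp add: power_mult_distrib yn)
    qed
    ultimately show ?thesis using g(1) by blast
  qed
  show ?thesis
  proof (intro exI[of _ ?C] conjI allI impI)
    show "0 < ?C" using E by simp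
    fix I :: "'i set" and f and \<epsilon> :: real
    assume "finite I" "card I = n" "\<forall>i\<in>I. \<forall>t. bounded_derivs m B (\<lambda>\<tau>. f (\<lambda>j\<in>I. cos ((t(i := \<tau>)) j)))" "0 < \<epsilon>" "\<epsilon> \<le> 1"
    then show "\<exists>N. \<exists>g\<in>shallow_networks \<sigma> I N. real N \<le> ?C * \<epsilon> powr (- (real n / real m)) \<and> (\<forall>x\<in>cube I. \<bar>f x - g x\<bar> \<le> \<epsilon>)"
      by (intro key) blast+
  qed
qed

lemma bounded_derivs_cos_update: "bounded_derivs m 1 (\<lambda>\<tau>. cos ((t(i := \<tau>)) j))"
  using bounded_derivs_cos_sin[of m] bounded_derivs_const[of "cos (t j)" 1 m] by (cases "i = j") auto

lemma cos_in_cube: "(\<lambda>j\<in>I. cos (t j)) \<in> cube I"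
  by (auto simp: cube_def)

lemma shallow_networks_scale:
  assumes "g \<in> shallow_networks \<sigma> I N"
  shows "(\<lambda>x. c * g x) \<in> shallow_networks \<sigma> I N"
proof -
  obtain a w b where "g = (\<lambda>x. \<Sum>k<N. a k * \<sigma> ((\<Sum>i\<in>I. w k i * x i) + b k))"
    using assms unfolding shallow_networks_def by blast
  then have "(\<lambda>x. c * g x) = (\<lambda>x. \<Sum>k<N. (c * a k) * \<sigma> ((\<Sum>i\<in>I. w k i * x i) + b k))"
    by (simp add: sum_distrib_left mult.assoc)
  then show ?thesis
    unfolding shallow_networks_def mem_Collect_eq by (intro exI[of _ "\<lambda>k. c * a k"] exI[of _ b] exI[of _ w] conjI) auto
qed

text \<open>The bound 1 on \<open>g\<close> keeps the output of a node inside the cube of the next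
  one; its price is the second \<open>\<epsilon>\<close> in the error.\<close>

definition rate_on :: "(real \<Rightarrow> real) \<Rightarrow> 'i set \<Rightarrow> nat \<Rightarrow> real \<Rightarrow> bool" where
  "rate_on \<sigma> I m C \<longleftrightarrow> (\<forall>h \<epsilon>. h \<in> W m I \<longrightarrow> 0 < \<epsilon> \<longrightarrow> \<epsilon> \<le> 1 \<longrightarrow>
    (\<exists>N. \<exists>g\<in>shallow_networks \<sigma> I N. real N \<le> C * \<epsilon> powr (- (real (card I) / real m)) \<and>
      (\<forall>x\<in>cube I. \<bar>g x\<bar> \<le> 1 \<and> \<bar>h x - g x\<bar> \<le> 2 * \<epsilon>)))"

text \<open>Approximating \<open>(1 - \<epsilon>) * h\<close> instead of \<open>h\<close> keeps the values of the network in \<open>[-1, 1]\<close>.\<close>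

lemma node_network_rate:
  fixes n m :: nat
  assumes \<sigma>: "infinitely_differentiable \<sigma>" "\<not> is_polynomial \<sigma>" and m: "1 \<le> m"
  shows "\<exists>C>0. \<forall>I :: 'i set. finite I \<longrightarrow> card I = n \<longrightarrow> rate_on \<sigma> I m C"
proof -
  obtain B where B: "B \<ge> 1" "\<forall>(I :: 'i set) h c. finite I \<longrightarrow> card I = n \<longrightarrow> smooth_on_cube m I h \<longrightarrow>
    (\<forall>e\<in>I. bounded_derivs m 1 (c e)) \<longrightarrow> (\<forall>s. (\<lambda>e\<in>I. c e s) \<in> cube I) \<longrightarrow>
    bounded_derivs m B (\<lambda>s. h (\<lambda>e\<in>I. c e s))"
    using bounded_derivs_compose[where ?'i = 'i, of n m 1] by (elim exE conjE)
  have "0 \<le> B" using B(1) by simp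
  from network_rate[where ?'i = 'i, OF \<sigma> m this, of n]
  obtain C where C: "C > 0" "\<forall>(I :: 'i set) f \<epsilon>. finite I \<longrightarrow> card I = n \<longrightarrow>
    (\<forall>i\<in>I. \<forall>t. bounded_derivs m B (\<lambda>\<tau>. f (\<lambda>j\<in>I. cos ((t(i := \<tau>)) j)))) \<longrightarrow> 0 < \<epsilon> \<longrightarrow> \<epsilon> \<le> 1 \<longrightarrow>
    (\<exists>N. \<exists>g\<in>shallow_networks \<sigma> I N. real N \<le> C * \<epsilon> powr (- (real n / real m)) \<and> (\<forall>x\<in>cube I. \<bar>f x - g x\<bar> \<le> \<epsilon>))"
    by (elim exE conjE)
  have key: "\<exists>N. \<exists>g\<in>shallow_networks \<sigma> I N. real N \<le> C * \<epsilon> powr (- (real n / real m)) \<and>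
      (\<forall>x\<in>cube I. \<bar>g x\<bar> \<le> 1 \<and> \<bar>h x - g x\<bar> \<le> 2 * \<epsilon>)"
    if I: "finite I" "card I = n" and h: "h \<in> W m I" and e: "0 < \<epsilon>" "\<epsilon> \<le> 1" for I :: "'i set" and h \<epsilon>
  proof -
    have sm: "smooth_on_cube m I h" by (rule W_smooth_on_cube[OF I(1) h order_refl])
    have "bounded_derivs m B (\<lambda>\<tau>. h (\<lambda>j\<in>I. cos ((t(i := \<tau>)) j)))" for i t
      by (rule B(2)[rule_format, of I h "\<lambda>j \<tau>. cos ((t(i := \<tau>)) j)", OF I sm bounded_derivs_cos_update cos_in_cube])
    then obtain N g where g: "g \<in> shallow_networks \<sigma> I N" "real N \<le> C * \<epsilon> powr (- (real n / real m))"
      "\<And>x. x \<in> cube I \<Longrightarrow> \<bar>h x - g x\<bar> \<le> \<epsilon>"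
      using C(2)[rule_format, of I h \<epsilon>, OF I _ e] by blast
    have "\<bar>(1 - \<epsilon>) * g x\<bar> \<le> 1 \<and> \<bar>h x - (1 - \<epsilon>) * g x\<bar> \<le> 2 * \<epsilon>" if x: "x \<in> cube I" for x
    proof -
      have hx: "\<bar>h x\<bar> \<le> 1" by (rule smooth_on_cube_bound[OF sm x])
      have "\<bar>(1 - \<epsilon>) * h x\<bar> \<le> (1 - \<epsilon>) * 1" unfolding abs_mult using hx e by (intro mult_mono) auto
      moreover have "\<bar>(1 - \<epsilon>) * (h x - g x)\<bar> \<le> 1 * \<epsilon>" unfolding abs_mult using g(3)[OF x] e by (intro mult_mono) auto
      moreover have "\<bar>\<epsilon> * h x\<bar> \<le> \<epsilon> * 1" unfolding abs_mult using hx e by (intro mult_mono) auto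
      ultimately show ?thesis by (simp add: algebra_simps) linarith
    qed
    then show ?thesis
      by (intro exI[of _ N] bexI[OF _ shallow_networks_scale[OF g(1), of "1 - \<epsilon>"]] conjI g(2)) blast
  qed
  show ?thesis
    unfolding rate_on_def
  proof (intro exI[of _ C] conjI allI impI C(1))
    fix I :: "'i set" and h and \<epsilon> :: real
    assume I: "finite I" "card I = n" and "h \<in> W m I" "0 < \<epsilon>" "\<epsilon> \<le> 1"
    from key[OF this] show "\<exists>N. \<exists>g\<in>shallow_networks \<sigma> I N. real N \<le> C * \<epsilon> powr (- (real (card I) / real m)) \<and>
      (\<forall>x\<in>cube I. \<bar>g x\<bar> \<le> 1 \<and> \<bar>h x - g x\<bar> \<le> 2 * \<epsilon>)" unfolding I(2) .
  qed
qed

subsection \<open>Propagation through the graph\<close>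

lemma node_induct:
  assumes "fin_digraph G" "acyclic (arcs_ends G)" "\<And>v. (\<And>u. (u, v) \<in> arcs_ends G \<Longrightarrow> P u) \<Longrightarrow> P v"
  shows "P v"
  using wf_arcs_ends[OF assms(1,2)] by (induction v rule: wf_induct_rule) (rule assms(3))

lemma in_arcs_tail:
  assumes "fin_digraph G" "e \<in> in_arcs G v"
  shows "(tail G e, v) \<in> arcs_ends G" "tail G e \<in> verts G"
proof -
  interpret fin_digraph G by fact
  show "(tail G e, v) \<in> arcs_ends G" using assms(2) by (auto simp: in_arcs_def arcs_ends_conv)
  show "tail G e \<in> verts G" using assms(2) by (auto simp: in_arcs_def)
qed

lemma verts_source_or_inner: "v \<in> verts G \<Longrightarrow> v \<in> sources G \<or> v \<in> inner_nodes G"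
  by (auto simp: inner_nodes_def)

lemma node_value_bound:
  assumes G: "fin_digraph G" "acyclic (arcs_ends G)"
    and h: "\<And>v y. v \<in> inner_nodes G \<Longrightarrow> y \<in> cube (in_arcs G v) \<Longrightarrow> \<bar>h v y\<bar> \<le> 1"
    and x: "x \<in> cube (sources G)" and v: "v \<in> verts G"
  shows "\<bar>node_value G h x v\<bar> \<le> 1"
  using v
proof (induction v rule: node_induct[OF G])
  case (1 v)
  show ?case
  proof (cases "v \<in> inner_nodes G")
    case True
    have "\<bar>node_value G h x (tail G e)\<bar> \<le> 1" if "e \<in> in_arcs G v" for e
      using 1(1) in_arcs_tail[OF G(1) that] by blast
    then have "node_value G h x (tail G e) \<in> {-1..1}" if "e \<in> in_arcs G v" for e
      using that unfolding atLeastAtMost_iff by (metis abs_le_iff minus_le_iff)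
    then have "(\<lambda>e\<in>in_arcs G v. node_value G h x (tail G e)) \<in> cube (in_arcs G v)"
      by (simp add: cube_def)
    then show ?thesis by (simp add: node_value_inner[OF G True] h[OF True])
  next
    case False
    then have "v \<in> sources G" using verts_source_or_inner[OF 1(2)] by simp
    then show ?thesis using x by (simp add: node_value_source cube_abs_le)
  qed
qed

lemma node_values_in_cube:
  assumes "fin_digraph G" "acyclic (arcs_ends G)"
    "\<And>v y. v \<in> inner_nodes G \<Longrightarrow> y \<in> cube (in_arcs G v) \<Longrightarrow> \<bar>h v y\<bar> \<le> 1" "x \<in> cube (sources G)"
  shows "(\<lambda>e\<in>in_arcs G v. node_value G h x (tail G e)) \<in> cube (in_arcs G v)"
proof -
  have "\<bar>node_value G h x (tail G e)\<bar> \<le> 1" if "e \<in> in_arcs G v" for e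
    by (rule node_value_bound[OF assms(1,2,3,4) in_arcs_tail(2)[OF assms(1) that]])
  then have "node_value G h x (tail G e) \<in> {-1..1}" if "e \<in> in_arcs G v" for e
    using that unfolding atLeastAtMost_iff by (metis abs_le_iff minus_le_iff)
  then show ?thesis by (simp add: cube_def)
qed

definition inner_ancestors :: "('v, 'e) pre_digraph \<Rightarrow> 'v \<Rightarrow> 'v set" where
  "inner_ancestors G v = {u \<in> inner_nodes G. (u, v) \<in> (arcs_ends G)\<^sup>*}"

text \<open>Of the errors of the inputs only the largest counts, because the constituent does not
  expand the maximum norm, and the node adds its own \<open>\<delta>\<close>. By acyclicity the
  inner ancestors of a predecessor are among those of \<open>v\<close> other than \<open>v\<close>,
  so their number bounds how often \<open>\<delta>\<close> is added.\<close>

lemma node_value_error: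
  assumes G: "fin_digraph G" "acyclic (arcs_ends G)"
    and m: "\<And>v. v \<in> inner_nodes G \<Longrightarrow> 1 \<le> m v"
    and h: "\<And>v. v \<in> inner_nodes G \<Longrightarrow> h v \<in> W (m v) (in_arcs G v)"
    and g: "\<And>v y. v \<in> inner_nodes G \<Longrightarrow> y \<in> cube (in_arcs G v) \<Longrightarrow> \<bar>g v y\<bar> \<le> 1 \<and> \<bar>h v y - g v y\<bar> \<le> \<delta>"
    and d: "0 \<le> \<delta>" and x: "x \<in> cube (sources G)" and v: "v \<in> verts G"
  shows "\<bar>node_value G h x v - node_value G g x v\<bar> \<le> real (card (inner_ancestors G v)) * \<delta>"
  using v
proof (induction v rule: node_induct[OF G])
  case (1 v)
  interpret fin_digraph G by fact
  have finI: "finite (inner_nodes G)" by (simp add: inner_nodes_def)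
  have hb: "\<bar>h v y\<bar> \<le> 1" if "v \<in> inner_nodes G" "y \<in> cube (in_arcs G v)" for v y
    using W_smooth_on_cube[OF _ h[OF that(1)] order_refl] that(2) smooth_on_cube_bound by fastforce
  show ?case
  proof (cases "v \<in> inner_nodes G")
    case True
    \<comment> \<open>An inner node is among its own inner ancestors; the count without it bounds
      what the inputs contribute.\<close>
    let ?r = "real (card (inner_ancestors G v) - 1) * \<delta>"
    let ?y = "\<lambda>e\<in>in_arcs G v. node_value G h x (tail G e)" and ?z = "\<lambda>e\<in>in_arcs G v. node_value G g x (tail G e)"
    have y: "?y \<in> cube (in_arcs G v)" by (rule node_values_in_cube[OF G hb x])
    have z: "?z \<in> cube (in_arcs G v)" by (rule node_values_in_cube[OF G _ x]) (use g in blast)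
    have finA: "finite (inner_ancestors G v)" using finI by (simp add: inner_ancestors_def)
    have vA: "v \<in> inner_ancestors G v" using True by (simp add: inner_ancestors_def)
    have "\<bar>?y e - ?z e\<bar> \<le> ?r" if e: "e \<in> in_arcs G v" for e
    proof -
      have uv: "(tail G e, v) \<in> arcs_ends G" by (rule in_arcs_tail[OF G(1) e])
      have "inner_ancestors G (tail G e) \<subseteq> inner_ancestors G v - {v}"
      proof
        fix u assume u: "u \<in> inner_ancestors G (tail G e)"
        then have "(u, v) \<in> (arcs_ends G)\<^sup>+" using uv by (auto simp: inner_ancestors_def)
        then show "u \<in> inner_ancestors G v - {v}"
          using u G(2) by (auto simp: inner_ancestors_def acyclic_def trancl_into_rtrancl)
      qed
      then have "card (inner_ancestors G (tail G e)) \<le> card (inner_ancestors G v) - 1"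
        using card_mono[of "inner_ancestors G v - {v}" "inner_ancestors G (tail G e)"] finA vA by (simp add: card_Diff_singleton)
      then have "real (card (inner_ancestors G (tail G e))) * \<delta> \<le> ?r" using d by (intro mult_right_mono) auto
      then show ?thesis using 1(1)[OF uv in_arcs_tail(2)[OF G(1) e]] e by simp
    qed
    then have "\<bar>h v ?y - h v ?z\<bar> \<le> ?r"
      using d by (intro W_lipschitz[OF finite_in_arcs h[OF True] m[OF True] y z]) auto
    moreover have "\<bar>h v ?z - g v ?z\<bar> \<le> \<delta>" using g[OF True z] by blast
    moreover have "real (card (inner_ancestors G v)) * \<delta> = ?r + \<delta>"
    proof -
      have "card (inner_ancestors G v) > 0" using finA vA by (auto simp: card_gt_0_iff)
      then have "real (card (inner_ancestors G v)) = real (card (inner_ancestors G v) - 1) + 1" by simp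
      then show ?thesis by (simp only: distrib_right mult_1)
    qed
    ultimately show ?thesis unfolding node_value_inner[OF G True] by linarith
  next
    case False
    then have "v \<in> sources G" using verts_source_or_inner[OF 1(2)] by simp
    then show ?thesis using d by (simp add: node_value_source)
  qed
qed

section \<open>Complexity of deep networks\<close>

lemma complexity_le_real:
  assumes R: "0 \<le> R"
    and F: "\<And>f. f \<in> F \<Longrightarrow> \<exists>N. \<exists>P\<in>\<N> N. real N \<le> R \<and> (\<forall>x\<in>cube I. \<bar>f x - P x\<bar> \<le> \<epsilon>)"
  shows "ereal_of_enat (complexity I \<N> F \<epsilon>) \<le> ereal R"
proof -
  have "(INF N\<in>{N. \<exists>P\<in>\<N> N. sup_norm I (\<lambda>x. f x - P x) \<le> \<epsilon>}. enat N) \<le> enat (nat \<lfloor>R\<rfloor>)" if f: "f \<in> F" for f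
  proof -
    obtain N P where N: "P \<in> \<N> N" "real N \<le> R" "\<And>x. x \<in> cube I \<Longrightarrow> \<bar>f x - P x\<bar> \<le> \<epsilon>" using F[OF f] by blast
    have "sup_norm I (\<lambda>x. f x - P x) \<le> \<epsilon>" by (rule sup_norm_le) (rule N(3))
    then have "(INF N\<in>{N. \<exists>P\<in>\<N> N. sup_norm I (\<lambda>x. f x - P x) \<le> \<epsilon>}. enat N) \<le> enat N"
      using N(1) by (intro INF_lower) auto
    also have "\<dots> \<le> enat (nat \<lfloor>R\<rfloor>)" using N(2) by (simp add: le_nat_floor)
    finally show ?thesis .
  qed
  then have "complexity I \<N> F \<epsilon> \<le> enat (nat \<lfloor>R\<rfloor>)" unfolding complexity_def by (intro SUP_least)
  then have "ereal_of_enat (complexity I \<N> F \<epsilon>) \<le> ereal_of_enat (enat (nat \<lfloor>R\<rfloor>))" by (simp only: ereal_of_enat_le_iff)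
  also have "\<dots> \<le> ereal R" using R by simp
  finally show ?thesis .
qed

lemma compositional_graphD:
  assumes "compositional_graph G m"
  shows "fin_digraph G" "acyclic (arcs_ends G)" "the_elem (sinks G) \<in> verts G" "sinks G = {the_elem (sinks G)}"
    "inner_nodes G \<noteq> {}" "finite (inner_nodes G)" "finite (sources G)" "finite (verts G)" "sources G \<noteq> {}"
    "\<And>v. v \<in> inner_nodes G \<Longrightarrow> 1 \<le> m v"
proof -
  have "digraph G" using assms by (simp add: compositional_graph_def)
  then interpret digraph G .
  show fd: "fin_digraph G" by unfold_locales
  show ac: "acyclic (arcs_ends G)" and ne: "inner_nodes G \<noteq> {}" using assms by (auto simp: compositional_graph_def)
  have "is_singleton (sinks G)" using assms by (simp add: compositional_graph_def)
  then show s: "sinks G = {the_elem (sinks G)}" by (simp add: is_singleton_the_elem)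
  then show "the_elem (sinks G) \<in> verts G" by (auto simp: sinks_def)
  show "finite (inner_nodes G)" "finite (sources G)" "finite (verts G)" by (auto simp: inner_nodes_def sources_def)
  show "1 \<le> m v" if "v \<in> inner_nodes G" for v using assms that by (auto simp: compositional_graph_def)
  show "sources G \<noteq> {}"
  proof -
    have "verts G \<noteq> {}" using ne by (auto simp: inner_nodes_def)
    \<comment> \<open>A node that is minimal for the relation of arcs has no in-edges.\<close>
    then obtain v where v: "v \<in> verts G" "\<And>u. (u, v) \<in> arcs_ends G \<Longrightarrow> u \<notin> verts G"
      using wfE_min'[OF wf_arcs_ends[OF fd ac]] by metis
    then have "in_arcs G v = {}" using in_arcs_tail[OF fd] by blast
    then have "v \<in> sources G" using v(1) by (simp add: sources_def in_degree_def)
    then show ?thesis by blast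
  qed
qed

text \<open>Explicit in \<open>\<epsilon>\<close> and in the constants, for all
  \<open>\<epsilon> \<le> 1\<close>: this yields the asymptotic rate for a fixed graph as well as
  the polynomial dependence on the dimension over a family.\<close>

lemma deep_complexity_le:
  fixes C :: "nat \<Rightarrow> nat \<Rightarrow> real"
  assumes G: "compositional_graph (G :: ('v, 'e) pre_digraph) m"
    and C: "\<forall>n k. 1 \<le> k \<longrightarrow> 0 < C n k \<and> (\<forall>I :: 'e set. finite I \<longrightarrow> card I = n \<longrightarrow> rate_on \<sigma> I k (C n k))"
    and e: "0 < \<epsilon>" "\<epsilon> \<le> 1"
  shows "ereal_of_enat (deep_complexity \<sigma> G m \<epsilon>) \<le> ereal (\<Sum>v\<in>inner_nodes G. C (in_degree G v) (m v) *
    (\<epsilon> / (2 * real (card (inner_nodes G)))) powr (- (real (in_degree G v) / real (m v))))"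
proof -
  note GD = compositional_graphD[OF G]
  interpret fin_digraph G by (rule GD(1))
  define K where "K = real (card (inner_nodes G))"
  have K: "K \<ge> 1" using GD(5,6) by (simp add: K_def Suc_le_eq card_gt_0_iff)
  \<comment> \<open>Each of the \<open>K\<close> inner nodes errs by at most
    \<open>2 * \<delta>\<close>.\<close>
  define \<delta> where "\<delta> = \<epsilon> / (2 * K)"
  have d: "0 < \<delta>" "\<delta> \<le> 1" using e K by (auto simp: \<delta>_def field_simps)
  have Cp: "0 < C (in_degree G v) (m v)" if "v \<in> inner_nodes G" for v using C[rule_format, OF GD(10)[OF that]] by blast
  show ?thesis
    unfolding deep_complexity_def
  proof (rule complexity_le_real)
    show "0 \<le> (\<Sum>v\<in>inner_nodes G. C (in_degree G v) (m v) *
        (\<epsilon> / (2 * real (card (inner_nodes G)))) powr (- (real (in_degree G v) / real (m v))))"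
      by (intro sum_nonneg mult_nonneg_nonneg) (auto intro: less_imp_le[OF Cp])
    fix f assume "f \<in> compositional_functions G m"
    then obtain h where f: "f = G_function G h" and h: "\<And>v. v \<in> inner_nodes G \<Longrightarrow> h v \<in> W (m v) (in_arcs G v)"
      unfolding compositional_functions_def by blast
    have "\<forall>v\<in>inner_nodes G. \<exists>p. snd p \<in> shallow_networks \<sigma> (in_arcs G v) (fst p) \<and>
        real (fst p) \<le> C (in_degree G v) (m v) * \<delta> powr (- (real (in_degree G v) / real (m v))) \<and>
        (\<forall>x\<in>cube (in_arcs G v). \<bar>snd p x\<bar> \<le> 1 \<and> \<bar>h v x - snd p x\<bar> \<le> 2 * \<delta>)"
    proof
      fix v assume v: "v \<in> inner_nodes G"
      have c: "card (in_arcs G v) = in_degree G v" by (simp add: in_degree_def)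
      have "rate_on \<sigma> (in_arcs G v) (m v) (C (in_degree G v) (m v))"
        using C GD(10)[OF v] finite_in_arcs c by blast
      from this[unfolded rate_on_def c, rule_format, OF h[OF v] d]
      obtain N g where "g \<in> shallow_networks \<sigma> (in_arcs G v) N"
        "real N \<le> C (in_degree G v) (m v) * \<delta> powr (- (real (in_degree G v) / real (m v)))"
        "\<forall>x\<in>cube (in_arcs G v). \<bar>g x\<bar> \<le> 1 \<and> \<bar>h v x - g x\<bar> \<le> 2 * \<delta>" by blast
      then show "\<exists>p. snd p \<in> shallow_networks \<sigma> (in_arcs G v) (fst p) \<and>
        real (fst p) \<le> C (in_degree G v) (m v) * \<delta> powr (- (real (in_degree G v) / real (m v))) \<and>
        (\<forall>x\<in>cube (in_arcs G v). \<bar>snd p x\<bar> \<le> 1 \<and> \<bar>h v x - snd p x\<bar> \<le> 2 * \<delta>)"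
        by (intro exI[of _ "(N, g)"]) simp
    qed
    from bchoice[OF this] obtain p where p: "\<And>v. v \<in> inner_nodes G \<Longrightarrow> snd (p v) \<in> shallow_networks \<sigma> (in_arcs G v) (fst (p v))"
      "\<And>v. v \<in> inner_nodes G \<Longrightarrow> real (fst (p v)) \<le> C (in_degree G v) (m v) * \<delta> powr (- (real (in_degree G v) / real (m v)))"
      "\<And>v x. v \<in> inner_nodes G \<Longrightarrow> x \<in> cube (in_arcs G v) \<Longrightarrow> \<bar>snd (p v) x\<bar> \<le> 1 \<and> \<bar>h v x - snd (p v) x\<bar> \<le> 2 * \<delta>"
      by blast
    define g where "g v = snd (p v)" for v
    define N where "N = (\<Sum>v\<in>inner_nodes G. fst (p v))"
    have "G_function G g \<in> deep_networks \<sigma> G N"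
      unfolding deep_networks_def N_def
      by (intro CollectI exI[of _ g] exI[of _ "\<lambda>v. fst (p v)"] conjI ballI refl) (simp add: g_def p(1))
    moreover have "real N \<le> (\<Sum>v\<in>inner_nodes G. C (in_degree G v) (m v) *
        (\<epsilon> / (2 * real (card (inner_nodes G)))) powr (- (real (in_degree G v) / real (m v))))"
      unfolding N_def of_nat_sum using p(2) unfolding \<delta>_def K_def by (intro sum_mono) blast
    moreover have "\<bar>f x - G_function G g x\<bar> \<le> \<epsilon>" if x: "x \<in> cube (sources G)" for x
    proof -
      have "\<bar>f x - G_function G g x\<bar> \<le> real (card (inner_ancestors G (the_elem (sinks G)))) * (2 * \<delta>)"
        unfolding f G_function_def using d p(3)
        by (intro node_value_error[OF GD(1,2) GD(10) h _ _ x GD(3)]) (auto simp: g_def)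
      also have "\<dots> \<le> K * (2 * \<delta>)"
        unfolding K_def using d GD(6) by (intro mult_right_mono) (auto simp: inner_ancestors_def intro!: card_mono)
      also have "\<dots> = \<epsilon>" using K by (simp add: \<delta>_def)
      finally show ?thesis .
    qed
    ultimately show "\<exists>N. \<exists>P\<in>deep_networks \<sigma> G N. real N \<le> (\<Sum>v\<in>inner_nodes G. C (in_degree G v) (m v) *
        (\<epsilon> / (2 * real (card (inner_nodes G)))) powr (- (real (in_degree G v) / real (m v)))) \<and>
        (\<forall>x\<in>cube (sources G). \<bar>f x - P x\<bar> \<le> \<epsilon>)" by blast
  qed
qed

text \<open>The constants are indexed by in-degree and order of smoothness, not by nodes or graphs;
  so only finitely many of them occur in a bounded family.\<close>

lemma node_rates:
  assumes \<sigma>: "infinitely_differentiable \<sigma>" "\<not> is_polynomial \<sigma>"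
  shows "\<exists>C. \<forall>n k. 1 \<le> k \<longrightarrow> 0 < C n k \<and> (\<forall>I :: 'e set. finite I \<longrightarrow> card I = n \<longrightarrow> rate_on \<sigma> I k (C n k))"
proof -
  have "\<forall>p::nat \<times> nat. \<exists>C. 1 \<le> snd p \<longrightarrow> 0 < C \<and> (\<forall>I :: 'e set. finite I \<longrightarrow> card I = fst p \<longrightarrow> rate_on \<sigma> I (snd p) C)"
    using node_network_rate[where ?'i = 'e, OF \<sigma>] by blast
  from choice[OF this] obtain C where "\<forall>p. 1 \<le> snd p \<longrightarrow> 0 < C p \<and> (\<forall>I :: 'e set. finite I \<longrightarrow> card I = fst p \<longrightarrow> rate_on \<sigma> I (snd p) (C p))"
    by (elim exE)
  then show ?thesis by (intro exI[of _ "\<lambda>n k. C (n, k)"]) simp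
qed

lemma deep_complexity_bigo:
  assumes \<sigma>: "infinitely_differentiable \<sigma>" "\<not> is_polynomial \<sigma>" and G: "compositional_graph (G :: ('v, 'e) pre_digraph) m"
  shows "is_bigo (deep_complexity \<sigma> G m) (\<lambda>\<epsilon>. \<Sum>v\<in>inner_nodes G. \<epsilon> powr (- real (in_degree G v) / real (m v)))"
proof -
  note GD = compositional_graphD[OF G]
  obtain C where C: "\<forall>n k. 1 \<le> k \<longrightarrow> 0 < C n k \<and> (\<forall>I :: 'e set. finite I \<longrightarrow> card I = n \<longrightarrow> rate_on \<sigma> I k (C n k))"
    using node_rates[where ?'e = 'e, OF \<sigma>] by (elim exE)
  define K where "K = 2 * real (card (inner_nodes G))"
  have K: "K > 0" using GD(5,6) by (simp add: K_def card_gt_0_iff)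
  define a where "a v = real (in_degree G v) / real (m v)" for v
  define b where "b v = C (in_degree G v) (m v) * (1 / K) powr (- a v)" for v
  have b: "0 < b v" if "v \<in> inner_nodes G" for v
    unfolding b_def using C[rule_format, OF GD(10)[OF that]] K by simp
  have "ereal_of_enat (deep_complexity \<sigma> G m \<epsilon>) \<le>
      ereal ((\<Sum>v\<in>inner_nodes G. b v) * (\<Sum>v\<in>inner_nodes G. \<epsilon> powr (- real (in_degree G v) / real (m v))))"
    if e: "0 < \<epsilon>" "\<epsilon> \<le> 1" for \<epsilon>
  proof -
    have "ereal_of_enat (deep_complexity \<sigma> G m \<epsilon>) \<le> ereal (\<Sum>v\<in>inner_nodes G. C (in_degree G v) (m v) * (\<epsilon> / K) powr (- a v))"
      unfolding a_def K_def by (rule deep_complexity_le[OF G C e])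
    also have "(\<Sum>v\<in>inner_nodes G. C (in_degree G v) (m v) * (\<epsilon> / K) powr (- a v)) = (\<Sum>v\<in>inner_nodes G. b v * \<epsilon> powr (- a v))"
      unfolding b_def using e K by (intro sum.cong refl) (simp add: powr_divide)
    also have "\<dots> \<le> (\<Sum>v\<in>inner_nodes G. (\<Sum>u\<in>inner_nodes G. b u) * \<epsilon> powr (- a v))"
    proof (intro sum_mono mult_right_mono)
      fix v assume "v \<in> inner_nodes G"
      then show "b v \<le> (\<Sum>u\<in>inner_nodes G. b u)"
        using GD(6) by (intro member_le_sum) (auto intro: less_imp_le[OF b])
    qed simp
    finally show ?thesis by (simp add: sum_distrib_left a_def)
  qed
  then show ?thesis
    unfolding is_bigo_def eventually_at_right_field
    by (intro exI[of _ "\<Sum>v\<in>inner_nodes G. b v"] exI[of _ 1]) simp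
qed

lemma deep_complexity_avoids_curse:
  fixes \<F> :: "(('v, 'e) pre_digraph \<times> ('v \<Rightarrow> nat)) set"
  assumes \<sigma>: "infinitely_differentiable \<sigma>" "\<not> is_polynomial \<sigma>" and F: "bounded_family \<F>"
  shows "avoids_curse (deep_complexity \<sigma>) \<F>"
proof -
  obtain C where C: "\<forall>n k. 1 \<le> k \<longrightarrow> 0 < C n k \<and> (\<forall>I :: 'e set. finite I \<longrightarrow> card I = n \<longrightarrow> rate_on \<sigma> I k (C n k))"
    using node_rates[where ?'e = 'e, OF \<sigma>] by (elim exE)
  obtain d M where dM: "\<And>G m v. (G, m) \<in> \<F> \<Longrightarrow> v \<in> inner_nodes G \<Longrightarrow> in_degree G v \<le> d \<and> m v \<le> M"
    using F unfolding bounded_family_def by blast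
  obtain A a where A: "\<And>G m. (G, m) \<in> \<F> \<Longrightarrow> card (verts G) \<le> A * card (sources G) ^ a"
    using F unfolding bounded_family_def by blast
  \<comment> \<open>Absolute values, as nothing is known of \<open>C n 0\<close>.\<close>
  define C1 where "C1 = (\<Sum>p\<in>{..d} \<times> {..M}. \<bar>C (fst p) (snd p)\<bar>)"
  have C1: "C n k \<le> C1" if "n \<le> d" "k \<le> M" for n k
    using member_le_sum[of "(n, k)" "{..d} \<times> {..M}" "\<lambda>p. \<bar>C (fst p) (snd p)\<bar>"] that unfolding C1_def by auto
  have C10: "0 \<le> C1" unfolding C1_def by (intro sum_nonneg) auto
  have "ereal_of_enat (deep_complexity \<sigma> G m \<epsilon>) \<le>
      ereal ((C1 * 2 ^ d * real A ^ (d + 1)) * real (card (sources G)) powr (real (a * (d + 1))) * \<epsilon> powr (- real d))"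
    if Gm: "(G, m) \<in> \<F>" and e: "\<epsilon> \<in> {0<..1}" for G m \<epsilon>
  proof -
    have G: "compositional_graph G m" using F Gm unfolding bounded_family_def by blast
    note GD = compositional_graphD[OF G]
    define K where "K = real (card (inner_nodes G))"
    define s where "s = real (card (sources G))"
    have K: "K \<ge> 1" using GD(5,6) by (simp add: K_def Suc_le_eq card_gt_0_iff)
    have s: "s > 0" using GD(7,9) by (simp add: s_def card_gt_0_iff)
    have e': "0 < \<epsilon>" "\<epsilon> \<le> 1" using e by auto
    have x: "1 \<le> 2 * K / \<epsilon>" using K e' by (simp add: field_simps)
    have "ereal_of_enat (deep_complexity \<sigma> G m \<epsilon>) \<le> ereal (\<Sum>v\<in>inner_nodes G. C (in_degree G v) (m v) *
        (\<epsilon> / (2 * real (card (inner_nodes G)))) powr (- (real (in_degree G v) / real (m v))))"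
      by (rule deep_complexity_le[OF G C e'])
    also have "(\<Sum>v\<in>inner_nodes G. C (in_degree G v) (m v) *
        (\<epsilon> / (2 * real (card (inner_nodes G)))) powr (- (real (in_degree G v) / real (m v)))) \<le>
        (\<Sum>v\<in>inner_nodes G. C1 * (2 * K / \<epsilon>) ^ d)"
    proof (intro sum_mono mult_mono C10)
      fix v assume v: "v \<in> inner_nodes G"
      show "C (in_degree G v) (m v) \<le> C1" using C1 dM[OF Gm v] by blast
      have "(\<epsilon> / (2 * K)) powr (- (real (in_degree G v) / real (m v))) = (2 * K / \<epsilon>) powr (real (in_degree G v) / real (m v))"
        using K e' by (simp add: powr_minus_divide powr_divide)
      also have "\<dots> \<le> (2 * K / \<epsilon>) powr real d"
      proof (intro powr_mono x)
        have "real (in_degree G v) / real (m v) \<le> real (in_degree G v) / 1"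
          using GD(10)[OF v] by (intro divide_left_mono) auto
        also have "\<dots> \<le> real d" using dM[OF Gm v] by simp
        finally show "real (in_degree G v) / real (m v) \<le> real d" .
      qed
      also have "\<dots> = (2 * K / \<epsilon>) ^ d" using K e' by (intro powr_realpow) auto
      finally show "(\<epsilon> / (2 * real (card (inner_nodes G)))) powr (- (real (in_degree G v) / real (m v))) \<le> (2 * K / \<epsilon>) ^ d"
        by (simp add: K_def)
    qed simp
    \<comment> \<open>One factor \<open>K\<close> counts the nodes, the other \<open>d\<close> come
      from the accuracy of order \<open>\<epsilon> / K\<close> that is asked of each node.\<close>
    also have "\<dots> = C1 * 2 ^ d * K ^ (d + 1) * \<epsilon> powr (- real d)"
      using K e' by (simp add: K_def[symmetric] power_mult_distrib power_divide powr_minus_divide powr_realpow)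
    also have "\<dots> \<le> C1 * 2 ^ d * (real A * s ^ a) ^ (d + 1) * \<epsilon> powr (- real d)"
    proof -
      have "card (inner_nodes G) \<le> card (verts G)" using GD(8) by (intro card_mono) (auto simp: inner_nodes_def)
      also have "\<dots> \<le> A * card (sources G) ^ a" by (rule A[OF Gm])
      finally have "K \<le> real A * s ^ a" unfolding K_def s_def by (metis of_nat_le_iff of_nat_mult of_nat_power)
      then show ?thesis using K C10 by (intro mult_right_mono mult_left_mono power_mono) auto
    qed
    also have "(real A * s ^ a) ^ (d + 1) = real A ^ (d + 1) * s powr (real (a * (d + 1)))"
      using s by (simp only: power_mult_distrib powr_realpow power_mult[symmetric])
    finally show ?thesis by (simp add: s_def mult.assoc del: power_Suc)
  qed
  then show ?thesis unfolding avoids_curse_def by blast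
qed

text \<open>Derivatives are followed through the graph along a single source variable, and after the
  substitution by cosines, which is the form that Jackson's theorem takes. All values stay in the
  cubes, so the composition lemma applies at every node, with one bound for all choices of
  constituents.\<close>

lemma composed_bounded_derivs:
  assumes G: "compositional_graph (G :: ('v, 'e) pre_digraph) m" and k: "\<And>v. v \<in> inner_nodes G \<Longrightarrow> k \<le> m v"
    and v: "v \<in> verts G"
  shows "\<exists>B\<ge>0. \<forall>h i t. (\<forall>v\<in>inner_nodes G. h v \<in> W (m v) (in_arcs G v)) \<longrightarrow>
    bounded_derivs k B (\<lambda>\<tau>. node_value G h (\<lambda>j\<in>sources G. cos ((t(i := \<tau>)) j)) v)"
  using v
proof (induction v rule: node_induct[OF compositional_graphD(1,2)[OF G]])
  case (1 v)
  note GD = compositional_graphD[OF G]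
  interpret fin_digraph G by (rule GD(1))
  show ?case
  proof (cases "v \<in> inner_nodes G")
    case False
    then have "v \<in> sources G" using verts_source_or_inner[OF 1(2)] by simp
    then have "node_value G h (\<lambda>j\<in>sources G. cos ((t(i := \<tau>)) j)) v = cos ((t(i := \<tau>)) v)" for h i t \<tau>
      by (simp add: node_value_source)
    then show ?thesis by (intro exI[of _ 1] conjI allI impI) (simp_all only: bounded_derivs_cos_update zero_le_one)
  next
    case True
    let ?x = "\<lambda>i t \<tau>. \<lambda>j\<in>sources G. cos ((t(i := \<tau>)) j)"
    have "\<forall>e\<in>in_arcs G v. \<exists>B. 0 \<le> B \<and> (\<forall>h i t. (\<forall>v\<in>inner_nodes G. h v \<in> W (m v) (in_arcs G v)) \<longrightarrow>
        bounded_derivs k B (\<lambda>\<tau>. node_value G h (?x i t \<tau>) (tail G e)))"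
      using 1(1)[OF in_arcs_tail[OF GD(1)]] by blast
    from bchoice[OF this] obtain Bt where Bt: "\<forall>e\<in>in_arcs G v. 0 \<le> Bt e \<and> (\<forall>h i t. (\<forall>v\<in>inner_nodes G. h v \<in> W (m v) (in_arcs G v)) \<longrightarrow>
        bounded_derivs k (Bt e) (\<lambda>\<tau>. node_value G h (?x i t \<tau>) (tail G e)))" by (elim exE)
    \<comment> \<open>A common bound for all inputs of the node.\<close>
    define B0 where "B0 = (\<Sum>e\<in>in_arcs G v. Bt e)"
    have B0: "Bt e \<le> B0" if "e \<in> in_arcs G v" for e
      unfolding B0_def using that Bt by (intro member_le_sum) auto
    obtain B' where B': "B' \<ge> 1" "\<forall>(I :: 'e set) h c. finite I \<longrightarrow> card I = card (in_arcs G v) \<longrightarrow> smooth_on_cube k I h \<longrightarrow>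
      (\<forall>e\<in>I. bounded_derivs k B0 (c e)) \<longrightarrow> (\<forall>s. (\<lambda>e\<in>I. c e s) \<in> cube I) \<longrightarrow>
      bounded_derivs k B' (\<lambda>s. h (\<lambda>e\<in>I. c e s))"
      using bounded_derivs_compose[where ?'i = 'e, of "card (in_arcs G v)" k B0] by (elim exE conjE)
    have key: "bounded_derivs k B' (\<lambda>\<tau>. node_value G h (?x i t \<tau>) v)"
      if h: "\<forall>v\<in>inner_nodes G. h v \<in> W (m v) (in_arcs G v)" for h i t
    proof -
      have hb: "\<bar>h v y\<bar> \<le> 1" if "v \<in> inner_nodes G" "y \<in> cube (in_arcs G v)" for v y
        using W_smooth_on_cube[OF finite_in_arcs h[rule_format, OF that(1)] order_refl] that(2) by (rule smooth_on_cube_bound)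
      have "bounded_derivs k B' (\<lambda>\<tau>. h v (\<lambda>e\<in>in_arcs G v. node_value G h (?x i t \<tau>) (tail G e)))"
      proof (rule B'(2)[rule_format, of "in_arcs G v" "h v" "\<lambda>e \<tau>. node_value G h (?x i t \<tau>) (tail G e)"])
        show "smooth_on_cube k (in_arcs G v) (h v)"
          by (rule W_smooth_on_cube[OF finite_in_arcs h[rule_format, OF True] k[OF True]])
        show "bounded_derivs k B0 (\<lambda>\<tau>. node_value G h (?x i t \<tau>) (tail G e))" if e: "e \<in> in_arcs G v" for e
          using Bt[rule_format, OF e, THEN conjunct2, rule_format, of h t i] h B0[OF e] bounded_derivs_mono by blast
        show "(\<lambda>e\<in>in_arcs G v. node_value G h (?x i t s) (tail G e)) \<in> cube (in_arcs G v)" for s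
          by (rule node_values_in_cube[OF GD(1,2) hb cos_in_cube])
      qed auto
      then show ?thesis unfolding node_value_inner[OF GD(1,2) True] .
    qed
    show ?thesis
    proof (intro exI[of _ B'] conjI allI impI)
      show "0 \<le> B'" using B'(1) by simp
    qed (rule key)
  qed
qed

lemma shallow_complexity_bigo:
  assumes \<sigma>: "infinitely_differentiable \<sigma>" "\<not> is_polynomial \<sigma>" and G: "compositional_graph (G :: ('v, 'e) pre_digraph) m"
  shows "is_bigo (shallow_complexity \<sigma> G m) (\<lambda>\<epsilon>. \<epsilon> powr (- real (card (sources G)) / real (Min (m ` inner_nodes G))))"
proof -
  note GD = compositional_graphD[OF G]
  define k where "k = Min (m ` inner_nodes G)"
  have k: "k \<le> m v" if "v \<in> inner_nodes G" for v using that GD(6) by (simp add: k_def)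
  have "k \<in> m ` inner_nodes G" unfolding k_def using GD(5,6) by (intro Min_in) auto
  then have k1: "1 \<le> k" using GD(10) by blast
  obtain B where B: "0 \<le> B" "\<And>h i t. (\<forall>v\<in>inner_nodes G. h v \<in> W (m v) (in_arcs G v)) \<Longrightarrow>
    bounded_derivs k B (\<lambda>\<tau>. node_value G h (\<lambda>j\<in>sources G. cos ((t(i := \<tau>)) j)) (the_elem (sinks G)))"
    using composed_bounded_derivs[OF G k GD(3)] by blast
  from network_rate[where ?'i = 'v, OF \<sigma> k1 B(1), of "card (sources G)"]
  obtain C where C: "C > 0" "\<forall>(I :: 'v set) f \<epsilon>. finite I \<longrightarrow> card I = card (sources G) \<longrightarrow>
    (\<forall>i\<in>I. \<forall>t. bounded_derivs k B (\<lambda>\<tau>. f (\<lambda>j\<in>I. cos ((t(i := \<tau>)) j)))) \<longrightarrow> 0 < \<epsilon> \<longrightarrow> \<epsilon> \<le> 1 \<longrightarrow>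
    (\<exists>N. \<exists>g\<in>shallow_networks \<sigma> I N. real N \<le> C * \<epsilon> powr (- (real (card (sources G)) / real k)) \<and> (\<forall>x\<in>cube I. \<bar>f x - g x\<bar> \<le> \<epsilon>))"
    by (elim exE conjE)
  have "ereal_of_enat (shallow_complexity \<sigma> G m \<epsilon>) \<le> ereal (C * \<epsilon> powr (- (real (card (sources G)) / real k)))"
    if e: "0 < \<epsilon>" "\<epsilon> \<le> 1" for \<epsilon>
    unfolding shallow_complexity_def
  proof (rule complexity_le_real)
    show "0 \<le> C * \<epsilon> powr (- (real (card (sources G)) / real k))" using C(1) by simp
    fix f assume "f \<in> compositional_functions G m"
    then obtain h where f: "f = G_function G h" and h: "\<forall>v\<in>inner_nodes G. h v \<in> W (m v) (in_arcs G v)"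
      unfolding compositional_functions_def by blast
    have "bounded_derivs k B (\<lambda>\<tau>. f (\<lambda>j\<in>sources G. cos ((t(i := \<tau>)) j)))" for i t
      using B(2)[OF h, of t i] unfolding f G_function_def .
    then show "\<exists>N. \<exists>P\<in>shallow_networks \<sigma> (sources G) N. real N \<le> C * \<epsilon> powr (- (real (card (sources G)) / real k)) \<and>
        (\<forall>x\<in>cube (sources G). \<bar>f x - P x\<bar> \<le> \<epsilon>)"
      by (intro C(2)[rule_format, OF GD(7) refl _ e])
  qed
  then have "is_bigo (shallow_complexity \<sigma> G m) (\<lambda>\<epsilon>. \<epsilon> powr (- (real (card (sources G)) / real k)))"
    unfolding is_bigo_def eventually_at_right_field
    by (intro exI[of _ C] exI[of _ 1]) simp
  then show ?thesis by (simp add: k_def)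
qed

subsection \<open>Zernike polynomials\<close>

text \<open>The matrix of an orthogonal projection. Each vector costs one projection of rank one,
  hence at most 1 of the trace. In the lower bound the trace is what the wave sees.\<close>

lemma projection_killing_vectors:
  fixes v :: "nat \<Rightarrow> 'a \<Rightarrow> complex"
  assumes A: "finite A"
  shows "\<exists>P. (\<forall>a\<in>A. \<forall>b\<in>A. P b a = cnj (P a b)) \<and> (\<forall>a\<in>A. \<forall>b\<in>A. (\<Sum>c\<in>A. P a c * P c b) = P a b) \<and>
    (\<forall>k<N. \<forall>a\<in>A. (\<Sum>b\<in>A. P a b * v k b) = 0) \<and> real (card A) - real N \<le> Re (\<Sum>a\<in>A. P a a)"
proof (induction N)
  case 0
  let ?P = "\<lambda>a b. if a = b then 1 else 0 :: complex"
  have idem: "(\<Sum>c\<in>A. ?P a c * ?P c b) = ?P a b" if "a \<in> A" "b \<in> A" for a b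
  proof -
    have "(\<Sum>c\<in>A. ?P a c * ?P c b) = (\<Sum>c\<in>A. if c = a then ?P a b else 0)" by (intro sum.cong) auto
    then show ?thesis using A that by simp
  qed
  show ?case
  proof (rule exI[of _ ?P], intro conjI ballI allI impI)
    fix a b assume ab: "a \<in> A" "b \<in> A"
    show "?P b a = cnj (?P a b)" by (cases "a = b") simp_all
    show "(\<Sum>c\<in>A. ?P a c * ?P c b) = ?P a b" by (rule idem[OF ab])
  next
    fix k a assume "k < (0::nat)"
    then show "(\<Sum>b\<in>A. ?P a b * v k b) = 0" by (rule less_zeroE)
  next
    have "(\<Sum>a\<in>A. ?P a a) = of_nat (card A)" by simp
    then show "real (card A) - real 0 \<le> Re (\<Sum>a\<in>A. ?P a a)" by (simp only: complex_Re_of_nat)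
  qed
next
  case (Suc N)
  then obtain P where P': "(\<forall>a\<in>A. \<forall>b\<in>A. P b a = cnj (P a b)) \<and> (\<forall>a\<in>A. \<forall>b\<in>A. (\<Sum>c\<in>A. P a c * P c b) = P a b) \<and>
    (\<forall>k<N. \<forall>a\<in>A. (\<Sum>b\<in>A. P a b * v k b) = 0) \<and> real (card A) - real N \<le> Re (\<Sum>a\<in>A. P a a)" by (elim exE)
  note PA = P'[THEN conjunct1] and PB = P'[THEN conjunct2, THEN conjunct1]
    and PC = P'[THEN conjunct2, THEN conjunct2, THEN conjunct1] and P4 = P'[THEN conjunct2, THEN conjunct2, THEN conjunct2]
  have P: "P b a = cnj (P a b)" "(\<Sum>c\<in>A. P a c * P c b) = P a b" if "a \<in> A" "b \<in> A" for a b
    using PA PB that by blast+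
  have P3: "(\<Sum>b\<in>A. P a b * v k b) = 0" if "k < N" "a \<in> A" for k a
    using PC that by blast
  \<comment> \<open>The part of \<open>v N\<close> that \<open>P\<close> does not kill yet.\<close>
  define w where "w a = (\<Sum>b\<in>A. P a b * v N b)" for a
  define n where "n = (\<Sum>a\<in>A. w a * cnj (w a))"
  show ?case
  proof (cases "\<forall>a\<in>A. w a = 0")
    case True
    then have "(\<Sum>b\<in>A. P a b * v k b) = 0" if "k < Suc N" "a \<in> A" for k a
      using P3[of k a] that by (cases "k = N") (auto simp: w_def)
    then have 3: "\<forall>k<Suc N. \<forall>a\<in>A. (\<Sum>b\<in>A. P a b * v k b) = 0" by blast
    have "real (card A) - real (Suc N) \<le> Re (\<Sum>a\<in>A. P a a)" using P4 by simp
    then show ?thesis by (intro exI[of _ P] conjI PA PB 3)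
next
    case False
    have nr: "n = of_real (\<Sum>a\<in>A. (cmod (w a))\<^sup>2)"
      by (simp add: n_def complex_norm_square del: of_real_power)
    have "(\<Sum>a\<in>A. (cmod (w a))\<^sup>2) > 0"
    proof -
      obtain a where "a \<in> A" "w a \<noteq> 0" using False by blast
      then show ?thesis using A by (intro sum_pos2[of A a]) auto
    qed
    then have n0: "n \<noteq> 0" unfolding nr by (simp del: of_real_sum)
    have Pw: "(\<Sum>c\<in>A. P a c * w c) = w a" if "a \<in> A" for a
    proof -
      have "(\<Sum>c\<in>A. P a c * w c) = (\<Sum>b\<in>A. (\<Sum>c\<in>A. P a c * P c b) * v N b)"
        unfolding w_def sum_distrib_left sum_distrib_right by (subst sum.swap) (simp add: mult.assoc)
      also have "\<dots> = w a" unfolding w_def using P(2)[OF that] by (intro sum.cong) auto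
      finally show ?thesis .
    qed
    have wP: "(\<Sum>c\<in>A. cnj (w c) * P c b) = cnj (w b)" if "b \<in> A" for b
    proof -
      have "(\<Sum>c\<in>A. cnj (w c) * P c b) = cnj (\<Sum>c\<in>A. P b c * w c)"
        unfolding cnj_sum using P(1)[OF that] by (intro sum.cong) (auto simp: mult.commute)
      then show ?thesis by (simp add: Pw[OF that])
    qed
    have wv: "(\<Sum>b\<in>A. cnj (w b) * x b) = (\<Sum>c\<in>A. cnj (w c) * (\<Sum>b\<in>A. P c b * x b))" for x
    proof -
      have "(\<Sum>b\<in>A. cnj (w b) * x b) = (\<Sum>b\<in>A. (\<Sum>c\<in>A. cnj (w c) * P c b) * x b)"
        using wP by (intro sum.cong) auto
      also have "\<dots> = (\<Sum>c\<in>A. cnj (w c) * (\<Sum>b\<in>A. P c b * x b))"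
        unfolding sum_distrib_left sum_distrib_right by (subst sum.swap) (simp add: mult.assoc)
      finally show ?thesis .
    qed
    \<comment> \<open>Splits off the line spanned by \<open>w\<close>. As \<open>w\<close> lies in
      the range of \<open>P\<close>, the result is a projection again, and it still kills the
      earlier vectors.\<close>
    define P' where "P' a b = P a b - w a * cnj (w b) / n" for a b
    have "cnj n = n" unfolding nr by (simp del: of_real_sum)
    then have 1: "P' b a = cnj (P' a b)" if "a \<in> A" "b \<in> A" for a b
      unfolding P'_def using P(1)[OF that] by (simp add: mult.commute)
    have 2: "(\<Sum>c\<in>A. P' a c * P' c b) = P' a b" if ab: "a \<in> A" "b \<in> A" for a b
    proof -
      have "(\<Sum>c\<in>A. P' a c * P' c b) = (\<Sum>c\<in>A. P a c * P c b - (P a c * w c) * (cnj (w b) / n) - (w a / n) * (cnj (w c) * P c b)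
          + (w c * cnj (w c)) * (w a * cnj (w b) / (n * n)))"
        unfolding P'_def by (intro sum.cong refl) (simp add: algebra_simps)
      also have "\<dots> = (\<Sum>c\<in>A. P a c * P c b) - (\<Sum>c\<in>A. P a c * w c) * (cnj (w b) / n) - (w a / n) * (\<Sum>c\<in>A. cnj (w c) * P c b)
          + n * (w a * cnj (w b) / (n * n))"
        unfolding n_def[symmetric] by (simp add: sum.distrib sum_subtractf sum_distrib_left sum_distrib_right sum_divide_distrib n_def)
      also have "\<dots> = P a b - w a * cnj (w b) / n - w a * cnj (w b) / n + w a * cnj (w b) / n"
        unfolding P(2)[OF ab] Pw[OF ab(1)] wP[OF ab(2)] using n0 by simp
      finally show ?thesis by (simp add: P'_def)
    qed
    have sub: "(\<Sum>b\<in>A. P' a b * x b) = (\<Sum>b\<in>A. P a b * x b) - w a / n * (\<Sum>c\<in>A. cnj (w c) * (\<Sum>b\<in>A. P c b * x b))" for a x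
      unfolding P'_def wv[symmetric] by (simp add: left_diff_distrib sum_subtractf sum_distrib_left mult.assoc)
    have 3: "(\<Sum>b\<in>A. P' a b * v k b) = 0" if "k < Suc N" "a \<in> A" for k a
    proof (cases "k = N")
      case True
      have "(\<Sum>c\<in>A. cnj (w c) * w c) = n" by (simp add: n_def mult.commute)
      then show ?thesis unfolding True sub w_def[symmetric] using n0 by simp
    next
      case False
      then have "(\<Sum>b\<in>A. P c b * v k b) = 0" if "c \<in> A" for c using P3[OF _ that] \<open>k < Suc N\<close> by simp
      then show ?thesis unfolding sub using that by simp
    qed
    have "(\<Sum>a\<in>A. P' a a) = (\<Sum>a\<in>A. P a a) - n / n"
      unfolding P'_def sum_subtractf sum_divide_distrib[symmetric] n_def ..
    then have 4: "real (card A) - real (Suc N) \<le> Re (\<Sum>a\<in>A. P' a a)" using P4 n0 by simp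
    show ?thesis by (intro exI[of _ P'] conjI ballI allI impI) (fact 1 2 3 4)+
  qed
qed

section \<open>Partial fractions and moments of the radial polynomials\<close>

lemma partial_fractions:
  fixes p :: "real poly" and J :: "real set"
  assumes J: "finite J" and p: "degree p < card J" and x: "\<And>j. j \<in> J \<Longrightarrow> x + j \<noteq> 0"
  shows "poly p x / (\<Prod>j\<in>J. x + j) = (\<Sum>j\<in>J. poly p (- j) / (\<Prod>i\<in>J - {j}. i - j) / (x + j))"
proof -
  define a where "a j = poly p (- j) / (\<Prod>i\<in>J - {j}. i - j)" for j
  \<comment> \<open>Lagrange interpolation of \<open>p\<close> at the nodes \<open>- j\<close>. Both
    polynomials have degree below the number of nodes, so they agree.\<close>
  define r where "r = (\<Sum>j\<in>J. smult (a j) (\<Prod>i\<in>J - {j}. [:i, 1:]))"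
  have "p = r"
  proof (rule poly_eqI_degree[of "uminus ` J"])
    show "card (uminus ` J) > degree p" using p by (simp add: card_image)
    have "degree (smult (a j) (\<Prod>i\<in>J - {j}. [:i, 1:])) \<le> card J - 1" if "j \<in> J" for j
    proof -
      have "degree (\<Prod>i\<in>J - {j}. [:i, 1:]) \<le> (\<Sum>i\<in>J - {j}. degree [:i, 1:])" using degree_prod_sum_le[of "J - {j}" "\<lambda>i. [:i, 1:]"] J by (simp add: o_def)
      also have "\<dots> = card J - 1" using J that by simp
      finally show ?thesis using degree_smult_le order_trans by blast
    qed
    then have "degree r \<le> card J - 1" unfolding r_def by (intro degree_sum_le J)
    then show "card (uminus ` J) > degree r" using p by (simp add: card_image)
    fix y assume "y \<in> uminus ` J"
    then obtain k where k: "k \<in> J" "y = - k" by blast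
    have "poly r y = (\<Sum>j\<in>J. a j * (\<Prod>i\<in>J - {j}. i - k))" by (simp add: r_def poly_sum poly_prod k)
    also have "\<dots> = (\<Sum>j\<in>J. if j = k then a k * (\<Prod>i\<in>J - {k}. i - k) else 0)"
    proof (intro sum.cong refl)
      fix j assume "j \<in> J"
      show "a j * (\<Prod>i\<in>J - {j}. i - k) = (if j = k then a k * (\<Prod>i\<in>J - {k}. i - k) else 0)"
        using k J by (auto simp: prod_zero_iff)
    qed
    also have "\<dots> = a k * (\<Prod>i\<in>J - {k}. i - k)" using k J by simp
    also have "\<dots> = poly p y"
    proof -
      have "(\<Prod>i\<in>J - {k}. i - k) \<noteq> 0" using J by (auto simp: prod_zero_iff)
      then show ?thesis by (simp add: a_def k)
    qed
    finally show "poly p y = poly r y" by simp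
  qed
  then have "poly p x = (\<Sum>j\<in>J. a j * (\<Prod>i\<in>J - {j}. x + i))"
    by (simp add: r_def poly_sum poly_prod add.commute)
  also have "\<dots> = (\<Sum>j\<in>J. a j / (x + j) * (\<Prod>i\<in>J. x + i))"
    using J x by (intro sum.cong refl) (simp add: prod.remove)
  also have "\<dots> = (\<Sum>j\<in>J. a j / (x + j)) * (\<Prod>i\<in>J. x + i)" by (simp add: sum_distrib_right)
  finally have e: "poly p x = (\<Sum>j\<in>J. a j / (x + j)) * (\<Prod>i\<in>J. x + i)" .
  have "(\<Prod>i\<in>J. x + i) \<noteq> 0" using x J by (auto simp: prod_zero_iff)
  then show ?thesis unfolding e a_def by simp
qed

text \<open>
  Radial parts of the Zernike polynomials in the variable \<open>u = \<rho>\<^sup>2\<close>: the function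
  \<open>zernike_radial \<kappa> l\<close> is \<open>R\<^sub>2\<^sub>l\<^sup>2\<^sup>\<kappa>\<close>. Its coefficients are the residues of the rational function of \<open>h\<close> that
  gives its moments \<open>\<integral>\<^sub>0\<^sup>1 u ^ h * zernike_radial \<kappa> l u du\<close>.
\<close>

definition zernike_moment :: "nat \<Rightarrow> nat \<Rightarrow> nat \<Rightarrow> real" where
  "zernike_moment \<kappa> l h = (\<Prod>i\<in>{\<kappa>..<l}. real h - real i) / (\<Prod>i\<in>{\<kappa>..l}. real h + real i + 1)"

definition zernike_coeff :: "nat \<Rightarrow> nat \<Rightarrow> nat \<Rightarrow> real" where
  "zernike_coeff \<kappa> l j = (\<Prod>i\<in>{\<kappa>..<l}. - real j - 1 - real i) / (\<Prod>i\<in>{\<kappa>..l} - {j}. real i - real j)"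

definition zernike_radial :: "nat \<Rightarrow> nat \<Rightarrow> real \<Rightarrow> real" where
  "zernike_radial \<kappa> l u = (\<Sum>j\<in>{\<kappa>..l}. zernike_coeff \<kappa> l j * u ^ j)"

text \<open>Partial fractions in \<open>h\<close> with poles at \<open>- (j + 1)\<close>; the terms
  are the integrals of \<open>u ^ (h + j)\<close> with the coefficients of the polynomial.\<close>

lemma zernike_moment_eq:
  assumes "\<kappa> \<le> l"
  shows "(\<Sum>j\<in>{\<kappa>..l}. zernike_coeff \<kappa> l j / real (h + j + 1)) = zernike_moment \<kappa> l h"
proof -
  define p where "p = (\<Prod>i\<in>{\<kappa>..<l}. [:- real i, 1:])"
  let ?f = "\<lambda>i. real i + 1"
  have inj: "inj_on ?f S" for S by (auto simp: inj_on_def)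
  have c: "card (?f ` {\<kappa>..l}) = l - \<kappa> + 1" using assms by (simp add: card_image[OF inj])
  have "degree p \<le> (\<Sum>i\<in>{\<kappa>..<l}. degree [:- real i, 1:])" unfolding p_def using degree_prod_sum_le[of "{\<kappa>..<l}" "\<lambda>i. [:- real i, 1:]"] by (simp add: o_def)
  then have "degree p < card (?f ` {\<kappa>..l})" using c by simp
  from partial_fractions[OF _ this, of "real h"]
  have "poly p (real h) / (\<Prod>j\<in>?f ` {\<kappa>..l}. real h + j) =
    (\<Sum>j\<in>?f ` {\<kappa>..l}. poly p (- j) / (\<Prod>i\<in>?f ` {\<kappa>..l} - {j}. i - j) / (real h + j))"
    by force
  also have "\<dots> = (\<Sum>j\<in>{\<kappa>..l}. poly p (- ?f j) / (\<Prod>i\<in>?f ` {\<kappa>..l} - {?f j}. i - ?f j) / (real h + ?f j))"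
    by (subst sum.reindex[OF inj]) (simp only: o_def)
  also have "\<dots> = (\<Sum>j\<in>{\<kappa>..l}. zernike_coeff \<kappa> l j / real (h + j + 1))"
  proof (intro sum.cong refl)
    fix j assume "j \<in> {\<kappa>..l}"
    have "?f ` {\<kappa>..l} - {?f j} = ?f ` ({\<kappa>..l} - {j})" by auto
    then have "(\<Prod>i\<in>?f ` {\<kappa>..l} - {?f j}. i - ?f j) = (\<Prod>i\<in>{\<kappa>..l} - {j}. real i - real j)"
      by (simp only: prod.reindex[OF inj] o_def) simp
    moreover have "poly p (- ?f j) = (\<Prod>i\<in>{\<kappa>..<l}. - real j - 1 - real i)"
      unfolding p_def poly_prod by (intro prod.cong refl) simp
    ultimately show "poly p (- ?f j) / (\<Prod>i\<in>?f ` {\<kappa>..l} - {?f j}. i - ?f j) / (real h + ?f j) =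
        zernike_coeff \<kappa> l j / real (h + j + 1)"
      by (simp add: zernike_coeff_def add_ac)
  qed
  also have "poly p (real h) / (\<Prod>j\<in>?f ` {\<kappa>..l}. real h + j) = zernike_moment \<kappa> l h"
    unfolding zernike_moment_def p_def poly_prod prod.reindex[OF inj] o_def by (simp add: add_ac)
  finally show ?thesis ..
qed

text \<open>The zeros of the numerator are the orthogonality relations.\<close>

lemma zernike_moment_zero: "\<kappa> \<le> h \<Longrightarrow> h < l \<Longrightarrow> zernike_moment \<kappa> l h = 0"
  unfolding zernike_moment_def by (auto simp: prod_zero_iff)

text \<open>This is the squared norm of the radial polynomial: its lower powers are orthogonal to
  it, so only the leading one contributes.\<close>

lemma zernike_leading:
  assumes "\<kappa> \<le> l"
  shows "zernike_coeff \<kappa> l l * zernike_moment \<kappa> l l = 1 / real (2 * l + 1)"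
proof -
  define X where "X = (\<Prod>i\<in>{\<kappa>..<l}. real l + real i + 1)"
  define Y where "Y = (\<Prod>i\<in>{\<kappa>..<l}. real l - real i)"
  have S: "{\<kappa>..l} - {l} = {\<kappa>..<l}" "{\<kappa>..l} = insert l {\<kappa>..<l}" using assms by auto
  have gen: "(s * x) / (s * y) * (y / (t * x)) = 1 / t" if "s \<noteq> 0" "x \<noteq> 0" "y \<noteq> 0" for s t x y :: real
    using that by simp
  have 1: "(\<Prod>i\<in>{\<kappa>..<l}. - real l - 1 - real i) = (- 1) ^ card {\<kappa>..<l} * X"
    unfolding X_def prod_uminus[symmetric] by (intro prod.cong refl) simp
  have 2: "(\<Prod>i\<in>{\<kappa>..<l}. real i - real l) = (- 1) ^ card {\<kappa>..<l} * Y"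
    unfolding Y_def prod_uminus[symmetric] by (intro prod.cong refl) simp
  have 3: "zernike_moment \<kappa> l l = Y / (real (2 * l + 1) * X)"
    unfolding zernike_moment_def S(2) X_def Y_def by simp
  have "X \<noteq> 0" unfolding X_def by (auto simp: prod_zero_iff add_eq_0_iff)
  moreover have "Y \<noteq> 0" unfolding Y_def by (auto simp: prod_zero_iff)
  ultimately show ?thesis
    unfolding zernike_coeff_def S(1) 1 2 3 by (intro gen) auto
qed

lemma prod_falling: "\<kappa> \<le> l \<Longrightarrow> l \<le> h \<Longrightarrow> (\<Prod>i\<in>{\<kappa>..<l}. real h - real i) * fact (h - l) = fact (h - \<kappa>)"
proof (induction l)
  case (Suc l)
  show ?case
  proof (cases "\<kappa> = Suc l")
    case False
    then have "(\<Prod>i\<in>{\<kappa>..<Suc l}. real h - real i) * fact (h - Suc l) =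
        (\<Prod>i\<in>{\<kappa>..<l}. real h - real i) * ((real h - real l) * fact (h - Suc l))"
      using Suc.prems by (simp add: prod.atLeastLessThan_Suc)
    also have "(real h - real l) * fact (h - Suc l) = fact (h - l)"
    proof -
      have "h - l = Suc (h - Suc l)" using Suc.prems by simp
      then show ?thesis using Suc.prems by (simp add: of_nat_diff)
    qed
    finally show ?thesis using Suc False by simp
  qed simp
qed simp

lemma prod_rising: "\<kappa> \<le> l \<Longrightarrow> (\<Prod>i\<in>{\<kappa>..l}. real h + real i + 1) * fact (h + \<kappa>) = fact (h + l + 1)"
proof (induction l)
  case (Suc l)
  show ?case
  proof (cases "\<kappa> = Suc l")
    case False
    then have "(\<Prod>i\<in>{\<kappa>..Suc l}. real h + real i + 1) = (\<Prod>i\<in>{\<kappa>..l}. real h + real i + 1) * (real h + real (Suc l) + 1)"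
      using Suc.prems by (simp add: prod.nat_ivl_Suc')
    then show ?thesis using Suc False by (simp add: mult_ac)
  qed (simp add: add_ac)
qed (simp add: add_ac)

text \<open>The reason for using these polynomials: this product does not depend on \<open>\<kappa>\<close>.\<close>

lemma binomial_zernike_moment:
  assumes "\<kappa> \<le> l"
  shows "real ((2 * h) choose (h + \<kappa>)) * zernike_moment \<kappa> l h = (if l \<le> h then fact (2 * h) / (fact (h - l) * fact (h + l + 1)) else 0)"
proof (cases "l \<le> h")
  case True
  have gen: "F / (p * q) * ((q / r) / (s / p)) = F / (r * s)" if "p \<noteq> 0" "q \<noteq> 0" for F p q r s :: real
    using that by (simp add: field_simps)
  have "real ((2 * h) choose (h + \<kappa>)) = fact (2 * h) / (fact (h + \<kappa>) * fact (2 * h - (h + \<kappa>)))"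
    using True assms by (intro binomial_fact) simp
  moreover have "2 * h - (h + \<kappa>) = h - \<kappa>" by simp
  moreover have "(\<Prod>i\<in>{\<kappa>..<l}. real h - real i) = fact (h - \<kappa>) / fact (h - l)"
    using prod_falling[OF assms True] by (simp only: nonzero_eq_divide_eq[OF fact_nonzero])
  moreover have "(\<Prod>i\<in>{\<kappa>..l}. real h + real i + 1) = fact (h + l + 1) / fact (h + \<kappa>)"
    using prod_rising[OF assms, of h] by (simp only: nonzero_eq_divide_eq[OF fact_nonzero])
  ultimately show ?thesis
    unfolding zernike_moment_def using True gen[OF fact_nonzero fact_nonzero] by (simp only: if_True)
next
  case False
  \<comment> \<open>For \<open>h < \<kappa>\<close> the moment need not vanish, but then the
    binomial coefficient does.\<close>
  then show ?thesis using zernike_moment_zero[of \<kappa> h l] by (cases "\<kappa> \<le> h") (auto simp: binomial_eq_0)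
qed

subsection \<open>Integrals over the unit interval and the unit disk\<close>

definition unit_measure :: "real measure" where
  "unit_measure = restrict_space lborel {0..1}"

lemma space_unit_measure [simp]: "space unit_measure = {0..1}"
  by (simp add: unit_measure_def space_restrict_space)

lemma emeasure_space_unit_measure: "emeasure unit_measure (space unit_measure) = 1"
  by (simp add: unit_measure_def emeasure_restrict_space space_restrict_space)

interpretation unit: finite_measure unit_measure
  by (rule finite_measureI) (simp only: emeasure_space_unit_measure, simp)

lemma measurable_unit_ident [measurable]: "(\<lambda>x. x) \<in> borel_measurable unit_measure"
  unfolding unit_measure_def by (intro measurable_restrict_space1) simp

lemma borel_measurable_unit:
  fixes f :: "real \<Rightarrow> complex"
  assumes "continuous_on {0..1} f"
  shows "f \<in> borel_measurable unit_measure"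
proof -
  have "f \<in> borel_measurable (restrict_space borel {0..1})"
    using assms by (intro borel_measurable_continuous_on_restrict)
  then show ?thesis
    unfolding unit_measure_def by (simp cong: measurable_cong_sets add: sets_restrict_space)
qed

lemma integrable_unit:
  fixes f :: "real \<Rightarrow> complex"
  assumes "continuous_on {0..1} f"
  shows "integrable unit_measure f"
proof -
  have "bounded (f ` {0..1})" using assms by (intro compact_imp_bounded compact_continuous_image) auto
  then obtain B where B: "\<And>x. x \<in> {0..1} \<Longrightarrow> norm (f x) \<le> B" unfolding bounded_iff by blast
  show ?thesis
  proof (rule unit.integrable_const_bound[of _ B])
    show "AE x in unit_measure. norm (f x) \<le> B" using B by (intro AE_I2) simp
    show "f \<in> borel_measurable unit_measure" using assms by (rule borel_measurable_unit)
  qed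
qed

lemma integral_unit_FTC:
  fixes f F :: "real \<Rightarrow> complex"
  assumes "\<And>x. x \<in> {0..1} \<Longrightarrow> (F has_vector_derivative f x) (at x within {0..1})" "continuous_on {0..1} f"
  shows "(LINT x|unit_measure. f x) = F 1 - F 0"
  unfolding unit_measure_def using assms
  by (subst integral_restrict_space) (auto intro!: integral_FTC_Icc)

lemma integral_unit_power: "(LINT u|unit_measure. complex_of_real u ^ h) = 1 / of_nat (h + 1)"
proof -
  have "(LINT u|unit_measure. complex_of_real u ^ h) = of_real (1 ^ (h + 1) / real (h + 1)) - complex_of_real (0 ^ (h + 1) / real (h + 1))"
  proof (rule integral_unit_FTC)
    fix x :: real
    have "((\<lambda>x. x ^ (h + 1) / real (h + 1)) has_real_derivative x ^ h) (at x within {0..1})"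
      by (auto intro!: derivative_eq_intros simp del: power_Suc)
    then have "((\<lambda>x. complex_of_real (x ^ (h + 1) / real (h + 1))) has_vector_derivative complex_of_real (x ^ h)) (at x within {0..1})"
      by (rule has_vector_derivative_of_real)
    then show "((\<lambda>x. complex_of_real (x ^ (h + 1) / real (h + 1))) has_vector_derivative complex_of_real x ^ h) (at x within {0..1})"
      by simp
  qed (intro continuous_intros)
  then show ?thesis by simp
qed

text \<open>Used in two roles: as angular factor in \<open>t\<close>, and as target in the variable
  \<open>u = \<rho>\<^sup>2\<close>, where the product over the disks is a wave in the sum of
  squares of the coordinates.\<close>

definition wave :: "int \<Rightarrow> real \<Rightarrow> complex" where
  "wave n t = cis (2 * pi * real_of_int n * t)"

lemma wave_continuous [continuous_intros]: "continuous_on S (wave n)"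
  unfolding wave_def by (intro continuous_intros)

lemma wave_mult: "wave a t * wave b t = wave (a + b) t"
  by (simp add: wave_def cis_mult algebra_simps)

lemma cnj_wave: "cnj (wave a t) = wave (- a) t"
  by (simp add: wave_def cis_cnj)

lemma norm_wave [simp]: "norm (wave a t) = 1"
  by (simp add: wave_def)

lemma integral_wave: "(LINT t|unit_measure. wave n t) = (if n = 0 then 1 else 0)"
proof (cases "n = 0")
  case True
  then show ?thesis using integral_unit_power[of 0] by (simp add: wave_def)
next
  case False
  let ?c = "2 * pi * real_of_int n"
  have c: "?c \<noteq> 0" using False by simp
  have "(LINT t|unit_measure. wave n t) = cis (?c * 1) / (\<i> * of_real ?c) - cis (?c * 0) / (\<i> * of_real ?c)"
  proof (rule integral_unit_FTC)
    fix x :: real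
    have "((\<lambda>z. exp (\<i> * of_real ?c * z) / (\<i> * of_real ?c)) has_field_derivative exp (\<i> * of_real ?c * of_real x)) (at (complex_of_real x))"
      using c by (auto intro!: derivative_eq_intros)
    then have "((\<lambda>x. exp (\<i> * of_real ?c * complex_of_real x) / (\<i> * of_real ?c)) has_vector_derivative exp (\<i> * of_real ?c * of_real x)) (at x within {0..1})"
      by (rule has_vector_derivative_real_field)
    then show "((\<lambda>x. cis (?c * x) / (\<i> * of_real ?c)) has_vector_derivative wave n x) (at x within {0..1})"
      by (simp add: wave_def cis_conv_exp o_def mult.assoc)
  qed (intro continuous_intros)
  moreover have "cis (?c * 1) = 1" using cis_multiple_2pi[of "real_of_int n"] by simp
  ultimately show ?thesis using False by simp
qed

lemma norm_integral_le:
  fixes f :: "'a \<Rightarrow> complex"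
  assumes "finite_measure M" "measure M (space M) = 1" "\<And>x. x \<in> space M \<Longrightarrow> norm (f x) \<le> B" "0 \<le> B"
  shows "norm (integral\<^sup>L M f) \<le> B"
proof (cases "integrable M f")
  case True
  interpret finite_measure M by fact
  have "norm (integral\<^sup>L M f) \<le> (LINT x|M. norm (f x))" by simp
  also have "\<dots> \<le> (LINT x|M. B)" using True assms(3) by (intro integral_mono) auto
  also have "\<dots> = B" using assms(2) by simp
  finally show ?thesis .
qed (use assms in \<open>simp add: not_integrable_integral_eq\<close>)

lemma measure_space_unit_measure: "measure unit_measure (space unit_measure) = 1"
  using emeasure_space_unit_measure by (simp only: measure_def) simp

section \<open>Inner product on the unit interval\<close>

definition unit_inner :: "(real \<Rightarrow> complex) \<Rightarrow> (real \<Rightarrow> complex) \<Rightarrow> complex" where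
  "unit_inner f g = (LINT u|unit_measure. f u * cnj (g u))"

lemma unit_inner_sum_right:
  assumes "finite I" "continuous_on {0..1} f" "\<And>i. i \<in> I \<Longrightarrow> continuous_on {0..1} (b i)"
  shows "unit_inner f (\<lambda>u. \<Sum>i\<in>I. c i * b i u) = (\<Sum>i\<in>I. cnj (c i) * unit_inner f (b i))"
proof -
  have "unit_inner f (\<lambda>u. \<Sum>i\<in>I. c i * b i u) = (LINT u|unit_measure. (\<Sum>i\<in>I. cnj (c i) * (f u * cnj (b i u))))"
    unfolding unit_inner_def by (simp add: sum_distrib_left mult_ac)
  also have "\<dots> = (\<Sum>i\<in>I. (LINT u|unit_measure. cnj (c i) * (f u * cnj (b i u))))"
    using assms by (intro Bochner_Integration.integral_sum integrable_unit continuous_intros) auto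
  finally show ?thesis by (simp add: unit_inner_def)
qed

lemma unit_inner_cnj: "unit_inner g f = cnj (unit_inner f g)"
proof -
  have "(LINT u|unit_measure. cnj (f u * cnj (g u))) = cnj (LINT u|unit_measure. f u * cnj (g u))" by (rule Bochner_Integration.integral_cnj)
  then show ?thesis by (simp add: unit_inner_def mult.commute)
qed

lemma unit_inner_diff:
  assumes "continuous_on {0..1} f" "continuous_on {0..1} g"
  shows "unit_inner (\<lambda>u. f u - g u) (\<lambda>u. f u - g u) = unit_inner f f - unit_inner f g - unit_inner g f + unit_inner g g"
proof -
  have int: "integrable unit_measure (\<lambda>u. a u * cnj (b u))" if "continuous_on {0..1} a" "continuous_on {0..1} b" for a b
    using that by (intro integrable_unit continuous_intros)
  have "unit_inner (\<lambda>u. f u - g u) (\<lambda>u. f u - g u) =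
    (LINT u|unit_measure. f u * cnj (f u) - f u * cnj (g u) - g u * cnj (f u) + g u * cnj (g u))"
    unfolding unit_inner_def by (simp add: algebra_simps)
  then show ?thesis by (simp add: unit_inner_def int assms)
qed

lemma unit_inner_bounds:
  assumes "continuous_on {0..1} f" "\<And>u. u \<in> {0..1} \<Longrightarrow> norm (f u) \<le> B" "0 \<le> B"
  shows "0 \<le> Re (unit_inner f f)" "Re (unit_inner f f) \<le> B\<^sup>2"
proof -
  have "integrable unit_measure (\<lambda>u. f u * cnj (f u))" using assms by (intro integrable_unit continuous_intros)
  then have "Re (unit_inner f f) = (LINT u|unit_measure. Re (f u * cnj (f u)))" unfolding unit_inner_def by (rule integral_Re[symmetric])
  moreover have "Re (f u * cnj (f u)) = (cmod (f u))\<^sup>2" for u by (simp add: complex_mult_cnj cmod_power2)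
  ultimately show "0 \<le> Re (unit_inner f f)" by (simp add: integral_nonneg)
  have "norm (unit_inner f f) \<le> B\<^sup>2"
    unfolding unit_inner_def
  proof (rule norm_integral_le[OF unit.finite_measure_axioms measure_space_unit_measure])
    fix x assume "x \<in> space unit_measure"
    then have "norm (f x) * norm (f x) \<le> B * B" using assms(2)[of x] assms(3) by (intro mult_mono) auto
    then show "norm (f x * cnj (f x)) \<le> B\<^sup>2" by (simp add: norm_mult power2_eq_square)
  qed simp
  then show "Re (unit_inner f f) \<le> B\<^sup>2" using complex_Re_le_cmod order_trans by blast
qed

text \<open>Pythagoras for an orthonormal family. With the optimal coefficients it gives Bessel's
  inequality; with arbitrary ones it turns a good approximation into a lower bound for the squared
  coefficients of \<open>f\<close>.\<close>

lemma unit_inner_best_approximation: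
  assumes I: "finite I" and f: "continuous_on {0..1} f" and b: "\<And>i. i \<in> I \<Longrightarrow> continuous_on {0..1} (b i)"
    and o: "\<And>i j. i \<in> I \<Longrightarrow> j \<in> I \<Longrightarrow> unit_inner (b i) (b j) = (if i = j then 1 else 0)"
  shows "Re (unit_inner (\<lambda>u. f u - (\<Sum>i\<in>I. c i * b i u)) (\<lambda>u. f u - (\<Sum>i\<in>I. c i * b i u))) =
    Re (unit_inner f f) - (\<Sum>i\<in>I. (cmod (unit_inner f (b i)))\<^sup>2) + (\<Sum>i\<in>I. (cmod (c i - unit_inner f (b i)))\<^sup>2)"
proof -
  let ?g = "\<lambda>u. \<Sum>i\<in>I. c i * b i u"
  have g: "continuous_on {0..1} ?g" using b by (intro continuous_intros)
  have fg: "unit_inner f ?g = (\<Sum>i\<in>I. cnj (c i) * unit_inner f (b i))"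
    by (rule unit_inner_sum_right[OF I f b])
  have gb: "unit_inner ?g (b i) = c i" if i: "i \<in> I" for i
  proof -
    have "unit_inner (b i) ?g = (\<Sum>j\<in>I. cnj (c j) * unit_inner (b i) (b j))"
      by (rule unit_inner_sum_right[OF I b[OF i] b])
    also have "\<dots> = (\<Sum>j\<in>I. if j = i then cnj (c i) else 0)" using o[OF i] by (intro sum.cong) auto
    also have "\<dots> = cnj (c i)" using I i by simp
    finally show ?thesis using unit_inner_cnj[of ?g "b i"] by simp
  qed
  have gg: "unit_inner ?g ?g = (\<Sum>i\<in>I. cnj (c i) * c i)"
  proof -
    have "unit_inner ?g ?g = (\<Sum>i\<in>I. cnj (c i) * unit_inner ?g (b i))" by (rule unit_inner_sum_right[OF I g b])
    then show ?thesis using gb by simp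
  qed
  have re: "- Re (cnj x * y) - Re (cnj (cnj x * y)) + Re (cnj x * x) = - (cmod y)\<^sup>2 + (cmod (x - y))\<^sup>2" for x y
    unfolding cmod_power2 by (simp add: power2_eq_square algebra_simps)
  define y where "y i = unit_inner f (b i)" for i
  have "Re (unit_inner (\<lambda>u. f u - ?g u) (\<lambda>u. f u - ?g u)) = Re (unit_inner f f) +
      (\<Sum>i\<in>I. - Re (cnj (c i) * y i) - Re (cnj (cnj (c i) * y i)) + Re (cnj (c i) * c i))"
    unfolding unit_inner_diff[OF f g] unit_inner_cnj[of ?g f] fg gg y_def[symmetric]
    by (simp only: minus_complex.sel plus_complex.sel Re_sum cnj_sum sum.distrib sum_subtractf sum_negf)
  also have "\<dots> = Re (unit_inner f f) - (\<Sum>i\<in>I. (cmod (y i))\<^sup>2) + (\<Sum>i\<in>I. (cmod (c i - y i))\<^sup>2)"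
    unfolding re by (simp add: sum.distrib sum_negf sum_subtractf)
  finally show ?thesis unfolding y_def .
qed

subsection \<open>The radial basis\<close>

lemma zernike_radial_continuous [continuous_intros]: "continuous_on S f \<Longrightarrow> continuous_on S (\<lambda>u. zernike_radial \<kappa> l (f u))"
  for f :: "real \<Rightarrow> real"
  unfolding zernike_radial_def by (intro continuous_intros)

lemma integral_power_zernike:
  assumes "\<kappa> \<le> l"
  shows "(LINT u|unit_measure. complex_of_real (u ^ h * zernike_radial \<kappa> l u)) = of_real (zernike_moment \<kappa> l h)"
proof -
  have "(LINT u|unit_measure. complex_of_real (u ^ h * zernike_radial \<kappa> l u)) =
      (LINT u|unit_measure. (\<Sum>j\<in>{\<kappa>..l}. of_real (zernike_coeff \<kappa> l j) * complex_of_real u ^ (h + j)))"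
    unfolding zernike_radial_def by (simp add: sum_distrib_left power_add mult_ac)
  also have "\<dots> = (\<Sum>j\<in>{\<kappa>..l}. (LINT u|unit_measure. of_real (zernike_coeff \<kappa> l j) * complex_of_real u ^ (h + j)))"
    by (intro Bochner_Integration.integral_sum integrable_unit continuous_intros)
  also have "\<dots> = of_real (\<Sum>j\<in>{\<kappa>..l}. zernike_coeff \<kappa> l j / real (h + j + 1))"
    by (simp add: integral_unit_power)
  finally show ?thesis by (simp only: zernike_moment_eq[OF assms])
qed

lemma zernike_orthogonal:
  assumes "\<kappa> \<le> l" "\<kappa> \<le> l'"
  shows "(LINT u|unit_measure. complex_of_real (zernike_radial \<kappa> l u * zernike_radial \<kappa> l' u)) =
    (if l = l' then 1 / of_nat (2 * l + 1) else 0)"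
proof -
  have main: "(LINT u|unit_measure. complex_of_real (zernike_radial \<kappa> l u * zernike_radial \<kappa> l' u)) =
    (if l = l' then 1 / of_nat (2 * l + 1) else 0)" if "\<kappa> \<le> l" "l \<le> l'" for l l'
  proof -
    have "(LINT u|unit_measure. complex_of_real (zernike_radial \<kappa> l u * zernike_radial \<kappa> l' u)) =
        (LINT u|unit_measure. (\<Sum>j\<in>{\<kappa>..l}. of_real (zernike_coeff \<kappa> l j) * complex_of_real (u ^ j * zernike_radial \<kappa> l' u)))"
      unfolding zernike_radial_def[of \<kappa> l] by (simp add: sum_distrib_left sum_distrib_right mult_ac)
    also have "\<dots> = (\<Sum>j\<in>{\<kappa>..l}. (LINT u|unit_measure. of_real (zernike_coeff \<kappa> l j) * complex_of_real (u ^ j * zernike_radial \<kappa> l' u)))"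
      by (intro Bochner_Integration.integral_sum integrable_unit continuous_intros)
    also have "\<dots> = (\<Sum>j\<in>{\<kappa>..l}. of_real (zernike_coeff \<kappa> l j * zernike_moment \<kappa> l' j))"
    proof (intro sum.cong refl)
      fix j
      have "\<kappa> \<le> l'" using that by simp
      from integral_power_zernike[OF this, of j]
      show "(LINT u|unit_measure. of_real (zernike_coeff \<kappa> l j) * complex_of_real (u ^ j * zernike_radial \<kappa> l' u)) =
          of_real (zernike_coeff \<kappa> l j * zernike_moment \<kappa> l' j)"
        by (simp only: integral_mult_right_zero of_real_mult)
    qed
    also have "\<dots> = (\<Sum>j\<in>{\<kappa>..l}. if j = l' then of_real (zernike_coeff \<kappa> l l * zernike_moment \<kappa> l l) else 0)"
      using that by (intro sum.cong refl) (auto simp: zernike_moment_zero)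
    also have "\<dots> = (if l = l' then 1 / of_nat (2 * l + 1) else 0)"
    proof (cases "l = l'")
      case True
      have "complex_of_real (1 / real (2 * l + 1)) = 1 / of_nat (2 * l + 1)"
        unfolding of_real_divide of_real_of_nat_eq of_real_1 ..
      then show ?thesis using that True unfolding zernike_leading[OF that(1)] by simp
    qed (use that in simp)
    finally show ?thesis .
  qed
  show ?thesis
  proof (cases "l \<le> l'")
    case False
    then show ?thesis using main[of l' l] assms by (simp add: mult.commute)
  qed (use main assms in blast)
qed

definition radial_basis :: "nat \<Rightarrow> nat \<Rightarrow> real \<Rightarrow> complex" where
  "radial_basis \<kappa> l u = of_real (sqrt (real (2 * l + 1)) * zernike_radial \<kappa> l u)"

lemma radial_basis_continuous [continuous_intros]: "continuous_on S f \<Longrightarrow> continuous_on S (\<lambda>u. radial_basis \<kappa> l (f u))"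
  for f :: "'a::topological_space \<Rightarrow> real"
  unfolding radial_basis_def zernike_radial_def by (intro continuous_intros)

lemma cnj_radial_basis [simp]: "cnj (radial_basis \<kappa> l u) = radial_basis \<kappa> l u"
  by (simp add: radial_basis_def)

lemma radial_basis_orthonormal:
  assumes "\<kappa> \<le> l" "\<kappa> \<le> l'"
  shows "unit_inner (radial_basis \<kappa> l) (radial_basis \<kappa> l') = (if l = l' then 1 else 0)"
proof -
  have "unit_inner (radial_basis \<kappa> l) (radial_basis \<kappa> l') =
    (LINT u|unit_measure. of_real (sqrt (real (2 * l + 1)) * sqrt (real (2 * l' + 1))) * complex_of_real (zernike_radial \<kappa> l u * zernike_radial \<kappa> l' u))"
    unfolding unit_inner_def cnj_radial_basis by (simp add: radial_basis_def mult_ac)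
  also have "\<dots> = of_real (sqrt (real (2 * l + 1)) * sqrt (real (2 * l' + 1))) * (if l = l' then 1 / of_nat (2 * l + 1) else 0)"
    by (simp only: integral_mult_right_zero zernike_orthogonal[OF assms])
  also have "\<dots> = (if l = l' then 1 else 0)"
  proof (cases "l = l'")
    case True
    have "sqrt (real (2 * l + 1)) * sqrt (real (2 * l + 1)) = real (2 * l + 1)" by simp
    moreover have "(of_nat (2 * l + 1) :: complex) \<noteq> 0" unfolding of_nat_eq_0_iff by simp
    ultimately show ?thesis using True by (simp only: of_real_of_nat_eq) simp
  qed simp
  finally show ?thesis .
qed

text \<open>Triangular system: the polynomial of index \<open>j\<close> has degree \<open>j\<close>
  with nonzero leading coefficient.\<close>

lemma power_in_radial_span: "\<exists>c. \<forall>u. complex_of_real u ^ j = (\<Sum>l\<le>j. c l * radial_basis 0 l u)"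
proof (induction j rule: less_induct)
  case (less j)
  have "\<forall>i\<in>{..<j}. \<exists>c. \<forall>u. complex_of_real u ^ i = (\<Sum>l\<le>i. c l * radial_basis 0 l u)" using less by blast
  from bchoice[OF this] obtain c where c: "\<And>i u. i < j \<Longrightarrow> complex_of_real u ^ i = (\<Sum>l\<le>i. c i l * radial_basis 0 l u)"
    by blast
  define a where "a i = complex_of_real (zernike_coeff 0 j i)" for i
  have "zernike_coeff 0 j j * zernike_moment 0 j j \<noteq> 0" using zernike_leading[of 0 j] by simp
  then have a: "a j \<noteq> 0" by (auto simp: a_def)
  define r where "r = complex_of_real (sqrt (real (2 * j + 1)))"
  have r: "r \<noteq> 0" by (simp add: r_def)
  have "complex_of_real u ^ j = (\<Sum>l\<le>j. ((if l = j then 1 / (r * a j) else 0) - (\<Sum>i<j. if l \<le> i then a i / a j * c i l else 0)) * radial_basis 0 l u)" for u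
  proof -
    have ins: "{0..j} = insert j {..<j}" by auto
    have "radial_basis 0 j u = r * (\<Sum>i\<in>{0..j}. a i * of_real u ^ i)"
      by (simp add: radial_basis_def zernike_radial_def r_def a_def)
    also have "\<dots> = r * (a j * of_real u ^ j + (\<Sum>i<j. a i * of_real u ^ i))" unfolding ins by simp
    finally have "of_real u ^ j = 1 / (r * a j) * radial_basis 0 j u - (\<Sum>i<j. a i / a j * of_real u ^ i)"
      using r a by (simp add: field_simps sum_divide_distrib[symmetric])
    also have "(\<Sum>i<j. a i / a j * of_real u ^ i) = (\<Sum>i<j. \<Sum>l\<le>j. (if l \<le> i then a i / a j * c i l else 0) * radial_basis 0 l u)"
    proof (intro sum.cong refl)
      fix i assume i: "i \<in> {..<j}"
      have "a i / a j * of_real u ^ i = (\<Sum>l\<le>i. a i / a j * c i l * radial_basis 0 l u)"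
        using c[of i u] i by (simp add: sum_distrib_left mult.assoc)
      also have "\<dots> = (\<Sum>l\<le>j. (if l \<le> i then a i / a j * c i l else 0) * radial_basis 0 l u)"
        using i by (intro sum.mono_neutral_cong_left) auto
      finally show "a i / a j * of_real u ^ i = (\<Sum>l\<le>j. (if l \<le> i then a i / a j * c i l else 0) * radial_basis 0 l u)" .
    qed
    also have "\<dots> = (\<Sum>l\<le>j. (\<Sum>i<j. if l \<le> i then a i / a j * c i l else 0) * radial_basis 0 l u)"
      unfolding sum_distrib_right by (rule sum.swap)
    also have "1 / (r * a j) * radial_basis 0 j u = (\<Sum>l\<le>j. (if l = j then 1 / (r * a j) else 0) * radial_basis 0 l u)"
      by (simp add: sum.delta if_distrib[of "\<lambda>x. x * _"] cong: if_cong)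
    finally show ?thesis by (simp add: sum_subtractf left_diff_distrib)
  qed
  then show ?case by (intro exI allI)
qed

lemma radial_span_dense:
  assumes f: "continuous_on {0..1} f" and e: "0 < e"
  shows "\<exists>L c. \<forall>u\<in>{0..1}. norm (f u - (\<Sum>l\<le>L. c l * radial_basis 0 l u)) \<le> e"
proof -
  have "continuous_on {0..1} (\<lambda>u. Re (f u))" "continuous_on {0..1} (\<lambda>u. Im (f u))" using f by (auto intro!: continuous_intros)
  note fc = this
  obtain g where g: "real_polynomial_function g" "\<And>u. u \<in> {0..1} \<Longrightarrow> \<bar>Re (f u) - g u\<bar> < e / 2"
    using e by (auto intro: Stone_Weierstrass_real_polynomial_function[OF compact_Icc fc(1), of "e / 2"])
  obtain h where h: "real_polynomial_function h" "\<And>u. u \<in> {0..1} \<Longrightarrow> \<bar>Im (f u) - h u\<bar> < e / 2"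
    using e by (auto intro: Stone_Weierstrass_real_polynomial_function[OF compact_Icc fc(2), of "e / 2"])
  obtain a p where a: "g = (\<lambda>u. \<Sum>i\<le>p. a i * u ^ i)" using g(1) unfolding real_polynomial_function_iff_sum by blast
  obtain b q where b: "h = (\<lambda>u. \<Sum>i\<le>q. b i * u ^ i)" using h(1) unfolding real_polynomial_function_iff_sum by blast
  define L where "L = max p q"
  define d where "d i = (if i \<le> p then complex_of_real (a i) else 0) + \<i> * (if i \<le> q then complex_of_real (b i) else 0)" for i
  have poly: "complex_of_real (g u) + \<i> * complex_of_real (h u) = (\<Sum>i\<le>L. d i * complex_of_real u ^ i)" for u
  proof -
    have "complex_of_real (g u) = (\<Sum>i\<le>L. (if i \<le> p then complex_of_real (a i) else 0) * complex_of_real u ^ i)"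
      unfolding a of_real_sum by (intro sum.mono_neutral_cong_left) (auto simp: L_def)
    moreover have "complex_of_real (h u) = (\<Sum>i\<le>L. (if i \<le> q then complex_of_real (b i) else 0) * complex_of_real u ^ i)"
      unfolding b of_real_sum by (intro sum.mono_neutral_cong_left) (auto simp: L_def)
    ultimately show ?thesis by (simp only: d_def distrib_right sum.distrib sum_distrib_left mult.assoc)
  qed
  have "\<forall>j. \<exists>c. \<forall>u. complex_of_real u ^ j = (\<Sum>l\<le>j. c l * radial_basis 0 l u)" using power_in_radial_span by blast
  from choice[OF this] obtain c where c: "\<And>j u. complex_of_real u ^ j = (\<Sum>l\<le>j. c j l * radial_basis 0 l u)" by blast
  define c' where "c' l = (\<Sum>i\<le>L. if l \<le> i then d i * c i l else 0)" for l
  have span: "(\<Sum>i\<le>L. d i * complex_of_real u ^ i) = (\<Sum>l\<le>L. c' l * radial_basis 0 l u)" for u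
  proof -
    have "(\<Sum>i\<le>L. d i * complex_of_real u ^ i) = (\<Sum>i\<le>L. \<Sum>l\<le>L. (if l \<le> i then d i * c i l else 0) * radial_basis 0 l u)"
    proof (intro sum.cong refl)
      fix i assume i: "i \<in> {..L}"
      have "d i * complex_of_real u ^ i = (\<Sum>l\<le>i. d i * c i l * radial_basis 0 l u)"
        unfolding c[of u i] by (simp add: sum_distrib_left mult.assoc)
      also have "\<dots> = (\<Sum>l\<le>L. (if l \<le> i then d i * c i l else 0) * radial_basis 0 l u)"
        using i by (intro sum.mono_neutral_cong_left) auto
      finally show "d i * complex_of_real u ^ i = (\<Sum>l\<le>L. (if l \<le> i then d i * c i l else 0) * radial_basis 0 l u)" .
    qed
    also have "\<dots> = (\<Sum>l\<le>L. c' l * radial_basis 0 l u)"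
      unfolding c'_def sum_distrib_right by (rule sum.swap)
    finally show ?thesis .
  qed
  have "norm (f u - (\<Sum>l\<le>L. c' l * radial_basis 0 l u)) \<le> e" if u: "u \<in> {0..1}" for u
  proof -
    have "f u - (\<Sum>l\<le>L. c' l * radial_basis 0 l u) = f u - (complex_of_real (g u) + \<i> * complex_of_real (h u))"
      by (simp only: span[symmetric] poly)
    also have "norm \<dots> \<le> \<bar>Re (f u) - g u\<bar> + \<bar>Im (f u) - h u\<bar>"
      using cmod_le[of "f u - (complex_of_real (g u) + \<i> * complex_of_real (h u))"] by simp
    also have "\<dots> \<le> e" using g(2)[OF u] h(2)[OF u] by simp
    finally show ?thesis .
  qed
  then show ?thesis by (intro exI[of _ L] exI[of _ c'] ballI)
qed

text \<open>
  Some wave of frequency at most \<open>4 * S\<close> is far from the polynomials of degree less than \<open>S\<close>: the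
  squared projections of \<open>S\<close> basis polynomials to the \<open>4 * S\<close> orthonormal waves sum up to at most \<open>S\<close>.
\<close>

lemma wave_with_high_degree_part:
  assumes S: "1 \<le> S"
  shows "\<exists>k\<in>{1..4 * S}. \<exists>L. 1 / 2 \<le> (\<Sum>l\<in>{S..L}. (cmod (unit_inner (wave (int k)) (radial_basis 0 l)))\<^sup>2)"
proof -
  have wo: "unit_inner (wave (int i)) (wave (int j)) = (if i = j then 1 else 0)" for i j
    unfolding unit_inner_def cnj_wave wave_mult integral_wave by simp
  let ?t = "\<lambda>k l. (cmod (unit_inner (wave (int k)) (radial_basis 0 l)))\<^sup>2"
  have rc: "continuous_on {0..1} (radial_basis 0 l)" for l
    using radial_basis_continuous[OF continuous_on_id] by simp
  have wc: "continuous_on {0..1} (wave n)" for n by (rule wave_continuous)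
  \<comment> \<open>Bessel's inequality for one basis polynomial against the orthonormal waves, not
    for one wave against the basis.\<close>
  have bessel: "(\<Sum>k\<in>{1..4 * S}. ?t k l) \<le> 1" for l
  proof -
    let ?f = "radial_basis 0 l"
    define c where "c k = unit_inner ?f (wave (int k))" for k
    let ?d = "\<lambda>u. ?f u - (\<Sum>k\<in>{1..4 * S}. c k * wave (int k) u)"
    have dc: "continuous_on {0..1} ?d" by (intro continuous_intros rc wc)
    have "bounded (?d ` {0..1})" by (intro compact_imp_bounded compact_continuous_image dc) simp
    then obtain B where B: "\<forall>y\<in>?d ` {0..1}. norm y \<le> B" unfolding bounded_iff by blast
    have "norm (?d 0) \<le> B" using B by (intro B[rule_format] imageI) simp
    then have "0 \<le> B" using norm_ge_zero[of "?d 0"] by linarith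
    then have "0 \<le> Re (unit_inner ?d ?d)" using B by (intro unit_inner_bounds(1)[OF dc, of B]) auto
    also have "\<dots> = Re (unit_inner ?f ?f) - (\<Sum>k\<in>{1..4 * S}. (cmod (unit_inner ?f (wave (int k))))\<^sup>2) + (\<Sum>k\<in>{1..4 * S}. (cmod (c k - unit_inner ?f (wave (int k))))\<^sup>2)"
      by (rule unit_inner_best_approximation) (auto simp: wo intro: rc wc)
    finally have "(\<Sum>k\<in>{1..4 * S}. (cmod (unit_inner ?f (wave (int k))))\<^sup>2) \<le> 1"
      by (simp add: c_def radial_basis_orthonormal)
    moreover have "cmod (unit_inner ?f (wave (int k))) = cmod (unit_inner (wave (int k)) ?f)" for k
      unfolding unit_inner_cnj[of ?f] by simp
    ultimately show ?thesis by simp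
  qed
  \<comment> \<open>Averaging: if each of the \<open>4 * S\<close> waves had more than
    \<open>1 / 4\<close> in degrees below \<open>S\<close>, the total would exceed
    \<open>S\<close>.\<close>
  have "\<exists>k\<in>{1..4 * S}. (\<Sum>l<S. ?t k l) \<le> 1 / 4"
  proof (rule ccontr)
    assume "\<not> ?thesis"
    then have "(\<Sum>k\<in>{1..4 * S}. 1 / 4) < (\<Sum>k\<in>{1..4 * S}. \<Sum>l<S. ?t k l)"
      using S by (intro sum_strict_mono) (auto simp: not_le)
    also have "\<dots> = (\<Sum>l<S. \<Sum>k\<in>{1..4 * S}. ?t k l)" by (rule sum.swap)
    also have "\<dots> \<le> (\<Sum>l<S. 1)" by (intro sum_mono bessel)
    finally show False by simp
  qed
  then obtain k where k: "k \<in> {1..4 * S}" "(\<Sum>l<S. ?t k l) \<le> 1 / 4" by blast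
  let ?w = "wave (int k)"
  \<comment> \<open>A uniform error of \<open>1 / 2\<close> leaves at most \<open>1 / 4\<close> of
    the squared norm to degrees above \<open>L\<close>. Another \<open>1 / 4\<close> lies below
    \<open>S\<close>, so at least half of it is in between.\<close>
  obtain L c where Lc: "\<And>u. u \<in> {0..1} \<Longrightarrow> norm (?w u - (\<Sum>l\<le>L. c l * radial_basis 0 l u)) \<le> 1 / 2"
    using radial_span_dense[OF wc[of "int k"], of "1 / 2"] half_gt_zero[OF zero_less_one] by blast
  let ?d = "\<lambda>u. ?w u - (\<Sum>l\<le>L. c l * radial_basis 0 l u)"
  have dc: "continuous_on {0..1} ?d" by (intro continuous_intros rc wc)
  have "Re (unit_inner ?d ?d) \<le> (1 / 2)\<^sup>2" by (rule unit_inner_bounds(2)[OF dc Lc]) auto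
  moreover have "Re (unit_inner ?d ?d) = Re (unit_inner ?w ?w) - (\<Sum>l\<le>L. (cmod (unit_inner ?w (radial_basis 0 l)))\<^sup>2) +
      (\<Sum>l\<le>L. (cmod (c l - unit_inner ?w (radial_basis 0 l)))\<^sup>2)"
    by (rule unit_inner_best_approximation) (auto simp: radial_basis_orthonormal intro: rc wc)
  moreover have "0 \<le> (\<Sum>l\<le>L. (cmod (c l - unit_inner ?w (radial_basis 0 l)))\<^sup>2)" by (intro sum_nonneg) auto
  ultimately have "3 / 4 \<le> (\<Sum>l\<le>L. ?t k l)" by (simp add: wo power2_eq_square)
  also have "\<dots> \<le> (\<Sum>l\<in>{..<S} \<union> {S..L}. ?t k l)" by (intro sum_mono2) auto
  also have "\<dots> = (\<Sum>l<S. ?t k l) + (\<Sum>l\<in>{S..L}. ?t k l)" by (intro sum.union_disjoint) auto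
  finally show ?thesis using k by (intro bexI[of _ k] exI[of _ L]) auto
qed

subsection \<open>The unit disk in polar coordinates\<close>

text \<open>The coordinates are \<open>u\<close>, the squared radius, and \<open>t\<close>, the
  angle divided by \<open>2 * pi\<close>. In them normalised area is the product measure, without a
  Jacobian.\<close>

definition disk_measure :: "(real \<times> real) measure" where
  "disk_measure = unit_measure \<Otimes>\<^sub>M unit_measure"

interpretation unit_pair: pair_sigma_finite unit_measure unit_measure ..

lemma space_disk_measure: "space disk_measure = {0..1} \<times> {0..1}"
  by (simp add: disk_measure_def space_pair_measure)

lemma emeasure_space_disk_measure: "emeasure disk_measure (space disk_measure) = 1"
proof -
  have "emeasure disk_measure ({0..1} \<times> {0..1}) = emeasure unit_measure {0..1} * emeasure unit_measure {0..1}"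
    unfolding disk_measure_def
    by (rule unit.emeasure_pair_measure_Times) (metis sets.top space_unit_measure)+
  then show ?thesis using emeasure_space_unit_measure by (simp add: space_disk_measure)
qed

interpretation disk: finite_measure disk_measure
  by (rule finite_measureI) (simp only: emeasure_space_disk_measure, simp)

lemma measure_space_disk_measure: "measure disk_measure (space disk_measure) = 1"
  using emeasure_space_disk_measure by (simp only: measure_def) simp

lemma borel_measurable_disk:
  fixes f :: "real \<times> real \<Rightarrow> complex"
  assumes "continuous_on UNIV f"
  shows "f \<in> borel_measurable disk_measure"
proof -
  have 1: "fst \<in> borel_measurable disk_measure" "snd \<in> borel_measurable disk_measure"
    unfolding disk_measure_def
    using measurable_compose[OF measurable_fst measurable_unit_ident, of unit_measure]
      measurable_compose[OF measurable_snd measurable_unit_ident, of unit_measure] by simp_all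
  have "(\<lambda>x. (fst x, snd x)) \<in> borel_measurable disk_measure" by (intro borel_measurable_Pair 1)
  from measurable_compose[OF this borel_measurable_continuous_onI[OF assms]] show ?thesis by simp
qed

lemma disk_bounded:
  fixes f :: "real \<times> real \<Rightarrow> complex"
  assumes "continuous_on UNIV f"
  shows "\<exists>B\<ge>0. \<forall>x\<in>space disk_measure. norm (f x) \<le> B"
proof -
  have "bounded (f ` ({0..1} \<times> {0..1}))"
    by (intro compact_imp_bounded compact_continuous_image compact_Times compact_Icc continuous_on_subset[OF assms]) auto
  then obtain B where "\<forall>y\<in>f ` ({0..1} \<times> {0..1}). norm y \<le> B" unfolding bounded_iff by blast
  then show ?thesis by (intro exI[of _ "\<bar>B\<bar>"]) (auto simp: space_disk_measure intro: order_trans[OF _ abs_ge_self])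
qed

lemma integrable_disk:
  fixes f :: "real \<times> real \<Rightarrow> complex"
  assumes "continuous_on UNIV f"
  shows "integrable disk_measure f"
proof -
  obtain B where "\<forall>x\<in>space disk_measure. norm (f x) \<le> B" using disk_bounded[OF assms] by blast
  then show ?thesis by (intro disk.integrable_const_bound[of _ B] borel_measurable_disk assms AE_I2) blast
qed

lemma integral_disk_product:
  fixes f g :: "real \<Rightarrow> complex"
  assumes "continuous_on UNIV f" "continuous_on UNIV g"
  shows "(LINT x|disk_measure. f (fst x) * g (snd x)) = (LINT u|unit_measure. f u) * (LINT t|unit_measure. g t)"
proof -
  have "continuous_on UNIV (\<lambda>x. f (fst x) * g (snd x))"
    by (intro continuous_intros continuous_on_compose2[OF assms(1)] continuous_on_compose2[OF assms(2)]) auto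
  then have "integrable (unit_measure \<Otimes>\<^sub>M unit_measure) (\<lambda>x. f (fst x) * g (snd x))"
    using integrable_disk by (simp add: disk_measure_def)
  from unit_pair.integral_fst'[OF this] show ?thesis by (simp add: disk_measure_def)
qed

definition disk_x :: "real \<times> real \<Rightarrow> real" where
  "disk_x p = sqrt (fst p) * cos (2 * pi * snd p)"

definition disk_y :: "real \<times> real \<Rightarrow> real" where
  "disk_y p = sqrt (fst p) * sin (2 * pi * snd p)"

lemma disk_xy_continuous [continuous_intros]: "continuous_on S disk_x" "continuous_on S disk_y"
  unfolding disk_x_def disk_y_def by (intro continuous_intros)+

lemma disk_xy_norm: "p \<in> space disk_measure \<Longrightarrow> (disk_x p)\<^sup>2 + (disk_y p)\<^sup>2 = fst p"
  by (auto simp: disk_x_def disk_y_def power_mult_distrib space_disk_measure simp flip: distrib_left)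

lemma cos_power_expand:
  "complex_of_real (cos x) ^ k = (\<Sum>j\<le>k. of_nat (k choose j) / 2 ^ k * cis (real_of_int (2 * int j - int k) * x))"
proof -
  have "complex_of_real (cos x) = (cis x + cis (- x)) / 2" by (simp add: complex_eq_iff)
  then have "complex_of_real (cos x) ^ k = (cis x + cis (- x)) ^ k / 2 ^ k" by (simp only: power_divide)
  also have "\<dots> = (\<Sum>j\<le>k. of_nat (k choose j) / 2 ^ k * (cis x ^ j * cis (- x) ^ (k - j)))"
    unfolding binomial_ring sum_divide_distrib by (simp add: mult.assoc)
  also have "\<dots> = (\<Sum>j\<le>k. of_nat (k choose j) / 2 ^ k * cis (real_of_int (2 * int j - int k) * x))"
  proof (intro sum.cong refl)
    fix j assume "j \<in> {..k}"
    then have "real j * x + real (k - j) * - x = real_of_int (2 * int j - int k) * x"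
      by (simp add: of_nat_diff algebra_simps)
    then show "of_nat (k choose j) / 2 ^ k * (cis x ^ j * cis (- x) ^ (k - j)) =
        of_nat (k choose j) / 2 ^ k * cis (real_of_int (2 * int j - int k) * x)"
      by (simp only: Complex.DeMoivre cis_mult)
  qed
  finally show ?thesis .
qed

text \<open>
  A test function on the disk: angular frequency \<open>2 * \<kappa>\<close> and the same radial coefficients for all
  \<open>\<kappa>\<close>. These are unitary images of each other, and their integrals against a function of
  \<open>\<alpha> * x + \<beta> * y\<close> differ by a phase that depends on the direction of \<open>(\<alpha>, \<beta>)\<close> only.
\<close>

locale radial_profile =
  fixes S L :: nat and c :: "nat \<Rightarrow> complex"
begin

text \<open>The sum starts at \<open>S\<close> so that \<open>\<kappa> \<le> l\<close> holds for all
  frequencies \<open>\<kappa> \<le> S\<close> and one vector of coefficients serves all of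
  them.\<close>

definition radial :: "nat \<Rightarrow> real \<Rightarrow> complex" where
  "radial \<kappa> u = (\<Sum>l\<in>{S..L}. c l * radial_basis \<kappa> l u)"

definition test :: "int \<Rightarrow> real \<times> real \<Rightarrow> complex" where
  "test \<kappa> p = radial (nat \<bar>\<kappa>\<bar>) (fst p) * wave (- 2 * \<kappa>) (snd p)"

definition mass :: real where
  "mass = (\<Sum>l\<in>{S..L}. (cmod (c l))\<^sup>2)"

lemma radial_continuous: "continuous_on T (radial \<kappa>)"
  unfolding radial_def using radial_basis_continuous[OF continuous_on_id, of T \<kappa>] by (intro continuous_intros)

lemma test_continuous [continuous_intros]: "continuous_on T (test \<kappa>)"
  unfolding test_def
  by (intro continuous_intros continuous_on_compose2[OF radial_continuous[of UNIV]] continuous_on_compose2[OF wave_continuous[of UNIV]]) auto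

lemma radial_norm:
  assumes "\<kappa> \<le> S"
  shows "unit_inner (radial \<kappa>) (radial \<kappa>) = of_real mass"
proof -
  have rc: "continuous_on {0..1} (radial_basis \<kappa> l)" for l
    using radial_basis_continuous[OF continuous_on_id, of "{0..1}" \<kappa> l] by simp
  have 1: "unit_inner f (radial \<kappa>) = (\<Sum>l\<in>{S..L}. cnj (c l) * unit_inner f (radial_basis \<kappa> l))"
    if "continuous_on {0..1} f" for f
    using unit_inner_sum_right[of "{S..L}" f "radial_basis \<kappa>" c] that rc unfolding radial_def[abs_def] by simp
  have "unit_inner (radial \<kappa>) (radial_basis \<kappa> l) = c l" if l: "l \<in> {S..L}" for l
  proof -
    have "unit_inner (radial_basis \<kappa> l) (radial \<kappa>) = (\<Sum>j\<in>{S..L}. if j = l then cnj (c l) else 0)"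
      unfolding 1[OF rc] using l assms by (intro sum.cong refl) (simp add: radial_basis_orthonormal)
    also have "\<dots> = cnj (c l)" using l by simp
    finally show ?thesis using unit_inner_cnj[of "radial \<kappa>" "radial_basis \<kappa> l"] by simp
  qed
  then have "unit_inner (radial \<kappa>) (radial \<kappa>) = (\<Sum>l\<in>{S..L}. cnj (c l) * c l)"
    unfolding 1[OF radial_continuous] by (intro sum.cong refl) simp
  also have "\<dots> = of_real mass"
    unfolding mass_def of_real_sum by (intro sum.cong refl) (simp add: complex_norm_square[symmetric] mult.commute)
  finally show ?thesis .
qed

lemma test_orthogonal:
  assumes "\<bar>\<kappa>\<bar> \<le> int S"
  shows "(LINT p|disk_measure. test \<kappa> p * cnj (test \<kappa>' p)) = (if \<kappa> = \<kappa>' then of_real mass else 0)"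
proof -
  have "(LINT p|disk_measure. test \<kappa> p * cnj (test \<kappa>' p)) =
      (LINT p|disk_measure. (radial (nat \<bar>\<kappa>\<bar>) (fst p) * cnj (radial (nat \<bar>\<kappa>'\<bar>) (fst p))) * wave (- 2 * \<kappa> + 2 * \<kappa>') (snd p))"
    unfolding test_def complex_cnj_mult cnj_wave wave_mult[symmetric] by (simp add: mult_ac)
  also have "\<dots> = unit_inner (radial (nat \<bar>\<kappa>\<bar>)) (radial (nat \<bar>\<kappa>'\<bar>)) * (LINT t|unit_measure. wave (- 2 * \<kappa> + 2 * \<kappa>') t)"
    unfolding unit_inner_def by (intro integral_disk_product continuous_intros radial_continuous)
  also have "\<dots> = (if \<kappa> = \<kappa>' then of_real mass else 0)"
    using assms by (auto simp: integral_wave radial_norm)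
  finally show ?thesis .
qed

text \<open>The wave is radial and meets frequency 0 only. The coefficients of the profile are the
  conjugates of those of the wave, so the pairing is the squared norm of its part in degrees
  \<open>S\<close> to \<open>L\<close>.\<close>

lemma test_wave:
  assumes "\<And>l. l \<in> {S..L} \<Longrightarrow> c l = cnj (unit_inner (wave n) (radial_basis 0 l))"
  shows "(LINT p|disk_measure. wave n (fst p) * test \<kappa> p) = (if \<kappa> = 0 then of_real mass else 0)"
proof -
  have "(LINT p|disk_measure. wave n (fst p) * test \<kappa> p) = (LINT p|disk_measure. (wave n (fst p) * radial (nat \<bar>\<kappa>\<bar>) (fst p)) * wave (- 2 * \<kappa>) (snd p))"
    by (simp add: test_def mult.assoc)
  also have "\<dots> = (LINT u|unit_measure. wave n u * radial (nat \<bar>\<kappa>\<bar>) u) * (LINT t|unit_measure. wave (- 2 * \<kappa>) t)"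
    by (intro integral_disk_product continuous_intros radial_continuous)
  also have "(LINT u|unit_measure. wave n u * radial 0 u) = of_real mass"
  proof -
    have "(LINT u|unit_measure. wave n u * radial 0 u) = unit_inner (wave n) (\<lambda>u. \<Sum>l\<in>{S..L}. cnj (c l) * radial_basis 0 l u)"
      by (simp add: unit_inner_def radial_def)
    also have "\<dots> = (\<Sum>l\<in>{S..L}. c l * unit_inner (wave n) (radial_basis 0 l))"
      using radial_basis_continuous[OF continuous_on_id, of "{0..1}" 0]
      by (subst unit_inner_sum_right) (auto intro: wave_continuous)
    also have "\<dots> = (\<Sum>l\<in>{S..L}. c l * cnj (c l))" using assms by (intro sum.cong refl) simp
    also have "\<dots> = of_real mass"
      unfolding mass_def of_real_sum by (intro sum.cong refl) (simp add: complex_norm_square[symmetric])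
    finally show ?thesis .
  qed
  then have "(LINT u|unit_measure. wave n u * radial (nat \<bar>\<kappa>\<bar>) u) * (LINT t|unit_measure. wave (- 2 * \<kappa>) t) =
      (if \<kappa> = 0 then of_real mass else 0)"
    by (simp add: integral_wave)
  finally show ?thesis .
qed

text \<open>The right-hand side does not involve \<open>\<kappa>\<close>. The binomial coefficient
  is, up to a power of 2, a Fourier coefficient of the \<open>2 * h\<close>-th power of the
  cosine.\<close>

lemma integral_power_radial:
  assumes "\<kappa> \<le> S"
  shows "of_nat ((2 * h) choose (h + \<kappa>)) * (LINT u|unit_measure. complex_of_real u ^ h * radial \<kappa> u) =
    (\<Sum>l\<in>{S..L}. c l * of_real (sqrt (real (2 * l + 1)) * (if l \<le> h then fact (2 * h) / (fact (h - l) * fact (h + l + 1)) else 0)))"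
proof -
  have "(LINT u|unit_measure. complex_of_real u ^ h * radial \<kappa> u) =
      (LINT u|unit_measure. (\<Sum>l\<in>{S..L}. c l * of_real (sqrt (real (2 * l + 1))) * complex_of_real (u ^ h * zernike_radial \<kappa> l u)))"
    unfolding radial_def radial_basis_def by (simp add: sum_distrib_left mult_ac)
  also have "\<dots> = (\<Sum>l\<in>{S..L}. (LINT u|unit_measure. c l * of_real (sqrt (real (2 * l + 1))) * complex_of_real (u ^ h * zernike_radial \<kappa> l u)))"
    by (intro Bochner_Integration.integral_sum integrable_unit continuous_intros)
  also have "\<dots> = (\<Sum>l\<in>{S..L}. c l * of_real (sqrt (real (2 * l + 1))) * of_real (zernike_moment \<kappa> l h))"
  proof (intro sum.cong refl)
    fix l assume "l \<in> {S..L}"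
    then have "\<kappa> \<le> l" using assms by simp
    from integral_power_zernike[OF this, of h]
    show "(LINT u|unit_measure. c l * of_real (sqrt (real (2 * l + 1))) * complex_of_real (u ^ h * zernike_radial \<kappa> l u)) =
        c l * of_real (sqrt (real (2 * l + 1))) * of_real (zernike_moment \<kappa> l h)"
      by (simp only: integral_mult_right_zero)
  qed
  finally have "of_nat ((2 * h) choose (h + \<kappa>)) * (LINT u|unit_measure. complex_of_real u ^ h * radial \<kappa> u) =
    (\<Sum>l\<in>{S..L}. c l * of_real (sqrt (real (2 * l + 1)) * (real ((2 * h) choose (h + \<kappa>)) * zernike_moment \<kappa> l h)))"
    by (simp add: sum_distrib_left mult_ac)
  also have "\<dots> = (\<Sum>l\<in>{S..L}. c l * of_real (sqrt (real (2 * l + 1)) * (if l \<le> h then fact (2 * h) / (fact (h - l) * fact (h + l + 1)) else 0)))"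
    using assms by (intro sum.cong refl) (simp only: binomial_zernike_moment atLeastAtMost_iff order_trans)
  finally show ?thesis .
qed

text \<open>Of the expanded power of the cosine the angular integral keeps at most one term, and
  none for odd \<open>k\<close>. What is left is a phase that depends on the direction, times the
  product of binomial coefficient and radial moment, which is the same for all
  \<open>\<kappa>\<close>.\<close>

lemma test_ridge_power:
  assumes \<kappa>: "\<bar>\<kappa>\<bar> \<le> int S"
  shows "(LINT p|disk_measure. complex_of_real (\<omega> * sqrt (fst p) * cos (2 * pi * snd p - \<theta>)) ^ k * test \<kappa> p) =
    cis (- 2 * real_of_int \<kappa> * \<theta>) *
    (LINT p|disk_measure. complex_of_real (\<omega> * sqrt (fst p) * cos (2 * pi * snd p - \<theta>)) ^ k * test 0 p)"
proof -
  define X where "X h = (\<Sum>l\<in>{S..L}. c l * of_real (sqrt (real (2 * l + 1)) * (if l \<le> h then fact (2 * h) / (fact (h - l) * fact (h + l + 1)) else 0)))" for h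
  have main: "(LINT p|disk_measure. complex_of_real (\<omega> * sqrt (fst p) * cos (2 * pi * snd p - \<theta>)) ^ k * test \<kappa> p) =
      cis (- 2 * real_of_int \<kappa> * \<theta>) * (if even k then of_real \<omega> ^ k / 2 ^ k * X (k div 2) else 0)"
    if \<kappa>: "\<bar>\<kappa>\<bar> \<le> int S" for \<kappa>
  proof -
    let ?r = "nat \<bar>\<kappa>\<bar>"
    have r: "?r \<le> S" using \<kappa> by simp
    define R where "R = (LINT u|unit_measure. complex_of_real (sqrt u) ^ k * radial ?r u)"
    have "complex_of_real (\<omega> * sqrt (fst p) * cos (2 * pi * snd p - \<theta>)) ^ k * test \<kappa> p =
        (\<Sum>j\<le>k. of_real \<omega> ^ k * (of_nat (k choose j) / 2 ^ k) * cis (- real_of_int (2 * int j - int k) * \<theta>) *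
          ((complex_of_real (sqrt (fst p)) ^ k * radial ?r (fst p)) * wave (2 * int j - int k - 2 * \<kappa>) (snd p)))" for p
    proof -
      have "cis (real_of_int (2 * int j - int k) * (2 * pi * snd p - \<theta>)) * wave (- 2 * \<kappa>) (snd p) =
          cis (- real_of_int (2 * int j - int k) * \<theta>) * wave (2 * int j - int k - 2 * \<kappa>) (snd p)" for j
        unfolding wave_def cis_mult by (simp add: algebra_simps)
      then have "complex_of_real (cos (2 * pi * snd p - \<theta>)) ^ k * wave (- 2 * \<kappa>) (snd p) =
          (\<Sum>j\<le>k. of_nat (k choose j) / 2 ^ k * (cis (- real_of_int (2 * int j - int k) * \<theta>) * wave (2 * int j - int k - 2 * \<kappa>) (snd p)))"
        unfolding cos_power_expand sum_distrib_right by (intro sum.cong refl) (simp only: mult.assoc)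
      then show ?thesis
        unfolding test_def of_real_mult power_mult_distrib
        by (simp only: mult.assoc mult.left_commute[of _ "radial _ _"] mult.left_commute[of "complex_of_real (cos _) ^ _"])
          (simp add: sum_distrib_left mult_ac)
    qed
    then have "(LINT p|disk_measure. complex_of_real (\<omega> * sqrt (fst p) * cos (2 * pi * snd p - \<theta>)) ^ k * test \<kappa> p) =
        (LINT p|disk_measure. (\<Sum>j\<le>k. of_real \<omega> ^ k * (of_nat (k choose j) / 2 ^ k) * cis (- real_of_int (2 * int j - int k) * \<theta>) *
          ((complex_of_real (sqrt (fst p)) ^ k * radial ?r (fst p)) * wave (2 * int j - int k - 2 * \<kappa>) (snd p))))"
      by simp
    also have "\<dots> = (\<Sum>j\<le>k. (LINT p|disk_measure. of_real \<omega> ^ k * (of_nat (k choose j) / 2 ^ k) * cis (- real_of_int (2 * int j - int k) * \<theta>) *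
          ((complex_of_real (sqrt (fst p)) ^ k * radial ?r (fst p)) * wave (2 * int j - int k - 2 * \<kappa>) (snd p))))"
      by (intro Bochner_Integration.integral_sum integrable_disk continuous_intros
          continuous_on_compose2[OF radial_continuous[of UNIV]] continuous_on_compose2[OF wave_continuous[of UNIV]]) auto
    also have "\<dots> = (\<Sum>j\<le>k. of_real \<omega> ^ k * (of_nat (k choose j) / 2 ^ k) * cis (- real_of_int (2 * int j - int k) * \<theta>) *
          (R * (if 2 * int j - int k - 2 * \<kappa> = 0 then 1 else 0)))"
    proof (intro sum.cong refl)
      fix j
      have "(LINT p|disk_measure. (complex_of_real (sqrt (fst p)) ^ k * radial ?r (fst p)) * wave (2 * int j - int k - 2 * \<kappa>) (snd p)) =
          R * (LINT t|unit_measure. wave (2 * int j - int k - 2 * \<kappa>) t)"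
        unfolding R_def by (intro integral_disk_product continuous_intros radial_continuous)
      then show "(LINT p|disk_measure. of_real \<omega> ^ k * (of_nat (k choose j) / 2 ^ k) * cis (- real_of_int (2 * int j - int k) * \<theta>) *
          ((complex_of_real (sqrt (fst p)) ^ k * radial ?r (fst p)) * wave (2 * int j - int k - 2 * \<kappa>) (snd p))) =
        of_real \<omega> ^ k * (of_nat (k choose j) / 2 ^ k) * cis (- real_of_int (2 * int j - int k) * \<theta>) *
          (R * (if 2 * int j - int k - 2 * \<kappa> = 0 then 1 else 0))"
        by (simp only: integral_mult_right_zero integral_wave)
    qed
    also have "\<dots> = cis (- 2 * real_of_int \<kappa> * \<theta>) * (if even k then of_real \<omega> ^ k / 2 ^ k * X (k div 2) else 0)"
    proof (cases "even k")
      case False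
      then have "2 * int j - int k - 2 * \<kappa> \<noteq> 0" for j by presburger
      then show ?thesis using False by simp
    next
      case True
      then obtain h where h: "k = 2 * h" by blast
      have R: "R = (LINT u|unit_measure. complex_of_real u ^ h * radial ?r u)"
        unfolding R_def h by (intro Bochner_Integration.integral_cong refl) (simp add: power_mult of_real_power[symmetric] del: of_real_power)
      have "(\<Sum>j\<le>k. of_real \<omega> ^ k * (of_nat (k choose j) / 2 ^ k) * cis (- real_of_int (2 * int j - int k) * \<theta>) *
          (R * (if 2 * int j - int k - 2 * \<kappa> = 0 then 1 else 0))) =
        (\<Sum>j\<le>k. if int j = int h + \<kappa> then of_real \<omega> ^ k * (of_nat (k choose j) / 2 ^ k) * cis (- 2 * real_of_int \<kappa> * \<theta>) * R else 0)"
      proof (intro sum.cong refl)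
        fix j
        show "of_real \<omega> ^ k * (of_nat (k choose j) / 2 ^ k) * cis (- real_of_int (2 * int j - int k) * \<theta>) *
          (R * (if 2 * int j - int k - 2 * \<kappa> = 0 then 1 else 0)) =
          (if int j = int h + \<kappa> then of_real \<omega> ^ k * (of_nat (k choose j) / 2 ^ k) * cis (- 2 * real_of_int \<kappa> * \<theta>) * R else 0)"
        proof (cases "int j = int h + \<kappa>")
          case True
          then have "2 * int j - int k = 2 * \<kappa>" using h by simp
          then show ?thesis using True by (simp add: mult.assoc)
        next
          case False
          then have "2 * int j - int k - 2 * \<kappa> \<noteq> 0" using h by auto
          then show ?thesis using False by simp
        qed
      qed
      \<comment> \<open>For negative \<open>\<kappa>\<close>, symmetry of the binomial coefficients
        replaces \<open>h + \<kappa>\<close> by \<open>h + \<bar>\<kappa>\<bar>\<close>. For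
        \<open>\<bar>\<kappa>\<bar> > h\<close> no index qualifies and the binomial coefficient is
        0.\<close>
      also have "\<dots> = of_real \<omega> ^ k * (of_nat ((2 * h) choose (h + ?r)) / 2 ^ k) * cis (- 2 * real_of_int \<kappa> * \<theta>) * R"
      proof (cases "?r \<le> h")
        case True
        define j0 where "j0 = nat (int h + \<kappa>)"
        have j0: "int j0 = int h + \<kappa>" "j0 \<le> k" using True h by (auto simp: j0_def)
        have "k choose j0 = (2 * h) choose (h + ?r)"
        proof (cases "\<kappa> \<ge> 0")
          case True
          then have "j0 = h + ?r" using j0 by simp
          then show ?thesis by (simp add: h)
        next
          case False
          then have e: "h + ?r = 2 * h - j0" using j0 by simp
          show ?thesis using binomial_symmetric[of j0 "2 * h"] j0(2) unfolding h e by simp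
        qed
        moreover have "(\<Sum>j\<le>k. if int j = int h + \<kappa> then of_real \<omega> ^ k * (of_nat (k choose j) / 2 ^ k) * cis (- 2 * real_of_int \<kappa> * \<theta>) * R else 0) =
          (\<Sum>j\<le>k. if j = j0 then of_real \<omega> ^ k * (of_nat (k choose j0) / 2 ^ k) * cis (- 2 * real_of_int \<kappa> * \<theta>) * R else 0)"
          using j0 by (intro sum.cong refl) auto
        ultimately show ?thesis using j0 by simp
      next
        case False
        then have "int j \<noteq> int h + \<kappa>" if "j \<le> k" for j using that h by auto
        moreover have "(2 * h) choose (h + ?r) = 0" using False by (intro binomial_eq_0) simp
        ultimately show ?thesis by (simp add: sum.neutral)
      qed
      also have "\<dots> = cis (- 2 * real_of_int \<kappa> * \<theta>) * (of_real \<omega> ^ k / 2 ^ k * (of_nat ((2 * h) choose (h + ?r)) * R))"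
        by simp
      also have "of_nat ((2 * h) choose (h + ?r)) * R = X h" unfolding R X_def by (rule integral_power_radial[OF r])
      finally show ?thesis using True h by simp
    qed
    finally show ?thesis .
  qed
  have "0 \<le> int S" by simp
  from main[OF \<kappa>] main[of 0] show ?thesis by simp
qed

end

context radial_profile begin

text \<open>Both sides are linear in \<open>g\<close> and continuous for the sup norm on the range
  of the linear form, and polynomials are dense there.\<close>

lemma test_ridge:
  assumes \<kappa>: "\<bar>\<kappa>\<bar> \<le> int S" and g: "continuous_on UNIV (g :: real \<Rightarrow> real)"
  shows "(LINT p|disk_measure. complex_of_real (g (\<omega> * sqrt (fst p) * cos (2 * pi * snd p - \<theta>))) * test \<kappa> p) =
    cis (- 2 * real_of_int \<kappa> * \<theta>) *
    (LINT p|disk_measure. complex_of_real (g (\<omega> * sqrt (fst p) * cos (2 * pi * snd p - \<theta>))) * test 0 p)"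
proof -
  let ?z = "\<lambda>p. \<omega> * sqrt (fst p) * cos (2 * pi * snd p - \<theta>)"
  let ?I = "\<lambda>g \<kappa>. (LINT p|disk_measure. complex_of_real (g (?z p)) * test \<kappa> p)"
  have zb: "?z p \<in> {-\<bar>\<omega>\<bar>..\<bar>\<omega>\<bar>}" if "p \<in> space disk_measure" for p
  proof -
    have "\<bar>sqrt (fst p) * cos (2 * pi * snd p - \<theta>)\<bar> \<le> 1 * 1"
      unfolding abs_mult using that by (intro mult_mono) (auto simp: space_disk_measure)
    then have "\<bar>?z p\<bar> \<le> \<bar>\<omega>\<bar>" by (simp add: abs_mult mult.assoc mult_left_le)
    then show ?thesis by (auto simp: abs_le_iff)
  qed
  have int: "integrable disk_measure (\<lambda>p. complex_of_real (h (?z p)) * test \<kappa> p)" if "continuous_on UNIV h" for h :: "real \<Rightarrow> real" and \<kappa>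
    by (intro integrable_disk continuous_intros continuous_on_compose2[OF that]) auto
  obtain B1 where B1: "0 \<le> B1" "\<And>p. p \<in> space disk_measure \<Longrightarrow> norm (test \<kappa> p) \<le> B1"
    using disk_bounded[OF test_continuous[of UNIV \<kappa>]] by blast
  obtain B2 where B2: "0 \<le> B2" "\<And>p. p \<in> space disk_measure \<Longrightarrow> norm (test 0 p) \<le> B2"
    using disk_bounded[OF test_continuous[of UNIV 0]] by blast
  let ?x = "?I g \<kappa> - cis (- 2 * real_of_int \<kappa> * \<theta>) * ?I g 0"
  have bound: "norm ?x \<le> \<eta> * (B1 + B2)" if \<eta>: "\<eta> > 0" for \<eta>
  proof -
    have "continuous_on {-\<bar>\<omega>\<bar>..\<bar>\<omega>\<bar>} g" using g continuous_on_subset by blast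
    then obtain h where h: "real_polynomial_function h" "\<And>y. y \<in> {-\<bar>\<omega>\<bar>..\<bar>\<omega>\<bar>} \<Longrightarrow> \<bar>g y - h y\<bar> < \<eta>"
      using Stone_Weierstrass_real_polynomial_function[OF compact_Icc _ \<eta>] by blast
    obtain a q where hq: "h = (\<lambda>y. \<Sum>i\<le>q. a i * y ^ i)" using h(1) unfolding real_polynomial_function_iff_sum by blast
    have hc: "continuous_on UNIV h" unfolding hq by (intro continuous_intros)
    have Ih: "?I h \<kappa>' = (\<Sum>i\<le>q. of_real (a i) * (LINT p|disk_measure. complex_of_real (?z p) ^ i * test \<kappa>' p))" for \<kappa>'
    proof -
      have "?I h \<kappa>' = (LINT p|disk_measure. (\<Sum>i\<le>q. of_real (a i) * (complex_of_real (?z p) ^ i * test \<kappa>' p)))"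
        unfolding hq by (simp add: sum_distrib_right mult.assoc)
      also have "\<dots> = (\<Sum>i\<le>q. (LINT p|disk_measure. of_real (a i) * (complex_of_real (?z p) ^ i * test \<kappa>' p)))"
        by (intro Bochner_Integration.integral_sum integrable_disk continuous_intros)
      finally show ?thesis by (simp only: integral_mult_right_zero)
    qed
    have "?I h \<kappa> = cis (- 2 * real_of_int \<kappa> * \<theta>) * ?I h 0"
      unfolding Ih sum_distrib_left by (intro sum.cong refl) (simp only: test_ridge_power[OF \<kappa>] mult.left_commute)
    then have xe: "?x = (?I g \<kappa> - ?I h \<kappa>) - cis (- 2 * real_of_int \<kappa> * \<theta>) * (?I g 0 - ?I h 0)"
      by (simp add: right_diff_distrib)
    have "norm ?x \<le> norm (?I g \<kappa> - ?I h \<kappa>) + norm (cis (- 2 * real_of_int \<kappa> * \<theta>) * (?I g 0 - ?I h 0))"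
      unfolding xe by (rule norm_triangle_ineq4)
    then have "norm ?x \<le> norm (?I g \<kappa> - ?I h \<kappa>) + norm (?I g 0 - ?I h 0)"
      by (simp only: norm_mult norm_cis mult_1)
    also have "\<dots> \<le> \<eta> * B1 + \<eta> * B2"
    proof -
      have *: "norm (?I g \<kappa>' - ?I h \<kappa>') \<le> \<eta> * B" if B: "0 \<le> B" "\<And>p. p \<in> space disk_measure \<Longrightarrow> norm (test \<kappa>' p) \<le> B" for \<kappa>' B
      proof -
        have de: "?I g \<kappa>' - ?I h \<kappa>' = (LINT p|disk_measure. complex_of_real (g (?z p)) * test \<kappa>' p - complex_of_real (h (?z p)) * test \<kappa>' p)"
          by (rule Bochner_Integration.integral_diff[symmetric, OF int[OF g] int[OF hc]])
        show ?thesis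
          unfolding de
        proof (rule norm_integral_le[OF disk.finite_measure_axioms measure_space_disk_measure])
          fix p assume p: "p \<in> space disk_measure"
          have "norm (complex_of_real (g (?z p) - h (?z p))) * norm (test \<kappa>' p) \<le> \<eta> * B"
            unfolding norm_of_real using h(2)[OF zb[OF p]] B(2)[OF p] \<eta> by (intro mult_mono) auto
          then show "norm (complex_of_real (g (?z p)) * test \<kappa>' p - complex_of_real (h (?z p)) * test \<kappa>' p) \<le> \<eta> * B"
            by (simp only: left_diff_distrib[symmetric] of_real_diff[symmetric] norm_mult)
        qed (use \<eta> B in simp)
      qed
      show ?thesis by (intro add_mono * B1 B2)
    qed
    finally show ?thesis by (simp add: distrib_left)
  qed
  have "norm ?x \<le> 0"
  proof (rule field_le_epsilon)
    fix e :: real assume e: "0 < e"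
    have "e / (B1 + B2 + 1) * (B1 + B2) \<le> e" using e B1(1) B2(1) by (simp add: field_simps)
    then show "norm ?x \<le> 0 + e" using bound[of "e / (B1 + B2 + 1)"] e B1(1) B2(1) by simp
  qed
  then show ?thesis by simp
qed

end

interpretation disks: product_sigma_finite "\<lambda>_ :: 'j. disk_measure"
  by (simp add: product_sigma_finite_def disk.sigma_finite_measure_axioms)

subsection \<open>Sums of ridge functions on products of disks\<close>

definition disks_measure :: "'j set \<Rightarrow> ('j \<Rightarrow> real \<times> real) measure" where
  "disks_measure J = (\<Pi>\<^sub>M j\<in>J. disk_measure)"

lemma space_disks_measure: "space (disks_measure J) = (\<Pi>\<^sub>E j\<in>J. space disk_measure)"
  by (simp add: disks_measure_def space_PiM)

lemma emeasure_space_disks_measure: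
  assumes "finite J"
  shows "emeasure (disks_measure J) (space (disks_measure J)) = 1"
  unfolding space_disks_measure unfolding disks_measure_def
  using assms by (subst disks.emeasure_PiM) (auto simp: emeasure_space_disk_measure)

lemma finite_measure_disks:
  assumes "finite J"
  shows "finite_measure (disks_measure J)" "measure (disks_measure J) (space (disks_measure J)) = 1"
  using emeasure_space_disks_measure[OF assms] by (auto intro!: finite_measureI simp: measure_def)

lemma integral_disks_prod:
  fixes f :: "'j \<Rightarrow> real \<times> real \<Rightarrow> complex"
  assumes "finite J" "\<And>j. j \<in> J \<Longrightarrow> continuous_on UNIV (f j)"
  shows "integrable (disks_measure J) (\<lambda>x. \<Prod>j\<in>J. f j (x j))"
    "(LINT x|disks_measure J. (\<Prod>j\<in>J. f j (x j))) = (\<Prod>j\<in>J. (LINT p|disk_measure. f j p))"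
  unfolding disks_measure_def using assms
  by (auto intro!: disks.product_integrable_prod disks.product_integral_prod integrable_disk)

lemma measurable_disks_coordinate:
  assumes "j \<in> J" "continuous_on UNIV (f :: real \<times> real \<Rightarrow> real)"
  shows "(\<lambda>x. f (x j)) \<in> borel_measurable (disks_measure J)"
proof -
  have "(\<lambda>p. complex_of_real (f p)) \<in> borel_measurable disk_measure"
    by (intro borel_measurable_disk continuous_intros assms)
  then have "(\<lambda>p. Re (complex_of_real (f p))) \<in> borel_measurable disk_measure" by (rule measurable_compose[OF _ borel_measurable_Re])
  then have f: "f \<in> borel_measurable disk_measure" unfolding Re_complex_of_real .
  show ?thesis unfolding disks_measure_def
    by (rule measurable_compose[OF measurable_component_singleton[OF assms(1), of "\<lambda>_. disk_measure"] f])
qed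

text \<open>Weierstrass in the variable \<open>exp y\<close>. Exponentials are preferred to powers
  because the exponential of a sum over disks is a product of functions of the single disks.\<close>

lemma exponential_sums_dense:
  fixes g :: "real \<Rightarrow> real"
  assumes g: "continuous_on UNIV g" and e: "0 < \<eta>"
  shows "\<exists>a q. \<forall>y\<in>{-R..R}. \<bar>g y - (\<Sum>i\<le>q. a i * exp (real i * y))\<bar> < \<eta>"
proof -
  have "continuous_on {exp (-R)..exp R} (\<lambda>s. g (ln s))"
  proof (intro continuous_on_compose2[OF g] continuous_on_ln continuous_intros)
    show "\<forall>x\<in>{exp (- R)..exp R}. x \<noteq> 0"
      using exp_gt_zero[of "-R"] by (metis atLeastAtMost_iff leD)
  qed auto
  then obtain h where h: "real_polynomial_function h" "\<And>s. s \<in> {exp (-R)..exp R} \<Longrightarrow> \<bar>g (ln s) - h s\<bar> < \<eta>"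
    using Stone_Weierstrass_real_polynomial_function[OF compact_Icc _ e] by blast
  obtain a q where hq: "h = (\<lambda>y. \<Sum>i\<le>q. a i * y ^ i)" using h(1) unfolding real_polynomial_function_iff_sum by blast
  have "\<bar>g y - (\<Sum>i\<le>q. a i * exp (real i * y))\<bar> < \<eta>" if "y \<in> {-R..R}" for y
    using h(2)[of "exp y"] that by (simp add: hq exp_of_nat_mult)
  then show ?thesis by (intro exI ballI)
qed

lemma polar_coordinates:
  fixes \<alpha> \<beta> :: real
  shows "\<exists>\<omega> \<theta>. \<alpha> = \<omega> * cos \<theta> \<and> \<beta> = \<omega> * sin \<theta>"
proof -
  have e: "rcis (cmod (Complex \<alpha> \<beta>)) (Arg (Complex \<alpha> \<beta>)) = Complex \<alpha> \<beta>" by (rule rcis_cmod_Arg)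
  have "cmod (Complex \<alpha> \<beta>) * cos (Arg (Complex \<alpha> \<beta>)) = \<alpha>" using arg_cong[OF e, of Re] unfolding Re_rcis complex.sel .
  moreover have "cmod (Complex \<alpha> \<beta>) * sin (Arg (Complex \<alpha> \<beta>)) = \<beta>" using arg_cong[OF e, of Im] unfolding Im_rcis complex.sel .
  ultimately show ?thesis
    by (intro exI[of _ "cmod (Complex \<alpha> \<beta>)"] exI[of _ "Arg (Complex \<alpha> \<beta>)"] conjI) (simp_all only:)
qed

context radial_profile begin

text \<open>Let \<open>v\<close> be the vector of phases of a direction. Integrated against an
  exponential of the linear form, this gives a multiple of the sum of
  \<open>cnj (v a) * P a b * v b\<close>; integrated against the wave, a multiple of the trace of
  \<open>P\<close>. The differences \<open>a - b\<close> run from \<open>- S\<close> to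
  \<open>S\<close>, the frequencies available on one disk.\<close>

definition tests :: "'j set \<Rightarrow> (('j \<Rightarrow> nat) \<Rightarrow> ('j \<Rightarrow> nat) \<Rightarrow> complex) \<Rightarrow> ('j \<Rightarrow> real \<times> real) \<Rightarrow> complex" where
  "tests J P x = (\<Sum>(a, b)\<in>(\<Pi>\<^sub>E j\<in>J. {..S}) \<times> (\<Pi>\<^sub>E j\<in>J. {..S}). P a b * (\<Prod>j\<in>J. test (int (a j) - int (b j)) (x j)))"

lemma finite_index: "finite J \<Longrightarrow> finite (\<Pi>\<^sub>E j\<in>J. {..S})"
  by (intro finite_PiE) auto

lemma integral_tests_prod:
  assumes J: "finite J" and f: "\<And>j. j \<in> J \<Longrightarrow> continuous_on UNIV (f j)"
  shows "integrable (disks_measure J) (\<lambda>x. (\<Prod>j\<in>J. f j (x j)) * tests J P x)"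
    "(LINT x|disks_measure J. (\<Prod>j\<in>J. f j (x j)) * tests J P x) =
      (\<Sum>(a, b)\<in>(\<Pi>\<^sub>E j\<in>J. {..S}) \<times> (\<Pi>\<^sub>E j\<in>J. {..S}). P a b * (\<Prod>j\<in>J. (LINT p|disk_measure. f j p * test (int (a j) - int (b j)) p)))"
proof -
  let ?Q = "(\<Pi>\<^sub>E j\<in>J. {..S}) \<times> (\<Pi>\<^sub>E j\<in>J. {..S})"
  let ?F = "\<lambda>q x. P (fst q) (snd q) * (\<Prod>j\<in>J. f j (x j) * test (int (fst q j) - int (snd q j)) (x j))"
  have eq: "(\<lambda>x. (\<Prod>j\<in>J. f j (x j)) * tests J P x) = (\<lambda>x. \<Sum>q\<in>?Q. ?F q x)"
    unfolding tests_def by (simp add: sum_distrib_left prod.distrib case_prod_beta mult_ac)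
  have c: "continuous_on UNIV (\<lambda>p. f j p * test \<kappa> p)" if "j \<in> J" for j \<kappa>
    using f[OF that] by (intro continuous_intros)
  have int: "integrable (disks_measure J) (?F q)" for q
    by (intro integrable_mult_right integral_disks_prod(1)[OF J] c)
  show "integrable (disks_measure J) (\<lambda>x. (\<Prod>j\<in>J. f j (x j)) * tests J P x)"
    unfolding eq by (intro Bochner_Integration.integrable_sum int)
  have "(LINT x|disks_measure J. (\<Prod>j\<in>J. f j (x j)) * tests J P x) = (\<Sum>q\<in>?Q. (LINT x|disks_measure J. ?F q x))"
    unfolding eq by (intro Bochner_Integration.integral_sum int)
  also have "\<dots> = (\<Sum>q\<in>?Q. P (fst q) (snd q) * (\<Prod>j\<in>J. (LINT p|disk_measure. f j p * test (int (fst q j) - int (snd q j)) p)))"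
    by (intro sum.cong refl, subst integral_mult_right_zero) (simp add: integral_disks_prod(2)[OF J c])
  finally show "(LINT x|disks_measure J. (\<Prod>j\<in>J. f j (x j)) * tests J P x) =
      (\<Sum>(a, b)\<in>?Q. P a b * (\<Prod>j\<in>J. (LINT p|disk_measure. f j p * test (int (a j) - int (b j)) p)))"
    by (simp add: case_prod_beta)
qed

lemma tests_integrable:
  assumes J: "finite J"
  shows "integrable (disks_measure J) (tests J P)"
  using integral_tests_prod(1)[OF J, of "\<lambda>_ _. 1"] by simp

lemma integral_tests_wave:
  assumes J: "finite J" and c: "\<And>l. l \<in> {S..L} \<Longrightarrow> c l = cnj (unit_inner (wave n) (radial_basis 0 l))"
  shows "(LINT x|disks_measure J. (\<Prod>j\<in>J. wave n (fst (x j))) * tests J P x) =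
    of_real mass ^ card J * (\<Sum>a\<in>(\<Pi>\<^sub>E j\<in>J. {..S}). P a a)"
proof -
  let ?A = "\<Pi>\<^sub>E j\<in>J. {..S}"
  have wc: "continuous_on UNIV (\<lambda>p::real \<times> real. wave n (fst p))"
    by (rule continuous_on_compose2[OF wave_continuous[of UNIV]]) (auto intro: continuous_intros)
  have tw: "(LINT p|disk_measure. wave n (fst p) * test \<kappa> p) = (if \<kappa> = 0 then of_real mass else 0)" for \<kappa>
    by (rule test_wave) (rule c)
  have "(LINT x|disks_measure J. (\<Prod>j\<in>J. wave n (fst (x j))) * tests J P x) =
      (\<Sum>(a, b)\<in>?A \<times> ?A. P a b * (\<Prod>j\<in>J. if int (a j) - int (b j) = 0 then of_real mass else 0))"
    unfolding integral_tests_prod(2)[OF J, of "\<lambda>_ p. wave n (fst p)", OF wc] tw ..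
  also have "\<dots> = (\<Sum>(a, b)\<in>?A \<times> ?A. if b = a then P a a * of_real mass ^ card J else 0)"
  proof (intro sum.cong refl, clarify)
    fix a b assume ab: "a \<in> ?A" "b \<in> ?A"
    show "P a b * (\<Prod>j\<in>J. if int (a j) - int (b j) = 0 then of_real mass else 0) =
        (if b = a then P a a * of_real mass ^ card J else 0)"
    proof (cases "b = a")
      case False
      have "\<exists>j\<in>J. a j \<noteq> b j" using False ab by (metis PiE_ext)
      then have "(\<Prod>j\<in>J. if int (a j) - int (b j) = 0 then of_real mass else (0::complex)) = 0"
        using J by (auto simp: prod_zero_iff)
      then show ?thesis using False by simp
    qed simp
  qed
  also have "\<dots> = (\<Sum>a\<in>?A. P a a * of_real mass ^ card J)"
    unfolding sum.cartesian_product[symmetric] using finite_index[OF J] by simp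
  finally show ?thesis by (simp add: sum_distrib_left mult.commute)
qed

text \<open>Tests of different frequency vectors are orthogonal, and at most
  \<open>(S + 1) ^ card J\<close> pairs share a difference. So the squared L2-norm is at most
  \<open>mass ^ card J\<close> times this number times the sum of the squared entries of
  \<open>P\<close>; for a projection this sum is the trace, again at most
  \<open>(S + 1) ^ card J\<close>. The total mass is 1, so L2 dominates L1.\<close>

lemma norm_tests_le:
  assumes J: "finite J"
    and P: "\<And>a b. a \<in> (\<Pi>\<^sub>E j\<in>J. {..S}) \<Longrightarrow> b \<in> (\<Pi>\<^sub>E j\<in>J. {..S}) \<Longrightarrow> P b a = cnj (P a b)"
      "\<And>a b. a \<in> (\<Pi>\<^sub>E j\<in>J. {..S}) \<Longrightarrow> b \<in> (\<Pi>\<^sub>E j\<in>J. {..S}) \<Longrightarrow> (\<Sum>c\<in>(\<Pi>\<^sub>E j\<in>J. {..S}). P a c * P c b) = P a b"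
  shows "(LINT x|disks_measure J. norm (tests J P x))\<^sup>2 \<le> mass ^ card J * (real ((S + 1) ^ card J))\<^sup>2"
proof -
  let ?M = "disks_measure J" and ?A = "\<Pi>\<^sub>E j\<in>J. {..S}"
  let ?Q = "?A \<times> ?A"
  interpret M: finite_measure ?M by (rule finite_measure_disks(1)[OF J])
  have fA: "finite ?A" by (rule finite_index[OF J])
  have cA: "card ?A = (S + 1) ^ card J" using J by (simp add: card_PiE)
  let ?k = "\<lambda>q j. int (fst q j) - int (snd q j)"
  have m0: "0 \<le> mass" unfolding mass_def by (intro sum_nonneg) auto
  have sq: "tests J P x * cnj (tests J P x) =
      (\<Sum>q\<in>?Q. cnj (P (fst q) (snd q)) * ((\<Prod>j\<in>J. cnj (test (?k q j) (x j))) * tests J P x))" for x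
    unfolding tests_def[of J P] by (simp add: sum_distrib_left sum_distrib_right case_prod_beta mult_ac)
  have cc: "continuous_on UNIV (\<lambda>p. cnj (test \<kappa> p))" for \<kappa> by (intro continuous_intros)
  note it = integral_tests_prod[OF J, of "\<lambda>j p. cnj (test (?k q j) p)" P for q, OF cc]
  have int2: "integrable ?M (\<lambda>x. tests J P x * cnj (tests J P x))"
    unfolding sq by (intro Bochner_Integration.integrable_sum integrable_mult_right it)
  have "(LINT x|?M. tests J P x * cnj (tests J P x)) =
      (\<Sum>q\<in>?Q. cnj (P (fst q) (snd q)) * (LINT x|?M. (\<Prod>j\<in>J. cnj (test (?k q j) (x j))) * tests J P x))"
    unfolding sq by (subst Bochner_Integration.integral_sum) (intro integrable_mult_right it, simp only: integral_mult_right_zero)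
  also have "\<dots> = (\<Sum>q\<in>?Q. \<Sum>p\<in>?Q. if \<forall>j\<in>J. ?k p j = ?k q j then cnj (P (fst q) (snd q)) * P (fst p) (snd p) * of_real mass ^ card J else 0)"
  proof (intro sum.cong refl)
    fix q assume q: "q \<in> ?Q"
    have "(LINT x|?M. (\<Prod>j\<in>J. cnj (test (?k q j) (x j))) * tests J P x) =
      (\<Sum>p\<in>?Q. P (fst p) (snd p) * (\<Prod>j\<in>J. (LINT x|disk_measure. test (?k p j) x * cnj (test (?k q j) x))))"
      unfolding it(2) by (simp add: case_prod_beta mult.commute)
    also have "\<dots> = (\<Sum>p\<in>?Q. P (fst p) (snd p) * (if \<forall>j\<in>J. ?k p j = ?k q j then of_real mass ^ card J else 0))"
    proof (intro sum.cong refl)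
      fix p assume p: "p \<in> ?Q"
      have "(\<Prod>j\<in>J. (LINT x|disk_measure. test (?k p j) x * cnj (test (?k q j) x))) =
          (\<Prod>j\<in>J. if ?k p j = ?k q j then of_real mass else 0)"
      proof (intro prod.cong refl test_orthogonal)
        fix j assume "j \<in> J"
        then have "fst p j \<le> S" "snd p j \<le> S" using p by (auto simp: PiE_iff)
        then show "\<bar>?k p j\<bar> \<le> int S" by linarith
      qed
      also have "\<dots> = (if \<forall>j\<in>J. ?k p j = ?k q j then of_real mass ^ card J else 0)"
        using J by (auto simp: prod_zero_iff)
      finally show "P (fst p) (snd p) * (\<Prod>j\<in>J. (LINT x|disk_measure. test (?k p j) x * cnj (test (?k q j) x))) =
        P (fst p) (snd p) * (if \<forall>j\<in>J. ?k p j = ?k q j then of_real mass ^ card J else 0)" by simp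
    qed
    finally have F: "(LINT x|?M. (\<Prod>j\<in>J. cnj (test (?k q j) (x j))) * tests J P x) =
      (\<Sum>p\<in>?Q. P (fst p) (snd p) * (if \<forall>j\<in>J. ?k p j = ?k q j then of_real mass ^ card J else 0))" .
    show "cnj (P (fst q) (snd q)) * (LINT x|?M. (\<Prod>j\<in>J. cnj (test (?k q j) (x j))) * tests J P x) =
        (\<Sum>p\<in>?Q. if \<forall>j\<in>J. ?k p j = ?k q j then cnj (P (fst q) (snd q)) * P (fst p) (snd p) * of_real mass ^ card J else 0)"
      unfolding F sum_distrib_left by (intro sum.cong refl) (simp add: mult.assoc)
  qed
  finally have sq_int: "(LINT x|?M. tests J P x * cnj (tests J P x)) =
    (\<Sum>q\<in>?Q. \<Sum>p\<in>?Q. if \<forall>j\<in>J. ?k p j = ?k q j then cnj (P (fst q) (snd q)) * P (fst p) (snd p) * of_real mass ^ card J else 0)" .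
  let ?n = "\<lambda>q. (cmod (P (fst q) (snd q)))\<^sup>2"
  let ?t = "\<lambda>p q. \<forall>j\<in>J. ?k p j = ?k q j"
  have "norm (LINT x|?M. tests J P x * cnj (tests J P x)) \<le>
      (\<Sum>q\<in>?Q. \<Sum>p\<in>?Q. if ?t p q then (?n q / 2 + ?n p / 2) * mass ^ card J else 0)"
    unfolding sq_int
  proof (intro order_trans[OF norm_sum] sum_mono)
    fix q p
    \<comment> \<open>A product of entries is at most the mean of their squares; by symmetry in
      \<open>p\<close> and \<open>q\<close> the two squares contribute equally.\<close>
    have "cmod (P (fst q) (snd q)) * cmod (P (fst p) (snd p)) \<le> ?n q / 2 + ?n p / 2"
      using sum_squares_bound[of "cmod (P (fst q) (snd q))" "cmod (P (fst p) (snd p))"] by simp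
    then have "cmod (P (fst q) (snd q)) * cmod (P (fst p) (snd p)) * mass ^ card J \<le> (?n q / 2 + ?n p / 2) * mass ^ card J"
      using m0 by (intro mult_right_mono) auto
    then show "norm (if ?t p q then cnj (P (fst q) (snd q)) * P (fst p) (snd p) * of_real mass ^ card J else 0)
        \<le> (if ?t p q then (?n q / 2 + ?n p / 2) * mass ^ card J else 0)"
      using m0 by (simp add: norm_mult norm_power)
  qed
  also have "\<dots> = (\<Sum>q\<in>?Q. \<Sum>p\<in>?Q. if ?t p q then ?n q * mass ^ card J else 0)"
  proof -
    have "(\<Sum>q\<in>?Q. \<Sum>p\<in>?Q. if ?t p q then ?n p / 2 * mass ^ card J else 0) =
        (\<Sum>p\<in>?Q. \<Sum>q\<in>?Q. if ?t p q then ?n p / 2 * mass ^ card J else 0)" by (rule sum.swap)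
    also have "\<dots> = (\<Sum>q\<in>?Q. \<Sum>p\<in>?Q. if ?t p q then ?n q / 2 * mass ^ card J else 0)"
      by (intro sum.cong refl if_cong) (auto simp: eq_commute)
    finally have s: "(\<Sum>q\<in>?Q. \<Sum>p\<in>?Q. if ?t p q then ?n p / 2 * mass ^ card J else 0) =
        (\<Sum>q\<in>?Q. \<Sum>p\<in>?Q. if ?t p q then ?n q / 2 * mass ^ card J else 0)" .
    have "(\<Sum>q\<in>?Q. \<Sum>p\<in>?Q. if ?t p q then (?n q / 2 + ?n p / 2) * mass ^ card J else 0) =
        (\<Sum>q\<in>?Q. \<Sum>p\<in>?Q. if ?t p q then ?n q / 2 * mass ^ card J else 0) +
        (\<Sum>q\<in>?Q. \<Sum>p\<in>?Q. if ?t p q then ?n p / 2 * mass ^ card J else 0)"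
      unfolding sum.distrib[symmetric] by (intro sum.cong refl) (simp add: distrib_right)
    also have "\<dots> = (\<Sum>q\<in>?Q. \<Sum>p\<in>?Q. if ?t p q then ?n q * mass ^ card J else 0)"
      unfolding s unfolding sum.distrib[symmetric] by (intro sum.cong refl) simp
    finally show ?thesis .
  qed
  also have "\<dots> \<le> (\<Sum>q\<in>?Q. ?n q * mass ^ card J * real ((S + 1) ^ card J))"
  proof (intro sum_mono)
    fix q assume q: "q \<in> ?Q"
    \<comment> \<open>A pair with given difference is determined by its first component.\<close>
    have "inj_on fst {p\<in>?Q. ?t p q}"
    proof (rule inj_onI)
      fix p p' assume p: "p \<in> {p\<in>?Q. ?t p q}" "p' \<in> {p\<in>?Q. ?t p q}" "fst p = fst p'"
      have "snd p = snd p'"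
      proof (rule PiE_ext)
        show "snd p \<in> ?A" "snd p' \<in> ?A" using p by auto
        fix j assume "j \<in> J"
        then have "?k p j = ?k p' j" using p(1,2) by simp
        then show "snd p j = snd p' j" using p(3) by simp
      qed
      then show "p = p'" using p(3) by (simp add: prod_eq_iff)
    qed
    then have "card {p\<in>?Q. ?t p q} \<le> card ?A" by (rule card_inj_on_le[OF _ _ fA]) auto
    then have "real (card {p\<in>?Q. ?t p q}) \<le> real ((S + 1) ^ card J)" unfolding cA by (rule of_nat_mono)
    then have "?n q * mass ^ card J * real (card {p\<in>?Q. ?t p q}) \<le> ?n q * mass ^ card J * real ((S + 1) ^ card J)"
      using m0 by (intro mult_left_mono) auto
    moreover have "(\<Sum>p\<in>?Q. if ?t p q then ?n q * mass ^ card J else 0) = (\<Sum>p\<in>{p\<in>?Q. ?t p q}. ?n q * mass ^ card J)"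
      using fA by (intro sum.inter_filter[symmetric]) auto
    ultimately show "(\<Sum>p\<in>?Q. if ?t p q then ?n q * mass ^ card J else 0) \<le> ?n q * mass ^ card J * real ((S + 1) ^ card J)"
      by (simp add: mult.commute)
  qed
  also have "\<dots> = (\<Sum>q\<in>?Q. ?n q) * (mass ^ card J * real ((S + 1) ^ card J))"
    by (simp add: sum_distrib_right mult.assoc)
  also have "\<dots> \<le> real ((S + 1) ^ card J) * (mass ^ card J * real ((S + 1) ^ card J))"
  proof (intro mult_right_mono)
    \<comment> \<open>The identity \<open>P = P * P\<close> on the diagonal, with \<open>P\<close>
      Hermitian. It forces each diagonal entry to be at most 1.\<close>
    have diag: "P a a = of_real (\<Sum>b\<in>?A. (cmod (P a b))\<^sup>2)" if a: "a \<in> ?A" for a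
    proof -
      have "P a a = (\<Sum>b\<in>?A. P a b * P b a)" by (rule P(2)[OF a a, symmetric])
      also have "\<dots> = (\<Sum>b\<in>?A. of_real ((cmod (P a b))\<^sup>2))"
      proof (intro sum.cong refl)
        fix b assume b: "b \<in> ?A"
        show "P a b * P b a = of_real ((cmod (P a b))\<^sup>2)"
          unfolding P(1)[OF a b] by (simp only: complex_norm_square)
      qed
      finally show ?thesis by simp
    qed
    have "(\<Sum>b\<in>?A. (cmod (P a b))\<^sup>2) \<le> 1" if a: "a \<in> ?A" for a
    proof -
      let ?s = "\<Sum>b\<in>?A. (cmod (P a b))\<^sup>2"
      have s0: "0 \<le> ?s" by (intro sum_nonneg) auto
      have "cmod (P a a) = ?s" unfolding diag[OF a] norm_of_real using s0 by simp
      then have "?s\<^sup>2 \<le> ?s" using member_le_sum[of a ?A "\<lambda>b. (cmod (P a b))\<^sup>2"] a fA by simp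
      then show ?thesis using s0 by (cases "?s = 0") (auto simp: power2_eq_square)
    qed
    then have "(\<Sum>a\<in>?A. \<Sum>b\<in>?A. (cmod (P a b))\<^sup>2) \<le> (\<Sum>a\<in>?A. 1)" by (intro sum_mono)
    then show "(\<Sum>q\<in>?Q. ?n q) \<le> real ((S + 1) ^ card J)"
      by (simp add: sum.cartesian_product case_prod_beta cA)
  qed (use m0 in auto)
  finally have le: "norm (LINT x|?M. tests J P x * cnj (tests J P x)) \<le> mass ^ card J * (real ((S + 1) ^ card J))\<^sup>2"
    by (simp add: power2_eq_square mult_ac)
  let ?\<nu> = "LINT x|?M. norm (tests J P x)"
  have i1: "integrable ?M (\<lambda>x. norm (tests J P x))" using tests_integrable[OF J] by (rule integrable_norm)
  have nsq: "Re (tests J P x * cnj (tests J P x)) = (norm (tests J P x))\<^sup>2" for x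
    by (simp add: complex_mult_cnj cmod_power2)
  have i2: "integrable ?M (\<lambda>x. (norm (tests J P x))\<^sup>2)" using integrable_Re[OF int2] unfolding nsq .
  \<comment> \<open>A variance is nonnegative: the square of the mean is at most the mean of the
    square.\<close>
  have "0 \<le> (LINT x|?M. (norm (tests J P x) - ?\<nu>)\<^sup>2)" by (intro Bochner_Integration.integral_nonneg) simp
  also have "\<dots> = (LINT x|?M. (norm (tests J P x))\<^sup>2 - 2 * ?\<nu> * norm (tests J P x) + ?\<nu>\<^sup>2)"
    by (simp add: power2_diff algebra_simps)
  also have "\<dots> = (LINT x|?M. (norm (tests J P x))\<^sup>2) - 2 * ?\<nu> * ?\<nu> + ?\<nu>\<^sup>2"
    using i1 i2 finite_measure_disks(2)[OF J] by simp
  finally have "?\<nu>\<^sup>2 \<le> (LINT x|?M. (norm (tests J P x))\<^sup>2)" by (simp add: power2_eq_square)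
  also have "\<dots> = Re (LINT x|?M. tests J P x * cnj (tests J P x))" unfolding nsq[symmetric] by (rule integral_Re[OF int2])
  also have "\<dots> \<le> norm (LINT x|?M. tests J P x * cnj (tests J P x))" by (rule complex_Re_le_cmod)
  finally show ?thesis using le by simp
qed

text \<open>
  If \<open>P\<close> is the projection that kills the vectors of phases of the directions of all units, then the
  combination of tests is orthogonal to every function of a unit.
\<close>

lemma integral_tests_ridge:
  fixes g :: "real \<Rightarrow> real" and \<omega> \<theta> :: "'j \<Rightarrow> real"
  assumes J: "finite J" and g: "continuous_on UNIV g"
    and P: "\<And>a. a \<in> (\<Pi>\<^sub>E j\<in>J. {..S}) \<Longrightarrow> (\<Sum>b\<in>(\<Pi>\<^sub>E j\<in>J. {..S}). P a b * (\<Prod>j\<in>J. cis (2 * real (b j) * \<theta> j))) = 0"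
  defines "T \<equiv> \<lambda>x. \<Sum>j\<in>J. \<omega> j * sqrt (fst (x j)) * cos (2 * pi * snd (x j) - \<theta> j)"
  shows "integrable (disks_measure J) (\<lambda>x. complex_of_real (g (T x)) * tests J P x)"
    "(LINT x|disks_measure J. complex_of_real (g (T x)) * tests J P x) = 0"
proof -
  let ?M = "disks_measure J" and ?A = "\<Pi>\<^sub>E j\<in>J. {..S}"
  interpret M: finite_measure ?M by (rule finite_measure_disks(1)[OF J])
  define R where "R = (\<Sum>j\<in>J. \<bar>\<omega> j\<bar>)"
  have TR: "T x \<in> {-R..R}" if x: "x \<in> space ?M" for x
  proof -
    have "\<bar>T x\<bar> \<le> R"
      unfolding T_def R_def
    proof (intro order_trans[OF sum_abs] sum_mono)
      fix j assume "j \<in> J"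
      then have "fst (x j) \<in> {0..1}" using x by (auto simp: space_disks_measure space_disk_measure PiE_iff mem_Times_iff)
      then have "\<bar>sqrt (fst (x j))\<bar> * \<bar>cos (2 * pi * snd (x j) - \<theta> j)\<bar> \<le> 1 * 1" by (intro mult_mono) auto
      then show "\<bar>\<omega> j * sqrt (fst (x j)) * cos (2 * pi * snd (x j) - \<theta> j)\<bar> \<le> \<bar>\<omega> j\<bar>"
        by (simp only: abs_mult mult.assoc) (simp add: mult_left_le)
    qed
    then show ?thesis by (auto simp: abs_le_iff)
  qed
  have Tm: "T \<in> borel_measurable ?M"
    unfolding T_def
    by (intro borel_measurable_sum measurable_disks_coordinate[of _ J "\<lambda>p. \<omega> j * sqrt (fst p) * cos (2 * pi * snd p - \<theta> j)" for j])
      (auto intro!: continuous_intros)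
  have int: "integrable ?M (\<lambda>x. complex_of_real (h (T x)) * tests J P x)" if h: "continuous_on UNIV h" for h :: "real \<Rightarrow> real"
  proof -
    have "bounded (h ` {-R..R})"
      by (intro compact_imp_bounded compact_continuous_image continuous_on_subset[OF h]) auto
    then obtain B where B: "\<And>y. y \<in> {-R..R} \<Longrightarrow> \<bar>h y\<bar> \<le> B"
      unfolding bounded_iff by (metis imageI real_norm_def)
    have "(\<lambda>x. h (T x)) \<in> borel_measurable ?M"
      using measurable_compose[OF Tm borel_measurable_continuous_onI[OF h]] .
    then have m: "(\<lambda>x. complex_of_real (h (T x)) * tests J P x) \<in> borel_measurable ?M"
      using borel_measurable_integrable[OF tests_integrable[OF J, of P]] by measurable
    show ?thesis
    proof (rule Bochner_Integration.integrable_bound[OF _ m])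
      show "integrable ?M (\<lambda>x. of_real \<bar>B\<bar> * tests J P x)" by (intro integrable_mult_right tests_integrable J)
      show "AE x in ?M. norm (complex_of_real (h (T x)) * tests J P x) \<le> norm (of_real \<bar>B\<bar> * tests J P x)"
      proof (intro AE_I2)
        fix x assume "x \<in> space ?M"
        then have "\<bar>h (T x)\<bar> \<le> \<bar>B\<bar>" using B[OF TR] by force
        then show "norm (complex_of_real (h (T x)) * tests J P x) \<le> norm (of_real \<bar>B\<bar> * tests J P x)"
          by (simp add: norm_mult mult_right_mono)
      qed
    qed
  qed
  show "integrable ?M (\<lambda>x. complex_of_real (g (T x)) * tests J P x)" by (rule int[OF g])
  \<comment> \<open>The exponential factorises over the disks and \<open>test_ridge\<close> applies
    to each factor. The phases of \<open>a\<close> come out of the inner sum, and those of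
    \<open>b\<close> are summed against a row of \<open>P\<close>, which gives 0.\<close>
  have exp0: "(LINT x|?M. complex_of_real (exp (s * T x)) * tests J P x) = 0" for s
  proof -
    let ?f = "\<lambda>j p. complex_of_real (exp (s * (\<omega> j * sqrt (fst p) * cos (2 * pi * snd p - \<theta> j))))"
    define Y where "Y j = (LINT p|disk_measure. ?f j p * test 0 p)" for j
    have e: "complex_of_real (exp (s * T x)) = (\<Prod>j\<in>J. ?f j (x j))" for x
      unfolding T_def by (simp add: sum_distrib_left exp_sum J)
    have fc: "continuous_on UNIV (?f j)" for j by (intro continuous_intros)
    have f: "(LINT p|disk_measure. ?f j p * test \<kappa> p) = cis (- 2 * real_of_int \<kappa> * \<theta> j) * Y j" if "\<bar>\<kappa>\<bar> \<le> int S" for j \<kappa>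
      unfolding Y_def by (rule test_ridge[OF that, of "\<lambda>y. exp (s * y)"]) (intro continuous_intros)
    have "(LINT x|?M. complex_of_real (exp (s * T x)) * tests J P x) =
        (\<Sum>(a, b)\<in>?A \<times> ?A. P a b * (\<Prod>j\<in>J. (LINT p|disk_measure. ?f j p * test (int (a j) - int (b j)) p)))"
      unfolding e by (rule integral_tests_prod(2)[OF J fc])
    also have "\<dots> = (\<Sum>(a, b)\<in>?A \<times> ?A. (\<Prod>j\<in>J. cis (- 2 * real (a j) * \<theta> j) * Y j) * (P a b * (\<Prod>j\<in>J. cis (2 * real (b j) * \<theta> j))))"
    proof (intro sum.cong refl, clarify)
      fix a b assume ab: "a \<in> ?A" "b \<in> ?A"
      have "(LINT p|disk_measure. ?f j p * test (int (a j) - int (b j)) p) =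
          (cis (- 2 * real (a j) * \<theta> j) * Y j) * cis (2 * real (b j) * \<theta> j)" if j: "j \<in> J" for j
      proof -
        have "a j \<le> S" "b j \<le> S" using ab j by (auto simp: PiE_iff)
        then have "\<bar>int (a j) - int (b j)\<bar> \<le> int S" by linarith
        moreover have "cis (- 2 * real_of_int (int (a j) - int (b j)) * \<theta> j) = cis (- 2 * real (a j) * \<theta> j) * cis (2 * real (b j) * \<theta> j)"
          by (simp add: cis_mult algebra_simps)
        ultimately show ?thesis by (simp add: f)
      qed
      then show "P a b * (\<Prod>j\<in>J. (LINT p|disk_measure. ?f j p * test (int (a j) - int (b j)) p)) =
          (\<Prod>j\<in>J. cis (- 2 * real (a j) * \<theta> j) * Y j) * (P a b * (\<Prod>j\<in>J. cis (2 * real (b j) * \<theta> j)))"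
        by (simp add: prod.distrib)
    qed
    also have "\<dots> = (\<Sum>a\<in>?A. (\<Prod>j\<in>J. cis (- 2 * real (a j) * \<theta> j) * Y j) * (\<Sum>b\<in>?A. P a b * (\<Prod>j\<in>J. cis (2 * real (b j) * \<theta> j))))"
      unfolding sum_distrib_left sum.cartesian_product ..
    also have "\<dots> = 0" using P by simp
    finally show ?thesis .
  qed
  define \<nu> where "\<nu> = (LINT x|?M. norm (tests J P x))"
  have \<nu>0: "0 \<le> \<nu>" unfolding \<nu>_def by (intro Bochner_Integration.integral_nonneg) simp
  have bound: "norm (LINT x|?M. complex_of_real (g (T x)) * tests J P x) \<le> \<eta> * \<nu>" if \<eta>: "0 < \<eta>" for \<eta>
  proof -
    obtain a q where aq: "\<And>y. y \<in> {-R..R} \<Longrightarrow> \<bar>g y - (\<Sum>i\<le>q. a i * exp (real i * y))\<bar> < \<eta>"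
      using exponential_sums_dense[OF g \<eta>, of R] by blast
    let ?h = "\<lambda>y. \<Sum>i\<le>q. a i * exp (real i * y)"
    have hc: "continuous_on UNIV ?h" by (intro continuous_intros)
    have ec: "continuous_on UNIV (\<lambda>y::real. exp (real i * y))" for i by (intro continuous_intros)
    have h0: "(LINT x|?M. complex_of_real (?h (T x)) * tests J P x) = 0"
    proof -
      have "(LINT x|?M. complex_of_real (?h (T x)) * tests J P x) =
          (LINT x|?M. (\<Sum>i\<le>q. of_real (a i) * (complex_of_real (exp (real i * T x)) * tests J P x)))"
        by (simp add: sum_distrib_right mult.assoc)
      also have "\<dots> = (\<Sum>i\<le>q. (LINT x|?M. of_real (a i) * (complex_of_real (exp (real i * T x)) * tests J P x)))"
        by (intro Bochner_Integration.integral_sum integrable_mult_right int[OF ec])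
      finally show ?thesis by (simp only: integral_mult_right_zero exp0) simp
    qed
    have "(LINT x|?M. complex_of_real (g (T x)) * tests J P x) =
        (LINT x|?M. complex_of_real (g (T x)) * tests J P x - complex_of_real (?h (T x)) * tests J P x)"
      using Bochner_Integration.integral_diff[OF int[OF g] int[OF hc]] h0 by simp
    then have "norm (LINT x|?M. complex_of_real (g (T x)) * tests J P x) \<le>
        (LINT x|?M. norm (complex_of_real (g (T x)) * tests J P x - complex_of_real (?h (T x)) * tests J P x))"
      by (simp only: integral_norm_bound)
    also have "\<dots> \<le> (LINT x|?M. \<eta> * norm (tests J P x))"
    proof (rule integral_mono)
      show "integrable ?M (\<lambda>x. norm (complex_of_real (g (T x)) * tests J P x - complex_of_real (?h (T x)) * tests J P x))"
        by (intro integrable_norm Bochner_Integration.integrable_diff int g hc)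
      show "integrable ?M (\<lambda>x. \<eta> * norm (tests J P x))" by (intro integrable_mult_right integrable_norm tests_integrable J)
      fix x assume x: "x \<in> space ?M"
      have "norm (complex_of_real (g (T x) - ?h (T x))) * norm (tests J P x) \<le> \<eta> * norm (tests J P x)"
        unfolding norm_of_real using aq[OF TR[OF x]] by (intro mult_right_mono) auto
      then show "norm (complex_of_real (g (T x)) * tests J P x - complex_of_real (?h (T x)) * tests J P x) \<le> \<eta> * norm (tests J P x)"
        by (simp only: left_diff_distrib[symmetric] of_real_diff[symmetric] norm_mult)
    qed
    finally show ?thesis by (simp add: \<nu>_def)
  qed
  have "norm (LINT x|?M. complex_of_real (g (T x)) * tests J P x) \<le> 0"
  proof (rule field_le_epsilon)
    fix e :: real assume e: "0 < e"
    have "e / (\<nu> + 1) * \<nu> \<le> e" using e \<nu>0 by (simp add: field_simps)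
    then show "norm (LINT x|?M. complex_of_real (g (T x)) * tests J P x) \<le> 0 + e"
      using bound[of "e / (\<nu> + 1)"] e \<nu>0 by simp
  qed
  then show "(LINT x|?M. complex_of_real (g (T x)) * tests J P x) = 0" by simp
qed

end

lemma Re_of_real_mult: "Re (of_real r * z) = r * Re z"
  by simp

text \<open>Duality: the combined test is orthogonal to the network, so its integral against the
  wave is at most \<open>\<delta>\<close> times its L1-norm. The \<open>g i\<close> may differ from
  unit to unit, so that they can absorb the biases, and \<open>k\<close> is fixed before the disks
  and the network are given.\<close>

lemma ridge_approximation_lower_bound:
  assumes S: "1 \<le> S"
  shows "\<exists>k\<in>{1..4 * S}. \<forall>(J :: 'j set) N w g \<alpha> \<beta> \<delta>. finite J \<longrightarrow> 2 * N \<le> (S + 1) ^ card J \<longrightarrow>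
    (\<forall>i<N. continuous_on UNIV (g i :: real \<Rightarrow> real)) \<longrightarrow>
    (\<forall>x\<in>space (disks_measure J). cmod ((\<Prod>j\<in>J. wave (int k) (fst (x j))) -
       (\<Sum>i<N. w i * complex_of_real (g i (\<Sum>j\<in>J. \<alpha> i j * disk_x (x j) + \<beta> i j * disk_y (x j))))) \<le> \<delta>) \<longrightarrow>
    (1 / 2) ^ card J \<le> 2 * \<delta>"
proof -
  obtain k L where k: "k \<in> {1..4 * S}"
    and half: "1 / 2 \<le> (\<Sum>l\<in>{S..L}. (cmod (unit_inner (wave (int k)) (radial_basis 0 l)))\<^sup>2)"
    using wave_with_high_degree_part[OF S] by blast
  define c where "c l = cnj (unit_inner (wave (int k)) (radial_basis 0 l))" for l
  interpret radial_profile S L c .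
  have mass: "1 / 2 \<le> mass" using half by (simp add: mass_def c_def)
  have "(1 / 2) ^ card J \<le> 2 * \<delta>"
    if J: "finite J" and N: "2 * N \<le> (S + 1) ^ card J" and g: "\<And>i. i < N \<Longrightarrow> continuous_on UNIV (g i)"
      and appr: "\<And>x. x \<in> space (disks_measure J) \<Longrightarrow> cmod ((\<Prod>j\<in>J. wave (int k) (fst (x j))) -
       (\<Sum>i<N. w i * complex_of_real (g i (\<Sum>j\<in>J. \<alpha> i j * disk_x (x j) + \<beta> i j * disk_y (x j))))) \<le> \<delta>"
    for J :: "'j set" and N w \<alpha> \<beta> \<delta> and g :: "nat \<Rightarrow> real \<Rightarrow> real"
  proof -
    let ?M = "disks_measure J" and ?A = "\<Pi>\<^sub>E j\<in>J. {..S}"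
    interpret M: finite_measure ?M by (rule finite_measure_disks(1)[OF J])
    define \<omega> where "\<omega> i j = (SOME \<omega>. \<exists>\<theta>. \<alpha> i j = \<omega> * cos \<theta> \<and> \<beta> i j = \<omega> * sin \<theta>)" for i j
    have \<omega>: "\<exists>\<theta>. \<alpha> i j = \<omega> i j * cos \<theta> \<and> \<beta> i j = \<omega> i j * sin \<theta>" for i j
      unfolding \<omega>_def by (rule someI_ex[OF polar_coordinates])
    define \<theta> where "\<theta> i j = (SOME \<theta>. \<alpha> i j = \<omega> i j * cos \<theta> \<and> \<beta> i j = \<omega> i j * sin \<theta>)" for i j
    have pc: "\<alpha> i j = \<omega> i j * cos (\<theta> i j) \<and> \<beta> i j = \<omega> i j * sin (\<theta> i j)" for i j
      unfolding \<theta>_def by (rule someI_ex[OF \<omega>])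
    define T where "T i x = (\<Sum>j\<in>J. \<omega> i j * sqrt (fst (x j)) * cos (2 * pi * snd (x j) - \<theta> i j))" for i and x :: "'j \<Rightarrow> real \<times> real"
    have T: "(\<Sum>j\<in>J. \<alpha> i j * disk_x (x j) + \<beta> i j * disk_y (x j)) = T i x" for i x
      unfolding T_def disk_x_def disk_y_def cos_diff
      by (intro sum.cong refl) (simp only: pc[THEN conjunct1] pc[THEN conjunct2], simp add: algebra_simps)
    obtain P where P': "(\<forall>a\<in>?A. \<forall>b\<in>?A. P b a = cnj (P a b)) \<and> (\<forall>a\<in>?A. \<forall>b\<in>?A. (\<Sum>c\<in>?A. P a c * P c b) = P a b) \<and>
      (\<forall>i<N. \<forall>a\<in>?A. (\<Sum>b\<in>?A. P a b * (\<Prod>j\<in>J. cis (2 * real (b j) * \<theta> i j))) = 0) \<and> real (card ?A) - real N \<le> Re (\<Sum>a\<in>?A. P a a)"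
      using projection_killing_vectors[OF finite_index[OF J], of N "\<lambda>i b. \<Prod>j\<in>J. cis (2 * real (b j) * \<theta> i j)"] by (elim exE)
    note PA = P'[THEN conjunct1, rule_format] and PB = P'[THEN conjunct2, THEN conjunct1, rule_format]
      and PC = P'[THEN conjunct2, THEN conjunct2, THEN conjunct1, rule_format] and PD = P'[THEN conjunct2, THEN conjunct2, THEN conjunct2]
    define D where "D = real ((S + 1) ^ card J)"
    have D: "D > 0" "real (card ?A) = D" using J by (simp_all add: D_def card_PiE)
    \<comment> \<open>At most half as many vectors as the dimension are killed, so half of the trace
      is left.\<close>
    have tr: "D / 2 \<le> Re (\<Sum>a\<in>?A. P a a)"
    proof -
      have "2 * real N \<le> D" unfolding D_def using N by (metis of_nat_le_iff of_nat_mult of_nat_numeral)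
      then show ?thesis using PD D by simp
    qed
    let ?e = "\<lambda>x. \<Prod>j\<in>J. wave (int k) (fst (x j))" and ?G = "\<lambda>x. \<Sum>i<N. w i * complex_of_real (g i (T i x))"
    define \<nu> where "\<nu> = (LINT x|?M. norm (tests J P x))"
    have ie: "integrable ?M (\<lambda>x. ?e x * tests J P x)"
      by (rule integral_tests_prod(1)[OF J, of "\<lambda>j p. wave (int k) (fst p)"])
        (rule continuous_on_compose2[OF wave_continuous[of UNIV]], auto intro: continuous_intros)
    have ig: "integrable ?M (\<lambda>x. complex_of_real (g i (T i x)) * tests J P x)"
      "(LINT x|?M. complex_of_real (g i (T i x)) * tests J P x) = 0" if "i < N" for i
      using integral_tests_ridge[OF J g[OF that] PC[OF that], where \<omega> = "\<omega> i"] unfolding T_def by simp_all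
    have GG: "?G x * tests J P x = (\<Sum>i<N. w i * (complex_of_real (g i (T i x)) * tests J P x))" for x
      by (simp add: sum_distrib_right mult.assoc)
    have iG: "integrable ?M (\<lambda>x. ?G x * tests J P x)"
      unfolding GG using ig by (intro Bochner_Integration.integrable_sum integrable_mult_right) auto
    have G0: "(LINT x|?M. ?G x * tests J P x) = 0"
      unfolding GG using ig by (subst Bochner_Integration.integral_sum) (auto intro!: integrable_mult_right)
    have eG: "(LINT x|?M. ?e x * tests J P x) = (LINT x|?M. ?e x * tests J P x - ?G x * tests J P x)"
      unfolding Bochner_Integration.integral_diff[OF ie iG] G0 by simp
    have "mass ^ card J * (D / 2) \<le> mass ^ card J * Re (\<Sum>a\<in>?A. P a a)"
      using tr mass by (intro mult_left_mono) auto
    also have "\<dots> = Re (of_real (mass ^ card J) * (\<Sum>a\<in>?A. P a a))" by (rule Re_of_real_mult[symmetric])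
    also have "\<dots> = Re (LINT x|?M. ?e x * tests J P x)"
      unfolding integral_tests_wave[OF J c_def, of P] of_real_power ..
    also have "\<dots> \<le> norm (LINT x|?M. ?e x * tests J P x)" by (rule complex_Re_le_cmod)
    also have "\<dots> \<le> (LINT x|?M. norm (?e x * tests J P x - ?G x * tests J P x))"
      unfolding eG by (rule integral_norm_bound)
    also have "\<dots> \<le> (LINT x|?M. \<delta> * norm (tests J P x))"
    proof (rule integral_mono)
      show "integrable ?M (\<lambda>x. norm (?e x * tests J P x - ?G x * tests J P x))"
        by (intro integrable_norm Bochner_Integration.integrable_diff ie iG)
      show "integrable ?M (\<lambda>x. \<delta> * norm (tests J P x))" by (intro integrable_mult_right integrable_norm tests_integrable J)
      fix x assume x: "x \<in> space ?M"
      have "norm (?e x - ?G x) * norm (tests J P x) \<le> \<delta> * norm (tests J P x)"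
        using appr[OF x] unfolding T by (intro mult_right_mono) auto
      then show "norm (?e x * tests J P x - ?G x * tests J P x) \<le> \<delta> * norm (tests J P x)"
        by (simp only: left_diff_distrib[symmetric] norm_mult)
    qed
    also have "\<dots> = \<delta> * \<nu>" by (simp add: \<nu>_def)
    finally have main: "mass ^ card J * (D / 2) \<le> \<delta> * \<nu>" .
    have \<nu>: "\<nu>\<^sup>2 \<le> mass ^ card J * D\<^sup>2"
      unfolding \<nu>_def D_def by (rule norm_tests_le[OF J PA PB])
    have "0 < mass ^ card J" using mass by simp
    then have "0 < \<delta> * \<nu>" using main D(1) by (meson half_gt_zero less_le_trans mult_pos_pos)
    moreover have "0 \<le> \<nu>" unfolding \<nu>_def by (intro Bochner_Integration.integral_nonneg) simp
    ultimately have \<delta>: "0 < \<delta>" by (simp add: zero_less_mult_iff)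
    have "(mass ^ card J * (D / 2))\<^sup>2 \<le> (\<delta> * \<nu>)\<^sup>2"
      using main \<open>0 < mass ^ card J\<close> D(1) by (intro power_mono) auto
    also have "\<dots> \<le> \<delta>\<^sup>2 * (mass ^ card J * D\<^sup>2)" unfolding power_mult_distrib using \<nu> by (intro mult_left_mono) auto
    finally have "mass ^ card J * (mass ^ card J * D\<^sup>2) \<le> (2 * \<delta>)\<^sup>2 * (mass ^ card J * D\<^sup>2)"
      by (simp add: power_mult_distrib power_divide power2_eq_square algebra_simps)
    then have "mass ^ card J \<le> (2 * \<delta>)\<^sup>2"
      using \<open>0 < mass ^ card J\<close> D(1) by (simp add: mult_le_cancel_right)
    moreover have "(1 / 2) ^ card J \<le> mass ^ card J" using mass by (intro power_mono) auto
    ultimately have h: "(1 / 2) ^ card J \<le> (2 * \<delta>)\<^sup>2" by linarith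
    \<comment> \<open>Passing to the square of the left-hand side avoids a square root; the loss is
      a factor exponential in \<open>card J\<close>, which does not depend on
      \<open>S\<close>.\<close>
    have "((1 / 2 :: real) ^ card J)\<^sup>2 \<le> (1 / 2) ^ card J"
      by (simp add: power2_eq_square mult_left_le power_le_one)
    then have "((1 / 2 :: real) ^ card J)\<^sup>2 \<le> (2 * \<delta>)\<^sup>2" using h by linarith
    then show ?thesis using \<delta> by (intro power2_le_imp_le[of "(1 / 2) ^ card J" "2 * \<delta>"]) auto
  qed
  note key = this
  show ?thesis
  proof (intro bexI[OF _ k] allI impI)
    fix J :: "'j set" and N w \<alpha> \<beta> \<delta> and g :: "nat \<Rightarrow> real \<Rightarrow> real"
    assume a: "finite J" "2 * N \<le> (S + 1) ^ card J" "\<forall>i<N. continuous_on UNIV (g i)"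
      "\<forall>x\<in>space (disks_measure J). cmod ((\<Prod>j\<in>J. wave (int k) (fst (x j))) -
       (\<Sum>i<N. w i * complex_of_real (g i (\<Sum>j\<in>J. \<alpha> i j * disk_x (x j) + \<beta> i j * disk_y (x j))))) \<le> \<delta>"
    show "(1 / 2) ^ card J \<le> 2 * \<delta>"
      by (rule key[OF a(1,2) a(3)[rule_format] a(4)[rule_format]])
  qed
qed

subsection \<open>Waves as compositional functions\<close>

text \<open>Every partial derivative of a product of functions of one variable is again such a
  product. The factor \<open>u\<close> selects the real or the imaginary part.\<close>

lemma partial_derivatives_prod:
  fixes \<xi> :: "'i \<Rightarrow> nat \<Rightarrow> real \<Rightarrow> complex"
  assumes I: "finite I"
    and \<xi>: "\<And>i n t. i \<in> I \<Longrightarrow> (\<xi> i n has_vector_derivative \<xi> i (Suc n) t) (at t)"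
  shows "partial_derivatives I m (\<lambda>y. Re (u * (\<Prod>i\<in>I. \<xi> i 0 (y i)))) (\<lambda>k y. Re (u * (\<Prod>i\<in>I. \<xi> i (k i) (y i))))"
  unfolding partial_derivatives_def
proof (intro conjI ballI impI refl)
  fix k i x assume i: "i \<in> I"
  let ?r = "\<Prod>j\<in>I - {i}. \<xi> j (k j) (x j)"
  have split: "(\<Prod>j\<in>I. F j) = F i * (\<Prod>j\<in>I - {i}. F j)" for F :: "'i \<Rightarrow> complex"
    by (rule prod.remove[OF I i])
  have e1: "(\<Prod>j\<in>I. \<xi> j (k j) ((x(i := t)) j)) = \<xi> i (k i) t * ?r" for t
  proof -
    have "(\<Prod>j\<in>I - {i}. \<xi> j (k j) ((x(i := t)) j)) = ?r" by (intro prod.cong) auto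
    then show ?thesis unfolding split by simp
  qed
  have e2: "(\<Prod>j\<in>I. \<xi> j ((k(i := Suc (k i))) j) (x j)) = \<xi> i (Suc (k i)) (x i) * ?r"
  proof -
    have "(\<Prod>j\<in>I - {i}. \<xi> j ((k(i := Suc (k i))) j) (x j)) = ?r" by (intro prod.cong) auto
    then show ?thesis unfolding split by simp
  qed
  have "((\<lambda>t. u * (\<xi> i (k i) t * ?r)) has_vector_derivative u * (\<xi> i (Suc (k i)) (x i) * ?r)) (at (x i))"
    by (rule has_vector_derivative_mult_right[OF has_vector_derivative_mult_left[OF \<xi>[OF i]]])
  then have "((\<lambda>t. Re (u * (\<xi> i (k i) t * ?r))) has_vector_derivative Re (u * (\<xi> i (Suc (k i)) (x i) * ?r))) (at (x i) within {-1..1})"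
    by (rule bounded_linear.has_vector_derivative[OF bounded_linear_Re has_vector_derivative_at_within])
  then show "((\<lambda>t. Re (u * (\<Prod>j\<in>I. \<xi> j (k j) ((x(i := t)) j)))) has_real_derivative
      Re (u * (\<Prod>j\<in>I. \<xi> j ((k(i := Suc (k i))) j) (x j)))) (at (x i) within {-1..1})"
    unfolding e1 e2 has_real_derivative_iff_has_vector_derivative .
qed

lemma continuous_on_coordinate_prod:
  fixes \<xi> :: "'i \<Rightarrow> real \<Rightarrow> complex"
  assumes "\<And>i. i \<in> I \<Longrightarrow> continuous_on UNIV (\<xi> i)"
  shows "continuous_on S (\<lambda>y. Re (u * (\<Prod>i\<in>I. \<xi> i (y i))))"
proof -
  have "continuous_on S (\<lambda>y. \<xi> i (y i))" if "i \<in> I" for i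
    by (rule continuous_on_compose2[OF assms[OF that] continuous_on_subset[OF continuous_on_product_coordinates]]) auto
  then show ?thesis by (intro continuous_intros) auto
qed

lemma norm_prod_derivatives_le:
  fixes \<xi> :: "'i \<Rightarrow> nat \<Rightarrow> real \<Rightarrow> complex"
  assumes I: "finite I" and R: "1 \<le> R" and c: "1 \<le> c" and u: "norm u \<le> 1" and k: "k \<in> multi_indices I m"
    and b: "\<And>i n t. i \<in> I \<Longrightarrow> n \<le> m \<Longrightarrow> t \<in> {-1..1} \<Longrightarrow> norm (\<xi> i n t) \<le> c * R ^ n" and y: "y \<in> cube I"
  shows "\<bar>Re (u * (\<Prod>i\<in>I. \<xi> i (k i) (y i)))\<bar> \<le> c ^ card I * R ^ m"
proof -
  have km: "(\<Sum>i\<in>I. k i) \<le> m" using k by (simp add: multi_indices_def)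
  have "\<bar>Re (u * (\<Prod>i\<in>I. \<xi> i (k i) (y i)))\<bar> \<le> norm (u * (\<Prod>i\<in>I. \<xi> i (k i) (y i)))" by (rule abs_Re_le_cmod)
  also have "\<dots> \<le> 1 * norm (\<Prod>i\<in>I. \<xi> i (k i) (y i))" unfolding norm_mult using u by (intro mult_right_mono) auto
  also have "\<dots> = (\<Prod>i\<in>I. norm (\<xi> i (k i) (y i)))" by (simp add: prod_norm)
  also have "\<dots> \<le> (\<Prod>i\<in>I. c * R ^ k i)"
  proof (intro prod_mono conjI b)
    fix i assume i: "i \<in> I"
    then have "k i \<le> (\<Sum>i\<in>I. k i)" using I by (intro member_le_sum) auto
    then show "k i \<le> m" using km by simp
    show "y i \<in> {-1..1}" using y i by (auto simp: cube_def)
  qed auto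
  also have "\<dots> = c ^ card I * R ^ (\<Sum>i\<in>I. k i)" by (simp add: prod.distrib power_sum)
  also have "\<dots> \<le> c ^ card I * R ^ m" using R c km by (intro mult_left_mono power_increasing) auto
  finally show ?thesis .
qed

lemma W_I:
  assumes I: "finite I" and D: "partial_derivatives I m h D"
    and cont: "\<And>k. k \<in> multi_indices I m \<Longrightarrow> continuous_on (cube I) (D k)"
    and b: "\<And>k x. k \<in> multi_indices I m \<Longrightarrow> x \<in> cube I \<Longrightarrow> \<bar>D k x\<bar> \<le> B"
    and a: "0 \<le> a" "a * (B * real (card (multi_indices I m))) \<le> 1"
  shows "(\<lambda>x. a * h x) \<in> W m I"
proof -
  have "partial_derivatives I m (\<lambda>x. a * h x) (\<lambda>k x. a * D k x)"
    using D unfolding partial_derivatives_def by (auto intro!: DERIV_cmult)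
  moreover have "continuous_on (cube I) (\<lambda>x. a * D k x)" if "k \<in> multi_indices I m" for k
    using cont[OF that] by (intro continuous_intros)
  moreover have "(\<Sum>k\<in>multi_indices I m. sup_norm I (\<lambda>x. a * D k x)) \<le> (\<Sum>k\<in>multi_indices I m. a * B)"
  proof (intro sum_mono sup_norm_le)
    fix k x assume "k \<in> multi_indices I m" "x \<in> cube I"
    then show "\<bar>a * D k x\<bar> \<le> a * B" using b a(1) by (simp add: abs_mult mult_left_mono)
  qed
  ultimately show ?thesis
    unfolding W_def using a(2) by (intro CollectI exI[of _ "\<lambda>k x. a * D k x"] conjI ballI) (auto simp: mult_ac)
qed

lemma partial_derivatives_sum:
  assumes "\<And>e. e \<in> E \<Longrightarrow> partial_derivatives I m (h e) (D e)"
  shows "partial_derivatives I m (\<lambda>x. \<Sum>e\<in>E. h e x) (\<lambda>k x. \<Sum>e\<in>E. D e k x)"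
  using assms unfolding partial_derivatives_def by (auto intro!: DERIV_sum)

text \<open>Complex-valued, so that the lemmas on products apply to it as they do to the
  exponentials.\<close>

fun quadratic_deriv :: "real \<Rightarrow> real \<Rightarrow> nat \<Rightarrow> real \<Rightarrow> complex" where
  "quadratic_deriv a b 0 t = of_real (a * t + b * t\<^sup>2)"
| "quadratic_deriv a b (Suc 0) t = of_real (a + 2 * b * t)"
| "quadratic_deriv a b (Suc (Suc 0)) t = of_real (2 * b)"
| "quadratic_deriv a b (Suc (Suc (Suc n))) t = 0"

lemma has_vector_derivative_quadratic:
  "(quadratic_deriv a b n has_vector_derivative quadratic_deriv a b (Suc n) t) (at t)"
proof -
  have of_real: "((\<lambda>t. complex_of_real (F t)) has_vector_derivative complex_of_real F') (at t)"
    if "(F has_real_derivative F') (at t)" for F F'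
    using that by (intro has_vector_derivative_of_real) (simp add: has_real_derivative_iff_has_vector_derivative)
  consider "n = 0" | "n = Suc 0" | "n = Suc (Suc 0)" | k where "n = Suc (Suc (Suc k))"
    by (metis not0_implies_Suc)
  then show ?thesis
  proof cases
    case 1
    have q: "quadratic_deriv a b 0 = (\<lambda>t. complex_of_real (a * t + b * t\<^sup>2))" by (rule ext) simp
    have "((\<lambda>t. complex_of_real (a * t + b * t\<^sup>2)) has_vector_derivative complex_of_real (a + 2 * b * t)) (at t)"
      by (rule of_real) (auto intro!: derivative_eq_intros)
    then show ?thesis unfolding 1 q quadratic_deriv.simps .
  next
    case 2
    have q: "quadratic_deriv a b (Suc 0) = (\<lambda>t. complex_of_real (a + 2 * b * t))" by (rule ext) simp
    have "((\<lambda>t. complex_of_real (a + 2 * b * t)) has_vector_derivative complex_of_real (2 * b)) (at t)"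
      by (rule of_real) (auto intro!: derivative_eq_intros)
    then show ?thesis unfolding 2 q quadratic_deriv.simps .
  next
    case 3
    have q: "quadratic_deriv a b (Suc (Suc 0)) = (\<lambda>t. complex_of_real (2 * b))" by (rule ext) simp
    show ?thesis unfolding 3 q quadratic_deriv.simps by simp
  next
    case 4
    have "quadratic_deriv a b n = (\<lambda>t. 0)" by (rule ext) (simp add: 4)
    then show ?thesis by (simp add: 4)
  qed
qed

lemma norm_quadratic_deriv_le:
  assumes ab: "\<bar>a\<bar> + \<bar>b\<bar> \<le> 1" and t: "t \<in> {-1..1}"
  shows "norm (quadratic_deriv a b n t) \<le> 2"
proof -
  have t1: "\<bar>t\<bar> \<le> 1" using t by auto
  have at: "\<bar>a * t\<bar> \<le> \<bar>a\<bar>" "\<bar>b * t\<bar> \<le> \<bar>b\<bar>" using t1 by (simp_all add: abs_mult mult_left_le)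
  have "t\<^sup>2 \<le> 1" using t1 by (simp add: abs_square_le_1)
  then have bt: "\<bar>b * t\<^sup>2\<bar> \<le> \<bar>b\<bar>" by (simp add: abs_mult mult_left_le)
  have le: "\<bar>a * t + b * t\<^sup>2\<bar> \<le> 2" "\<bar>a + 2 * b * t\<bar> \<le> 2" "\<bar>2 * b\<bar> \<le> 2" using ab at bt by linarith+
  consider "n = 0" | "n = Suc 0" | "n = Suc (Suc 0)" | k where "n = Suc (Suc (Suc k))"
    by (metis not0_implies_Suc)
  then show ?thesis
  proof cases
    case 1
    show ?thesis unfolding 1 quadratic_deriv.simps norm_of_real by (rule le(1))
  next
    case 2
    show ?thesis unfolding 2 quadratic_deriv.simps norm_of_real by (rule le(2))
  next
    case 3
    show ?thesis unfolding 3 quadratic_deriv.simps norm_of_real by (rule le(3))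
  next
    case 4
    show ?thesis unfolding 4 quadratic_deriv.simps by simp
  qed
qed

lemma small_factor:
  fixes x :: real
  assumes "0 \<le> x"
  shows "0 < 1 / (x + 1)" "1 / (x + 1) * x \<le> 1"
  using assms by (simp_all add: field_simps)

lemma quadratic_in_W:
  fixes I :: "'i set"
  assumes I: "finite I"
  shows "\<exists>c>0. \<forall>\<alpha> \<beta>. (\<forall>e\<in>I. \<bar>\<alpha> e\<bar> + \<bar>\<beta> e\<bar> \<le> 1) \<longrightarrow> (\<lambda>y. c * (\<Sum>e\<in>I. \<alpha> e * y e + \<beta> e * (y e)\<^sup>2)) \<in> W m I"
proof -
  let ?B = "real (card I) * 2 ^ card I"
  let ?c = "1 / (?B * real (card (multi_indices I m)) + 1)"
  have c: "0 < ?c" "?c * (?B * real (card (multi_indices I m))) \<le> 1" by (intro small_factor; simp)+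
  have "(\<lambda>y. ?c * (\<Sum>e\<in>I. \<alpha> e * y e + \<beta> e * (y e)\<^sup>2)) \<in> W m I" if ab: "\<forall>e\<in>I. \<bar>\<alpha> e\<bar> + \<bar>\<beta> e\<bar> \<le> 1" for \<alpha> \<beta> :: "'i \<Rightarrow> real"
  proof -
    \<comment> \<open>A summand that depends on \<open>y e\<close> alone, written as a product with
      the constant 1 in the other variables.\<close>
    define \<xi> where "\<xi> e i n t = (if i = e then quadratic_deriv (\<alpha> e) (\<beta> e) n t else if n = 0 then 1 else 0)" for e i n t
    define D where "D e k y = Re (1 * (\<Prod>i\<in>I. \<xi> e i (k i) (y i)))" for e k y
    have deriv: "(\<xi> e i n has_vector_derivative \<xi> e i (Suc n) t) (at t)" for e i n t
      using has_vector_derivative_quadratic[of "\<alpha> e" "\<beta> e" n t] by (cases "i = e") (simp_all add: \<xi>_def[abs_def])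
    have ec: "continuous_on UNIV (\<xi> e i n)" for e i n
      using deriv by (intro continuous_at_imp_continuous_on ballI has_vector_derivative_continuous)
    have pd: "partial_derivatives I m (\<lambda>y. \<Sum>e\<in>I. Re (1 * (\<Prod>i\<in>I. \<xi> e i 0 (y i)))) (\<lambda>k y. \<Sum>e\<in>I. D e k y)"
      unfolding D_def by (intro partial_derivatives_sum partial_derivatives_prod I deriv)
    have "(\<lambda>x. ?c * (\<Sum>e\<in>I. Re (1 * (\<Prod>i\<in>I. \<xi> e i 0 (x i))))) \<in> W m I"
    proof (rule W_I[OF I pd])
      show "continuous_on (cube I) (\<lambda>y. \<Sum>e\<in>I. D e k y)" for k
        unfolding D_def by (intro continuous_on_sum continuous_on_coordinate_prod ec)
      fix k x assume k: "k \<in> multi_indices I m" and x: "x \<in> cube I"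
      have "\<bar>D e k x\<bar> \<le> 2 ^ card I" if e: "e \<in> I" for e
      proof -
        have "norm (\<xi> e i n t) \<le> 2 * 1 ^ n" if "t \<in> {-1..1}" for i n t
          using norm_quadratic_deriv_le[OF ab[rule_format, OF e] that, of n] by (simp add: \<xi>_def)
        then show ?thesis unfolding D_def
          using norm_prod_derivatives_le[OF I, of 1 2 1 k m "\<xi> e" x] k x by simp
      qed
      then have "\<bar>\<Sum>e\<in>I. D e k x\<bar> \<le> (\<Sum>e\<in>I. 2 ^ card I)" by (intro order_trans[OF sum_abs] sum_mono)
      then show "\<bar>\<Sum>e\<in>I. D e k x\<bar> \<le> ?B" by simp
    qed (use c in auto)
    moreover have "Re (1 * (\<Prod>i\<in>I. \<xi> e i 0 (y i))) = \<alpha> e * y e + \<beta> e * (y e)\<^sup>2" if e: "e \<in> I" for e y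
    proof -
      have "(\<Prod>i\<in>I. \<xi> e i 0 (y i)) = \<xi> e e 0 (y e) * (\<Prod>i\<in>I - {e}. \<xi> e i 0 (y i))" by (rule prod.remove[OF I e])
      also have "(\<Prod>i\<in>I - {e}. \<xi> e i 0 (y i)) = 1" by (intro prod.neutral) (auto simp: \<xi>_def)
      finally show ?thesis by (simp add: \<xi>_def)
    qed
    ultimately show ?thesis by (simp cong: sum.cong)
  qed
  then show ?thesis using c(1) by (intro exI[of _ ?c] conjI allI impI)
qed

text \<open>Leibniz rule for the derivatives of \<open>p' * exp p\<close> with \<open>p\<close>
  quadratic: beyond \<open>p''\<close> nothing is left, so only the two preceding derivatives
  enter.\<close>

fun exp_quadratic_deriv :: "complex \<Rightarrow> complex \<Rightarrow> nat \<Rightarrow> real \<Rightarrow> complex" where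
  "exp_quadratic_deriv a b 0 t = exp (a * of_real t + b * of_real t ^ 2)"
| "exp_quadratic_deriv a b (Suc n) t = (a + 2 * b * of_real t) * exp_quadratic_deriv a b n t +
     of_nat n * (2 * b) * (case n of 0 \<Rightarrow> 0 | Suc n' \<Rightarrow> exp_quadratic_deriv a b n' t)"

lemma has_vector_derivative_exp_quadratic:
  "(exp_quadratic_deriv a b n has_vector_derivative exp_quadratic_deriv a b (Suc n) t) (at t)"
proof (induction n rule: less_induct)
  case (less n)
  have lin: "((\<lambda>t. a + 2 * b * complex_of_real t) has_vector_derivative 2 * b) (at t)"
    by (rule has_vector_derivative_real_field[of "\<lambda>z. a + 2 * b * z"]) (auto intro!: derivative_eq_intros)
  show ?case
  proof (cases n)
    case 0
    have e: "((\<lambda>z. exp (a * z + b * z ^ 2)) has_field_derivative exp (a * of_real t + b * of_real t ^ 2) * (a + 2 * b * of_real t)) (at (of_real t))"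
      by (auto intro!: derivative_eq_intros simp: algebra_simps)
    have "((\<lambda>t. exp (a * complex_of_real t + b * complex_of_real t ^ 2)) has_vector_derivative
        exp (a * of_real t + b * of_real t ^ 2) * (a + 2 * b * of_real t)) (at t)"
      by (rule has_vector_derivative_real_field[OF e])
    moreover have "exp_quadratic_deriv a b 0 = (\<lambda>t. exp (a * complex_of_real t + b * complex_of_real t ^ 2))" by (rule ext) simp
    ultimately show ?thesis by (simp add: 0 mult.commute)
  next
    case (Suc k)
    have eq: "exp_quadratic_deriv a b n = (\<lambda>t. (a + 2 * b * of_real t) * exp_quadratic_deriv a b k t +
      of_nat k * (2 * b) * (case k of 0 \<Rightarrow> 0 | Suc k' \<Rightarrow> exp_quadratic_deriv a b k' t))" by (rule ext) (simp add: Suc)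
    have d1: "(exp_quadratic_deriv a b k has_vector_derivative exp_quadratic_deriv a b n t) (at t)"
      using less[of k] Suc by simp
    have d2: "((\<lambda>t. of_nat k * (2 * b) * (case k of 0 \<Rightarrow> 0 | Suc k' \<Rightarrow> exp_quadratic_deriv a b k' t)) has_vector_derivative
      of_nat k * (2 * b) * exp_quadratic_deriv a b k t) (at t)"
    proof (cases k)
      case (Suc k')
      have "(exp_quadratic_deriv a b k' has_vector_derivative exp_quadratic_deriv a b k t) (at t)"
        using less[of k'] Suc \<open>n = Suc k\<close> by simp
      then show ?thesis unfolding Suc nat.case by (rule has_vector_derivative_mult_right)
    qed simp
    have s: "exp_quadratic_deriv a b (Suc n) t = (a + 2 * b * of_real t) * exp_quadratic_deriv a b n t + 2 * b * exp_quadratic_deriv a b k t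
       + of_nat k * (2 * b) * exp_quadratic_deriv a b k t"
      unfolding Suc by (subst exp_quadratic_deriv.simps(2)) (simp only: nat.case of_nat_Suc distrib_right mult_1_left add.assoc)
    show ?thesis unfolding s
      by (subst eq, rule has_vector_derivative_add[OF has_vector_derivative_mult[OF lin d1] d2])
  qed
qed

text \<open>A step of the recursion has weight at most \<open>2 * K + k * (2 * K)\<close> with
  \<open>k < m\<close>, which explains the factor \<open>2 * (m + 1) * K\<close> per order.\<close>

lemma norm_exp_quadratic_deriv_le:
  assumes ab: "\<bar>\<alpha>\<bar> + \<bar>\<beta>\<bar> \<le> 1" and t: "t \<in> {-1..1}" and K: "1 \<le> K" and n: "n \<le> m"
  shows "norm (exp_quadratic_deriv (\<i> * of_real (K * \<alpha>)) (\<i> * of_real (K * \<beta>)) n t) \<le> (2 * real (m + 1) * K) ^ n"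
  using n
proof (induction n rule: less_induct)
  case (less n)
  let ?a = "\<i> * of_real (K * \<alpha>)" and ?b = "\<i> * of_real (K * \<beta>)"
  let ?E = "exp_quadratic_deriv ?a ?b" and ?c = "2 * real (m + 1) * K"
  have t1: "\<bar>t\<bar> \<le> 1" using t by auto
  have "1 * 1 \<le> ?c" using K by (intro mult_mono) auto
  then have c1: "1 \<le> ?c" by simp
  have nb: "norm (2 * ?b) \<le> 2 * K" using ab K by (simp add: norm_mult abs_mult)
  have na: "norm (?a + 2 * ?b * of_real t) \<le> 2 * K"
  proof -
    have "norm (?a + 2 * ?b * of_real t) \<le> norm ?a + norm (2 * ?b * of_real t)" by (rule norm_triangle_ineq)
    also have "\<dots> = K * \<bar>\<alpha>\<bar> + 2 * K * \<bar>\<beta>\<bar> * \<bar>t\<bar>" using K by (simp add: norm_mult abs_mult)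
    also have "\<dots> \<le> K * \<bar>\<alpha>\<bar> + 2 * K * \<bar>\<beta>\<bar> * 1" using K t1 by (intro add_left_mono mult_left_mono) auto
    also have "\<dots> \<le> 2 * (K * (\<bar>\<alpha>\<bar> + \<bar>\<beta>\<bar>))" using K by (simp add: algebra_simps)
    also have "\<dots> \<le> 2 * (K * 1)" using K ab by (intro mult_left_mono) auto
    finally show ?thesis by simp
  qed
  show ?case
  proof (cases n)
    case 0
    have "?E 0 t = cis (K * \<alpha> * t + K * \<beta> * t ^ 2)" by (simp add: cis_conv_exp algebra_simps)
    then show ?thesis unfolding 0 by (simp only: norm_cis power_0 order_refl)
  next
    case (Suc k)
    have Ek: "norm (?E k t) \<le> ?c ^ k" using less(1)[of k] less(2) Suc by simp
    have Ek': "norm (case k of 0 \<Rightarrow> 0 | Suc k' \<Rightarrow> ?E k' t) \<le> ?c ^ k"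
    proof (cases k)
      case (Suc k')
      have "norm (?E k' t) \<le> ?c ^ k'" using less(1)[of k'] less(2) Suc \<open>n = Suc k\<close> by simp
      also have "\<dots> \<le> ?c ^ k" using c1 Suc by (intro power_increasing) auto
      finally show ?thesis by (simp only: Suc nat.case)
    qed simp
    have "norm (?E n t) \<le> norm ((?a + 2 * ?b * of_real t) * ?E k t) + norm (of_nat k * (2 * ?b) * (case k of 0 \<Rightarrow> 0 | Suc k' \<Rightarrow> ?E k' t))"
      unfolding Suc exp_quadratic_deriv.simps by (rule norm_triangle_ineq)
    also have "\<dots> = norm (?a + 2 * ?b * of_real t) * norm (?E k t) + real k * (norm (2 * ?b) * norm (case k of 0 \<Rightarrow> 0 | Suc k' \<Rightarrow> ?E k' t))"
      by (simp only: norm_mult norm_of_nat mult.assoc)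
    also have "\<dots> \<le> (2 * K) * ?c ^ k + real k * ((2 * K) * ?c ^ k)"
      using K c1 by (intro add_mono mult_mono mult_left_mono na nb Ek Ek') auto
    also have "\<dots> = (real k + 1) * (2 * K * ?c ^ k)" by (simp add: algebra_simps)
    also have "\<dots> \<le> real (m + 1) * (2 * K * ?c ^ k)"
      using less(2) Suc K c1 by (intro mult_right_mono) auto
    also have "\<dots> = ?c ^ n" unfolding Suc power_Suc by (simp only: mult_ac)
    finally show ?thesis .
  qed
qed

text \<open>The constant \<open>c\<close> does not depend on the frequency. The phase has linear and
  quadratic terms because the sink may be fed by sources, whose values it must square, and by inner
  nodes, whose values it takes as they are.\<close>

lemma wave_in_W:
  fixes I :: "'i set"
  assumes I: "finite I"
  shows "\<exists>c>0. \<forall>K\<ge>1. \<forall>\<alpha> \<beta> u. (\<forall>e\<in>I. \<bar>\<alpha> e\<bar> + \<bar>\<beta> e\<bar> \<le> 1) \<longrightarrow> norm u \<le> 1 \<longrightarrow>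
    (\<lambda>y. c / K ^ m * Re (u * cis (K * (\<Sum>e\<in>I. \<alpha> e * y e + \<beta> e * (y e)\<^sup>2)))) \<in> W m I"
proof -
  let ?M = "real (card (multi_indices I m))"
  let ?c = "1 / ((2 * real (m + 1)) ^ m * ?M + 1)"
  have c: "0 < ?c" "?c * ((2 * real (m + 1)) ^ m * ?M) \<le> 1" by (intro small_factor; simp)+
  have "(\<lambda>y. ?c / K ^ m * Re (u * cis (K * (\<Sum>e\<in>I. \<alpha> e * y e + \<beta> e * (y e)\<^sup>2)))) \<in> W m I"
    if K: "1 \<le> K" and ab: "\<forall>e\<in>I. \<bar>\<alpha> e\<bar> + \<bar>\<beta> e\<bar> \<le> 1" and u: "norm u \<le> 1" for K u and \<alpha> \<beta> :: "'i \<Rightarrow> real"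
  proof -
    define \<xi> where "\<xi> e = exp_quadratic_deriv (\<i> * of_real (K * \<alpha> e)) (\<i> * of_real (K * \<beta> e))" for e
    have deriv: "(\<xi> e n has_vector_derivative \<xi> e (Suc n) t) (at t)" for e n t
      unfolding \<xi>_def by (rule has_vector_derivative_exp_quadratic)
    have ec: "continuous_on UNIV (\<xi> e n)" for e n
      using deriv by (intro continuous_at_imp_continuous_on ballI has_vector_derivative_continuous)
    have pd: "partial_derivatives I m (\<lambda>y. Re (u * (\<Prod>i\<in>I. \<xi> i 0 (y i)))) (\<lambda>k y. Re (u * (\<Prod>i\<in>I. \<xi> i (k i) (y i))))"
      by (intro partial_derivatives_prod I deriv)
    have "(\<lambda>y. ?c / K ^ m * Re (u * (\<Prod>e\<in>I. \<xi> e 0 (y e)))) \<in> W m I"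
    proof (rule W_I[OF I pd])
      show "continuous_on (cube I) (\<lambda>y. Re (u * (\<Prod>i\<in>I. \<xi> i (k i) (y i))))" for k
        by (intro continuous_on_coordinate_prod ec)
      show "\<bar>Re (u * (\<Prod>i\<in>I. \<xi> i (k i) (x i)))\<bar> \<le> 1 ^ card I * (2 * real (m + 1) * K) ^ m"
        if "k \<in> multi_indices I m" "x \<in> cube I" for k x
      proof (rule norm_prod_derivatives_le[OF I _ _ u that(1) _ that(2)])
        have "1 * 1 \<le> 2 * real (m + 1) * K" using K by (intro mult_mono) auto
        then show "1 \<le> 2 * real (m + 1) * K" by simp
        show "norm (\<xi> i n t) \<le> 1 * (2 * real (m + 1) * K) ^ n" if "i \<in> I" "n \<le> m" "t \<in> {-1..1}" for i n t
          unfolding \<xi>_def using norm_exp_quadratic_deriv_le[OF ab[rule_format, OF that(1)] that(3) K that(2)] by simp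
      qed simp
      show "0 \<le> ?c / K ^ m" using c(1) K by simp
      have "?c / K ^ m * (1 ^ card I * (2 * real (m + 1) * K) ^ m * ?M) = ?c * ((2 * real (m + 1)) ^ m * ?M)"
        using K by (simp add: power_mult_distrib)
      then show "?c / K ^ m * (1 ^ card I * (2 * real (m + 1) * K) ^ m * ?M) \<le> 1" using c(2) by simp
    qed
    moreover have "(\<Prod>e\<in>I. \<xi> e 0 (y e)) = cis (K * (\<Sum>e\<in>I. \<alpha> e * y e + \<beta> e * (y e)\<^sup>2))" for y
    proof -
      have "(\<Prod>e\<in>I. \<xi> e 0 (y e)) = (\<Prod>e\<in>I. exp (\<i> * of_real (K * (\<alpha> e * y e + \<beta> e * (y e)\<^sup>2))))"
        unfolding \<xi>_def by (simp add: algebra_simps)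
      also have "\<dots> = exp (\<Sum>e\<in>I. \<i> * of_real (K * (\<alpha> e * y e + \<beta> e * (y e)\<^sup>2)))" by (rule exp_sum[OF I, symmetric])
      also have "\<dots> = cis (K * (\<Sum>e\<in>I. \<alpha> e * y e + \<beta> e * (y e)\<^sup>2))"
        by (simp add: cis_conv_exp sum_distrib_left)
      finally show ?thesis .
    qed
    ultimately show ?thesis by simp
  qed
  then show ?thesis using c(1) by (intro exI[of _ ?c] conjI allI impI)
qed

section \<open>Paths to the sink\<close>

lemma sink_induct:
  assumes G: "compositional_graph G m" and v: "v \<in> verts G" and P: "P v"
    and step: "\<And>u w. (u, w) \<in> arcs_ends G \<Longrightarrow> P u \<Longrightarrow> P w"
  shows "P (the_elem (sinks G))"
proof -
  note GD = compositional_graphD[OF G]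
  interpret fin_digraph G by (rule GD(1))
  have "finite (arcs_ends G)" by (simp add: arcs_ends_def)
  \<comment> \<open>A walk along out-edges has to end, and it can end only in the unique
    sink.\<close>
  then have "wf ((arcs_ends G)\<inverse>)" using GD(2) by (rule finite_acyclic_wf_converse)
  then have "v \<in> verts G \<longrightarrow> P v \<longrightarrow> P (the_elem (sinks G))"
  proof (induction v rule: wf_induct_rule)
    case (less v)
    show ?case
    proof (intro impI)
      assume v: "v \<in> verts G" "P v"
      show "P (the_elem (sinks G))"
      proof (cases "v \<in> sinks G")
        case True
        then have "v = the_elem (sinks G)" using GD(4) by auto
        then show ?thesis using v(2) by simp
      next
        case False
        then have "out_arcs G v \<noteq> {}" using v(1) by (auto simp: sinks_def out_degree_def)
        then obtain e where "e \<in> out_arcs G v" by blast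
        then have e: "e \<in> arcs G" "tail G e = v" by simp_all
        then have a: "(v, head G e) \<in> arcs_ends G" by (auto simp: arcs_ends_conv)
        then have "(head G e, v) \<in> (arcs_ends G)\<inverse>" by simp
        from less[OF this] show ?thesis using step[OF a v(2)] e(1) by simp
      qed
    qed
  qed
  then show ?thesis using v P by simp
qed

lemma head_inner:
  assumes "compositional_graph G m" "(u, w) \<in> arcs_ends G"
  shows "w \<in> inner_nodes G"
proof -
  interpret fin_digraph G by (rule compositional_graphD(1)[OF assms(1)])
  obtain e where e: "e \<in> arcs G" "head G e = w" using assms(2) by (auto simp: arcs_ends_conv)
  then have "e \<in> in_arcs G w" by simp
  then have "in_degree G w \<noteq> 0" unfolding in_degree_def using finite_in_arcs by (metis card_0_eq empty_iff)
  then show ?thesis using e by (auto simp: inner_nodes_def sources_def)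
qed

lemma sink_inner:
  assumes G: "compositional_graph G m"
  shows "the_elem (sinks G) \<in> inner_nodes G"
proof -
  obtain v where v: "v \<in> inner_nodes G" using compositional_graphD(5)[OF G] by blast
  then have "v \<in> verts G" by (simp add: inner_nodes_def)
  then show ?thesis by (rule sink_induct[OF G, of v "\<lambda>v. v \<in> inner_nodes G"]) (fact v, erule head_inner[OF G])
qed

lemma tail_not_sink:
  assumes G: "compositional_graph G m" and e: "e \<in> in_arcs G v"
  shows "tail G e \<noteq> the_elem (sinks G)"
proof
  assume t: "tail G e = the_elem (sinks G)"
  interpret fin_digraph G by (rule compositional_graphD(1)[OF G])
  have "the_elem (sinks G) \<in> sinks G" using compositional_graphD(4)[OF G] by auto
  then have "out_arcs G (tail G e) = {}" using t finite_out_arcs by (simp add: sinks_def out_degree_def)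
  moreover have "e \<in> out_arcs G (tail G e)" using e by simp
  ultimately show False by blast
qed

text \<open>Sum of the products of the weights \<open>c\<close> along the paths from the source \<open>i\<close> to a node.\<close>

definition path_weight :: "('v, 'e) pre_digraph \<Rightarrow> ('v \<Rightarrow> real) \<Rightarrow> 'v \<Rightarrow> 'v \<Rightarrow> real" where
  "path_weight G c i = node_value G (\<lambda>v y. c v * (\<Sum>e\<in>in_arcs G v. y e)) (\<lambda>j. if j = i then 1 else 0)"

lemma path_weight_source: "v \<in> sources G \<Longrightarrow> path_weight G c i v = (if v = i then 1 else 0)"
  by (simp add: path_weight_def node_value_source)

lemma path_weight_inner:
  assumes "compositional_graph G m" "v \<in> inner_nodes G"
  shows "path_weight G c i v = c v * (\<Sum>e\<in>in_arcs G v. path_weight G c i (tail G e))"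
  unfolding path_weight_def using compositional_graphD(1,2)[OF assms(1)] assms(2) by (subst node_value_inner) auto

lemma path_weight_nonneg:
  assumes G: "compositional_graph G m" and c: "\<And>v. 0 < c v" and v: "v \<in> verts G"
  shows "0 \<le> path_weight G c i v"
  using v
proof (induction v rule: node_induct[OF compositional_graphD(1,2)[OF G]])
  case (1 v)
  show ?case
  proof (cases "v \<in> sources G")
    case False
    then have "v \<in> inner_nodes G" using 1(2) by (simp add: inner_nodes_def)
    moreover have "0 \<le> path_weight G c i (tail G e)" if "e \<in> in_arcs G v" for e
      by (rule 1(1)[OF in_arcs_tail[OF compositional_graphD(1)[OF G] that]])
    then have "0 \<le> (\<Sum>e\<in>in_arcs G v. path_weight G c i (tail G e))" by (rule sum_nonneg)
    ultimately show ?thesis using path_weight_inner[OF G] c[of v] by simp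
  qed (simp add: path_weight_source)
qed

text \<open>Every source influences the sink; otherwise its variable would be missing in the phase
  of the wave.\<close>

lemma path_weight_sink_pos:
  assumes G: "compositional_graph G m" and c: "\<And>v. 0 < c v" and i: "i \<in> sources G"
  shows "0 < path_weight G c i (the_elem (sinks G))"
proof (rule sink_induct[OF G, of i "\<lambda>v. 0 < path_weight G c i v"])
  show "i \<in> verts G" using i by (simp add: sources_def)
  show "0 < path_weight G c i i" using i by (simp add: path_weight_source)
  fix u w assume uw: "(u, w) \<in> arcs_ends G" and u: "0 < path_weight G c i u"
  interpret fin_digraph G by (rule compositional_graphD(1)[OF G])
  obtain e where e: "e \<in> in_arcs G w" "tail G e = u" using uw by (auto simp: arcs_ends_conv)
  have "0 < (\<Sum>e\<in>in_arcs G w. path_weight G c i (tail G e))"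
    by (rule sum_pos2[OF _ e(1)]) (use e(2) u path_weight_nonneg[OF G c] in \<open>auto\<close>)
  then show "0 < path_weight G c i w"
    unfolding path_weight_inner[OF G head_inner[OF G uw]] using c[of w] by simp
qed

lemma sum_restrict: "(\<Sum>e\<in>A. F e (restrict g A e)) = (\<Sum>e\<in>A. F e (g e))"
  by (intro sum.cong) auto

text \<open>A value is squared on edges that leave a source and only added up from there on. The
  statement is about the sum over in-edges and not about the value of a node, because at the sink
  this sum is the phase of the wave.\<close>

lemma node_value_sum_of_squares:
  assumes G: "compositional_graph G m"
    and \<alpha>: "\<And>e. \<alpha> e = (if tail G e \<in> sources G then 0 else 1)"
    and \<beta>: "\<And>e. \<beta> e = (if tail G e \<in> sources G then l (tail G e) else 0)"
    and h: "\<And>v y. v \<in> inner_nodes G \<Longrightarrow> v \<noteq> the_elem (sinks G) \<Longrightarrow>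
      h v y = c v * (\<Sum>e\<in>in_arcs G v. \<alpha> e * y e + \<beta> e * (y e)\<^sup>2)"
  shows "\<And>v. (\<Sum>e\<in>in_arcs G v. \<alpha> e * node_value G h x (tail G e) + \<beta> e * (node_value G h x (tail G e))\<^sup>2) =
    (\<Sum>i\<in>sources G. (\<Sum>e\<in>in_arcs G v. path_weight G c i (tail G e)) * (l i * (x i)\<^sup>2))"
proof -
  note GD = compositional_graphD[OF G]
  interpret fin_digraph G by (rule GD(1))
  have key: "(if v \<in> sources G then l v * (x v)\<^sup>2 else node_value G h x v) = (\<Sum>i\<in>sources G. path_weight G c i v * (l i * (x i)\<^sup>2))"
    if "v \<in> verts G" "v \<noteq> the_elem (sinks G)" for v
    using that
  proof (induction v rule: node_induct[OF GD(1,2)])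
    case (1 v)
    show ?case
    proof (cases "v \<in> sources G")
      case True
      have "(\<Sum>i\<in>sources G. path_weight G c i v * (l i * (x i)\<^sup>2)) = (\<Sum>i\<in>sources G. if v = i then l i * (x i)\<^sup>2 else 0)"
        using True by (intro sum.cong refl) (simp add: path_weight_source)
      also have "\<dots> = l v * (x v)\<^sup>2" using True GD(7) by simp
      finally show ?thesis using True by simp
    next
      case False
      then have v: "v \<in> inner_nodes G" using 1(2) by (simp add: inner_nodes_def)
      have IH: "(if tail G e \<in> sources G then l (tail G e) * (x (tail G e))\<^sup>2 else node_value G h x (tail G e)) =
          (\<Sum>i\<in>sources G. path_weight G c i (tail G e) * (l i * (x i)\<^sup>2))" if e: "e \<in> in_arcs G v" for e
        by (rule 1(1)) (use in_arcs_tail[OF GD(1) e] tail_not_sink[OF G e] in auto)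
      have "node_value G h x v = c v * (\<Sum>e\<in>in_arcs G v. \<alpha> e * node_value G h x (tail G e) + \<beta> e * (node_value G h x (tail G e))\<^sup>2)"
        unfolding node_value_inner[OF GD(1,2) v] h[OF v 1(3)] sum_restrict[of "\<lambda>e z. \<alpha> e * z + \<beta> e * z\<^sup>2"] ..
      also have "\<dots> = c v * (\<Sum>e\<in>in_arcs G v. \<Sum>i\<in>sources G. path_weight G c i (tail G e) * (l i * (x i)\<^sup>2))"
      proof (intro arg_cong[where f = "(*) (c v)"] sum.cong refl)
        fix e assume "e \<in> in_arcs G v"
        from IH[OF this] show "\<alpha> e * node_value G h x (tail G e) + \<beta> e * (node_value G h x (tail G e))\<^sup>2 =
            (\<Sum>i\<in>sources G. path_weight G c i (tail G e) * (l i * (x i)\<^sup>2))"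
          by (cases "tail G e \<in> sources G") (simp_all add: \<alpha> \<beta> node_value_source)
      qed
      also have "\<dots> = c v * (\<Sum>i\<in>sources G. \<Sum>e\<in>in_arcs G v. path_weight G c i (tail G e) * (l i * (x i)\<^sup>2))"
        by (subst sum.swap) (rule refl)
      also have "\<dots> = (\<Sum>i\<in>sources G. path_weight G c i v * (l i * (x i)\<^sup>2))"
        unfolding path_weight_inner[OF G v] by (simp add: sum_distrib_left sum_distrib_right mult.assoc)
      finally show ?thesis using False by simp
    qed
  qed
  show "(\<Sum>e\<in>in_arcs G v. \<alpha> e * node_value G h x (tail G e) + \<beta> e * (node_value G h x (tail G e))\<^sup>2) =
    (\<Sum>i\<in>sources G. (\<Sum>e\<in>in_arcs G v. path_weight G c i (tail G e)) * (l i * (x i)\<^sup>2))" for v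
  proof -
    have "(\<Sum>e\<in>in_arcs G v. \<alpha> e * node_value G h x (tail G e) + \<beta> e * (node_value G h x (tail G e))\<^sup>2) =
      (\<Sum>e\<in>in_arcs G v. \<Sum>i\<in>sources G. path_weight G c i (tail G e) * (l i * (x i)\<^sup>2))"
    proof (intro sum.cong refl)
      fix e assume e: "e \<in> in_arcs G v"
      show "\<alpha> e * node_value G h x (tail G e) + \<beta> e * (node_value G h x (tail G e))\<^sup>2 =
            (\<Sum>i\<in>sources G. path_weight G c i (tail G e) * (l i * (x i)\<^sup>2))"
        using key[OF in_arcs_tail(2)[OF GD(1) e] tail_not_sink[OF G e]]
        by (cases "tail G e \<in> sources G") (simp_all add: \<alpha> \<beta> node_value_source)
    qed
    also have "\<dots> = (\<Sum>i\<in>sources G. \<Sum>e\<in>in_arcs G v. path_weight G c i (tail G e) * (l i * (x i)\<^sup>2))" by (rule sum.swap)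
    finally show ?thesis by (simp add: sum_distrib_right)
  qed
qed

text \<open>Sources reach the sink along different paths, so their squares would arrive with unequal
  coefficients \<open>q i\<close>. Scaling the squares by \<open>\<mu> / q i\<close> at the edges
  that leave the sources equalises them.\<close>

lemma waves_are_compositional:
  assumes G: "compositional_graph (G :: ('v, 'e) pre_digraph) m"
  shows "\<exists>a>0. \<forall>k u. 1 \<le> k \<longrightarrow> norm u \<le> 1 \<longrightarrow> (\<exists>f\<in>compositional_functions G m. \<forall>x.
    f x = a / real k ^ m (the_elem (sinks G)) * Re (u * cis (2 * pi * real k * (\<Sum>i\<in>sources G. (x i)\<^sup>2))))"
proof -
  note GD = compositional_graphD[OF G]
  interpret fin_digraph G by (rule GD(1))
  define s where "s = the_elem (sinks G)"
  have s: "s \<in> inner_nodes G" unfolding s_def by (rule sink_inner[OF G])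
  have fin: "finite (in_arcs G v)" for v by (rule finite_in_arcs)
  have "\<forall>v. \<exists>c>0. \<forall>\<alpha> \<beta>. (\<forall>e\<in>in_arcs G v. \<bar>\<alpha> e\<bar> + \<bar>\<beta> e\<bar> \<le> 1) \<longrightarrow>
      (\<lambda>y. c * (\<Sum>e\<in>in_arcs G v. \<alpha> e * y e + \<beta> e * (y e)\<^sup>2)) \<in> W (m v) (in_arcs G v)"
    by (intro allI quadratic_in_W fin)
  from choice[OF this] obtain c0 where c0: "\<forall>v. 0 < c0 v \<and> (\<forall>\<alpha> \<beta>. (\<forall>e\<in>in_arcs G v. \<bar>\<alpha> e\<bar> + \<bar>\<beta> e\<bar> \<le> 1) \<longrightarrow>
      (\<lambda>y. c0 v * (\<Sum>e\<in>in_arcs G v. \<alpha> e * y e + \<beta> e * (y e)\<^sup>2)) \<in> W (m v) (in_arcs G v))"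
    by (elim exE)
  \<comment> \<open>The constituent at the sink is the wave. Weight 1 there makes \<open>q i\<close>
    the coefficient that arrives in its phase.\<close>
  define c where "c = c0(s := 1)"
  have c: "0 < c v" for v using c0 by (simp add: c_def)
  obtain a0 where a0: "a0 > 0 \<and> (\<forall>K\<ge>1. \<forall>\<alpha> \<beta> u. (\<forall>e\<in>in_arcs G s. \<bar>\<alpha> e\<bar> + \<bar>\<beta> e\<bar> \<le> 1) \<longrightarrow> norm u \<le> 1 \<longrightarrow>
    (\<lambda>y. a0 / K ^ m s * Re (u * cis (K * (\<Sum>e\<in>in_arcs G s. \<alpha> e * y e + \<beta> e * (y e)\<^sup>2)))) \<in> W (m s) (in_arcs G s))"
    using wave_in_W[OF fin, of s "m s"] by (elim exE)
  define q where "q i = path_weight G c i s" for i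
  have q: "0 < q i" if "i \<in> sources G" for i unfolding q_def s_def by (rule path_weight_sink_pos[OF G c that])
  have qs: "q i = (\<Sum>e\<in>in_arcs G s. path_weight G c i (tail G e))" for i
    unfolding q_def path_weight_inner[OF G s] by (simp add: c_def)
  \<comment> \<open>At most every \<open>q i\<close>, so that the coefficients
    \<open>\<mu> / q i\<close> are at most 1; and at most 1 itself, which gives
    \<open>K \<ge> 1\<close> below.\<close>
  define \<mu> where "\<mu> = Min (insert 1 (q ` sources G))"
  have \<mu>: "0 < \<mu>" "\<mu> \<le> 1" "\<And>i. i \<in> sources G \<Longrightarrow> \<mu> \<le> q i"
    unfolding \<mu>_def using GD(7) q by (auto simp: Min_gr_iff)
  define l where "l i = \<mu> / q i" for i
  define \<alpha> where "\<alpha> e = (if tail G e \<in> sources G then 0 else 1 :: real)" for e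
  define \<beta> where "\<beta> e = (if tail G e \<in> sources G then l (tail G e) else 0)" for e
  have ab: "\<forall>e\<in>in_arcs G v. \<bar>\<alpha> e\<bar> + \<bar>\<beta> e\<bar> \<le> 1" for v
    using \<mu> q by (auto simp: \<alpha>_def \<beta>_def l_def field_simps)
  define a where "a = a0 * (\<mu> / (2 * pi)) ^ m s"
  have "\<exists>f\<in>compositional_functions G m. \<forall>x. f x = a / real k ^ m s * Re (u * cis (2 * pi * real k * (\<Sum>i\<in>sources G. (x i)\<^sup>2)))"
    if k: "1 \<le> k" and u: "norm u \<le> 1" for k u
  proof -
    \<comment> \<open>The division undoes the common factor \<open>\<mu>\<close> in the
      phase.\<close>
    define K where "K = 2 * pi * real k / \<mu>"
    have "\<mu> * 1 \<le> (2 * pi) * real k" using k \<mu> pi_gt3 by (intro mult_mono) auto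
    then have K: "1 \<le> K" using \<mu>(1) by (simp add: K_def field_simps)
    define h where "h v y = (if v = s then a0 / K ^ m s * Re (u * cis (K * (\<Sum>e\<in>in_arcs G s. \<alpha> e * y e + \<beta> e * (y e)\<^sup>2)))
      else c0 v * (\<Sum>e\<in>in_arcs G v. \<alpha> e * y e + \<beta> e * (y e)\<^sup>2))" for v and y :: "'e \<Rightarrow> real"
    have hW: "h v \<in> W (m v) (in_arcs G v)" for v
    proof (cases "v = s")
      case True
      then show ?thesis unfolding h_def[abs_def] using a0[THEN conjunct2, rule_format, OF K ab[rule_format] u] by simp
    next
      case False
      then show ?thesis unfolding h_def[abs_def] using c0[rule_format, THEN conjunct2, rule_format, OF ab[rule_format], of v] by simp
    qed
    have hv: "h v y = c v * (\<Sum>e\<in>in_arcs G v. \<alpha> e * y e + \<beta> e * (y e)\<^sup>2)" if "v \<noteq> the_elem (sinks G)" for v y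
      using that by (simp add: h_def c_def s_def)
    have "G_function G h x = a / real k ^ m s * Re (u * cis (2 * pi * real k * (\<Sum>i\<in>sources G. (x i)\<^sup>2)))" for x
    proof -
      have "(\<Sum>e\<in>in_arcs G s. \<alpha> e * node_value G h x (tail G e) + \<beta> e * (node_value G h x (tail G e))\<^sup>2) = (\<Sum>i\<in>sources G. q i * (l i * (x i)\<^sup>2))"
        unfolding qs by (rule node_value_sum_of_squares[OF G \<alpha>_def \<beta>_def hv])
      also have "\<dots> = (\<Sum>i\<in>sources G. \<mu> * (x i)\<^sup>2)"
      proof (intro sum.cong refl)
        fix i assume "i \<in> sources G"
        from q[OF this] show "q i * (l i * (x i)\<^sup>2) = \<mu> * (x i)\<^sup>2" by (simp add: l_def)
      qed
      finally have inner: "(\<Sum>e\<in>in_arcs G s. \<alpha> e * node_value G h x (tail G e) + \<beta> e * (node_value G h x (tail G e))\<^sup>2) = \<mu> * (\<Sum>i\<in>sources G. (x i)\<^sup>2)"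
        by (simp add: sum_distrib_left)
      have "G_function G h x = h s (\<lambda>e\<in>in_arcs G s. node_value G h x (tail G e))"
        unfolding G_function_def s_def[symmetric] by (rule node_value_inner[OF GD(1,2) s])
      also have "\<dots> = a0 / K ^ m s * Re (u * cis (K * (\<Sum>e\<in>in_arcs G s. \<alpha> e * node_value G h x (tail G e) + \<beta> e * (node_value G h x (tail G e))\<^sup>2)))"
        unfolding h_def sum_restrict by simp
      also have "\<dots> = a0 / K ^ m s * Re (u * cis (K * (\<mu> * (\<Sum>i\<in>sources G. (x i)\<^sup>2))))" unfolding inner ..
      also have "a0 / K ^ m s = a / real k ^ m s" using \<mu>(1) k by (simp add: K_def a_def power_divide power_mult_distrib)
      also have "K * (\<mu> * (\<Sum>i\<in>sources G. (x i)\<^sup>2)) = 2 * pi * real k * (\<Sum>i\<in>sources G. (x i)\<^sup>2)" using \<mu>(1) by (simp add: K_def)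
      finally show ?thesis .
    qed
    moreover have "G_function G h \<in> compositional_functions G m"
      unfolding compositional_functions_def using hW by blast
    ultimately show ?thesis by (intro bexI[of _ "G_function G h"] allI)
  qed
  moreover have "0 < a" using a0 \<mu>(1) by (simp add: a_def)
  ultimately show ?thesis unfolding s_def[symmetric] by (intro exI[of _ a] conjI allI impI)
qed

subsection \<open>Lower bound for shallow networks\<close>

text \<open>A finite infimum in \<open>enat\<close> is attained.\<close>

lemma complexity_witness:
  assumes R: "ereal_of_enat (complexity I \<N> F \<epsilon>) \<le> ereal R" and f: "f \<in> F"
  shows "\<exists>N. \<exists>P\<in>\<N> N. sup_norm I (\<lambda>x. f x - P x) \<le> \<epsilon> \<and> real N \<le> R"
proof -
  let ?A = "{N. \<exists>P\<in>\<N> N. sup_norm I (\<lambda>x. f x - P x) \<le> \<epsilon>}"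
  have "(INF N\<in>?A. enat N) \<le> complexity I \<N> F \<epsilon>" unfolding complexity_def using f by (rule SUP_upper)
  then have le: "ereal_of_enat (INF N\<in>?A. enat N) \<le> ereal R" using R by (meson ereal_of_enat_le_iff order_trans)
  then obtain n where n: "(INF N\<in>?A. enat N) = enat n" by (cases "INF N\<in>?A. enat N") auto
  then have "(INF N\<in>?A. enat N) < enat (Suc n)" by simp
  then obtain N where N: "N \<in> ?A" "N < Suc n" unfolding INF_less_iff by auto
  have "real n \<le> R" using le unfolding n by simp
  then have "real N \<le> R" using N(2) by simp
  then show ?thesis using N(1) by blast
qed

lemma sum_pairs: "(\<Sum>t<2 * r. F t) = (\<Sum>j<r. F (2 * j) + F (Suc (2 * j)))"
  for F :: "nat \<Rightarrow> 'a::comm_monoid_add"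
  by (induction r) (simp_all add: add.assoc)

lemma sum_lessThan_add: "(\<Sum>i<N + M. F i) = (\<Sum>i<N. F i) + (\<Sum>i<M. F (N + i))"
  for F :: "nat \<Rightarrow> 'a::comm_monoid_add"
  by (induction M) (simp_all add: add.assoc)

text \<open>Coordinates are paired, two for each disk, and those left over are set to 0. A linear
  form on the cube thus becomes a sum of linear forms on the disks.\<close>

lemma disks_in_cube:
  fixes I :: "'i set"
  assumes I: "finite I" and r: "2 * r \<le> card I"
  shows "\<exists>p q X. (\<forall>z\<in>space (disks_measure {..<r}). X z \<in> cube I \<and> (\<Sum>i\<in>I. (X z i)\<^sup>2) = (\<Sum>j<r. fst (z j))) \<and>
    (\<forall>z w. (\<Sum>i\<in>I. w i * X z i) = (\<Sum>j<r. w (p j) * disk_x (z j) + w (q j) * disk_y (z j)))"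
proof -
  obtain s where s: "bij_betw s {0..<card I} I" using ex_bij_betw_nat_finite[OF I] by blast
  define Y where "Y z t = (if t < 2 * r then (if even t then disk_x (z (t div 2)) else disk_y (z (t div 2))) else 0)"
    for z :: "nat \<Rightarrow> real \<times> real" and t
  define X where "X z = (\<lambda>i\<in>I. Y z (inv_into {0..<card I} s i))" for z
  have Xs: "X z (s t) = Y z t" if "t < card I" for z t
    using s that unfolding X_def by (simp add: bij_betw_def inv_into_f_f) (auto simp: bij_betw_def)
  have sum: "(\<Sum>i\<in>I. H i (X z i)) = (\<Sum>j<r. H (s (2 * j)) (disk_x (z j)) + H (s (Suc (2 * j))) (disk_y (z j)))"
    if H: "\<And>i. H i 0 = 0" for H :: "'i \<Rightarrow> real \<Rightarrow> real" and z
  proof -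
    have "(\<Sum>i\<in>I. H i (X z i)) = (\<Sum>t\<in>{0..<card I}. H (s t) (X z (s t)))"
      by (rule sum.reindex_bij_betw[OF s, symmetric])
    also have "\<dots> = (\<Sum>t\<in>{0..<card I}. H (s t) (Y z t))" by (intro sum.cong refl) (simp add: Xs)
    also have "\<dots> = (\<Sum>t<2 * r. H (s t) (Y z t))"
      using r by (intro sum.mono_neutral_right) (auto simp: Y_def H)
    also have "\<dots> = (\<Sum>j<r. H (s (2 * j)) (disk_x (z j)) + H (s (Suc (2 * j))) (disk_y (z j)))"
      unfolding sum_pairs by (intro sum.cong refl) (auto simp: Y_def)
    finally show ?thesis .
  qed
  have disk: "\<bar>disk_x p\<bar> \<le> 1 \<and> \<bar>disk_y p\<bar> \<le> 1" if p: "p \<in> space disk_measure" for p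
  proof -
    have "(disk_x p)\<^sup>2 + (disk_y p)\<^sup>2 \<le> 1" using disk_xy_norm[OF p] p by (auto simp: space_disk_measure)
    then have "(disk_x p)\<^sup>2 \<le> 1" "(disk_y p)\<^sup>2 \<le> 1"
      using zero_le_power2[of "disk_x p"] zero_le_power2[of "disk_y p"] by linarith+
    then show ?thesis by (simp add: abs_square_le_1)
  qed
  have z: "z j \<in> space disk_measure" if "z \<in> space (disks_measure {..<r})" "j < r" for z j
    using that by (auto simp: space_disks_measure)
  have cube: "X z \<in> cube I" if zz: "z \<in> space (disks_measure {..<r})" for z
  proof -
    have "\<bar>Y z t\<bar> \<le> 1" for t
      using disk[OF z[OF zz, of "t div 2"]] by (cases "t < 2 * r") (auto simp: Y_def)
    then have "Y z t \<in> {-1..1}" for t by (simp add: abs_le_iff)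
    then show ?thesis unfolding X_def cube_def by (intro restrict_PiE_iff[THEN iffD2]) auto
  qed
  have "(\<Sum>i\<in>I. (X z i)\<^sup>2) = (\<Sum>j<r. fst (z j))" if "z \<in> space (disks_measure {..<r})" for z
    using sum[of "\<lambda>_ y. y\<^sup>2" z] disk_xy_norm z[OF that] by simp
  moreover have "(\<Sum>i\<in>I. w i * X z i) = (\<Sum>j<r. w (s (2 * j)) * disk_x (z j) + w (s (Suc (2 * j))) * disk_y (z j))" for z w
    by (rule sum) simp
  ultimately show ?thesis using cube
    by (intro exI[of _ "\<lambda>j. s (2 * j)"] exI[of _ "\<lambda>j. s (Suc (2 * j))"] exI[of _ X] conjI ballI allI)
qed

lemma shallow_networks_approximate_wave:
  assumes \<sigma>: "continuous_on UNIV \<sigma>"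
    and R: "ereal_of_enat (complexity I (shallow_networks \<sigma> I) F \<epsilon>) \<le> ereal R"
    and f: "\<exists>f\<in>F. \<forall>x. f x = A * Re (u * cis (b * (\<Sum>i\<in>I. (x i)\<^sup>2)))"
  shows "\<exists>N a w c. real N \<le> R \<and> (\<forall>x\<in>cube I. \<bar>A * Re (u * cis (b * (\<Sum>i\<in>I. (x i)\<^sup>2))) -
    (\<Sum>k<N. a k * \<sigma> ((\<Sum>i\<in>I. w k i * x i) + c k))\<bar> \<le> \<epsilon>)"
proof -
  obtain f where f: "f \<in> F" "\<And>x. f x = A * Re (u * cis (b * (\<Sum>i\<in>I. (x i)\<^sup>2)))" using f by blast
  obtain N P where P: "P \<in> shallow_networks \<sigma> I N" "sup_norm I (\<lambda>x. f x - P x) \<le> \<epsilon>" "real N \<le> R"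
    using complexity_witness[OF R f(1)] by blast
  obtain a w c where P': "P = (\<lambda>x. \<Sum>k<N. a k * \<sigma> ((\<Sum>i\<in>I. w k i * x i) + c k))"
    using P(1) unfolding shallow_networks_def by blast
  have coord: "continuous_on S (\<lambda>x :: 'a \<Rightarrow> real. x i)" for S i
    by (rule continuous_on_subset[OF continuous_on_product_coordinates]) simp
  \<comment> \<open>Needed to read pointwise bounds off \<open>sup_norm\<close>, which means nothing
    for an unbounded function.\<close>
  have "continuous_on (cube I) (\<lambda>x. f x - P x)"
    unfolding f(2) P' by (intro continuous_intros coord continuous_on_compose2[OF \<sigma>]) auto
  then have bdd: "bdd_above ((\<lambda>x. \<bar>f x - P x\<bar>) ` cube I)" by (rule continuous_on_cube_bdd_above)
  have "\<bar>f x - P x\<bar> \<le> \<epsilon>" if "x \<in> cube I" for x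
    using abs_le_sup_norm[OF bdd that] P(2) by linarith
  then show ?thesis unfolding f(2) P' using P(3)
    by (intro exI[of _ N] exI[of _ a] exI[of _ w] exI[of _ c] conjI ballI)
qed

text \<open>All frequencies up to \<open>4 * S\<close> must be offered, as the lower bound picks one
  of them. Two real networks, for cosine and sine, form one complex network with at most
  \<open>2 * R\<close> units.\<close>

lemma shallow_units_lower_bound:
  fixes \<F> :: "(('i \<Rightarrow> real) \<Rightarrow> real) set"
  assumes \<sigma>: "continuous_on UNIV \<sigma>" and I: "finite I" "2 * r \<le> card I" and S: "1 \<le> S"
    and waves: "\<And>k u. k \<in> {1..4 * S} \<Longrightarrow> norm u \<le> 1 \<Longrightarrow>
      \<exists>f\<in>\<F>. \<forall>x. f x = A k * Re (u * cis (2 * pi * real k * (\<Sum>i\<in>I. (x i)\<^sup>2)))"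
    and A: "\<And>k. k \<in> {1..4 * S} \<Longrightarrow> 0 < A k \<and> \<epsilon> \<le> A k * (1 / 2) ^ (r + 3)"
    and R: "ereal_of_enat (complexity I (shallow_networks \<sigma> I) \<F> \<epsilon>) \<le> ereal R"
  shows "real (S + 1) ^ r < 4 * R"
proof (rule ccontr)
  assume small: "\<not> real (S + 1) ^ r < 4 * R"
  obtain k where k: "k \<in> {1..4 * S}" and lower: "\<forall>(J :: nat set) N w g \<alpha> \<beta> \<delta>. finite J \<longrightarrow> 2 * N \<le> (S + 1) ^ card J \<longrightarrow>
    (\<forall>i<N. continuous_on UNIV (g i :: real \<Rightarrow> real)) \<longrightarrow>
    (\<forall>x\<in>space (disks_measure J). cmod ((\<Prod>j\<in>J. wave (int k) (fst (x j))) -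
       (\<Sum>i<N. w i * complex_of_real (g i (\<Sum>j\<in>J. \<alpha> i j * disk_x (x j) + \<beta> i j * disk_y (x j))))) \<le> \<delta>) \<longrightarrow>
    (1 / 2) ^ card J \<le> 2 * \<delta>"
    using ridge_approximation_lower_bound[OF S] by (elim bexE)
  obtain p q X where X: "(\<forall>z\<in>space (disks_measure {..<r}). X z \<in> cube I \<and> (\<Sum>i\<in>I. (X z i)\<^sup>2) = (\<Sum>j<r. fst (z j))) \<and>
    (\<forall>z w. (\<Sum>i\<in>I. w i * X z i) = (\<Sum>j<r. w (p j) * disk_x (z j) + w (q j) * disk_y (z j)))"
    using disks_in_cube[OF I] by (elim exE)
  note Xw = X[THEN conjunct2, rule_format]
  note Ak = A[OF k]
  obtain N1 a1 w1 b1 where n1: "real N1 \<le> R \<and> (\<forall>x\<in>cube I. \<bar>A k * Re (1 * cis (2 * pi * real k * (\<Sum>i\<in>I. (x i)\<^sup>2))) -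
    (\<Sum>k<N1. a1 k * \<sigma> ((\<Sum>i\<in>I. w1 k i * x i) + b1 k))\<bar> \<le> \<epsilon>)"
    using shallow_networks_approximate_wave[OF \<sigma> R waves[OF k, of 1]] by auto
  \<comment> \<open>With \<open>u = - \<i>\<close> the real part is the sine.\<close>
  obtain N2 a2 w2 b2 where n2: "real N2 \<le> R \<and> (\<forall>x\<in>cube I. \<bar>A k * Re (- \<i> * cis (2 * pi * real k * (\<Sum>i\<in>I. (x i)\<^sup>2))) -
    (\<Sum>k<N2. a2 k * \<sigma> ((\<Sum>i\<in>I. w2 k i * x i) + b2 k))\<bar> \<le> \<epsilon>)"
    using shallow_networks_approximate_wave[OF \<sigma> R waves[OF k, of "- \<i>"]] by auto
  let ?N = "N1 + N2"
  define w where "w i = (if i < N1 then of_real (a1 i / A k) else \<i> * of_real (a2 (i - N1) / A k))" for i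
  define b where "b i = (if i < N1 then b1 i else b2 (i - N1))" for i
  define v where "v i = (if i < N1 then w1 i else w2 (i - N1))" for i
  have N: "2 * ?N \<le> (S + 1) ^ r"
  proof -
    have "real (2 * ?N) \<le> real ((S + 1) ^ r)" using n1 n2 small by simp
    then show ?thesis by (rule of_nat_le_iff[THEN iffD1])
  qed
  have "cmod ((\<Prod>j<r. wave (int k) (fst (z j))) -
      (\<Sum>i<?N. w i * complex_of_real (\<sigma> ((\<Sum>j<r. v i (p j) * disk_x (z j) + v i (q j) * disk_y (z j)) + b i)))) \<le> 2 * \<epsilon> / A k"
    if z: "z \<in> space (disks_measure {..<r})" for z
  proof -
    note Xz = X[THEN conjunct1, rule_format, OF z]
    let ?\<theta> = "2 * pi * real k * (\<Sum>j<r. fst (z j))"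
    have wave: "(\<Prod>j<r. wave (int k) (fst (z j))) = cis ?\<theta>"
      unfolding wave_def by (induction r) (simp_all add: cis_mult distrib_left mult.commute add.commute)
    let ?P1 = "\<Sum>i<N1. a1 i * \<sigma> ((\<Sum>i'\<in>I. w1 i i' * X z i') + b1 i)" and ?P2 = "\<Sum>i<N2. a2 i * \<sigma> ((\<Sum>i'\<in>I. w2 i i' * X z i') + b2 i)"
    have net: "(\<Sum>i<?N. w i * complex_of_real (\<sigma> ((\<Sum>j<r. v i (p j) * disk_x (z j) + v i (q j) * disk_y (z j)) + b i))) =
        Complex (?P1 / A k) (?P2 / A k)"
    proof -
      have "(\<Sum>i<?N. w i * complex_of_real (\<sigma> ((\<Sum>j<r. v i (p j) * disk_x (z j) + v i (q j) * disk_y (z j)) + b i))) =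
        (\<Sum>i<?N. w i * complex_of_real (\<sigma> ((\<Sum>i'\<in>I. v i i' * X z i') + b i)))" unfolding Xw ..
      also have "\<dots> = of_real (?P1 / A k) + \<i> * of_real (?P2 / A k)"
        unfolding sum_lessThan_add by (simp add: w_def v_def b_def sum_divide_distrib sum_distrib_left mult.assoc)
      finally show ?thesis by (simp add: complex_eq_iff)
    qed
    have e1: "\<bar>A k * cos ?\<theta> - ?P1\<bar> \<le> \<epsilon>" using n1[THEN conjunct2, rule_format, OF Xz[THEN conjunct1]] Xz by simp
    have e2: "\<bar>A k * sin ?\<theta> - ?P2\<bar> \<le> \<epsilon>" using n2[THEN conjunct2, rule_format, OF Xz[THEN conjunct1]] Xz by simp
    have d: "\<bar>y - P / A k\<bar> \<le> \<epsilon> / A k" if "\<bar>A k * y - P\<bar> \<le> \<epsilon>" for y P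
    proof -
      have "y - P / A k = (A k * y - P) / A k" using Ak by (simp add: field_simps)
      then show ?thesis using that Ak by (simp add: divide_right_mono)
    qed
    have "cmod (cis ?\<theta> - Complex (?P1 / A k) (?P2 / A k)) \<le> \<bar>cos ?\<theta> - ?P1 / A k\<bar> + \<bar>sin ?\<theta> - ?P2 / A k\<bar>"
      using cmod_le[of "cis ?\<theta> - Complex (?P1 / A k) (?P2 / A k)"] by simp
    also have "\<dots> \<le> \<epsilon> / A k + \<epsilon> / A k" by (intro add_mono d e1 e2)
    finally show ?thesis unfolding wave net by simp
  qed
  moreover have "continuous_on UNIV (\<lambda>t. \<sigma> (t + b i))" for i
    by (rule continuous_on_compose2[OF \<sigma>]) (auto intro: continuous_intros)
  ultimately have "(1 / 2) ^ card {..<r} \<le> 2 * (2 * \<epsilon> / A k)"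
    using lower[rule_format, of "{..<r}" ?N "\<lambda>i t. \<sigma> (t + b i)" w "\<lambda>i j. v i (p j)" "\<lambda>i j. v i (q j)" "2 * \<epsilon> / A k"] N
    by simp
  \<comment> \<open>The reason for the exponent \<open>r + 3\<close>: the right-hand side is half of
    \<open>(1 / 2) ^ r\<close>.\<close>
  also have "\<dots> \<le> 4 * (1 / 2) ^ (r + 3)" using Ak by (simp add: field_simps)
  finally show False by (simp add: power_add power3_eq_cube)
qed

text \<open>For an accuracy of order \<open>S powr (- M)\<close> about \<open>S ^ r\<close> units
  are needed with \<open>r \<ge> n / 3\<close>, while the assumed bound is of order
  \<open>S powr (n / 4)\<close>, since \<open>M * c \<le> 1 / 4\<close>. The factor \<open>c\<close>
  depends on \<open>M\<close> alone and so serves a whole family.\<close>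

lemma shallow_complexity_not_bigo:
  assumes \<sigma>: "continuous_on UNIV \<sigma>" and G: "compositional_graph (G :: ('v, 'e) pre_digraph) m"
    and n: "2 \<le> card (sources G)" and M: "m (the_elem (sinks G)) \<le> M"
  shows "\<not> is_bigo (shallow_complexity \<sigma> G m) (\<lambda>\<epsilon>. \<epsilon> powr (- (1 / (4 * (real M + 1))) * real (card (sources G))))"
proof
  define n where "n = real (card (sources G))"
  define r where "r = card (sources G) div 2"
  define c where "c = 1 / (4 * (real M + 1))"
  let ?s = "the_elem (sinks G)"
  have n2: "n \<ge> 2" using assms(3) by (simp add: n_def)
  \<comment> \<open>Rounding in \<open>n div 2\<close> costs most for \<open>n = 3\<close>, where
    equality holds.\<close>
  have r: "n / 3 \<le> real r"
  proof -
    have "card (sources G) \<le> 3 * r" using assms(3) unfolding r_def by linarith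
    then have "n \<le> real (3 * r)" unfolding n_def by (rule of_nat_mono)
    then show ?thesis by simp
  qed
  have M1: "1 \<le> M" using compositional_graphD(10)[OF G sink_inner[OF G]] M by linarith
  have c: "0 < c" "real M * c \<le> 1 / 4" by (simp_all add: c_def field_simps)
  obtain a where a: "0 < a \<and> (\<forall>k u. 1 \<le> k \<longrightarrow> norm u \<le> 1 \<longrightarrow> (\<exists>f\<in>compositional_functions G m. \<forall>x.
    f x = a / real k ^ m ?s * Re (u * cis (2 * pi * real k * (\<Sum>i\<in>sources G. (x i)\<^sup>2)))))"
    using waves_are_compositional[OF G] by (elim exE)
  assume "is_bigo (shallow_complexity \<sigma> G m) (\<lambda>\<epsilon>. \<epsilon> powr (- (1 / (4 * (real M + 1))) * real (card (sources G))))"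
  then obtain C e0 where e0: "0 < e0"
    and C: "\<And>\<epsilon>. 0 < \<epsilon> \<Longrightarrow> \<epsilon> < e0 \<Longrightarrow> ereal_of_enat (shallow_complexity \<sigma> G m \<epsilon>) \<le> ereal (C * \<epsilon> powr (- c * n))"
    unfolding is_bigo_def eventually_at_right_field c_def n_def by blast
  define E where "E = a * (1 / 2) ^ (r + 3)"
  have E: "0 < E" using a by (simp add: E_def)
  \<comment> \<open>All factors that do not depend on \<open>S\<close>, among them
    \<open>4 powr (n / 4)\<close> from \<open>4 * S\<close>; the summand 1 makes it at least
    1.\<close>
  define C1 where "C1 = 4 * \<bar>C\<bar> * E powr (- c * n) * 4 powr (n / 4) + 1"
  have C1: "1 \<le> C1" by (simp add: C1_def)
  \<comment> \<open>The power 12 fits the gap \<open>n / 3 - n / 4 = n / 12\<close> between the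
    exponents; \<open>E / e0\<close> makes \<open>\<epsilon>\<close> small enough for the asymptotic
    bound.\<close>
  obtain S :: nat where S: "1 + C1 ^ 12 + E / e0 < real S" using reals_Archimedean2 by blast
  have pos: "0 < C1 ^ 12" "0 < E / e0" using C1 E e0 by auto
  have S1: "1 \<le> real S" "C1 ^ 12 \<le> real S" "E / e0 < real S" using S pos by linarith+
  have S0: "0 < real S" "1 \<le> S" using S1(1) by auto
  \<comment> \<open>Small enough for the amplitudes of all frequencies up to \<open>4 * S\<close> at
    once.\<close>
  define \<epsilon> where "\<epsilon> = E / (4 * real S) ^ M"
  have \<epsilon>: "0 < \<epsilon>" using E S0 by (simp add: \<epsilon>_def)
  have "4 * real S \<le> (4 * real S) ^ M" using S0 M1 S1(1) by (intro self_le_power) auto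
  then have Sm: "real S \<le> (4 * real S) ^ M" using S0 by linarith
  have "E < e0 * real S" using S1(3) e0 by (simp add: field_simps)
  also have "\<dots> \<le> e0 * (4 * real S) ^ M" using e0 Sm by (intro mult_left_mono) auto
  finally have "\<epsilon> < e0" using S0 by (simp add: \<epsilon>_def field_simps)
  note R = C[OF \<epsilon> this, unfolded shallow_complexity_def]
  have "real (S + 1) ^ r < 4 * (C * \<epsilon> powr (- c * n))"
  proof (rule shallow_units_lower_bound[OF \<sigma> compositional_graphD(7)[OF G] _ S0(2) _ _ R])
    show "2 * r \<le> card (sources G)" by (simp add: r_def)
    show "\<exists>f\<in>compositional_functions G m. \<forall>x. f x = a / real k ^ m ?s * Re (u * cis (2 * pi * real k * (\<Sum>i\<in>sources G. (x i)\<^sup>2)))"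
      if "k \<in> {1..4 * S}" "norm u \<le> 1" for k u
      using a[THEN conjunct2, rule_format, of k u] that by simp
    fix k assume k: "k \<in> {1..4 * S}"
    have "real k ^ m ?s \<le> (4 * real S) ^ m ?s"
    proof (rule power_mono)
      have "real k \<le> real (4 * S)" using k by (intro of_nat_mono) auto
      then show "real k \<le> 4 * real S" by simp
    qed simp
    also have "\<dots> \<le> (4 * real S) ^ M" using S1(1) M by (intro power_increasing) auto
    finally have "E / (4 * real S) ^ M \<le> E / real k ^ m ?s" using E k by (intro divide_left_mono) auto
    then show "0 < a / real k ^ m ?s \<and> \<epsilon> \<le> a / real k ^ m ?s * (1 / 2) ^ (r + 3)"
      using a k by (simp add: \<epsilon>_def E_def)
  qed
  also have "\<dots> \<le> 4 * (\<bar>C\<bar> * \<epsilon> powr (- c * n))" by (intro mult_left_mono mult_right_mono) auto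
  also have "\<epsilon> powr (- c * n) = E powr (- c * n) * ((4 * real S) ^ M) powr (c * n)"
    using E S0 by (simp add: \<epsilon>_def powr_divide powr_minus field_simps)
  also have "((4 * real S) ^ M) powr (c * n) = (4 * real S) powr (real M * (c * n))"
  proof -
    have "0 < 4 * real S" using S0 by simp
    from powr_realpow[OF this, of M, symmetric] show ?thesis by (simp only: powr_powr)
  qed
  also have "4 * (\<bar>C\<bar> * (E powr (- c * n) * (4 * real S) powr (real M * (c * n)))) \<le>
      4 * (\<bar>C\<bar> * (E powr (- c * n) * (4 * real S) powr (n / 4)))"
  proof (intro mult_left_mono powr_mono)
    show "real M * (c * n) \<le> n / 4" using mult_right_mono[OF c(2), of n] n2 by (simp add: mult.assoc)
  qed (use S1 in auto)
  also have "\<dots> = (C1 - 1) * real S powr (n / 4)" by (simp add: C1_def powr_mult)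
  also have "\<dots> \<le> C1 * real S powr (n / 4)" by (intro mult_right_mono) auto
  also have "\<dots> \<le> real S powr (n / 12) * real S powr (n / 4)"
  proof (intro mult_right_mono)
    have "C1 = (C1 ^ 12) powr (1 / 12)" using C1 by (simp add: powr_powr flip: powr_numeral)
    also have "\<dots> \<le> real S powr (1 / 12)" using S1(2) C1 by (intro powr_mono2) auto
    also have "\<dots> \<le> real S powr (n / 12)" using S1(1) n2 by (intro powr_mono) auto
    finally show "C1 \<le> real S powr (n / 12)" .
  qed simp
  also have "\<dots> = real S powr (n / 3)" by (simp flip: powr_add)
  also have "\<dots> \<le> real S powr real r" using S1(1) r by (intro powr_mono) auto
  also have "\<dots> = real S ^ r" using S0 by (simp add: powr_realpow)
  also have "\<dots> \<le> real (S + 1) ^ r" by (intro power_mono) auto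
  finally show False by simp
qed

lemma infinitely_differentiable_continuous:
  assumes "infinitely_differentiable \<sigma>"
  shows "continuous_on UNIV \<sigma>"
proof -
  have "(deriv ^^ 0) \<sigma> field_differentiable at x" for x using assms unfolding infinitely_differentiable_def by blast
  then show ?thesis by (intro continuous_at_imp_continuous_on ballI field_differentiable_imp_continuous_at) simp
qed

lemma shallow_complexity_suffers_curse:
  fixes \<F> :: "(('v, 'e) pre_digraph \<times> ('v \<Rightarrow> nat)) set"
  assumes \<sigma>: "infinitely_differentiable \<sigma>" and F: "bounded_family \<F>"
  shows "suffers_curse (shallow_complexity \<sigma>) \<F>"
proof -
  obtain d M where dM: "\<And>G m v. (G, m) \<in> \<F> \<Longrightarrow> v \<in> inner_nodes G \<Longrightarrow> in_degree G v \<le> d \<and> m v \<le> M"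
    using F unfolding bounded_family_def by blast
  have G: "compositional_graph G m" if "(G, m) \<in> \<F>" for G m using F that unfolding bounded_family_def by blast
  have "\<not> is_bigo (shallow_complexity \<sigma> G m) (\<lambda>\<epsilon>. \<epsilon> powr (- (1 / (4 * (real M + 1))) * real (card (sources G))))"
    if "(G, m) \<in> \<F>" "2 \<le> card (sources G)" for G m
    using shallow_complexity_not_bigo[OF infinitely_differentiable_continuous[OF \<sigma>] G[OF that(1)] that(2)]
      dM[OF that(1) sink_inner[OF G[OF that(1)]]] by blast
  then show ?thesis unfolding suffers_curse_def
    by (intro exI[of _ "1 / (4 * (real M + 1))"] conjI) auto
qed

theorem theorem3:
  fixes \<sigma> :: "real \<Rightarrow> real"
  assumes "infinitely_differentiable \<sigma>"
    and "\<not> is_polynomial \<sigma>"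
  shows "(\<forall>\<F> :: (('v, 'e) pre_digraph \<times> ('v \<Rightarrow> nat)) set. bounded_family \<F> \<longrightarrow>
            avoids_curse (deep_complexity \<sigma>) \<F> \<and> suffers_curse (shallow_complexity \<sigma>) \<F>) \<and>
         (\<forall>(G :: ('v, 'e) pre_digraph) m. compositional_graph G m \<longrightarrow>
            is_bigo (shallow_complexity \<sigma> G m)
              (\<lambda>\<epsilon>. \<epsilon> powr (- real (card (sources G)) / real (Min (m ` inner_nodes G)))) \<and>
            is_bigo (deep_complexity \<sigma> G m)
              (\<lambda>\<epsilon>. \<Sum>v\<in>inner_nodes G. \<epsilon> powr (- real (in_degree G v) / real (m v))))"
  by (intro conjI allI impI deep_complexity_avoids_curse[OF assms] shallow_complexity_suffers_curse[OF assms(1)]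
      shallow_complexity_bigo[OF assms] deep_complexity_bigo[OF assms])

end
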